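(* Let $2\le p<\infty$. Fix a choice of sign $\pm$. Consider the complex-valued modified KdV equation (mKdV) on $\mathcal{M}=\mathbb{R}$ or $\mathcal{M}=\mathbb{T}$, $$\partial_tu=-\partial_x^3u\pm6|u|^2\partial_xu,\qquad (x,t)\in\mathcal{M}\times\mathbb{R},$$ and the complex-valued renormalized mKdV on $\mathbb{T}$, $$\partial_tu=-\partial_x^3u\pm6\Big(|u|^2-\frac1{2\pi}\int_{\mathbb{T}}|u|^2dx\Big)\partial_xu,\qquad (x,t)\in\mathbb{T}\times\mathbb{R}.$$ (i) There exists $C=C(p)>0$ such that $$\|u(t)\|_{M^{2,p}(\mathbb{R})}\le C\big(1+\|u(0)\|_{M^{2,p}(\mathbb{R})}\big)^{\frac p2-1}\|u(0)\|_{M^{2,p}(\mathbb{R})}$$ for any Schwartz class solution $u$ to the complex-valued mKdV on $\mathbb{R}$ and any $t\in\mathbb{R}$. (ii) There exists $C=C(p)>0$ such that $$\|u(t)\|_{\mathcal{F}L^p(\mathbb{T})}\le C\big(1+\|u(0)\|_{\mathcal{F}L^p(\mathbb{T})}\big)^{\frac p2-1}\|u(0)\|_{\mathcal{F}L^p(\mathbb{T})}$$ for any smooth solution $u$ to the complex-valued mKdV on $\mathbb{T}$ and any $t\in\mathbb{R}$. In particular, the same global-in-time bound also holds for any smooth solution $u$ to the complex-valued renormalized mKdV on $\mathbb{T}$.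
   Context: $\mathbb{T}=\mathbb{R}/(2\pi\mathbb{Z})$. Fourier transform: $\widehat f(\xi)=\frac1{\sqrt{2\pi}}\int_{\mathbb{R}}f(x)e^{-ix\xi}dx$, $\xi\in\mathbb{R}$, on $\mathbb{R}$, and $\widehat f(\xi)=\frac1{\sqrt{2\pi}}\int_0^{2\pi}f(x)e^{-ix\xi}dx$, $\xi\in\mathbb{Z}$, on $\mathbb{T}$. Fourier-Lebesgue space: $\|f\|_{\mathcal{F}L^p(\mathbb{T})}=\big(\sum_{\xi\in\mathbb{Z}}|\widehat f(\xi)|^p\big)^{1/p}$. Modulation space: fix $\psi\in\mathcal{S}(\mathbb{R})$ with $\operatorname{supp}\psi\subset[-1,1]$ and $\sum_{k\in\mathbb{Z}}\psi(\xi-k)\equiv1$; let $\psi_n(D)$ be the Fourier multiplier operator with multiplier $\psi_n(\xi)=\psi(\xi-n)$. Then $\|f\|_{M^{2,p}(\mathbb{R})}=\big(\sum_{n\in\mathbb{Z}}\|\psi_n(D)f\|_{L^2(\mathbb{R})}^p\big)^{1/p}$. A Schwartz class solution is a global-in-time classical solution with $u(t)\in\mathcal{S}(\mathbb{R})$ for all $t\in\mathbb{R}$, continuous in $t$ with values in $\mathcal{S}(\mathbb{R})$; a smooth solution on $\mathbb{T}$ is a global-in-time classical solution, $C^\infty$ in $x$, continuous in $t$ with values in $C^\infty(\mathbb{T})$. *)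

theory Defs
  imports "HOL-Analysis.Analysis"
begin

definition dx :: "(real \<Rightarrow> complex) \<Rightarrow> real \<Rightarrow> complex" where
  "dx f = (\<lambda>x. vector_derivative f (at x))"

(* The value of vector_derivative is unspecified where f is not differentiable;
   iterated dx is only used for functions satisfying this predicate. *)
definition smooth :: "(real \<Rightarrow> complex) \<Rightarrow> bool" where
  "smooth f \<longleftrightarrow> (\<forall>n x. (dx ^^ n) f differentiable at x)"

definition schwartz :: "(real \<Rightarrow> complex) \<Rightarrow> bool" where
  "schwartz f \<longleftrightarrow> smooth f \<and> (\<forall>k j. bounded (range (\<lambda>x. x ^ k *\<^sub>R (dx ^^ j) f x)))"

(* Functions on the torus R/(2 pi Z) are represented by 2 pi-periodic functions on R. *)
definition smooth_torus :: "(real \<Rightarrow> complex) \<Rightarrow> bool" where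
  "smooth_torus f \<longleftrightarrow> smooth f \<and> (\<forall>x. f (x + 2 * pi) = f x)"

(* Continuity for the Frechet topology generated by the seminorms
   sup_x |x^k d^j f(x)|, k, j >= 0. *)
definition continuous_into_schwartz :: "(real \<Rightarrow> real \<Rightarrow> complex) \<Rightarrow> bool" where
  "continuous_into_schwartz u \<longleftrightarrow>
    (\<forall>k j t. uniform_limit UNIV (\<lambda>s x. x ^ k *\<^sub>R (dx ^^ j) (u s) x)
                              (\<lambda>x. x ^ k *\<^sub>R (dx ^^ j) (u t) x) (at t))"

(* Continuity for the Frechet topology generated by the seminorms sup_x |d^j f(x)|, j >= 0;
   by periodicity the supremum may be taken over all of R. *)
definition continuous_into_smooth_torus :: "(real \<Rightarrow> real \<Rightarrow> complex) \<Rightarrow> bool" where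
  "continuous_into_smooth_torus u \<longleftrightarrow>
    (\<forall>j t. uniform_limit UNIV (\<lambda>s. (dx ^^ j) (u s)) ((dx ^^ j) (u t)) (at t))"

definition fourier :: "(real \<Rightarrow> complex) \<Rightarrow> real \<Rightarrow> complex" where
  "fourier f \<xi> = complex_of_real (1 / sqrt (2 * pi)) * (LINT x|lborel. f x * cis (- (x * \<xi>)))"

definition inverse_fourier :: "(real \<Rightarrow> complex) \<Rightarrow> real \<Rightarrow> complex" where
  "inverse_fourier g x = complex_of_real (1 / sqrt (2 * pi)) * (LINT \<xi>|lborel. g \<xi> * cis (x * \<xi>))"

definition fourier_torus :: "(real \<Rightarrow> complex) \<Rightarrow> int \<Rightarrow> complex" where
  "fourier_torus f \<xi> = complex_of_real (1 / sqrt (2 * pi)) *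
    (LINT x:{0..2 * pi}|lborel. f x * cis (- (x * of_int \<xi>)))"

definition fourier_multiplier ::
    "(real \<Rightarrow> complex) \<Rightarrow> (real \<Rightarrow> complex) \<Rightarrow> real \<Rightarrow> complex" where
  "fourier_multiplier m f = inverse_fourier (\<lambda>\<xi>. m \<xi> * fourier f \<xi>)"

definition L2_norm :: "(real \<Rightarrow> complex) \<Rightarrow> real" where
  "L2_norm f = sqrt (LINT x|lborel. (norm (f x))\<^sup>2)"

definition modulation_window :: "(real \<Rightarrow> complex) \<Rightarrow> bool" where
  "modulation_window \<psi> \<longleftrightarrow> schwartz \<psi> \<and> closure {\<xi>. \<psi> \<xi> \<noteq> 0} \<subseteq> {-1..1} \<and>
    (\<forall>\<xi>. ((\<lambda>k::int. \<psi> (\<xi> - of_int k)) has_sum 1) UNIV)"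

(* The two norms below are real-valued and are only applied to Schwartz functions,
   respectively smooth functions on the torus, for which all the integrals and sums converge. *)
definition modulation_norm :: "(real \<Rightarrow> complex) \<Rightarrow> real \<Rightarrow> (real \<Rightarrow> complex) \<Rightarrow> real" where
  "modulation_norm \<psi> p f =
    (\<Sum>\<^sub>\<infinity>n::int. L2_norm (fourier_multiplier (\<lambda>\<xi>. \<psi> (\<xi> - of_int n)) f) powr p) powr (1 / p)"

definition fourier_lebesgue_norm :: "real \<Rightarrow> (real \<Rightarrow> complex) \<Rightarrow> real" where
  "fourier_lebesgue_norm p f = (\<Sum>\<^sub>\<infinity>\<xi>::int. norm (fourier_torus f \<xi>) powr p) powr (1 / p)"

(* In the following, \<sigma> is the sign of the nonlinearity and u t x is the value
   of the solution at time t and position x. *)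
definition mkdv :: "real \<Rightarrow> (real \<Rightarrow> real \<Rightarrow> complex) \<Rightarrow> bool" where
  "mkdv \<sigma> u \<longleftrightarrow> (\<forall>t x. ((\<lambda>s. u s x) has_vector_derivative
      - (dx ^^ 3) (u t) x + complex_of_real (\<sigma> * 6 * (norm (u t x))\<^sup>2) * dx (u t) x) (at t))"

definition renormalized_mkdv :: "real \<Rightarrow> (real \<Rightarrow> real \<Rightarrow> complex) \<Rightarrow> bool" where
  "renormalized_mkdv \<sigma> u \<longleftrightarrow> (\<forall>t x. ((\<lambda>s. u s x) has_vector_derivative
      - (dx ^^ 3) (u t) x
      + complex_of_real (\<sigma> * 6 * ((norm (u t x))\<^sup>2
          - 1 / (2 * pi) * (LINT y:{0..2 * pi}|lborel. (norm (u t y))\<^sup>2))) * dx (u t) x) (at t))"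

definition schwartz_mkdv_solution :: "real \<Rightarrow> (real \<Rightarrow> real \<Rightarrow> complex) \<Rightarrow> bool" where
  "schwartz_mkdv_solution \<sigma> u \<longleftrightarrow>
    (\<forall>t. schwartz (u t)) \<and> continuous_into_schwartz u \<and> mkdv \<sigma> u"

definition smooth_torus_mkdv_solution :: "real \<Rightarrow> (real \<Rightarrow> real \<Rightarrow> complex) \<Rightarrow> bool" where
  "smooth_torus_mkdv_solution \<sigma> u \<longleftrightarrow>
    (\<forall>t. smooth_torus (u t)) \<and> continuous_into_smooth_torus u \<and> mkdv \<sigma> u"

definition smooth_torus_renormalized_mkdv_solution ::
    "real \<Rightarrow> (real \<Rightarrow> real \<Rightarrow> complex) \<Rightarrow> bool" where
  "smooth_torus_renormalized_mkdv_solution \<sigma> u \<longleftrightarrow>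
    (\<forall>t. smooth_torus (u t)) \<and> continuous_into_smooth_torus u \<and> renormalized_mkdv \<sigma> u"

end

(*
  For k = kappa + i n with n an integer, the ratio w of the components of a decaying (or periodic)
  solution of the AKNS system with potential u solves the Riccati equation
  w' = sigma cnj u - k w - u w^2. When |w| <= 1/2, the identity obtained by differentiating
  ln (1 - sigma |w|^2) gives
    sigma Re int u w = kappa int |w|^2 / (1 - sigma |w|^2),
  and the left side is conserved: the time derivative of u w is an exact x-derivative, since the
  Riccati solution is stable and therefore evolves by the second equation of the Lax pair. The
  right side is, up to cubic errors, the mass A_n of the Fourier transform F of u near frequency n
  at scale kappa (Lorentzian weight). So N = kappa^-1 sum_n A_n^(p/2) satisfies
  N(t) <= C N(0) + C N(0)^3 + C N(t)^3, and a continuity argument gives N(t) <= C N(0) as soon as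
  N(0) is small. Finally N is at least c kappa^(-p/2) S and at most C kappa^-1 S with
  S = sum_m (int_m^(m+1) |F|^2)^(p/2), which is equivalent to the p-th power of the norm, and the
  choice of kappa as a multiple of (1 + norm of u(0))^p makes N(0) small.
  The term in the renormalized equation that is a function of time times u_x is a translation and
  does not affect the conservation law.
*)

theory Submission
  imports Defs "HOL-Probability.Probability" "HOL-Real_Asymp.Real_Asymp"
begin

text \<open>Choosing \<kappa> from the norm of u(0) alone gives no control of sup |u|, so Re (k + u
  w) can be negative at some points and two Riccati solutions cannot be compared by a direct
  estimate. The way out: Re (u w) is, up to a fraction of Re k, half the derivative of the bounded
  function -ln (1 - \<sigma> |w|^2), so an integrating factor costs only a constant. Bounded Riccati
  solutions are then controlled by the forcing of their difference, which gives uniqueness and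
  differentiability in time for solutions picked independently at each time. The Lorentzian weight
  of A_n is too weak to construct w: it would place the linear part of w in plain L^2, which does
  not bound sup |w|. The iteration therefore measures u with bracket power -2s, s < 1/2, at scale
  \<kappa>, and the solution with power 2 - 2s. That slower weight has to be recovered from the A_m
  at neighbouring m by Jensen's inequality; it is not summable over n by itself, but its cube is.
  Line and circle share all of this: a frequency group with its measure on one side, a physical
  measure with a decay weight \<rho> on the other.\<close>

subsection \<open>Riccati equations\<close>

text \<open>Integrating factor exp (A), with A an antiderivative of a. A lower bound on Re a up to
  the derivative of a bounded \<theta> suffices, as \<theta> contributes at most exp (2 M). Since
  \<rho> varies at most quadratically it can be frozen at x, and 2 / \<mu> + 4 / \<mu>^3 is the
  integral of 2 (1 + t^2) exp (-\<mu> t) over t > 0. The conclusion is free of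
  \<open>Z\<close>.\<close>

lemma linear_ode_bound:
  fixes z a c :: "real \<Rightarrow> complex" and \<theta> \<theta>' \<rho> :: "real \<Rightarrow> real"
  assumes z: "\<And>x. (z has_vector_derivative (c x - a x * z x)) (at x)"
    and a: "continuous_on UNIV a"
    and \<theta>: "\<And>x. (\<theta> has_real_derivative \<theta>' x) (at x)"
    and re: "\<And>x. \<mu> + \<theta>' x \<le> Re (a x)" and \<mu>: "\<mu> > 0"
    and M: "\<And>x. \<bar>\<theta> x\<bar> \<le> M"
    and Z: "\<And>x. norm (z x) \<le> Z"
    and c: "\<And>x. norm (c x) \<le> K * \<rho> x"
    and K: "K \<ge> 0"
    and \<rho>: "\<And>x y. \<rho> y \<le> 2 * (1 + (x - y)\<^sup>2) * \<rho> x"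
  shows "norm (z x) \<le> exp (2 * M) * (2 / \<mu> + 4 / \<mu> ^ 3) * K * \<rho> x"
proof -
  \<comment> \<open>exp (-\<mu> t) p(t) is the integral of (1 + r^2) exp (-\<mu> r) over r >
    t.\<close>
  define p where "p t = t\<^sup>2 / \<mu> + 2 * t / \<mu>\<^sup>2 + (1 / \<mu> + 2 / \<mu> ^ 3)" for t :: real
  have \<rho>0: "\<rho> x \<ge> 0"
    using \<rho>[of x x] by simp
  let ?D = "2 * exp (2 * M) * K * \<rho> x * p 0"
  have main: "norm (z x) \<le> exp (2 * M - \<mu> * (x - y)) * Z + ?D" if "y < x" for y
  proof -
    have "continuous_on {y..x} a"
      using a continuous_on_subset by blast
    then obtain A where A: "\<And>s. s \<in> {y..x} \<Longrightarrow> (A has_vector_derivative a s) (at s within {y..x})"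
      using antiderivative_continuous by blast
    have Ac: "continuous_on {y..x} A"
      using A by (meson continuous_on_eq_continuous_within has_vector_derivative_continuous)
    have A': "(A has_vector_derivative a s) (at s)" if "y < s" "s < x" for s
      using A[of s] that at_within_Icc_at[of y s x] by simp
    \<comment> \<open>Monotonicity of g bounds Re (A s) - Re (A x) by -\<mu> (x - s) plus the
      oscillation of \<theta>.\<close>
    define g where "g s = Re (A s) - \<mu> * s - \<theta> s" for s
    have \<theta>c: "continuous_on {y..x} \<theta>"
      using \<theta> by (meson DERIV_isCont continuous_at_imp_continuous_on)
    have mono: "g s \<le> g x" if "y \<le> s" "s \<le> x" for s
    proof (rule DERIV_nonneg_imp_increasing_open[OF that(2)])
      fix r assume r: "s < r" "r < x"
      have "y < r" "r < x"
        using r that by auto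
      then have "((\<lambda>s. Re (A s)) has_vector_derivative Re (a r)) (at r)"
        by (intro bounded_linear.has_vector_derivative[OF bounded_linear_Re] A')
      then have "((\<lambda>s. Re (A s)) has_real_derivative Re (a r)) (at r)"
        by (simp add: has_real_derivative_iff_has_vector_derivative)
      then have "(g has_real_derivative (Re (a r) - \<mu> - \<theta>' r)) (at r)"
        unfolding g_def by (intro DERIV_diff DERIV_cmult_Id \<theta>)
      then show "\<exists>y. (g has_real_derivative y) (at r) \<and> 0 \<le> y"
        using re[of r] by (intro exI[of _ "Re (a r) - \<mu> - \<theta>' r"]) auto
    next
      show "continuous_on {s..x} g"
        unfolding g_def
        by (intro continuous_intros continuous_on_subset[OF Ac] continuous_on_subset[OF \<theta>c])
          (use that in auto)
    qed
    have expA: "norm (exp (A s - A x)) \<le> exp (2 * M - \<mu> * (x - s))" if "y \<le> s" "s \<le> x" for s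
    proof -
      have "Re (A s) - Re (A x) \<le> 2 * M - \<mu> * (x - s)"
        using mono[OF that] M[of s] M[of x] unfolding g_def by (simp add: algebra_simps abs_le_iff)
      then show ?thesis
        by simp
    qed
    define h where "h s = exp (A s - A x) * z s" for s
    define \<phi> where "\<phi> s = 2 * exp (2 * M) * K * \<rho> x * (exp (- \<mu> * (x - s)) * p (x - s))" for s
    have "norm (h x - h y) \<le> \<phi> x - \<phi> y"
    proof (rule differentiable_bound_general[where f' = "\<lambda>s. exp (A s - A x) * c s"
          and \<phi>' = "\<lambda>s. 2 * exp (2 * M) * K * \<rho> x * (exp (- \<mu> * (x - s)) * (1 + (x - s)\<^sup>2))"])
      show "y < x" by fact
      have "continuous_on {y..x} z"
        using z by (meson continuous_at_imp_continuous_on has_vector_derivative_continuous)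
      then show "continuous_on {y..x} h"
        unfolding h_def by (intro continuous_intros Ac)
      show "continuous_on {y..x} \<phi>"
        unfolding \<phi>_def p_def using \<mu> by (intro continuous_intros) auto
      fix s assume s: "y < s" "s < x"
      have "((\<lambda>s. exp (A s - A x)) has_vector_derivative (a s * exp (A s - A x))) (at s)"
        by (rule has_vector_derivative_eq_rhs,
            rule field_vector_diff_chain_at[where f = "\<lambda>s. A s - A x" and g = exp, unfolded o_def])
           (auto intro!: derivative_eq_intros A'[OF s])
      then show "(h has_vector_derivative exp (A s - A x) * c s) (at s)"
        unfolding h_def
        by (auto intro!: derivative_eq_intros z simp: algebra_simps)
      show "(\<phi> has_vector_derivative
          2 * exp (2 * M) * K * \<rho> x * (exp (- \<mu> * (x - s)) * (1 + (x - s)\<^sup>2))) (at s)"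
      proof -
        have e: "((\<lambda>s. exp (- \<mu> * (x - s))) has_real_derivative (\<mu> * exp (- \<mu> * (x - s)))) (at s)"
          by (auto intro!: derivative_eq_intros)
        have "((\<lambda>s. (x - s)\<^sup>2) has_real_derivative (- 2 * (x - s))) (at s)"
          by (auto intro!: derivative_eq_intros)
        moreover have "((\<lambda>s. 2 * (x - s)) has_real_derivative (- 2)) (at s)"
          by (auto intro!: derivative_eq_intros)
        ultimately have "((\<lambda>s. p (x - s)) has_real_derivative
            (- 2 * (x - s)) / \<mu> + (- 2) / \<mu>\<^sup>2 + 0) (at s)"
          unfolding p_def by (intro DERIV_add DERIV_cdivide DERIV_const)
        from DERIV_cmult[OF DERIV_mult[OF e this], of "2 * exp (2 * M) * K * \<rho> x"]
        have "(\<phi> has_real_derivative 2 * exp (2 * M) * K * \<rho> x * (\<mu> * exp (- \<mu> * (x - s)) * p (x - s)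
            + ((- 2 * (x - s)) / \<mu> + (- 2) / \<mu>\<^sup>2 + 0) * exp (- \<mu> * (x - s)))) (at s)"
          unfolding \<phi>_def .
        moreover have "\<mu> * p (x - s) + ((- 2 * (x - s)) / \<mu> + (- 2) / \<mu>\<^sup>2 + 0) = 1 + (x - s)\<^sup>2"
          using \<mu> unfolding p_def by (simp add: field_simps power2_eq_square power3_eq_cube)
        moreover have "\<mu> * e * b + d * e = e * (\<mu> * b + d)" for e b d :: real
          by (simp add: algebra_simps)
        ultimately show ?thesis
          by (simp only: has_real_derivative_iff_has_vector_derivative)
      qed
      have "norm (exp (A s - A x) * c s) \<le> exp (2 * M - \<mu> * (x - s)) * (K * \<rho> s)"
        unfolding norm_mult by (intro mult_mono expA c) (use s in auto)
      also have "\<dots> \<le> exp (2 * M - \<mu> * (x - s)) * (K * (2 * (1 + (x - s)\<^sup>2) * \<rho> x))"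
        by (intro mult_left_mono \<rho> K) auto
      also have "\<dots> = 2 * exp (2 * M) * K * \<rho> x * (exp (- \<mu> * (x - s)) * (1 + (x - s)\<^sup>2))"
      proof -
        have "exp (2 * M - \<mu> * (x - s)) = exp (2 * M) * exp (- \<mu> * (x - s))"
          by (simp add: exp_add[symmetric])
        then show ?thesis
          by (simp only: mult_ac)
      qed
      finally show "norm (exp (A s - A x) * c s)
          \<le> 2 * exp (2 * M) * K * \<rho> x * (exp (- \<mu> * (x - s)) * (1 + (x - s)\<^sup>2))" .
    qed
    moreover have "\<phi> y \<ge> 0"
      unfolding \<phi>_def p_def using that \<mu> K \<rho>0 by auto
    moreover have "\<phi> x = ?D"
      unfolding \<phi>_def by simp
    moreover have "norm (h y) \<le> exp (2 * M - \<mu> * (x - y)) * Z"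
      unfolding h_def norm_mult by (intro mult_mono expA Z) (use that in auto)
    moreover have "h x = z x"
      unfolding h_def by simp
    ultimately show ?thesis
      by (smt (verit) norm_triangle_ineq2)
  qed
  \<comment> \<open>Letting y tend to minus infinity removes the initial value: z is bounded and the
    exponential factor decays.\<close>
  have lim: "((\<lambda>y. exp (2 * M - \<mu> * (x - y)) * Z + ?D) \<longlongrightarrow> 0 * Z + ?D) at_bot"
  proof (intro tendsto_intros)
    have "LIM y at_bot. 2 * M - \<mu> * (x - y) :> at_bot"
      using \<mu> by real_asymp
    then show "((\<lambda>y. exp (2 * M - \<mu> * (x - y))) \<longlongrightarrow> 0) at_bot"
      by (rule filterlim_compose[OF exp_at_bot])
  qed
  have "norm (z x) \<le> 0 * Z + ?D"
    by (rule tendsto_lowerbound[OF lim])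
       (auto intro!: main eventually_mono[OF eventually_gt_at_bot[of x]]
          simp: eventually_at_bot_linorder intro: exI[of _ "x - 1"])
  then show ?thesis
    unfolding p_def by (simp add: algebra_simps)
qed

text \<open>The scalar \<open>w\<close> is the ratio of the two components of a solution of the AKNS system with spectral parameter \<open>k\<close>.\<close>

definition riccati :: "real \<Rightarrow> complex \<Rightarrow> (real \<Rightarrow> complex) \<Rightarrow> (real \<Rightarrow> complex) \<Rightarrow> bool" where
  "riccati \<sigma> k q w \<longleftrightarrow>
    (\<forall>x. (w has_vector_derivative (of_real \<sigma> * cnj (q x) - k * w x - q x * (w x)\<^sup>2)) (at x))
    \<and> (\<forall>x. norm (w x) \<le> 1 / 2)"

lemma riccatiD:
  assumes "riccati \<sigma> k q w"
  shows "(w has_vector_derivative (of_real \<sigma> * cnj (q x) - k * w x - q x * (w x)\<^sup>2)) (at x)"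
    and "norm (w x) \<le> 1 / 2"
  using assms by (auto simp: riccati_def)

lemma has_real_derivative_norm_square:
  fixes w :: "real \<Rightarrow> complex"
  assumes "(w has_vector_derivative w') (at x)"
  shows "((\<lambda>x. (norm (w x))\<^sup>2) has_real_derivative 2 * Re (cnj (w x) * w')) (at x)"
proof -
  have *: "((\<lambda>x. Re (w x)) has_real_derivative Re w') (at x)"
    "((\<lambda>x. Im (w x)) has_real_derivative Im w') (at x)"
    using assms by (simp_all add: has_vector_derivative_complex_iff)
  have "((\<lambda>x. (Re (w x))\<^sup>2 + (Im (w x))\<^sup>2) has_real_derivative 2 * Re (cnj (w x) * w')) (at x)"
    by (rule derivative_eq_intros * refl)+ simp
  then show ?thesis
    by (simp add: cmod_power2)
qed

lemma sigma_bounds: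
  fixes \<sigma> b :: real
  assumes "\<sigma> = 1 \<or> \<sigma> = -1" "\<bar>b\<bar> \<le> 1 / 2"
  shows "3 / 4 \<le> 1 - \<sigma> * b\<^sup>2" "1 - \<sigma> * b\<^sup>2 \<le> 5 / 4"
proof -
  have "b\<^sup>2 \<le> (1 / 2)\<^sup>2"
    using assms(2) by (metis abs_ge_zero power2_abs power_mono)
  then have "b\<^sup>2 \<le> 1 / 4"
    by (simp add: power2_eq_square)
  moreover have "0 \<le> b\<^sup>2" by simp
  ultimately have "- (1 / 4) \<le> \<sigma> * b\<^sup>2" "\<sigma> * b\<^sup>2 \<le> 1 / 4"
    using assms(1) by (elim disjE; clarsimp; linarith)+
  then show "3 / 4 \<le> 1 - \<sigma> * b\<^sup>2" "1 - \<sigma> * b\<^sup>2 \<le> 5 / 4"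
    by linarith+
qed

text \<open>As \<sigma>^2 = 1, the factor \<sigma> - |w|^2 in Re (cnj w w') equals \<sigma> (1 -
  \<sigma> |w|^2), so the division by 1 - \<sigma> |w|^2 leaves Re (q w) without denominator.
  Besides the energy identity this provides the bounded function that absorbs Re (q w) in
  \<open>riccati_pair_stability\<close>.\<close>

lemma riccati_log_derivative:
  assumes w: "riccati \<sigma> k q w" and \<sigma>: "\<sigma> = 1 \<or> \<sigma> = -1"
  shows "((\<lambda>x. - ln (1 - \<sigma> * (norm (w x))\<^sup>2)) has_real_derivative
    (2 * Re (q x * w x) - 2 * Re k * (\<sigma> * (norm (w x))\<^sup>2 / (1 - \<sigma> * (norm (w x))\<^sup>2)))) (at x)"
proof -
  let ?w' = "of_real \<sigma> * cnj (q x) - k * w x - q x * (w x)\<^sup>2"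
  have pos: "1 - \<sigma> * (norm (w x))\<^sup>2 > 0"
    using sigma_bounds(1)[OF \<sigma>, of "norm (w x)"] riccatiD(2)[OF w, of x] by simp
  have re: "Re (cnj (w x) * ?w') = (\<sigma> - (norm (w x))\<^sup>2) * Re (q x * w x) - Re k * (norm (w x))\<^sup>2"
    unfolding cmod_power2 by (simp add: algebra_simps power2_eq_square)
  define N D where "N = (\<lambda>x. (norm (w x))\<^sup>2)" and "D = 2 * Re (cnj (w x) * ?w')"
  have d: "(N has_real_derivative D) (at x)"
    unfolding N_def D_def by (rule has_real_derivative_norm_square[OF riccatiD(1)[OF w]])
  have "1 - \<sigma> * N x > 0"
    using pos by (simp add: N_def)
  then have "((\<lambda>x. - ln (1 - \<sigma> * N x)) has_real_derivative (\<sigma> * D / (1 - \<sigma> * N x))) (at x)"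
    by (auto intro!: derivative_eq_intros d)
  then have "((\<lambda>x. - ln (1 - \<sigma> * (norm (w x))\<^sup>2)) has_real_derivative
    (\<sigma> * (2 * Re (cnj (w x) * ?w')) / (1 - \<sigma> * (norm (w x))\<^sup>2))) (at x)"
    unfolding N_def D_def .
  also have "\<sigma> * (2 * Re (cnj (w x) * ?w')) / (1 - \<sigma> * (norm (w x))\<^sup>2)
     = 2 * Re (q x * w x) - 2 * Re k * (\<sigma> * (norm (w x))\<^sup>2 / (1 - \<sigma> * (norm (w x))\<^sup>2))"
    unfolding re using \<sigma> pos by (auto simp: field_simps simp del: minus_complex.simps times_complex.simps)
  finally show ?thesis .
qed

text \<open>The bounds by ln 2 and by -1/4 serve the stability estimate; the two quadratic ones pass
  the decay of w on to the energy density and to its antiderivative.\<close>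

lemma riccati_log_bound:
  assumes w: "riccati \<sigma> k q w" and \<sigma>: "\<sigma> = 1 \<or> \<sigma> = -1"
  shows "\<bar>- ln (1 - \<sigma> * (norm (w x))\<^sup>2)\<bar> \<le> ln 2"
    and "\<bar>- ln (1 - \<sigma> * (norm (w x))\<^sup>2)\<bar> \<le> 2 * (norm (w x))\<^sup>2"
    and "\<sigma> * (norm (w x))\<^sup>2 / (1 - \<sigma> * (norm (w x))\<^sup>2) \<ge> - (1 / 4)"
    and "\<bar>\<sigma> * (norm (w x))\<^sup>2 / (1 - \<sigma> * (norm (w x))\<^sup>2)\<bar> \<le> 2 * (norm (w x))\<^sup>2"
proof -
  let ?b = "(norm (w x))\<^sup>2"
  note s = sigma_bounds[OF \<sigma>, of "norm (w x)"]
  have b: "3 / 4 \<le> 1 - \<sigma> * ?b" "1 - \<sigma> * ?b \<le> 5 / 4"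
    using s riccatiD(2)[OF w, of x] by simp_all
  have b2: "?b \<le> 1 / 4"
    using b \<sigma> by (auto)
  have "ln (1 - \<sigma> * ?b) \<le> ln 2"
    using b by (intro ln_mono) auto
  moreover have "ln (1 / 2) \<le> ln (1 - \<sigma> * ?b)"
    using b by (intro ln_mono) auto
  ultimately show "\<bar>- ln (1 - \<sigma> * ?b)\<bar> \<le> ln 2"
    by (simp add: ln_div)
  have u: "ln (1 - \<sigma> * ?b) \<le> - \<sigma> * ?b"
    using ln_le_minus_one[of "1 - \<sigma> * ?b"] b by simp
  have "- ln (1 - \<sigma> * ?b) = ln (inverse (1 - \<sigma> * ?b))"
    using b by (simp add: ln_inverse)
  also have "\<dots> \<le> inverse (1 - \<sigma> * ?b) - 1"
    using b by (intro ln_le_minus_one) auto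
  also have "\<dots> = \<sigma> * ?b / (1 - \<sigma> * ?b)"
    using b by (simp add: field_simps)
  finally have l: "- ln (1 - \<sigma> * ?b) \<le> \<sigma> * ?b / (1 - \<sigma> * ?b)" .
  have r: "\<bar>\<sigma> * ?b / (1 - \<sigma> * ?b)\<bar> \<le> ?b / (3 / 4)"
    unfolding abs_divide using b \<sigma> by (intro frac_le) (auto simp: abs_mult)
  then show fr: "\<bar>\<sigma> * ?b / (1 - \<sigma> * ?b)\<bar> \<le> 2 * ?b"
    by (rule order_trans) simp
  have "\<bar>\<sigma> * ?b\<bar> \<le> 2 * ?b"
    using \<sigma> by auto
  then show "\<bar>- ln (1 - \<sigma> * ?b)\<bar> \<le> 2 * ?b"
    using u by (intro abs_leI order_trans[OF l] order_trans[OF abs_ge_self fr]) simp_all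
  show "\<sigma> * ?b / (1 - \<sigma> * ?b) \<ge> - (1 / 4)"
    using \<sigma>
  proof
    assume "\<sigma> = 1"
    then show ?thesis using b by (intro order_trans[OF _ divide_nonneg_pos]) auto
  next
    assume "\<sigma> = -1"
    moreover have "?b / (1 + ?b) \<le> 1 / 4"
      using b2 by (subst pos_divide_le_eq) (auto simp: add_pos_nonneg)
    ultimately show ?thesis by simp
  qed
qed

lemma riccati_continuous:
  "riccati \<sigma> k q w \<Longrightarrow> continuous_on A w"
  by (meson continuous_at_imp_continuous_on has_vector_derivative_continuous riccatiD(1))

text \<open>Differences of Riccati solutions obey a linear equation with coefficient k + q1 w1 + q2
  w2. With \<theta> the mean of the two logarithms, the terms Re (q1 w1) + Re (q2 w2) cancel and Re
  k times (1 + b1 + b2) is left, at least Re k / 2 because each b is at least -1/4. Hence \<mu> = Re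
  k / 2 and M = ln 2 in \<open>linear_ode_bound\<close>.\<close>

lemma riccati_pair_stability:
  fixes z c :: "real \<Rightarrow> complex" and \<rho> :: "real \<Rightarrow> real"
  assumes w1: "riccati \<sigma> k q1 w1" and w2: "riccati \<sigma> k q2 w2" and \<sigma>: "\<sigma> = 1 \<or> \<sigma> = -1"
    and q: "continuous_on UNIV q1" "continuous_on UNIV q2" and k: "Re k > 0"
    and z: "\<And>x. (z has_vector_derivative (c x - (k + q1 x * w1 x + q2 x * w2 x) * z x)) (at x)"
    and Z: "\<And>x. norm (z x) \<le> Z"
    and c: "\<And>x. norm (c x) \<le> K * \<rho> x" and K: "K \<ge> 0"
    and \<rho>: "\<And>x y. \<rho> y \<le> 2 * (1 + (x - y)\<^sup>2) * \<rho> x"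
  shows "norm (z x) \<le> 4 * (4 / Re k + 32 / Re k ^ 3) * K * \<rho> x"
proof -
  define \<theta> where "\<theta> w x = - ln (1 - \<sigma> * (norm (w x :: complex))\<^sup>2)" for w and x :: real
  define b where "b w x = \<sigma> * (norm (w x))\<^sup>2 / (1 - \<sigma> * (norm (w x :: complex))\<^sup>2)" for w and x :: real
  have "norm (z x) \<le> exp (2 * ln 2) * (2 / (Re k / 2) + 4 / (Re k / 2) ^ 3) * K * \<rho> x"
  proof (rule linear_ode_bound[where a = "\<lambda>x. k + q1 x * w1 x + q2 x * w2 x" and c = c and \<rho> = \<rho>
        and \<theta> = "\<lambda>x. (\<theta> w1 x + \<theta> w2 x) / 2"
        and \<theta>' = "\<lambda>x. (2 * Re (q1 x * w1 x) - 2 * Re k * b w1 x + (2 * Re (q2 x * w2 x) - 2 * Re k * b w2 x)) / 2"])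
    show "continuous_on UNIV (\<lambda>x. k + q1 x * w1 x + q2 x * w2 x)"
      by (intro continuous_intros q riccati_continuous[OF w1] riccati_continuous[OF w2])
    fix x
    show "((\<lambda>x. (\<theta> w1 x + \<theta> w2 x) / 2) has_real_derivative
       (2 * Re (q1 x * w1 x) - 2 * Re k * b w1 x + (2 * Re (q2 x * w2 x) - 2 * Re k * b w2 x)) / 2) (at x)"
      unfolding \<theta>_def b_def
      by (intro DERIV_cdivide DERIV_add riccati_log_derivative[OF w1 \<sigma>] riccati_log_derivative[OF w2 \<sigma>])
    have "- (1 / 4) \<le> b w1 x" "- (1 / 4) \<le> b w2 x"
      unfolding b_def using riccati_log_bound(3)[OF w1 \<sigma>] riccati_log_bound(3)[OF w2 \<sigma>] by auto
    then have "Re k * (- (1 / 4)) \<le> Re k * b w1 x" "Re k * (- (1 / 4)) \<le> Re k * b w2 x"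
      using k mult_left_mono[of "- (1 / 4)" _ "Re k"] by (meson less_imp_le)+
    then show "Re k / 2 + (2 * Re (q1 x * w1 x) - 2 * Re k * b w1 x + (2 * Re (q2 x * w2 x) - 2 * Re k * b w2 x)) / 2
      \<le> Re (k + q1 x * w1 x + q2 x * w2 x)"
      by (simp add: field_simps)
    have "\<bar>\<theta> w1 x\<bar> \<le> ln 2" "\<bar>\<theta> w2 x\<bar> \<le> ln 2"
      unfolding \<theta>_def using riccati_log_bound(1)[OF w1 \<sigma>] riccati_log_bound(1)[OF w2 \<sigma>] by auto
    then show "\<bar>(\<theta> w1 x + \<theta> w2 x) / 2\<bar> \<le> ln 2"
      by (simp add: abs_le_iff)
  qed (rule z Z c K \<rho> | use k in simp)+
  also have "exp (2 * ln 2) = (4 :: real)"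
    by (simp only: exp_double) simp
  also have "2 / (Re k / 2) + 4 / (Re k / 2) ^ 3 = 4 / Re k + 32 / Re k ^ 3"
    by (simp add: power_divide)
  finally show ?thesis .
qed

subsection \<open>Decay and continuity in time\<close>

text \<open>On the line, \<open>X\<close> is Lebesgue measure, \<open>L = 0\<close> and \<open>\<rho> x = 1 / (1 + x\<^sup>2)\<close>; on the circle, \<open>X\<close> is
  Lebesgue measure on a period, \<open>L = 2 * pi\<close> and \<open>\<rho> = 1\<close>.\<close>

locale phys =
  fixes X :: "real measure" and L :: real and \<rho> :: "real \<Rightarrow> real"
  assumes sets_X: "sets X = sets borel"
    and \<rho>_pos: "\<And>x. \<rho> x > 0" and \<rho>_le: "\<And>x. \<rho> x \<le> 1"
    and \<rho>_shift: "\<And>x y. \<rho> y \<le> 2 * (1 + (x - y)\<^sup>2) * \<rho> x"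
    and \<rho>_int: "integrable X \<rho>"
    and int_deriv: "\<And>g g' K c. \<lbrakk>\<And>x. (g has_vector_derivative g' x) (at x); continuous_on UNIV g';
      \<And>x. g (x + L) = g x; \<And>x. norm (g' x) \<le> K * \<rho> x; \<And>x. norm (g x - c) \<le> K * \<rho> x\<rbrakk>
      \<Longrightarrow> (LINT x|X. g' x) = (0 :: complex)"
begin

definition dec :: "(real \<Rightarrow> 'a::real_normed_vector) \<Rightarrow> bool" where
  "dec f \<longleftrightarrow> (\<exists>K. \<forall>x. norm (f x) \<le> K * \<rho> x)"

lemma decE:
  assumes "dec f"
  obtains K where "K > 0" "\<And>x. norm (f x) \<le> K * \<rho> x" "\<And>x. norm (f x) \<le> K"
proof -
  obtain K where K: "\<And>x. norm (f x) \<le> K * \<rho> x"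
    using assms by (auto simp: dec_def)
  have "norm (f x) \<le> (\<bar>K\<bar> + 1) * \<rho> x" for x
    using K[of x] \<rho>_pos[of x] by (smt (verit) mult_right_mono)
  moreover have "(\<bar>K\<bar> + 1) * \<rho> x \<le> \<bar>K\<bar> + 1" for x
    using \<rho>_le[of x] \<rho>_pos[of x] by (intro mult_left_le) auto
  ultimately show ?thesis
    using that[of "\<bar>K\<bar> + 1"] by (meson abs_ge_zero add_nonneg_pos order_trans zero_less_one)
qed

lemma decI: "(\<And>x. norm (f x) \<le> K * \<rho> x) \<Longrightarrow> dec f"
  by (auto simp: dec_def)

lemma integrable_dec:
  fixes f :: "real \<Rightarrow> 'a::{banach, second_countable_topology}"
  assumes "continuous_on UNIV f" "dec f"
  shows "integrable X f"
proof -
  obtain K where K: "\<And>x. norm (f x) \<le> K * \<rho> x"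
    using assms by (auto simp: dec_def)
  have "f \<in> borel_measurable X"
    using borel_measurable_continuous_onI[OF assms(1)] measurable_cong_sets[OF sets_X refl] by blast
  then show ?thesis
    by (rule Bochner_Integration.integrable_bound[of X "\<lambda>x. K * \<rho> x", rotated])
       (use \<rho>_int K in \<open>auto intro!: AE_I2 order_trans[OF K]\<close>)
qed

lemma dec_add:
  assumes "dec f" "dec g" shows "dec (\<lambda>x. f x + g x)"
proof -
  obtain K K' where "\<And>x. norm (f x) \<le> K * \<rho> x" "\<And>x. norm (g x) \<le> K' * \<rho> x"
    using assms unfolding dec_def by blast
  then show ?thesis
    by (intro decI[of _ "K + K'"]) (metis norm_triangle_mono distrib_right)
qed

lemma dec_mult_bounded:
  fixes f g :: "real \<Rightarrow> complex"
  assumes "dec f" "\<And>x. norm (g x) \<le> B" shows "dec (\<lambda>x. f x * g x)" "dec (\<lambda>x. g x * f x)"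
proof -
  obtain K where K: "K > 0" "\<And>x. norm (f x) \<le> K * \<rho> x"
    using decE[OF assms(1)] by metis
  have "norm (f x) * norm (g x) \<le> (K * B) * \<rho> x" for x
    using mult_mono[OF K(2)[of x] assms(2)[of x]] K(1) \<rho>_pos[of x] by (simp add: mult_ac)
  then show "dec (\<lambda>x. f x * g x)" "dec (\<lambda>x. g x * f x)"
    by (auto intro!: decI[of _ "K * B"] simp: norm_mult mult.commute)
qed

lemma dec_mult:
  fixes f g :: "real \<Rightarrow> complex"
  assumes "dec f" "dec g" shows "dec (\<lambda>x. f x * g x)"
  using decE[OF assms(2)] dec_mult_bounded(1)[OF assms(1)] by metis

lemma dec_cnj: "dec f \<Longrightarrow> dec (\<lambda>x. cnj (f x))"
  by (simp add: dec_def)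

lemma dec_cmult: "dec f \<Longrightarrow> dec (\<lambda>x. c * f x :: complex)"
  using dec_mult_bounded(2)[of f "\<lambda>_. c" "norm c"] by simp

lemma dec_minus: "dec f \<Longrightarrow> dec (\<lambda>x. - f x)"
  by (simp add: dec_def)

lemma dec_diff: "dec f \<Longrightarrow> dec g \<Longrightarrow> dec (\<lambda>x. f x - g x)"
  using dec_add[of f "\<lambda>x. - g x"] dec_minus[of g] by simp

text \<open>With the quadratic term moved to the forcing, |w| <= 1/2 bounds the forcing by 2 |q|,
  and the constant coefficient k needs no correction \<theta>.\<close>

lemma dec_riccati:
  assumes w: "riccati \<sigma> k q w" and q: "dec q" and k: "Re k > 0" and \<sigma>: "\<sigma> = 1 \<or> \<sigma> = -1"
  shows "dec w"
proof -
  obtain K where K: "K > 0" "\<And>x. norm (q x) \<le> K * \<rho> x"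
    using decE[OF q] by metis
  have w2: "norm (w x) \<le> 1 / 2" for x
    by (rule riccatiD(2)[OF w])
  have c: "norm (of_real \<sigma> * cnj (q x) - q x * (w x)\<^sup>2) \<le> (2 * K) * \<rho> x" for x
  proof -
    have "norm (w x) ^ 2 \<le> 1"
      using w2[of x] by (intro power_le_one) auto
    then have "norm (q x) * norm (w x) ^ 2 \<le> norm (q x) * 1"
      by (intro mult_left_mono) auto
    moreover have "norm (of_real \<sigma> * cnj (q x)) = norm (q x)"
      using \<sigma> by (auto simp: norm_mult)
    moreover have "norm (q x * (w x)\<^sup>2) = norm (q x) * norm (w x) ^ 2"
      by (simp add: norm_mult norm_power)
    ultimately have "norm (of_real \<sigma> * cnj (q x) - q x * (w x)\<^sup>2) \<le> 2 * norm (q x)"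
      by (intro order_trans[OF norm_triangle_ineq4]) linarith
    then show ?thesis
      using K(2)[of x] by simp
  qed
  have "norm (w x) \<le> exp (2 * 0) * (2 / Re k + 4 / Re k ^ 3) * (2 * K) * \<rho> x" for x
    by (rule linear_ode_bound[where \<rho> = \<rho> and \<theta> = "\<lambda>_. 0" and \<theta>' = "\<lambda>_. 0" and a = "\<lambda>_. k"
            and c = "\<lambda>x. of_real \<sigma> * cnj (q x) - q x * (w x)\<^sup>2" and Z = "1 / 2" and M = 0])
       (use riccatiD(1)[OF w] w2 c k K(1) \<rho>_shift in \<open>simp_all add: algebra_simps\<close>)
  then show ?thesis
    by (rule decI)
qed

text \<open>\<open>int_deriv\<close> applied to the logarithm: its boundary values cancel at
  infinity on the line and by periodicity on the circle. \<open>int_deriv\<close> speaks of complex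
  functions, hence the coercions. The last step multiplies by \<sigma> and uses \<sigma>^2 =
  1.\<close>

lemma energy_identity:
  assumes w: "riccati \<sigma> k q w" and q: "dec q" "continuous_on UNIV q" and k: "Re k > 0"
    and \<sigma>: "\<sigma> = 1 \<or> \<sigma> = -1" and per: "\<And>x. w (x + L) = w x"
  shows "Re k * (LINT x|X. (norm (w x))\<^sup>2 / (1 - \<sigma> * (norm (w x))\<^sup>2)) = \<sigma> * Re (LINT x|X. q x * w x)"
proof -
  let ?N = "\<lambda>x. (norm (w x))\<^sup>2"
  let ?b = "\<lambda>x. \<sigma> * ?N x / (1 - \<sigma> * ?N x)"
  have decw: "dec w"
    by (rule dec_riccati[OF w q(1) k \<sigma>])
  have cw: "continuous_on UNIV w"
    by (rule riccati_continuous[OF w])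
  have nz: "1 - \<sigma> * ?N x \<noteq> 0" for x
    using sigma_bounds(1)[OF \<sigma>, of "norm (w x)"] riccatiD(2)[OF w, of x] by auto
  obtain Kw where Kw: "Kw > 0" "\<And>x. norm (w x) \<le> Kw * \<rho> x" "\<And>x. norm (w x) \<le> Kw"
    using decE[OF decw] by metis
  have N: "?N x \<le> (Kw * Kw) * \<rho> x" for x
    unfolding power2_eq_square using mult_mono[OF Kw(3)[of x] Kw(2)[of x]] Kw(1) by (simp add: mult.assoc)
  have cb: "continuous_on UNIV ?b"
    by (intro continuous_intros cw) (use nz in auto)
  have decb: "dec ?b"
    by (rule decI[of _ "2 * (Kw * Kw)"])
       (use mult_left_mono[OF N, of 2] order_trans[OF riccati_log_bound(4)[OF w \<sigma>]] in \<open>simp add: mult.assoc\<close>)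
  have cqw: "continuous_on UNIV (\<lambda>x. q x * w x)"
    by (intro continuous_intros cw q)
  have decqw: "dec (\<lambda>x. q x * w x)"
    by (rule dec_mult[OF q(1) decw])
  note int = integrable_dec[OF cb decb] integrable_dec[OF cqw decqw]
  obtain Kd where Kd: "\<And>x. norm (complex_of_real (2 * Re (q x * w x) - 2 * Re k * ?b x)) \<le> Kd * \<rho> x"
  proof -
    obtain K1 where K1: "\<And>x. norm (q x * w x) \<le> K1 * \<rho> x"
      using decqw by (auto simp: dec_def)
    obtain K2 where K2: "\<And>x. norm (?b x) \<le> K2 * \<rho> x"
      using decb by (auto simp: dec_def)
    have "norm (complex_of_real (2 * Re (q x * w x) - 2 * Re k * ?b x)) \<le> (2 * K1 + 2 * Re k * K2) * \<rho> x" for x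
    proof -
      have "\<bar>Re (q x * w x)\<bar> \<le> K1 * \<rho> x"
        using K1[of x] abs_Re_le_cmod[of "q x * w x"] by linarith
      moreover have "\<bar>Re k * ?b x\<bar> \<le> Re k * (K2 * \<rho> x)"
        using K2[of x] k by (simp only: abs_mult abs_of_pos real_norm_def) (intro mult_left_mono, auto)
      ultimately have "\<bar>2 * Re (q x * w x) - 2 * Re k * ?b x\<bar> \<le> 2 * (K1 * \<rho> x) + 2 * (Re k * (K2 * \<rho> x))"
        by (simp only: mult.assoc)
      then show ?thesis
        unfolding norm_of_real by (simp only: algebra_simps)
    qed
    then show ?thesis
      using that by blast
  qed
  have "(LINT x|X. complex_of_real (2 * Re (q x * w x) - 2 * Re k * ?b x)) = 0"
  proof (rule int_deriv[where g = "\<lambda>x. complex_of_real (- ln (1 - \<sigma> * ?N x))" and K = "Kd + 2 * (Kw * Kw)" and c = 0])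
    fix x
    show "((\<lambda>x. complex_of_real (- ln (1 - \<sigma> * ?N x))) has_vector_derivative
       complex_of_real (2 * Re (q x * w x) - 2 * Re k * ?b x)) (at x)"
      using riccati_log_derivative[OF w \<sigma>, of x]
      unfolding has_real_derivative_iff_has_vector_derivative
      by (rule bounded_linear.has_vector_derivative[OF bounded_linear_of_real])
    show "complex_of_real (- ln (1 - \<sigma> * ?N (x + L))) = complex_of_real (- ln (1 - \<sigma> * ?N x))"
      using per by simp
    have "Kd * \<rho> x \<le> (Kd + 2 * (Kw * Kw)) * \<rho> x" "2 * (Kw * Kw) * \<rho> x \<le> (Kd + 2 * (Kw * Kw)) * \<rho> x"
      using \<rho>_pos[of x] order_trans[OF norm_ge_zero Kd[of x]] by (auto simp: distrib_right)
    moreover have "\<bar>ln (1 - \<sigma> * ?N x)\<bar> \<le> 2 * (Kw * Kw) * \<rho> x"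
      using riccati_log_bound(2)[OF w \<sigma>, of x] N[of x] by simp
    ultimately show "norm (complex_of_real (2 * Re (q x * w x) - 2 * Re k * ?b x)) \<le> (Kd + 2 * (Kw * Kw)) * \<rho> x"
      "norm (complex_of_real (- ln (1 - \<sigma> * ?N x)) - 0) \<le> (Kd + 2 * (Kw * Kw)) * \<rho> x"
      using Kd[of x] by (auto simp del: of_real_minus of_real_diff of_real_mult intro: order_trans)
  next
    show "continuous_on UNIV (\<lambda>x. complex_of_real (2 * Re (q x * w x) - 2 * Re k * ?b x))"
      by (intro continuous_intros cw q) (use nz in auto)
  qed
  then have "(LINT x|X. 2 * Re (q x * w x) - 2 * Re k * ?b x) = 0"
    by (simp only: integral_complex_of_real of_real_eq_0_iff)
  then have "2 * (LINT x|X. Re (q x * w x)) - 2 * Re k * (LINT x|X. ?b x) = 0"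
  proof -
    have "integrable X (\<lambda>x. 2 * Re (q x * w x))" "integrable X (\<lambda>x. 2 * Re k * ?b x)"
      by (intro integrable_mult_right integrable_Re int)+
    from Bochner_Integration.integral_diff[OF this] show ?thesis
      using \<open>(LINT x|X. 2 * Re (q x * w x) - 2 * Re k * ?b x) = 0\<close>
      by (simp only: integral_mult_right_zero)
  qed
  moreover have "(LINT x|X. Re (q x * w x)) = Re (LINT x|X. q x * w x)"
    by (rule integral_Re[OF int(2)])
  moreover have "(LINT x|X. ?b x) = \<sigma> * (LINT x|X. ?N x / (1 - \<sigma> * ?N x))"
    by (simp only: times_divide_eq_right[symmetric] integral_mult_right_zero)
  ultimately have "2 * Re (LINT x|X. q x * w x) - 2 * Re k * (\<sigma> * (LINT x|X. ?N x / (1 - \<sigma> * ?N x))) = 0"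
    by (simp only:)
  then have "Re k * (\<sigma> * (LINT x|X. ?N x / (1 - \<sigma> * ?N x))) = Re (LINT x|X. q x * w x)"
    by (simp only: mult.assoc)
  then show ?thesis
    using \<sigma> by auto
qed

text \<open>Continuity in time for the norm sup |f| / \<rho>. Both the Schwartz and the smooth
  periodic topology give it for every x-derivative of the solution.\<close>

definition wcont :: "(real \<Rightarrow> real \<Rightarrow> complex) \<Rightarrow> bool" where
  "wcont f \<longleftrightarrow> (\<forall>t. dec (f t) \<and> (\<forall>e>0. \<exists>d>0. \<forall>s. \<bar>s - t\<bar> < d \<longrightarrow> (\<forall>x. norm (f s x - f t x) \<le> e * \<rho> x)))"

lemma wcontD:
  assumes "wcont f"
  shows "dec (f t)"
    and "e > 0 \<Longrightarrow> \<exists>d>0. \<forall>s. \<bar>s - t\<bar> < d \<longrightarrow> (\<forall>x. norm (f s x - f t x) \<le> e * \<rho> x)"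
  using assms unfolding wcont_def by auto

lemma wcont_add:
  assumes f: "wcont f" and g: "wcont g"
  shows "wcont (\<lambda>t x. f t x + g t x)"
  unfolding wcont_def
proof (intro allI conjI impI)
  fix t show "dec (\<lambda>x. f t x + g t x)"
    by (intro dec_add wcontD f g)
next
  fix t e :: real assume "e > 0"
  then obtain d1 d2 where d: "d1 > 0" "\<And>s x. \<bar>s - t\<bar> < d1 \<Longrightarrow> norm (f s x - f t x) \<le> e / 2 * \<rho> x"
     "d2 > 0" "\<And>s x. \<bar>s - t\<bar> < d2 \<Longrightarrow> norm (g s x - g t x) \<le> e / 2 * \<rho> x"
    using wcontD(2)[OF f, of "e / 2" t] wcontD(2)[OF g, of "e / 2" t] half_gt_zero by metis
  show "\<exists>d>0. \<forall>s. \<bar>s - t\<bar> < d \<longrightarrow> (\<forall>x. norm (f s x + g s x - (f t x + g t x)) \<le> e * \<rho> x)"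
  proof (intro exI[of _ "min d1 d2"] conjI allI impI)
    fix s x assume "\<bar>s - t\<bar> < min d1 d2"
    then have "norm (f s x - f t x) + norm (g s x - g t x) \<le> e / 2 * \<rho> x + e / 2 * \<rho> x"
      by (intro add_mono d) auto
    moreover have "norm (f s x + g s x - (f t x + g t x)) \<le> norm (f s x - f t x) + norm (g s x - g t x)"
      by (metis add_diff_add norm_triangle_ineq)
    ultimately show "norm (f s x + g s x - (f t x + g t x)) \<le> e * \<rho> x"
      by simp
  qed (use d in auto)
qed

lemma wcont_cnj: "wcont f \<Longrightarrow> wcont (\<lambda>t x. cnj (f t x))"
  unfolding wcont_def by (metis complex_cnj_diff complex_mod_cnj dec_cnj)

text \<open>The second factor is only bounded and uniformly continuous, without decay, so that
  scalars depending on time are covered (\<open>wcont_scale\<close>).\<close>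

lemma wcont_mult:
  assumes f: "wcont f"
    and B: "\<And>t. \<exists>B. \<forall>x. norm (g t x) \<le> B"
    and g: "\<And>t e. e > 0 \<Longrightarrow> \<exists>d>0. \<forall>s. \<bar>s - t\<bar> < d \<longrightarrow> (\<forall>x. norm (g s x - g t x) \<le> e)"
  shows "wcont (\<lambda>t x. f t x * g t x)"
  unfolding wcont_def
proof (intro allI conjI impI)
  fix t show "dec (\<lambda>x. f t x * g t x)"
    using B[of t] dec_mult_bounded(1)[OF wcontD(1)[OF f]] by blast
next
  fix t e :: real assume e: "e > 0"
  obtain B where B: "B > 0" "\<And>x. norm (g t x) \<le> B"
    using assms(2)[of t] by (meson less_add_one order_trans less_imp_le abs_ge_self abs_ge_zero le_less_trans)
  obtain K where K: "K > 0" "\<And>x. norm (f t x) \<le> K * \<rho> x"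
    using decE[OF wcontD(1)[OF f]] by metis
  \<comment> \<open>e1 <= 1 bounds g near t by B + 1; the two parts of the product difference then
    add up to e1 (B + 1 + K) \<rho>.\<close>
  define e1 where "e1 = min 1 (e / (B + 1 + K))"
  have e1: "e1 > 0" "e1 \<le> 1" "e1 * (B + 1 + K) \<le> e"
  proof -
    show "e1 > 0" "e1 \<le> 1"
      using e B K by (auto simp: e1_def)
    have "e1 * (B + 1 + K) \<le> e / (B + 1 + K) * (B + 1 + K)"
      using B K by (intro mult_right_mono) (auto simp: e1_def)
    then show "e1 * (B + 1 + K) \<le> e"
      using B K by simp
  qed
  obtain d1 d2 where d: "d1 > 0" "\<And>s x. \<bar>s - t\<bar> < d1 \<Longrightarrow> norm (f s x - f t x) \<le> e1 * \<rho> x"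
     "d2 > 0" "\<And>s x. \<bar>s - t\<bar> < d2 \<Longrightarrow> norm (g s x - g t x) \<le> e1"
    using wcontD(2)[OF f e1(1), of t] g[OF e1(1), of t] by metis
  show "\<exists>d>0. \<forall>s. \<bar>s - t\<bar> < d \<longrightarrow> (\<forall>x. norm (f s x * g s x - f t x * g t x) \<le> e * \<rho> x)"
  proof (intro exI[of _ "min d1 d2"] conjI allI impI)
    fix s x assume s: "\<bar>s - t\<bar> < min d1 d2"
    have fs: "norm (f s x - f t x) \<le> e1 * \<rho> x" and gs: "norm (g s x - g t x) \<le> e1"
      using d(2,4)[of s x] s by auto
    have "norm (g s x) \<le> norm (g s x - g t x) + norm (g t x)"
      using norm_triangle_ineq[of "g s x - g t x" "g t x"] by simp
    then have gb: "norm (g s x) \<le> B + 1"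
      using gs B(2)[of x] e1 by linarith
    have "f s x * g s x - f t x * g t x = (f s x - f t x) * g s x + f t x * (g s x - g t x)"
      by (simp add: algebra_simps)
    then have "norm (f s x * g s x - f t x * g t x)
        \<le> norm (f s x - f t x) * norm (g s x) + norm (f t x) * norm (g s x - g t x)"
      by (metis norm_mult norm_triangle_ineq)
    also have "\<dots> \<le> (e1 * \<rho> x) * (B + 1) + (K * \<rho> x) * e1"
      using e1 \<rho>_pos[of x] K(1) by (intro add_mono mult_mono fs gs gb K(2)) auto
    also have "\<dots> = e1 * (B + 1 + K) * \<rho> x"
      by (simp add: algebra_simps)
    also have "\<dots> \<le> e * \<rho> x"
      using e1 \<rho>_pos[of x] by (intro mult_right_mono) auto
    finally show "norm (f s x * g s x - f t x * g t x) \<le> e * \<rho> x" .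
  qed (use d in auto)
qed

lemma wcont_mult2:
  assumes "wcont f" "wcont g"
  shows "wcont (\<lambda>t x. f t x * g t x)"
proof (rule wcont_mult[OF assms(1)])
  fix t show "\<exists>B. \<forall>x. norm (g t x) \<le> B"
    using decE[OF wcontD(1)[OF assms(2)]] by metis
next
  fix t e :: real assume "e > 0"
  then obtain d where d: "d > 0" "\<And>s x. \<bar>s - t\<bar> < d \<Longrightarrow> norm (g s x - g t x) \<le> e * \<rho> x"
    using wcontD(2)[OF assms(2)] by metis
  have "e * \<rho> x \<le> e" for x
    using \<rho>_le[of x] \<open>e > 0\<close> by simp
  then show "\<exists>d>0. \<forall>s. \<bar>s - t\<bar> < d \<longrightarrow> (\<forall>x. norm (g s x - g t x) \<le> e)"
    using d by (meson order_trans)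
qed

lemma wcont_scale:
  assumes "wcont f" "continuous_on UNIV (c :: real \<Rightarrow> complex)"
  shows "wcont (\<lambda>t x. c t * f t x)"
proof -
  have "wcont (\<lambda>t x. f t x * c t)"
  proof (rule wcont_mult[OF assms(1)])
    fix t e :: real assume "e > 0"
    then show "\<exists>d>0. \<forall>s. \<bar>s - t\<bar> < d \<longrightarrow> (\<forall>x::real. norm (c s - c t) \<le> e)"
      using assms(2) unfolding continuous_on_iff dist_norm real_norm_def
      by (metis UNIV_I less_imp_le)
  qed auto
  then show ?thesis
    by (simp add: mult.commute)
qed

end

subsection \<open>Conservation of the Riccati energy along the flow\<close>

lemma complex_of_norm_squared: "(complex_of_real (norm z))\<^sup>2 = z * cnj z"
  by (simp add: complex_norm_square flip: of_real_power)

text \<open>The entries of the time matrix of the AKNS pair for the modified KdV flow.\<close>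

definition akns_a :: "complex \<Rightarrow> complex \<Rightarrow> complex \<Rightarrow> complex \<Rightarrow> complex \<Rightarrow> complex" where
  "akns_a k q r q1 r1 = - (k ^ 3 / 2) + q * r * k - (q * r1 - q1 * r)"

definition akns_b :: "complex \<Rightarrow> complex \<Rightarrow> complex \<Rightarrow> complex \<Rightarrow> complex \<Rightarrow> complex" where
  "akns_b k q r q1 q2 = - (q * k\<^sup>2) - q1 * k - q2 + 2 * q\<^sup>2 * r"

definition akns_c :: "complex \<Rightarrow> complex \<Rightarrow> complex \<Rightarrow> complex \<Rightarrow> complex \<Rightarrow> complex" where
  "akns_c k q r r1 r2 = - (r * k\<^sup>2) + r1 * k - r2 + 2 * q * r\<^sup>2"

text \<open>The time derivative that the Lax pair predicts for w. If the vector (y1, y2) evolves by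
  the matrix with rows (a, b) and (c, -a), then w = y2 / y1 satisfies w_t = c - 2 a w - b w^2. The
  last bracket is w_x, so the term with c0 accounts for transport at speed c0.\<close>

definition akns_P :: "complex \<Rightarrow> complex \<Rightarrow> complex \<Rightarrow> complex \<Rightarrow> complex \<Rightarrow> complex \<Rightarrow> complex \<Rightarrow> complex \<Rightarrow> complex \<Rightarrow> complex" where
  "akns_P k c0 q r q1 r1 q2 r2 w = akns_c k q r r1 r2 - 2 * akns_a k q r q1 r1 * w
     - akns_b k q r q1 q2 * w\<^sup>2 - c0 * (r - k * w - q * w\<^sup>2)"

text \<open>The flux of the density q w. Since k / 2 + q w and a + b w are the x- and t-derivatives
  of ln y1, equality of mixed derivatives gives (q w)_t = (a + b w)_x; transport contributes -c0 q
  w.\<close>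

definition akns_J :: "complex \<Rightarrow> complex \<Rightarrow> complex \<Rightarrow> complex \<Rightarrow> complex \<Rightarrow> complex \<Rightarrow> complex \<Rightarrow> complex \<Rightarrow> complex" where
  "akns_J k c0 q r q1 r1 q2 w = akns_a k q r q1 r1 + akns_b k q r q1 q2 * w - c0 * q * w"

text \<open>A statement at fixed time: \<open>V\<close> and \<open>R\<close> are merely the
  right-hand sides of the flow for q and r. The first claim says that the candidate \<open>P\<close>
  solves the Riccati equation linearised in the direction (V, R); the second is the conservation law
  with \<open>P\<close> in the place of w_t. Once the derivatives are expanded, both are polynomial
  identities.\<close>

lemma akns_derivatives:
  fixes q r q1 r1 q2 r2 w :: "real \<Rightarrow> complex" and q3 r3 k c0 :: complex
  assumes q: "(q has_vector_derivative q1 x) (at x)" and r: "(r has_vector_derivative r1 x) (at x)"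
    and q1: "(q1 has_vector_derivative q2 x) (at x)" and r1: "(r1 has_vector_derivative r2 x) (at x)"
    and q2: "(q2 has_vector_derivative q3) (at x)" and r2: "(r2 has_vector_derivative r3) (at x)"
    and w: "(w has_vector_derivative (r x - k * w x - q x * (w x)\<^sup>2)) (at x)"
  defines "V \<equiv> - q3 + 6 * q x * r x * q1 x - c0 * q1 x"
    and "R \<equiv> - r3 + 6 * q x * r x * r1 x - c0 * r1 x"
    and "P \<equiv> \<lambda>x. akns_P k c0 (q x) (r x) (q1 x) (r1 x) (q2 x) (r2 x) (w x)"
  shows "(P has_vector_derivative (R - k * P x - V * (w x)\<^sup>2 - 2 * q x * w x * P x)) (at x)"
    and "((\<lambda>x. akns_J k c0 (q x) (r x) (q1 x) (r1 x) (q2 x) (w x))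
      has_vector_derivative (V * w x + q x * P x)) (at x)"
proof -
  let ?w' = "r x - k * w x - q x * (w x)\<^sup>2"
  define a' where "a' = (q1 x * r x + q x * r1 x) * k - (q x * r2 x - q2 x * r x)"
  define b' where "b' = - (q1 x * k\<^sup>2) - q2 x * k - q3 + 2 * (2 * q x * q1 x * r x + (q x)\<^sup>2 * r1 x)"
  define c' where "c' = - (r1 x * k\<^sup>2) + r2 x * k - r3 + 2 * (q1 x * (r x)\<^sup>2 + q x * (2 * r x * r1 x))"
  have sq: "((\<lambda>x. (f x)\<^sup>2) has_vector_derivative 2 * f x * f') (at x)"
    if "(f has_vector_derivative f') (at x)" for f :: "real \<Rightarrow> complex" and f'
    unfolding power2_eq_square
    by (rule has_vector_derivative_eq_rhs[OF has_vector_derivative_mult[OF that that]]) simp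
  have cm: "((\<lambda>x. c * f x) has_vector_derivative c * f') (at x)"
    "((\<lambda>x. f x * c) has_vector_derivative f' * c) (at x)"
    if "(f has_vector_derivative f') (at x)" for f :: "real \<Rightarrow> complex" and f' c
    using that by (auto intro!: derivative_eq_intros)
  have da: "((\<lambda>x. akns_a k (q x) (r x) (q1 x) (r1 x)) has_vector_derivative a') (at x)"
    unfolding akns_a_def
    by (rule has_vector_derivative_eq_rhs, (rule q r q1 r1 has_vector_derivative_const has_vector_derivative_add
         has_vector_derivative_diff has_vector_derivative_mult)+)
       (simp add: a'_def algebra_simps)
  have db: "((\<lambda>x. akns_b k (q x) (r x) (q1 x) (q2 x)) has_vector_derivative b') (at x)"
    unfolding akns_b_def
    by (rule has_vector_derivative_eq_rhs, (rule q r q1 q2 has_vector_derivative_const sq has_vector_derivative_minus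
         has_vector_derivative_add has_vector_derivative_diff has_vector_derivative_mult)+)
       (simp add: b'_def algebra_simps)
  have dc: "((\<lambda>x. akns_c k (q x) (r x) (r1 x) (r2 x)) has_vector_derivative c') (at x)"
    unfolding akns_c_def
    by (rule has_vector_derivative_eq_rhs, (rule q r r1 r2 has_vector_derivative_const sq has_vector_derivative_minus
         has_vector_derivative_add has_vector_derivative_diff has_vector_derivative_mult)+)
       (simp add: c'_def algebra_simps)
  let ?a = "\<lambda>x. akns_a k (q x) (r x) (q1 x) (r1 x)" and ?b = "\<lambda>x. akns_b k (q x) (r x) (q1 x) (q2 x)"
  have "(P has_vector_derivative (c' - (2 * ?a x * ?w' + 2 * a' * w x) - (?b x * (2 * w x * ?w') + b' * (w x)\<^sup>2)
      - c0 * (r1 x - k * ?w' - (q x * (2 * w x * ?w') + q1 x * (w x)\<^sup>2)))) (at x)"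
    unfolding P_def akns_P_def
    by (intro has_vector_derivative_diff has_vector_derivative_mult cm sq q r w da db dc)
  then show "(P has_vector_derivative (R - k * P x - V * (w x)\<^sup>2 - 2 * q x * w x * P x)) (at x)"
    by (rule has_vector_derivative_eq_rhs)
       (unfold P_def akns_P_def R_def V_def akns_a_def akns_b_def akns_c_def a'_def b'_def c'_def, algebra)
  have "((\<lambda>x. akns_J k c0 (q x) (r x) (q1 x) (r1 x) (q2 x) (w x))
      has_vector_derivative (a' + (?b x * ?w' + b' * w x) - (c0 * q x * ?w' + c0 * q1 x * w x))) (at x)"
    unfolding akns_J_def
    by (intro has_vector_derivative_add has_vector_derivative_diff has_vector_derivative_mult cm q w da db)
  then show "((\<lambda>x. akns_J k c0 (q x) (r x) (q1 x) (r1 x) (q2 x) (w x))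
      has_vector_derivative (V * w x + q x * P x)) (at x)"
    by (rule has_vector_derivative_eq_rhs)
       (unfold P_def akns_P_def R_def V_def akns_a_def akns_b_def akns_c_def a'_def b'_def c'_def, algebra)
qed

text \<open>The continuous function \<open>c\<close> unifies the equations: it is 0 for mKdV and 6
  \<sigma> times the mean of |u|^2 for the renormalised equation. On the line the period is L = 0
  and \<open>per_u\<close> is trivial.\<close>

locale mkdv_flow = phys +
  fixes \<sigma> :: real and u :: "real \<Rightarrow> real \<Rightarrow> complex" and c :: "real \<Rightarrow> real"
  assumes \<sigma>: "\<sigma> = 1 \<or> \<sigma> = -1"
    and smooth_u: "\<And>t j x. ((dx ^^ j) (u t) has_vector_derivative (dx ^^ Suc j) (u t) x) (at x)"
    and per_u: "\<And>t j x. (dx ^^ j) (u t) (x + L) = (dx ^^ j) (u t) x"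
    and wcont_u: "\<And>j. wcont (\<lambda>t. (dx ^^ j) (u t))"
    and cont_c: "continuous_on UNIV c"
    and flow: "\<And>t x. ((\<lambda>s. u s x) has_vector_derivative
      - (dx ^^ 3) (u t) x + of_real (\<sigma> * 6 * (norm (u t x))\<^sup>2 - c t) * dx (u t) x) (at t)"
begin

abbreviation "v t \<equiv> (\<lambda>x. - (dx ^^ 3) (u t) x + of_real (\<sigma> * 6 * (norm (u t x))\<^sup>2 - c t) * dx (u t) x)"

lemma cont_u: "continuous_on UNIV ((dx ^^ j) (u t))"
  by (meson continuous_at_imp_continuous_on has_vector_derivative_continuous smooth_u)

lemma cont_u0: "continuous_on UNIV (u t)"
  using cont_u[of 0 t] by simp

lemma wcont_u0: "wcont u"
  using wcont_u[of 0] by simp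

lemma wcont_u1: "wcont (\<lambda>t. dx (u t))"
  using wcont_u[of 1] by simp

lemma dec_u: "dec ((dx ^^ j) (u t))"
  by (rule wcontD(1)[OF wcont_u])

lemma wcont_v: "wcont v"
proof -
  have "wcont (\<lambda>t x. (-1) * (dx ^^ 3) (u t) x + (of_real (\<sigma> * 6) * ((u t x * cnj (u t x)) * dx (u t) x)
       + of_real (- c t) * dx (u t) x))"
    by (intro wcont_add wcont_scale wcont_mult2 wcont_cnj wcont_u wcont_u0 wcont_u1 continuous_intros cont_c)
  then show ?thesis
    by (simp add: complex_of_norm_squared algebra_simps)
qed

text \<open>The equation gives a time derivative only for each x separately. Continuity of v in the
  \<rho>-weighted norm and the mean value inequality make the difference quotient converge uniformly
  relative to \<rho>.\<close>

lemma flow_quotient: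
  assumes "e > 0"
  obtains d where "d > 0" "\<And>s x. \<bar>s - t\<bar> < d \<Longrightarrow> norm (u s x - u t x - (s - t) *\<^sub>R v t x) \<le> \<bar>s - t\<bar> * (e * \<rho> x)"
proof -
  obtain d where d: "d > 0" "\<And>s x. \<bar>s - t\<bar> < d \<Longrightarrow> norm (v s x - v t x) \<le> e * \<rho> x"
    using wcontD(2)[OF wcont_v assms, of t] by metis
  have "norm (u s x - u t x - (s - t) *\<^sub>R v t x) \<le> norm (s - t) * (e * \<rho> x)" if s: "\<bar>s - t\<bar> < d" for s x
  proof (rule vector_differentiable_bound_linearization[where S = "{t - d<..<t + d}" and f = "\<lambda>s. u s x" and f' = "\<lambda>s. v s x"])
    fix r assume "r \<in> {t - d<..<t + d}"
    then have "\<bar>r - t\<bar> < d" by auto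
    show "((\<lambda>s. u s x) has_vector_derivative v r x) (at r within {t - d<..<t + d})"
      by (rule has_vector_derivative_at_within[OF flow])
    show "norm (v r x - v t x) \<le> e * \<rho> x"
      by (rule d(2)[OF \<open>\<bar>r - t\<bar> < d\<close>])
  next
    show "closed_segment t s \<subseteq> {t - d<..<t + d}"
      using s d(1) by (intro closed_segment_subset) auto
    show "t \<in> {t - d<..<t + d}"
      using d(1) by auto
  qed
  then show ?thesis
    using that[OF d(1)] by simp
qed

text \<open>The integral of u w has derivative zero at t, whichever Riccati solution ws is taken at
  time s. With h = s - t, the error z = (ws - wt) / h - P solves a linear equation of the type of
  \<open>riccati_pair_stability\<close> with small forcing, so z is small. The first-order term of u
  w is then v wt + u P, an exact x-derivative by \<open>akns_derivatives\<close>.\<close>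

lemma riccati_flow_step:
  assumes k: "Re k > 0" and wt: "riccati \<sigma> k (u t) wt" and per: "\<And>x. wt (x + L) = wt x" and e: "e > 0"
  obtains d where "d > 0"
    "\<And>s ws. \<bar>s - t\<bar> < d \<Longrightarrow> riccati \<sigma> k (u s) ws \<Longrightarrow>
        norm ((LINT x|X. u s x * ws x) - (LINT x|X. u t x * wt x)) \<le> e * \<bar>s - t\<bar>"
proof -
  define r where "r j x = of_real \<sigma> * cnj ((dx ^^ j) (u t) x)" for j x
  define P where "P x = akns_P k (of_real (c t)) (u t x) (r 0 x) ((dx ^^ 1) (u t) x) (r 1 x) ((dx ^^ 2) (u t) x) (r 2 x) (wt x)" for x
  define J where "J x = akns_J k (of_real (c t)) (u t x) (r 0 x) ((dx ^^ 1) (u t) x) (r 1 x) ((dx ^^ 2) (u t) x) (wt x)" for x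
  have dr: "(r j has_vector_derivative r (Suc j) x) (at x)" for j x
    unfolding r_def using bounded_linear.has_vector_derivative[OF bounded_linear_cnj smooth_u]
    by (intro has_vector_derivative_mult_right)
  have V: "v t x = - (dx ^^ 3) (u t) x + 6 * u t x * r 0 x * (dx ^^ 1) (u t) x - of_real (c t) * (dx ^^ 1) (u t) x" for x
    by (simp add: r_def complex_of_norm_squared algebra_simps)
  have R: "of_real \<sigma> * cnj (v t x) = - r 3 x + 6 * u t x * r 0 x * r 1 x - of_real (c t) * r 1 x" for x
    by (simp add: r_def complex_of_norm_squared algebra_simps)
  have num: "Suc 0 = 1" "Suc 1 = 2" "Suc 2 = 3"
    by auto
  have wt': "(wt has_vector_derivative (r 0 x - k * wt x - u t x * (wt x)\<^sup>2)) (at x)" for x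
    using riccatiD(1)[OF wt, of x] by (simp add: r_def)
  note ak = akns_derivatives[OF smooth_u[of 0 t _, simplified funpow_0 num] dr[of 0 _, unfolded num]
      smooth_u[of 1 t, unfolded num] dr[of 1, unfolded num] smooth_u[of 2 t, unfolded num] dr[of 2, unfolded num] wt',
      where ?c0.0 = "of_real (c t)"]
  have P': "(P has_vector_derivative (of_real \<sigma> * cnj (v t x) - k * P x - v t x * (wt x)\<^sup>2 - 2 * u t x * wt x * P x)) (at x)" for x
    unfolding R unfolding V P_def[abs_def] by (rule ak(1))
  have J': "(J has_vector_derivative (v t x * wt x + u t x * P x)) (at x)" for x
    unfolding V J_def[abs_def] P_def by (rule ak(2))
  have decu0: "dec (u t)"
    using dec_u[of 0 t] by simp
  have decv: "dec (v t)"
    by (rule wcontD(1)[OF wcont_v])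
  have decw: "dec wt"
    by (rule dec_riccati[OF wt decu0 k \<sigma>])
  have decr: "dec (r j)" for j
    unfolding r_def[abs_def] by (intro dec_cmult dec_cnj dec_u)
  have decc: "dec (\<lambda>x. f x * c)" if "dec f" for f and c :: complex
    using dec_cmult[OF that, of c] by (simp add: mult.commute)
  note decs = dec_add dec_diff dec_minus dec_mult decc dec_cmult decu0 decw decr dec_u
  have decP: "dec P"
  proof -
    have "P = (\<lambda>x. - (r 0 x * k\<^sup>2) + r 1 x * k - r 2 x + 2 * (u t x * (r 0 x * r 0 x))
       - (2 * (u t x * r 0 x * k * wt x - (u t x * r 1 x - (dx ^^ 1) (u t) x * r 0 x) * wt x) - k ^ 3 * wt x)
       - ((- (u t x * k\<^sup>2) - (dx ^^ 1) (u t) x * k - (dx ^^ 2) (u t) x + 2 * (u t x * (u t x * r 0 x))) * (wt x * wt x))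
       - of_real (c t) * (r 0 x - k * wt x - u t x * (wt x * wt x)))"
      unfolding P_def akns_P_def akns_a_def akns_b_def akns_c_def
      by (rule ext) (simp add: field_simps power2_eq_square)
    then show ?thesis
      by (simp only:) (intro decs)
  qed
  \<comment> \<open>The flux tends to the constant -k^3 / 2, not to 0; the parameter c of
    \<open>int_deriv\<close> admits this.\<close>
  have decJ: "dec (\<lambda>x. J x - (- (k ^ 3 / 2)))"
  proof -
    have "(\<lambda>x. J x - (- (k ^ 3 / 2))) = (\<lambda>x. u t x * r 0 x * k - (u t x * r 1 x - (dx ^^ 1) (u t) x * r 0 x)
       + (- (u t x * k\<^sup>2) - (dx ^^ 1) (u t) x * k - (dx ^^ 2) (u t) x + 2 * (u t x * (u t x * r 0 x))) * wt x
       - of_real (c t) * (u t x * wt x))"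
      unfolding J_def akns_J_def akns_a_def akns_b_def
      by (rule ext) (simp add: field_simps power2_eq_square)
    then show ?thesis
      by (simp only:) (intro decs)
  qed
  have cu: "continuous_on UNIV (u t)" for t
    using cont_u[of 0 t] by simp
  have cw: "continuous_on UNIV wt"
    by (rule riccati_continuous[OF wt])
  have cP: "continuous_on UNIV P"
    by (meson P' continuous_at_imp_continuous_on has_vector_derivative_continuous)
  have cv: "continuous_on UNIV (v t)"
    using cont_u[of 1 t] by (intro continuous_intros cu cont_u) auto
  have decJ': "dec (\<lambda>x. v t x * wt x + u t x * P x)"
    by (intro dec_add dec_mult decv decw decu0 decP)
  have cJ': "continuous_on UNIV (\<lambda>x. v t x * wt x + u t x * P x)"
    by (intro continuous_on_add continuous_on_mult cv cw cu cP)
  have int0: "(LINT x|X. v t x * wt x + u t x * P x) = 0"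
  proof -
    obtain K1 where K1: "K1 > 0" "\<And>x. norm (J x - (- (k ^ 3 / 2))) \<le> K1 * \<rho> x"
      using decE[OF decJ] by metis
    obtain K2 where K2: "K2 > 0" "\<And>x. norm (v t x * wt x + u t x * P x) \<le> K2 * \<rho> x"
      using decE[OF decJ'] by metis
    have m: "K1 * \<rho> x \<le> (K1 + K2) * \<rho> x" "K2 * \<rho> x \<le> (K1 + K2) * \<rho> x" for x
      using K1(1) K2(1) \<rho>_pos[of x] by (auto simp: distrib_right)
    show ?thesis
    proof (rule int_deriv[OF J' cJ' _ order_trans[OF K2(2) m(2)] order_trans[OF K1(2) m(1)]])
      fix x show "J (x + L) = J x"
        using per_u[of 0 t] per_u[of 1 t] per_u[of 2 t] per by (simp add: J_def r_def)
    qed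
  qed
  obtain Kv where Kv: "Kv > 0" "\<And>x. norm (v t x) \<le> Kv * \<rho> x" "\<And>x. norm (v t x) \<le> Kv"
    using decE[OF decv] by metis
  obtain KP where KP: "KP > 0" "\<And>x. norm (P x) \<le> KP"
    using decE[OF decP] by metis
  obtain Ku where Ku: "Ku > 0" "\<And>x. norm (u t x) \<le> Ku * \<rho> x" "\<And>x. norm (u t x) \<le> Ku"
    using decE[OF decu0] by metis
  define D where "D = 4 * (4 / Re k + 32 / Re k ^ 3)"
  have D: "D > 0"
    using k by (simp add: D_def add_pos_pos)
  \<comment> \<open>e1 times A will bound the forcing of the equation for z, and e1 times E the
    final error relative to |h|; hence e1 = e / (1 + E).\<close>
  define A where "A = 2 + Kv * (2 * D) + (1 + Ku * (2 * D)) * KP"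
  define E where "E = (1 + Kv * (2 * D) + Ku * (D * A)) * (LINT x|X. \<rho> x)"
  have A: "A > 0"
    unfolding A_def using Kv Ku KP D by (intro add_pos_nonneg) auto
  have \<rho>I: "(LINT x|X. \<rho> x) \<ge> 0"
    using \<rho>_pos by (intro integral_nonneg_AE) (auto intro: less_imp_le)
  have E: "E \<ge> 0"
    unfolding E_def using Kv Ku D A \<rho>I by (intro mult_nonneg_nonneg add_nonneg_nonneg) auto
  define e1 where "e1 = e / (1 + E)"
  have e1: "e1 > 0" "e1 * E \<le> e"
    using e E by (auto simp: e1_def field_simps)
  obtain d1 where d1: "d1 > 0" "\<And>s x. \<bar>s - t\<bar> < d1 \<Longrightarrow> norm (u s x - u t x - (s - t) *\<^sub>R v t x) \<le> \<bar>s - t\<bar> * (e1 * \<rho> x)"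
    using flow_quotient[OF e1(1)] by blast
  obtain d2 where d2: "d2 > 0" "\<And>s x. \<bar>s - t\<bar> < d2 \<Longrightarrow> norm (u s x - u t x) \<le> e1 * \<rho> x"
    using wcontD(2)[OF wcont_u[of 0] e1(1), of t] by auto
  show ?thesis
  proof (rule that[of "min d1 d2"])
    show "min d1 d2 > 0"
      using d1 d2 by simp
    fix s ws assume s: "\<bar>s - t\<bar> < min d1 d2" and ws: "riccati \<sigma> k (u s) ws"
    show "norm ((LINT x|X. u s x * ws x) - (LINT x|X. u t x * wt x)) \<le> e * \<bar>s - t\<bar>"
    proof (cases "s = t")
      \<comment> \<open>No quotient can be formed here. Stability with zero forcing gives
        uniqueness, so the two integrals agree.\<close>
      case True
      have "ws x = wt x" for x
      proof -
        have "norm (ws x - wt x) \<le> D * 0 * 1"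
          unfolding D_def
        proof (rule riccati_pair_stability[OF ws wt \<sigma> cu cu k, where c = "\<lambda>_. 0" and \<rho> = "\<lambda>_. 1" and z = "\<lambda>x. ws x - wt x" and Z = 1])
          fix x
          show "((\<lambda>x. ws x - wt x) has_vector_derivative (0 - (k + u s x * ws x + u t x * wt x) * (ws x - wt x))) (at x)"
            by (rule has_vector_derivative_eq_rhs[OF has_vector_derivative_diff[OF riccatiD(1)[OF ws] riccatiD(1)[OF wt]]])
               (simp add: True algebra_simps power2_eq_square)
          show "norm (ws x - wt x) \<le> 1"
            using riccatiD(2)[OF ws, of x] riccatiD(2)[OF wt, of x] norm_triangle_ineq4[of "ws x" "wt x"] by linarith
        qed auto
        then show ?thesis by simp
      qed
      then show ?thesis
        using True by simp
    next
      case False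
      define h where "h = s - t"
      have h: "h \<noteq> 0"
        using False by (simp add: h_def)
      define Dq where "Dq x = (u s x - u t x) / of_real h - v t x" for x
      define z where "z x = (ws x - wt x) / of_real h - P x" for x
      have Dq: "norm (Dq x) \<le> e1 * \<rho> x" for x
      proof -
        have "Dq x = (u s x - u t x - (s - t) *\<^sub>R v t x) / of_real h"
          using h by (simp add: Dq_def h_def[symmetric] field_simps scaleR_conv_of_real)
        then have "norm (Dq x) = norm (u s x - u t x - (s - t) *\<^sub>R v t x) / \<bar>h\<bar>"
          by (simp add: norm_divide)
        also have "\<dots> \<le> e1 * \<rho> x"
          using d1(2)[of s x] s h by (simp add: divide_le_eq h_def mult.commute)
        finally show ?thesis .
      qed
      have dq: "norm (u s x - u t x) \<le> e1 * \<rho> x" "norm (u s x - u t x) \<le> e1" for x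
      proof -
        show 1: "norm (u s x - u t x) \<le> e1 * \<rho> x"
          using d2(2)[of s x] s by simp
        show "norm (u s x - u t x) \<le> e1"
          by (rule order_trans[OF 1]) (use \<rho>_le[of x] e1 in simp)
      qed
      have w2: "norm (ws x) \<le> 1 / 2" "norm (wt x) \<le> 1 / 2" for x
        using riccatiD(2)[OF ws] riccatiD(2)[OF wt] by auto
      have ww: "norm (ws x * wt x) \<le> 1" for x
        using mult_mono[OF w2(1)[of x] w2(2)[of x]] by (simp add: norm_mult)
      have dw: "norm (ws x - wt x) \<le> D * (2 * e1) * 1" for x
        unfolding D_def
      proof (rule riccati_pair_stability[OF ws wt \<sigma> cu cu k, where z = "\<lambda>x. ws x - wt x" and Z = 1 and \<rho> = "\<lambda>_. 1"
            and c = "\<lambda>x. of_real \<sigma> * cnj (u s x - u t x) - (u s x - u t x) * (ws x * wt x)"])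
        fix x
        show "((\<lambda>x. ws x - wt x) has_vector_derivative
           (of_real \<sigma> * cnj (u s x - u t x) - (u s x - u t x) * (ws x * wt x)
            - (k + u s x * ws x + u t x * wt x) * (ws x - wt x))) (at x)"
          by (rule has_vector_derivative_eq_rhs[OF has_vector_derivative_diff[OF riccatiD(1)[OF ws] riccatiD(1)[OF wt]]])
             (simp add: algebra_simps power2_eq_square)
        show "norm (ws x - wt x) \<le> 1"
          using w2[of x] norm_triangle_ineq4[of "ws x" "wt x"] by linarith
        have "norm (of_real \<sigma> * cnj (u s x - u t x)) = norm (u s x - u t x)"
          using \<sigma> by (auto simp: norm_mult simp flip: complex_cnj_diff)
        moreover have "norm ((u s x - u t x) * (ws x * wt x)) \<le> norm (u s x - u t x) * 1"
          unfolding norm_mult[of "u s x - u t x"] by (intro mult_left_mono ww) auto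
        ultimately show "norm (of_real \<sigma> * cnj (u s x - u t x) - (u s x - u t x) * (ws x * wt x)) \<le> 2 * e1 * 1"
          using dq(2)[of x] by (intro order_trans[OF norm_triangle_ineq4]) simp
      qed (use e1 in auto)
      have dw': "norm (ws x - wt x) \<le> 2 * D * e1" for x
        using dw[of x] by simp
      \<comment> \<open>The a priori bound 1 / |h| + KP on z degenerates as h tends to 0. This is
        harmless: the stability estimate uses boundedness of z but its constant is independent of
        the bound.\<close>
      have z: "norm (z x) \<le> D * (e1 * A) * 1" for x
        unfolding D_def
      proof (rule riccati_pair_stability[OF ws wt \<sigma> cu cu k, where z = z and \<rho> = "\<lambda>_. 1" and Z = "1 / \<bar>h\<bar> + KP"
            and c = "\<lambda>x. of_real \<sigma> * cnj (Dq x) - Dq x * (ws x * wt x) - v t x * wt x * (ws x - wt x)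
               - ((u s x - u t x) * ws x + u t x * (ws x - wt x)) * P x"])
        fix x
        let ?dw = "of_real \<sigma> * cnj (u s x) - k * ws x - u s x * (ws x)\<^sup>2
            - (of_real \<sigma> * cnj (u t x) - k * wt x - u t x * (wt x)\<^sup>2)"
        have "(z has_vector_derivative (?dw / of_real h
            - (of_real \<sigma> * cnj (v t x) - k * P x - v t x * (wt x)\<^sup>2 - 2 * u t x * wt x * P x))) (at x)"
          unfolding z_def[abs_def]
          by (intro has_vector_derivative_diff has_vector_derivative_divide P' riccatiD(1)[OF ws] riccatiD(1)[OF wt])
        moreover have "?dw / of_real h
            - (of_real \<sigma> * cnj (v t x) - k * P x - v t x * (wt x)\<^sup>2 - 2 * u t x * wt x * P x)
          = of_real \<sigma> * cnj (Dq x) - Dq x * (ws x * wt x) - v t x * wt x * (ws x - wt x)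
               - ((u s x - u t x) * ws x + u t x * (ws x - wt x)) * P x - (k + u s x * ws x + u t x * wt x) * z x"
        proof -
          obtain i :: complex where i: "i * of_real h = 1" "cnj i = i" "\<And>y. y / of_real h = y * i"
            using h by (intro that[of "1 / of_real h"]) auto
          define V where "V = v t x"
          have "(us' - k * ws x - us * (ws x)\<^sup>2 - (ut' - k * wt x - ut * (wt x)\<^sup>2)) * i
            - (vt' - k * P x - vt * (wt x)\<^sup>2 - 2 * ut * wt x * P x)
          = ((us' - ut') * i - vt') - ((us - ut) * i - vt) * (ws x * wt x) - vt * wt x * (ws x - wt x)
               - ((us - ut) * ws x + ut * (ws x - wt x)) * P x - (k + us * ws x + ut * wt x) * ((ws x - wt x) * i - P x)"
            for us us' ut ut' vt vt'
            by algebra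
          from this[of "of_real \<sigma> * cnj (u s x)" "u s x" "of_real \<sigma> * cnj (u t x)" "u t x" "of_real \<sigma> * cnj V" V]
          show ?thesis
            unfolding z_def Dq_def V_def[symmetric] i(3)
            by (simp add: i(2) right_diff_distrib mult.assoc left_diff_distrib)
        qed
        ultimately show "(z has_vector_derivative (of_real \<sigma> * cnj (Dq x) - Dq x * (ws x * wt x) - v t x * wt x * (ws x - wt x)
               - ((u s x - u t x) * ws x + u t x * (ws x - wt x)) * P x - (k + u s x * ws x + u t x * wt x) * z x)) (at x)"
          by simp
        have "norm (ws x - wt x) \<le> 1"
          using w2[of x] norm_triangle_ineq4[of "ws x" "wt x"] by linarith
        then have "norm ((ws x - wt x) / of_real h) \<le> 1 / \<bar>h\<bar>"
          by (simp add: norm_divide divide_right_mono)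
        then show "norm (z x) \<le> 1 / \<bar>h\<bar> + KP"
          unfolding z_def using KP(2)[of x] by (intro order_trans[OF norm_triangle_ineq4] add_mono)
        have Dq1: "norm (Dq x) \<le> e1"
          by (rule order_trans[OF Dq]) (use \<rho>_le[of x] e1 in simp)
        have 1: "norm (of_real \<sigma> * cnj (Dq x)) \<le> e1"
          using \<sigma> Dq1 by (auto simp: norm_mult)
        have 2: "norm (Dq x * (ws x * wt x)) \<le> e1 * 1"
          unfolding norm_mult[of "Dq x"] by (intro mult_mono Dq1 ww) (use e1 in auto)
        have 3: "norm (v t x * wt x * (ws x - wt x)) \<le> Kv * 1 * (2 * D * e1)"
          unfolding norm_mult by (intro mult_mono Kv dw' order_trans[OF w2(2)]) (use Kv e1 D in auto)
        have 4: "norm (((u s x - u t x) * ws x + u t x * (ws x - wt x)) * P x) \<le> (e1 * 1 + Ku * (2 * D * e1)) * KP"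
          unfolding norm_mult
        proof (intro mult_mono KP(2) order_trans[OF norm_triangle_ineq] add_mono)
          show "norm ((u s x - u t x) * ws x) \<le> e1 * 1"
            unfolding norm_mult by (intro mult_mono dq order_trans[OF w2(1)]) (use e1 in auto)
          show "norm (u t x * (ws x - wt x)) \<le> Ku * (2 * D * e1)"
            unfolding norm_mult by (intro mult_mono Ku(3) dw') (use e1 Ku in auto)
        qed (use e1 Ku D in auto)
        have "norm (of_real \<sigma> * cnj (Dq x) - Dq x * (ws x * wt x) - v t x * wt x * (ws x - wt x)
               - ((u s x - u t x) * ws x + u t x * (ws x - wt x)) * P x)
            \<le> e1 + e1 * 1 + Kv * 1 * (2 * D * e1) + (e1 * 1 + Ku * (2 * D * e1)) * KP"
          by (intro order_trans[OF norm_triangle_ineq4] add_mono 1 2 3 4)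
        also have "\<dots> = e1 * A * 1"
          by (simp add: A_def algebra_simps)
        finally show "norm (of_real \<sigma> * cnj (Dq x) - Dq x * (ws x * wt x) - v t x * wt x * (ws x - wt x)
               - ((u s x - u t x) * ws x + u t x * (ws x - wt x)) * P x) \<le> e1 * A * 1" .
      qed (use e1 A in auto)
      have decus: "dec (u s)"
        using dec_u[of 0 s] by simp
      have intS: "integrable X (\<lambda>x. u s x * ws x)" "integrable X (\<lambda>x. u t x * wt x)"
        using dec_riccati[OF ws decus k \<sigma>] decus decw decu0
        by (intro integrable_dec continuous_on_mult cu riccati_continuous[OF ws] cw dec_mult; simp)+
      have intJ: "integrable X (\<lambda>x. v t x * wt x + u t x * P x)"
        by (rule integrable_dec[OF cJ' decJ'])
      \<comment> \<open>The first-order Taylor remainder of u w in time; the subtracted linear term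
        has integral zero by \<open>int0\<close>.\<close>
      define F where "F x = (u s x * ws x - u t x * wt x) - of_real h * (v t x * wt x + u t x * P x)" for x
      have "(LINT x|X. u s x * ws x) - (LINT x|X. u t x * wt x) = (LINT x|X. F x)"
        unfolding F_def using intS intJ int0
        by (subst Bochner_Integration.integral_diff) (simp_all add: Bochner_Integration.integral_diff)
      also have "norm \<dots> \<le> (LINT x|X. norm (F x))"
        by (rule integral_norm_bound)
      also have "\<dots> \<le> (LINT x|X. \<bar>h\<bar> * (e1 * (1 + Kv * (2 * D) + Ku * (D * A))) * \<rho> x)"
      proof (rule integral_mono)
        show "integrable X (\<lambda>x. norm (F x))"
          unfolding F_def using intS intJ by (intro integrable_norm) auto
        show "integrable X (\<lambda>x. \<bar>h\<bar> * (e1 * (1 + Kv * (2 * D) + Ku * (D * A))) * \<rho> x)"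
          using \<rho>_int by simp
        fix x
        have "F x = of_real h * (Dq x * ws x + v t x * (ws x - wt x) + u t x * z x)"
          using h by (simp add: F_def Dq_def z_def field_simps)
        then have "norm (F x) = \<bar>h\<bar> * norm (Dq x * ws x + v t x * (ws x - wt x) + u t x * z x)"
          by (simp add: norm_mult)
        also have "norm (Dq x * ws x + v t x * (ws x - wt x) + u t x * z x)
          \<le> (e1 * \<rho> x) * 1 + (Kv * \<rho> x) * (2 * D * e1) + (Ku * \<rho> x) * (D * (e1 * A))"
        proof (intro order_trans[OF norm_triangle_ineq] add_mono)
          show "norm (Dq x * ws x) \<le> (e1 * \<rho> x) * 1"
            unfolding norm_mult by (intro mult_mono Dq order_trans[OF w2(1)]) (use e1 \<rho>_pos[of x] in auto)
          show "norm (v t x * (ws x - wt x)) \<le> (Kv * \<rho> x) * (2 * D * e1)"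
            unfolding norm_mult by (intro mult_mono Kv(2) dw') (use Kv \<rho>_pos[of x] in auto)
          show "norm (u t x * z x) \<le> (Ku * \<rho> x) * (D * (e1 * A))"
            unfolding norm_mult using z by (intro mult_mono Ku(2)) (use Ku \<rho>_pos[of x] in auto)
        qed
        also have "\<dots> = (e1 * (1 + Kv * (2 * D) + Ku * (D * A))) * \<rho> x"
          by (simp add: algebra_simps)
        finally show "norm (F x) \<le> \<bar>h\<bar> * (e1 * (1 + Kv * (2 * D) + Ku * (D * A))) * \<rho> x"
          by (simp add: mult_left_mono mult.assoc)
      qed
      also have "\<dots> = \<bar>h\<bar> * (e1 * E)"
        using \<rho>_int by (simp add: E_def)
      also have "\<dots> \<le> \<bar>h\<bar> * e"
        using e1 by (intro mult_left_mono) auto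
      finally show ?thesis
        by (simp add: h_def mult.commute)
    qed
  qed
qed

text \<open>The solutions w t are arbitrary choices at each time, since
  \<open>riccati_flow_step\<close> allows any ws. An interval is used because Riccati solutions are
  available only while the data stay small. The energy inherits constancy through
  \<open>energy_identity\<close>.\<close>

lemma energy_conserved:
  assumes k: "Re k > 0" and w: "\<And>t. t \<in> {a..b} \<Longrightarrow> riccati \<sigma> k (u t) (w t)"
    and per: "\<And>t x. t \<in> {a..b} \<Longrightarrow> w t (x + L) = w t x"
    and st: "s \<in> {a..b}" "t \<in> {a..b}"
  shows "(LINT x|X. (norm (w s x))\<^sup>2 / (1 - \<sigma> * (norm (w s x))\<^sup>2)) = (LINT x|X. (norm (w t x))\<^sup>2 / (1 - \<sigma> * (norm (w t x))\<^sup>2))"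
proof -
  let ?\<alpha> = "\<lambda>t. LINT x|X. u t x * w t x"
  have "(?\<alpha> has_derivative (\<lambda>_. 0)) (at t within {a..b})" if t: "t \<in> {a..b}" for t
    unfolding has_derivative_within_alt
  proof (intro conjI allI impI)
    fix e :: real assume e: "e > 0"
    obtain d where d: "d > 0" "\<And>s ws. \<bar>s - t\<bar> < d \<Longrightarrow> riccati \<sigma> k (u s) ws \<Longrightarrow>
        norm ((LINT x|X. u s x * ws x) - (LINT x|X. u t x * w t x)) \<le> e * \<bar>s - t\<bar>"
      using riccati_flow_step[OF k w[OF t] per[OF t] e] by blast
    show "\<exists>d>0. \<forall>y\<in>{a..b}. norm (y - t) < d \<longrightarrow> norm (?\<alpha> y - ?\<alpha> t - 0) \<le> e * norm (y - t)"
      using d w by (intro exI[of _ d]) auto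
  qed simp
  then have "?\<alpha> s = ?\<alpha> t"
    using has_derivative_zero_unique[of "{a..b}" ?\<alpha> s t] st by auto
  moreover have "Re k * (LINT x|X. (norm (w t x))\<^sup>2 / (1 - \<sigma> * (norm (w t x))\<^sup>2)) = \<sigma> * Re (?\<alpha> t)" if "t \<in> {a..b}" for t
    using dec_u[of 0 t] by (intro energy_identity[OF w[OF that] _ cont_u0 k \<sigma> per[OF that]]) simp_all
  ultimately have "Re k * (LINT x|X. (norm (w s x))\<^sup>2 / (1 - \<sigma> * (norm (w s x))\<^sup>2))
     = Re k * (LINT x|X. (norm (w t x))\<^sup>2 / (1 - \<sigma> * (norm (w t x))\<^sup>2))"
    using st by simp
  then show ?thesis
    using k by simp
qed

end

subsection \<open>Convolution and synthesis on a frequency group\<close>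

text \<open>For a, b, c the brackets of \<xi>, \<eta>, \<xi> - \<eta>, this distributes the output
  weight of a convolution over its factors. As c <= 2 max a b, the case b <= a leaves the constant
  2, carried by the term b^(-s') b^(s'); in the case a < b, s <= s' allows b^(s - s') to be replaced
  by a^(s - s').\<close>

lemma bracket_kernel_bound:
  fixes a b c s s' :: real
  assumes "1 \<le> a" "1 \<le> b" "1 \<le> c" "c \<le> a + b" "0 < s" "s \<le> s'" "s \<le> 1"
  shows "a powr - s \<le> 2 * (b powr - s' + a powr - s') * (c powr - s * b powr s')"
proof -
  have c0: "c powr - s > 0" "b powr s' > 0"
    using assms by auto
  have le2: "(2 * x) powr s \<le> 2 * x powr s" if "x \<ge> 1" for x
  proof -
    have "(2::real) powr s \<le> 2 powr 1"
      using assms by (intro powr_mono) auto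
    then show ?thesis
      using that by (simp add: powr_mult mult_right_mono)
  qed
  have key: "a powr - s * c powr s \<le> 2 * (b powr - s' + a powr - s') * b powr s'"
  proof (cases "b \<le> a")
    case True
    have "c powr s \<le> 2 * a powr s"
      using True assms by (intro order_trans[OF powr_mono2 le2[of a]]) auto
    then have "a powr - s * c powr s \<le> a powr - s * (2 * a powr s)"
      by (intro mult_left_mono) auto
    also have "\<dots> = 2"
      using assms by (simp add: powr_minus field_simps)
    also have "\<dots> = 2 * (b powr - s' * b powr s')"
      using assms by (simp add: powr_minus field_simps)
    also have "\<dots> \<le> 2 * ((b powr - s' + a powr - s') * b powr s')"
      by (intro mult_left_mono mult_right_mono) auto
    finally show ?thesis by (simp only: mult.assoc)
  next
    case False
    have "c powr s \<le> 2 * b powr s"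
      using False assms by (intro order_trans[OF powr_mono2 le2[of b]]) auto
    then have "a powr - s * c powr s \<le> a powr - s * (2 * b powr s)"
      by (intro mult_left_mono) auto
    also have "b powr s = b powr (s - s') * b powr s'"
      using assms by (simp add: powr_add[symmetric])
    also have "a powr - s * (2 * (b powr (s - s') * b powr s')) \<le> a powr - s * (2 * (a powr (s - s') * b powr s'))"
      using False assms by (intro mult_left_mono mult_right_mono powr_mono2') auto
    also have "\<dots> = 2 * (a powr - s' * b powr s')"
      using assms by (simp add: powr_add[symmetric] mult_ac)
    also have "\<dots> \<le> 2 * ((b powr - s' + a powr - s') * b powr s')"
      by (intro mult_left_mono mult_right_mono) auto
    finally show ?thesis by (simp only: mult.assoc)
  qed
  have "a powr - s = (a powr - s * c powr s) * c powr - s"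
    using assms by (simp add: powr_minus field_simps)
  also have "\<dots> \<le> (2 * (b powr - s' + a powr - s') * b powr s') * c powr - s"
    using key c0 by (intro mult_right_mono) auto
  finally show ?thesis
    by (simp add: mult_ac)
qed

lemma ennreal_norm_sum_square:
  "ennreal ((norm (a + b :: complex))\<^sup>2) \<le> 2 * ennreal ((norm a)\<^sup>2) + 2 * ennreal ((norm b)\<^sup>2)"
proof -
  have "(norm (a + b))\<^sup>2 \<le> (norm a + norm b)\<^sup>2"
    by (intro power_mono norm_triangle_ineq) auto
  also have "\<dots> \<le> 2 * (norm a)\<^sup>2 + 2 * (norm b)\<^sup>2"
    using sum_squares_bound[of "norm a" "norm b"] by (simp add: power2_sum)
  finally have "ennreal ((norm (a + b))\<^sup>2) \<le> ennreal (2 * (norm a)\<^sup>2 + 2 * (norm b)\<^sup>2)"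
    by (rule ennreal_leI)
  then show ?thesis
    by (simp add: ennreal_plus ennreal_mult)
qed

lemma ennreal_sum_square_le:
  fixes a b :: ennreal
  shows "(a + b)\<^sup>2 \<le> 2 * a\<^sup>2 + 2 * b\<^sup>2"
proof (cases "a = \<top> \<or> b = \<top>")
  case True
  then show ?thesis by (auto simp: power2_eq_square ennreal_mult_top ennreal_top_mult)
next
  case False
  then obtain x y where xy: "a = ennreal x" "x \<ge> 0" "b = ennreal y" "y \<ge> 0"
    by (metis ennreal_cases)
  have "(x + y)\<^sup>2 \<le> 2 * x\<^sup>2 + 2 * y\<^sup>2"
    using sum_squares_bound[of x y] by (simp add: power2_sum)
  then have "ennreal ((x + y)\<^sup>2) \<le> ennreal (2 * x\<^sup>2 + 2 * y\<^sup>2)"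
    by (rule ennreal_leI)
  then show ?thesis
    using xy by (simp add: ennreal_plus ennreal_mult ennreal_power[symmetric])
qed

lemma cnj_measurable [measurable]: "cnj \<in> borel_measurable borel"
  by (intro borel_measurable_continuous_onI continuous_intros)

text \<open>The group of frequencies is the line with Lebesgue measure, or the integers with counting
  measure, seen in the line through \<open>\<iota>\<close>.\<close>

locale freq = sigma_finite_measure M for M :: "'g::ab_group_add measure" +
  fixes \<iota> :: "'g \<Rightarrow> real"
  assumes space_M: "space M = UNIV"
    and \<iota>_meas [measurable]: "\<iota> \<in> borel_measurable M"
    and \<iota>_diff: "\<And>a b. \<iota> (a - b) = \<iota> a - \<iota> b"
    and diff_meas [measurable]: "(\<lambda>p. fst p - snd p) \<in> M \<Otimes>\<^sub>M M \<rightarrow>\<^sub>M M"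
    and nn_shift: "\<And>f c. f \<in> borel_measurable M \<Longrightarrow> (\<integral>\<^sup>+\<xi>. f (\<xi> - c) \<partial>M) = (\<integral>\<^sup>+\<xi>. f \<xi> \<partial>M)"
    and nn_refl: "\<And>f. f \<in> borel_measurable M \<Longrightarrow> (\<integral>\<^sup>+\<xi>. f (- \<xi>) \<partial>M) = (\<integral>\<^sup>+\<xi>. f \<xi> \<partial>M)"
begin

lemma in_space [simp]: "x \<in> space M"
  by (simp add: space_M)

lemma \<iota>_0 [simp]: "\<iota> 0 = 0"
  using \<iota>_diff[of 0 0] by simp

lemma \<iota>_minus [simp]: "\<iota> (- a) = - \<iota> a"
  using \<iota>_diff[of 0 a] by simp

lemma diff_measurable [measurable (raw)]:
  assumes [measurable]: "f \<in> N \<rightarrow>\<^sub>M M" "g \<in> N \<rightarrow>\<^sub>M M"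
  shows "(\<lambda>x. f x - g x) \<in> N \<rightarrow>\<^sub>M M"
proof -
  have "(\<lambda>p. fst p - snd p) \<circ> (\<lambda>x. (f x, g x)) \<in> N \<rightarrow>\<^sub>M M"
    by (intro measurable_comp[OF _ diff_meas]) measurable
  then show ?thesis by (simp add: o_def)
qed

lemma const_measurable [measurable]: "(\<lambda>_. c) \<in> N \<rightarrow>\<^sub>M M"
  by simp

lemma minus_measurable [measurable]: "(\<lambda>x. - x) \<in> M \<rightarrow>\<^sub>M M"
proof -
  have "(\<lambda>x. 0 - x) \<in> M \<rightarrow>\<^sub>M M" by measurable
  then show ?thesis by simp
qed

lemma nn_reflect_shift:
  assumes [measurable]: "f \<in> borel_measurable M"
  shows "(\<integral>\<^sup>+\<eta>. f (\<xi> - \<eta>) \<partial>M) = (\<integral>\<^sup>+\<eta>. f \<eta> \<partial>M)"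
proof -
  have "(\<integral>\<^sup>+\<eta>. f (\<xi> - \<eta>) \<partial>M) = (\<integral>\<^sup>+\<eta>. f (- (\<eta> - \<xi>)) \<partial>M)"
    by simp
  also have "\<dots> = (\<integral>\<^sup>+\<eta>. f (- \<eta>) \<partial>M)"
    by (rule nn_shift[of "\<lambda>\<eta>. f (- \<eta>)"]) measurable
  also have "\<dots> = (\<integral>\<^sup>+\<eta>. f \<eta> \<partial>M)"
    by (rule nn_refl) measurable
  finally show ?thesis .
qed

lemma psf: "pair_sigma_finite M M"
  by (simp add: pair_sigma_finite_def sigma_finite_measure_axioms)

lemma nn_conv:
  assumes [measurable]: "f \<in> borel_measurable M" "g \<in> borel_measurable M"
  shows "(\<integral>\<^sup>+\<xi>. \<integral>\<^sup>+\<eta>. f (\<xi> - \<eta>) * g \<eta> \<partial>M \<partial>M) = (\<integral>\<^sup>+\<xi>. f \<xi> \<partial>M) * (\<integral>\<^sup>+\<xi>. g \<xi> \<partial>M)"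
proof -
  have "(\<integral>\<^sup>+\<xi>. \<integral>\<^sup>+\<eta>. f (\<xi> - \<eta>) * g \<eta> \<partial>M \<partial>M) = (\<integral>\<^sup>+\<eta>. \<integral>\<^sup>+\<xi>. f (\<xi> - \<eta>) * g \<eta> \<partial>M \<partial>M)"
    by (rule pair_sigma_finite.Fubini'[OF psf]) measurable
  also have "\<dots> = (\<integral>\<^sup>+\<eta>. (\<integral>\<^sup>+\<xi>. f \<xi> \<partial>M) * g \<eta> \<partial>M)"
    by (intro nn_integral_cong, subst nn_integral_multc) (measurable, simp add: nn_shift)
  also have "\<dots> = (\<integral>\<^sup>+\<xi>. f \<xi> \<partial>M) * (\<integral>\<^sup>+\<xi>. g \<xi> \<partial>M)"
    by (rule nn_integral_cmult) measurable
  finally show ?thesis .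
qed

text \<open>Cauchy-Schwarz for the measure with density g, that is, with g split into two square
  roots, and then Tonelli. Nonnegative integrals avoid any integrability hypothesis.\<close>

lemma young_12:
  fixes f g :: "'g \<Rightarrow> real"
  assumes [measurable]: "f \<in> borel_measurable M" "g \<in> borel_measurable M" and nn: "\<And>x. f x \<ge> 0" "\<And>x. g x \<ge> 0"
  shows "(\<integral>\<^sup>+\<xi>. (\<integral>\<^sup>+\<eta>. ennreal (f (\<xi> - \<eta>) * g \<eta>) \<partial>M)\<^sup>2 \<partial>M)
     \<le> (\<integral>\<^sup>+\<xi>. ennreal ((f \<xi>)\<^sup>2) \<partial>M) * (\<integral>\<^sup>+\<xi>. ennreal (g \<xi>) \<partial>M)\<^sup>2"
proof -
  have "(\<integral>\<^sup>+\<eta>. ennreal (f (\<xi> - \<eta>) * g \<eta>) \<partial>M)\<^sup>2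
     \<le> (\<integral>\<^sup>+\<eta>. ennreal ((f (\<xi> - \<eta>))\<^sup>2) * ennreal (g \<eta>) \<partial>M) * (\<integral>\<^sup>+\<eta>. ennreal (g \<eta>) \<partial>M)" for \<xi>
  proof -
    have "(\<integral>\<^sup>+\<eta>. ennreal (f (\<xi> - \<eta>) * g \<eta>) \<partial>M)
      = (\<integral>\<^sup>+\<eta>. ennreal (f (\<xi> - \<eta>) * sqrt (g \<eta>)) * ennreal (sqrt (g \<eta>)) \<partial>M)"
      using nn by (intro nn_integral_cong) (simp add: ennreal_mult[symmetric] mult.assoc)
    also have "(\<dots>)\<^sup>2 \<le> (\<integral>\<^sup>+\<eta>. (ennreal (f (\<xi> - \<eta>) * sqrt (g \<eta>)))\<^sup>2 \<partial>M) * (\<integral>\<^sup>+\<eta>. (ennreal (sqrt (g \<eta>)))\<^sup>2 \<partial>M)"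
      by (rule Cauchy_Schwarz_nn_integral) measurable
    also have "(\<integral>\<^sup>+\<eta>. (ennreal (f (\<xi> - \<eta>) * sqrt (g \<eta>)))\<^sup>2 \<partial>M) = (\<integral>\<^sup>+\<eta>. ennreal ((f (\<xi> - \<eta>))\<^sup>2) * ennreal (g \<eta>) \<partial>M)"
      using nn by (intro nn_integral_cong) (simp add: ennreal_power power_mult_distrib ennreal_mult[symmetric])
    also have "(\<integral>\<^sup>+\<eta>. (ennreal (sqrt (g \<eta>)))\<^sup>2 \<partial>M) = (\<integral>\<^sup>+\<eta>. ennreal (g \<eta>) \<partial>M)"
      using nn by (intro nn_integral_cong) (simp add: ennreal_power)
    finally show ?thesis .
  qed
  then have "(\<integral>\<^sup>+\<xi>. (\<integral>\<^sup>+\<eta>. ennreal (f (\<xi> - \<eta>) * g \<eta>) \<partial>M)\<^sup>2 \<partial>M)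
    \<le> (\<integral>\<^sup>+\<xi>. (\<integral>\<^sup>+\<eta>. ennreal ((f (\<xi> - \<eta>))\<^sup>2) * ennreal (g \<eta>) \<partial>M) * (\<integral>\<^sup>+\<eta>. ennreal (g \<eta>) \<partial>M) \<partial>M)"
    by (intro nn_integral_mono)
  also have "\<dots> = (\<integral>\<^sup>+\<xi>. (\<integral>\<^sup>+\<eta>. ennreal ((f (\<xi> - \<eta>))\<^sup>2) * ennreal (g \<eta>) \<partial>M) \<partial>M) * (\<integral>\<^sup>+\<eta>. ennreal (g \<eta>) \<partial>M)"
    by (rule nn_integral_multc) measurable
  also have "\<dots> = (\<integral>\<^sup>+\<xi>. ennreal ((f \<xi>)\<^sup>2) \<partial>M) * (\<integral>\<^sup>+\<xi>. ennreal (g \<xi>) \<partial>M) * (\<integral>\<^sup>+\<eta>. ennreal (g \<eta>) \<partial>M)"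
    by (subst nn_conv) simp_all
  finally show ?thesis
    by (simp add: power2_eq_square mult.assoc)
qed

lemma holder_conv:
  fixes f g :: "'g \<Rightarrow> real"
  assumes [measurable]: "f \<in> borel_measurable M" "g \<in> borel_measurable M" and nn: "\<And>x. f x \<ge> 0" "\<And>x. g x \<ge> 0"
  shows "(\<integral>\<^sup>+\<eta>. ennreal (f (\<xi> - \<eta>) * g \<eta>) \<partial>M)\<^sup>2 \<le> (\<integral>\<^sup>+\<xi>. ennreal ((f \<xi>)\<^sup>2) \<partial>M) * (\<integral>\<^sup>+\<xi>. ennreal ((g \<xi>)\<^sup>2) \<partial>M)"
proof -
  have "(\<integral>\<^sup>+\<eta>. ennreal (f (\<xi> - \<eta>) * g \<eta>) \<partial>M)\<^sup>2 = (\<integral>\<^sup>+\<eta>. ennreal (f (\<xi> - \<eta>)) * ennreal (g \<eta>) \<partial>M)\<^sup>2"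
    using nn by (simp add: ennreal_mult)
  also have "\<dots> \<le> (\<integral>\<^sup>+\<eta>. (ennreal (f (\<xi> - \<eta>)))\<^sup>2 \<partial>M) * (\<integral>\<^sup>+\<eta>. (ennreal (g \<eta>))\<^sup>2 \<partial>M)"
    by (rule Cauchy_Schwarz_nn_integral) measurable
  also have "\<dots> = (\<integral>\<^sup>+\<eta>. ennreal ((f (\<xi> - \<eta>))\<^sup>2) \<partial>M) * (\<integral>\<^sup>+\<eta>. ennreal ((g \<eta>)\<^sup>2) \<partial>M)"
    using nn by (simp add: ennreal_power)
  also have "(\<integral>\<^sup>+\<eta>. ennreal ((f (\<xi> - \<eta>))\<^sup>2) \<partial>M) = (\<integral>\<^sup>+\<eta>. ennreal ((f \<eta>)\<^sup>2) \<partial>M)"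
    by (rule nn_reflect_shift) measurable
  finally show ?thesis .
qed

text \<open>The inverse Fourier transform without normalising factor: convolutions go to products
  exactly, and the factor 2 pi appears in the Plancherel identities instead.\<close>

definition synth :: "('g \<Rightarrow> complex) \<Rightarrow> real \<Rightarrow> complex" where
  "synth f x = (LINT \<xi>|M. f \<xi> * cis (x * \<iota> \<xi>))"

definition conv :: "('g \<Rightarrow> complex) \<Rightarrow> ('g \<Rightarrow> complex) \<Rightarrow> 'g \<Rightarrow> complex" where
  "conv f g \<xi> = (LINT \<eta>|M. f (\<xi> - \<eta>) * g \<eta>)"

lemma cis_measurable [measurable]: "cis \<in> borel_measurable borel"
  by (intro borel_measurable_continuous_onI continuous_intros)

lemma integrable_cis:
  assumes "integrable M f"
  shows "integrable M (\<lambda>\<xi>. f \<xi> * cis (x * \<iota> \<xi>))"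
proof -
  have [measurable]: "f \<in> borel_measurable M" using assms by auto
  show ?thesis
    by (rule Bochner_Integration.integrable_bound[OF assms]) (measurable, simp add: norm_mult)
qed

lemma synth_diff: "integrable M f \<Longrightarrow> integrable M g \<Longrightarrow> synth (\<lambda>\<xi>. f \<xi> - g \<xi>) x = synth f x - synth g x"
  unfolding synth_def by (simp add: left_diff_distrib integrable_cis)

lemma synth_cmult: "synth (\<lambda>\<xi>. c * f \<xi>) x = c * synth f x"
  unfolding synth_def by (simp add: mult.assoc)

lemma norm_synth_le:
  assumes "integrable M f"
  shows "ennreal (norm (synth f x)) \<le> (\<integral>\<^sup>+\<xi>. norm (f \<xi>) \<partial>M)"
proof -
  have "ennreal (norm (synth f x)) \<le> ennreal (LINT \<xi>|M. norm (f \<xi> * cis (x * \<iota> \<xi>)))"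
    unfolding synth_def by (intro ennreal_leI integral_norm_bound)
  also have "\<dots> = ennreal (LINT \<xi>|M. norm (f \<xi>))"
    by (simp add: norm_mult)
  also have "\<dots> = (\<integral>\<^sup>+\<xi>. norm (f \<xi>) \<partial>M)"
    using assms by (intro nn_integral_eq_integral[symmetric]) auto
  finally show ?thesis .
qed

lemma conv_measurable [measurable]:
  assumes [measurable]: "f \<in> borel_measurable M" "g \<in> borel_measurable M"
  shows "conv f g \<in> borel_measurable M"
  unfolding conv_def[abs_def] by measurable

lemma conv_le:
  assumes [measurable]: "f \<in> borel_measurable M" "g \<in> borel_measurable M"
  shows "ennreal (norm (conv f g \<xi>)) \<le> (\<integral>\<^sup>+\<eta>. ennreal (norm (f (\<xi> - \<eta>)) * norm (g \<eta>)) \<partial>M)"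
proof (cases "integrable M (\<lambda>\<eta>. f (\<xi> - \<eta>) * g \<eta>)")
  case True
  have "ennreal (norm (conv f g \<xi>)) \<le> ennreal (LINT \<eta>|M. norm (f (\<xi> - \<eta>) * g \<eta>))"
    unfolding conv_def by (intro ennreal_leI integral_norm_bound)
  also have "\<dots> = (\<integral>\<^sup>+\<eta>. ennreal (norm (f (\<xi> - \<eta>) * g \<eta>)) \<partial>M)"
    using True by (intro nn_integral_eq_integral[symmetric]) auto
  finally show ?thesis
    by (simp add: norm_mult)
next
  case False
  then show ?thesis
    unfolding conv_def by (simp add: not_integrable_integral_eq)
qed

lemma conv_nn_le:
  assumes [measurable]: "f \<in> borel_measurable M" "g \<in> borel_measurable M"
  shows "(\<integral>\<^sup>+\<xi>. ennreal (norm (conv f g \<xi>)) \<partial>M) \<le> (\<integral>\<^sup>+\<xi>. norm (f \<xi>) \<partial>M) * (\<integral>\<^sup>+\<xi>. norm (g \<xi>) \<partial>M)"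
proof -
  have "(\<integral>\<^sup>+\<xi>. ennreal (norm (conv f g \<xi>)) \<partial>M) \<le> (\<integral>\<^sup>+\<xi>. (\<integral>\<^sup>+\<eta>. ennreal (norm (f (\<xi> - \<eta>))) * ennreal (norm (g \<eta>)) \<partial>M) \<partial>M)"
    by (intro nn_integral_mono order_trans[OF conv_le]) (simp_all add: ennreal_mult)
  also have "\<dots> = (\<integral>\<^sup>+\<xi>. norm (f \<xi>) \<partial>M) * (\<integral>\<^sup>+\<xi>. norm (g \<xi>) \<partial>M)"
    by (rule nn_conv) measurable
  finally show ?thesis .
qed

lemma integrable_conv:
  assumes f: "integrable M f" and g: "integrable M g"
  shows "integrable M (conv f g)"
proof -
  have [measurable]: "f \<in> borel_measurable M" "g \<in> borel_measurable M" using assms by auto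
  have "(\<integral>\<^sup>+\<xi>. ennreal (norm (conv f g \<xi>)) \<partial>M) < \<infinity>"
    using f g by (intro le_less_trans[OF conv_nn_le]) (auto simp: integrable_iff_bounded ennreal_mult_less_top)
  then show ?thesis
    by (intro integrableI_bounded) auto
qed

text \<open>The class of bounded integrable functions. On it convolution integrands are integrable
  at every point, not just almost everywhere, so that linearity of \<open>conv\<close> holds
  pointwise.\<close>

definition bdd :: "('g \<Rightarrow> complex) \<Rightarrow> bool" where
  "bdd f \<longleftrightarrow> integrable M f \<and> (\<exists>K. \<forall>\<xi>. norm (f \<xi>) \<le> K)"

lemma bddD: "bdd f \<Longrightarrow> integrable M f" "bdd f \<Longrightarrow> f \<in> borel_measurable M"
  by (auto simp: bdd_def)

lemma conv_integrand:
  assumes f: "bdd f" and g: "integrable M g"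
  shows "integrable M (\<lambda>\<eta>. f (\<xi> - \<eta>) * g \<eta>)"
proof -
  have [measurable]: "f \<in> borel_measurable M" "g \<in> borel_measurable M" using f g by (auto simp: bdd_def)
  obtain K where K: "\<And>\<xi>. norm (f \<xi>) \<le> K" using f by (auto simp: bdd_def)
  show ?thesis
    by (rule Bochner_Integration.integrable_bound[of M "\<lambda>\<eta>. K * norm (g \<eta>)"])
       (use g K in \<open>auto intro!: AE_I2 mult_right_mono simp: norm_mult abs_mult intro: order_trans[OF _ abs_ge_self]\<close>)
qed

lemma bdd_conv:
  assumes f: "bdd f" and g: "integrable M g"
  shows "bdd (conv f g)"
proof -
  obtain K where K: "\<And>\<xi>. norm (f \<xi>) \<le> K" using f by (auto simp: bdd_def)
  have "norm (conv f g \<xi>) \<le> (LINT \<eta>|M. K * norm (g \<eta>))" for \<xi>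
  proof -
    have "norm (conv f g \<xi>) \<le> (LINT \<eta>|M. norm (f (\<xi> - \<eta>) * g \<eta>))"
      unfolding conv_def by (rule integral_norm_bound)
    also have "\<dots> \<le> (LINT \<eta>|M. K * norm (g \<eta>))"
      using g K by (intro integral_mono integrable_norm conv_integrand f g) (auto simp: norm_mult mult_right_mono)
    finally show ?thesis .
  qed
  then show ?thesis
    using integrable_conv[OF _ g, of f] f unfolding bdd_def by blast
qed

lemma conv_diff_right: "bdd f \<Longrightarrow> integrable M g \<Longrightarrow> integrable M h \<Longrightarrow>
    conv f (\<lambda>\<eta>. g \<eta> - h \<eta>) \<xi> = conv f g \<xi> - conv f h \<xi>"
  unfolding conv_def by (simp add: right_diff_distrib conv_integrand)

lemma conv_diff_left:
  assumes "bdd f" "bdd g" "integrable M h"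
  shows "conv (\<lambda>\<eta>. f \<eta> - g \<eta>) h \<xi> = conv f h \<xi> - conv g h \<xi>"
  unfolding conv_def by (simp add: left_diff_distrib conv_integrand assms)

lemma synth_conv:
  assumes f: "integrable M f" and g: "integrable M g"
  shows "synth (conv f g) x = synth f x * synth g x"
proof -
  have [measurable]: "f \<in> borel_measurable M" "g \<in> borel_measurable M" using f g by auto
  let ?h = "\<lambda>\<eta> \<xi>. f (\<xi> - \<eta>) * g \<eta> * cis (x * \<iota> \<xi>)"
  have int: "integrable (M \<Otimes>\<^sub>M M) (case_prod ?h)"
  proof (rule integrableI_bounded)
    show "case_prod ?h \<in> borel_measurable (M \<Otimes>\<^sub>M M)" by measurable
    have "(\<integral>\<^sup>+p. ennreal (norm (case_prod ?h p)) \<partial>(M \<Otimes>\<^sub>M M)) = (\<integral>\<^sup>+\<eta>. \<integral>\<^sup>+\<xi>. ennreal (norm (?h \<eta> \<xi>)) \<partial>M \<partial>M)"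
      by (subst nn_integral_fst[symmetric]) auto
    also have "\<dots> = (\<integral>\<^sup>+\<xi>. \<integral>\<^sup>+\<eta>. ennreal (norm (?h \<eta> \<xi>)) \<partial>M \<partial>M)"
      by (rule pair_sigma_finite.Fubini'[OF psf, symmetric]) measurable
    also have "\<dots> = (\<integral>\<^sup>+\<xi>. \<integral>\<^sup>+\<eta>. ennreal (norm (f (\<xi> - \<eta>))) * ennreal (norm (g \<eta>)) \<partial>M \<partial>M)"
      by (simp add: norm_mult ennreal_mult)
    also have "\<dots> = (\<integral>\<^sup>+\<xi>. norm (f \<xi>) \<partial>M) * (\<integral>\<^sup>+\<xi>. norm (g \<xi>) \<partial>M)"
      by (rule nn_conv) measurable
    also have "\<dots> < \<infinity>"
      using f g by (auto simp: integrable_iff_bounded ennreal_mult_less_top)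
    finally show "(\<integral>\<^sup>+p. ennreal (norm (case_prod ?h p)) \<partial>(M \<Otimes>\<^sub>M M)) < \<infinity>" .
  qed
  have sh: "(LINT \<xi>|M. f (\<xi> - \<eta>) * cis (x * \<iota> (\<xi> - \<eta>))) = synth f x" for \<eta>
  proof -
    have "distr M M (\<lambda>\<xi>. \<xi> - \<eta>) = M"
    proof (rule measure_eqI)
      fix A assume A: "A \<in> sets (distr M M (\<lambda>\<xi>. \<xi> - \<eta>))"
      then have [measurable]: "A \<in> sets M" by simp
      have "emeasure (distr M M (\<lambda>\<xi>. \<xi> - \<eta>)) A = (\<integral>\<^sup>+\<xi>. indicator A (\<xi> - \<eta>) \<partial>M)"
        by (subst nn_integral_distr[of "\<lambda>\<xi>. \<xi> - \<eta>" M M "indicator A", symmetric]) auto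
      also have "\<dots> = emeasure M A"
        by (subst nn_shift) auto
      finally show "emeasure (distr M M (\<lambda>\<xi>. \<xi> - \<eta>)) A = emeasure M A" .
    qed simp
    then have "synth f x = (LINT \<xi>|distr M M (\<lambda>\<xi>. \<xi> - \<eta>). f \<xi> * cis (x * \<iota> \<xi>))"
      by (simp add: synth_def)
    also have "\<dots> = (LINT \<xi>|M. f (\<xi> - \<eta>) * cis (x * \<iota> (\<xi> - \<eta>)))"
      by (rule integral_distr) measurable
    finally show ?thesis by simp
  qed
  have "synth (conv f g) x = (LINT \<xi>|M. (LINT \<eta>|M. ?h \<eta> \<xi>))"
    unfolding synth_def conv_def by simp
  also have "\<dots> = (LINT \<eta>|M. (LINT \<xi>|M. ?h \<eta> \<xi>))"
    by (rule pair_sigma_finite.Fubini_integral[OF psf int])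
  also have "\<dots> = (LINT \<eta>|M. synth f x * (g \<eta> * cis (x * \<iota> \<eta>)))"
  proof (rule Bochner_Integration.integral_cong[OF refl])
    fix \<eta>
    have "?h \<eta> \<xi> = (g \<eta> * cis (x * \<iota> \<eta>)) * (f (\<xi> - \<eta>) * cis (x * \<iota> (\<xi> - \<eta>)))" for \<xi>
      by (simp add: \<iota>_diff cis_mult mult_ac right_diff_distrib)
    then show "(LINT \<xi>|M. ?h \<eta> \<xi>) = synth f x * (g \<eta> * cis (x * \<iota> \<eta>))"
      by (simp only: integral_mult_right_zero sh mult.commute)
  qed
  also have "\<dots> = synth f x * synth g x"
    by (simp add: synth_def)
  finally show ?thesis .
qed

lemma synth_derivative:
  assumes f: "integrable M f" and fi: "integrable M (\<lambda>\<xi>. of_real (\<iota> \<xi>) * f \<xi>)"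
  shows "(synth f has_vector_derivative synth (\<lambda>\<xi>. \<i> * of_real (\<iota> \<xi>) * f \<xi>) x) (at x)"
proof -
  have [measurable]: "f \<in> borel_measurable M" using f by auto
  let ?g = "\<lambda>\<xi>. \<i> * of_real (\<iota> \<xi>) * f \<xi>"
  have gi: "integrable M ?g"
    using integrable_mult_right[OF fi, of \<i>] by (simp add: mult.assoc)
  \<comment> \<open>This crude bound, linear in |y - x|, supplies the dominating function 2 |\<iota>
    f|; the pointwise limit comes from \<open>cisd\<close>.\<close>
  have cisb: "norm (cis y - cis x - of_real (y - x) * (\<i> * cis x)) \<le> 2 * \<bar>y - x\<bar>" for x y :: real
  proof -
    have "norm (cis y - cis x) \<le> 1 * norm (y - x)"
    proof (rule differentiable_bound[of UNIV cis "\<lambda>x h. of_real h * (\<i> * cis x)"])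
      fix z :: real
      show "(cis has_derivative (\<lambda>h. of_real h * (\<i> * cis z))) (at z)"
        by (auto intro!: derivative_eq_intros simp: scaleR_conv_of_real)
      show "onorm (\<lambda>h. complex_of_real h * (\<i> * cis z)) \<le> 1"
        by (rule onorm_le) (simp add: norm_mult)
    qed auto
    then show ?thesis
      by (intro order_trans[OF norm_triangle_ineq4]) (simp add: norm_mult flip: of_real_diff)
  qed
  have cisd: "((\<lambda>y. norm (cis (y * a) - cis (x * a) - of_real ((y - x) * a) * (\<i> * cis (x * a))) / norm (y - x)) \<longlongrightarrow> 0) (at x)" for a :: real
  proof -
    have "((\<lambda>y. cis (y * a)) has_derivative (\<lambda>h. of_real (h * a) * (\<i> * cis (x * a)))) (at x)"
      by (auto intro!: derivative_eq_intros simp: scaleR_conv_of_real algebra_simps)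
    then show ?thesis
      unfolding has_derivative_iff_norm by simp
  qed
  have "((\<lambda>y. norm (synth f y - synth f x - (y - x) *\<^sub>R synth ?g x) / norm (y - x)) \<longlongrightarrow> 0) (at x)"
    unfolding tendsto_at_iff_sequentially
  proof (intro allI impI)
    fix X :: "nat \<Rightarrow> real" assume X: "\<forall>i. X i \<in> UNIV - {x}" "X \<longlonglongrightarrow> x"
    let ?d = "\<lambda>y \<xi>. cis (y * \<iota> \<xi>) - cis (x * \<iota> \<xi>) - of_real ((y - x) * \<iota> \<xi>) * (\<i> * cis (x * \<iota> \<xi>))"
    have lim: "(\<lambda>i. LINT \<xi>|M. norm (f \<xi>) * (norm (?d (X i) \<xi>) / norm (X i - x))) \<longlonglongrightarrow> (LINT \<xi>|M. 0)"
    proof (rule integral_dominated_convergence[where w = "\<lambda>\<xi>. 2 * norm (of_real (\<iota> \<xi>) * f \<xi>)"])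
      show "integrable M (\<lambda>\<xi>. 2 * norm (of_real (\<iota> \<xi>) * f \<xi>))"
        using fi by auto
      show "AE \<xi> in M. (\<lambda>i. norm (f \<xi>) * (norm (?d (X i) \<xi>) / norm (X i - x))) \<longlonglongrightarrow> 0"
      proof (rule AE_I2)
        fix \<xi>
        have "(\<lambda>i. norm (?d (X i) \<xi>) / norm (X i - x)) \<longlonglongrightarrow> 0"
          using cisd[of "\<iota> \<xi>"] X unfolding tendsto_at_iff_sequentially o_def by blast
        from tendsto_mult_left[OF this, of "norm (f \<xi>)"]
        show "(\<lambda>i. norm (f \<xi>) * (norm (?d (X i) \<xi>) / norm (X i - x))) \<longlonglongrightarrow> 0" by simp
      qed
      fix i
      show "AE \<xi> in M. norm (norm (f \<xi>) * (norm (?d (X i) \<xi>) / norm (X i - x))) \<le> 2 * norm (of_real (\<iota> \<xi>) * f \<xi>)"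
      proof (rule AE_I2)
        fix \<xi>
        have "norm (?d (X i) \<xi>) \<le> 2 * \<bar>\<iota> \<xi>\<bar> * norm (X i - x)"
          using cisb[of "X i * \<iota> \<xi>" "x * \<iota> \<xi>"] by (simp add: left_diff_distrib[symmetric] abs_mult mult_ac)
        then have "norm (?d (X i) \<xi>) / norm (X i - x) \<le> 2 * \<bar>\<iota> \<xi>\<bar>"
          using X(1) by (simp add: divide_le_eq)
        from mult_left_mono[OF this norm_ge_zero[of "f \<xi>"]]
        show "norm (norm (f \<xi>) * (norm (?d (X i) \<xi>) / norm (X i - x))) \<le> 2 * norm (of_real (\<iota> \<xi>) * f \<xi>)"
          by (simp add: norm_mult abs_mult mult_ac)
      qed
    qed measurable
    have le: "norm (synth f y - synth f x - (y - x) *\<^sub>R synth ?g x) / norm (y - x)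
        \<le> (LINT \<xi>|M. norm (f \<xi>) * (norm (?d y \<xi>) / norm (y - x)))" for y
    proof -
      have "synth f y - synth f x - (y - x) *\<^sub>R synth ?g x = (LINT \<xi>|M. f \<xi> * cis (y * \<iota> \<xi>) - f \<xi> * cis (x * \<iota> \<xi>) - of_real (y - x) * (?g \<xi> * cis (x * \<iota> \<xi>)))"
        unfolding synth_def by (simp add: integrable_cis f gi scaleR_conv_of_real)
      moreover have "f \<xi> * cis (y * \<iota> \<xi>) - f \<xi> * cis (x * \<iota> \<xi>) - of_real (y - x) * (?g \<xi> * cis (x * \<iota> \<xi>)) = f \<xi> * ?d y \<xi>" for \<xi>
        by (simp add: algebra_simps)
      ultimately have eq: "synth f y - synth f x - (y - x) *\<^sub>R synth ?g x = (LINT \<xi>|M. f \<xi> * ?d y \<xi>)"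
        by (simp only:)
      have "norm (synth f y - synth f x - (y - x) *\<^sub>R synth ?g x) / norm (y - x) \<le> (LINT \<xi>|M. norm (f \<xi> * ?d y \<xi>)) / norm (y - x)"
        unfolding eq by (intro divide_right_mono integral_norm_bound norm_ge_zero)
      also have "\<dots> = (LINT \<xi>|M. norm (f \<xi>) * (norm (?d y \<xi>) / norm (y - x)))"
        by (simp only: norm_mult times_divide_eq_right integral_divide_zero)
      finally show ?thesis .
    qed
    show "((\<lambda>y. norm (synth f y - synth f x - (y - x) *\<^sub>R synth ?g x) / norm (y - x)) \<circ> X) \<longlonglongrightarrow> 0"
      unfolding o_def
    proof (rule tendsto_sandwich[OF _ _ tendsto_const])
      show "(\<lambda>i. LINT \<xi>|M. norm (f \<xi>) * (norm (?d (X i) \<xi>) / norm (X i - x))) \<longlonglongrightarrow> 0"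
        using lim by (simp only: Bochner_Integration.integral_zero)
      show "\<forall>\<^sub>F i in sequentially. norm (synth f (X i) - synth f x - (X i - x) *\<^sub>R synth ?g x) / norm (X i - x)
          \<le> (LINT \<xi>|M. norm (f \<xi>) * (norm (?d (X i) \<xi>) / norm (X i - x)))"
        using le by (intro always_eventually allI)
    qed simp
  qed
  then show ?thesis
    unfolding has_vector_derivative_def has_derivative_iff_norm
    by (auto intro: bounded_linear_scaleR_left)
qed

text \<open>The frequency side of the map f to \<sigma> cnj f, that is, of the second potential of
  the AKNS system (\<open>synth_crefl\<close>).\<close>

definition crefl :: "real \<Rightarrow> ('g \<Rightarrow> complex) \<Rightarrow> 'g \<Rightarrow> complex" where
  "crefl \<sigma> F \<xi> = of_real \<sigma> * cnj (F (- \<xi>))"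

lemma integrable_crefl:
  assumes "integrable M F"
  shows "integrable M (crefl \<sigma> F)"
proof -
  have [measurable]: "F \<in> borel_measurable M" using assms by auto
  have "(\<integral>\<^sup>+\<xi>. ennreal (norm (F (- \<xi>))) \<partial>M) = (\<integral>\<^sup>+\<xi>. ennreal (norm (F \<xi>)) \<partial>M)"
    by (rule nn_refl) measurable
  then have "integrable M (\<lambda>\<xi>. F (- \<xi>))"
    using assms unfolding integrable_iff_bounded by simp
  then show ?thesis
    unfolding crefl_def[abs_def] by auto
qed

lemma bdd_crefl:
  assumes "bdd F"
  shows "bdd (crefl \<sigma> F)"
proof -
  obtain K where "\<And>\<xi>. norm (F \<xi>) \<le> K" using assms by (auto simp: bdd_def)
  then have "norm (crefl \<sigma> F \<xi>) \<le> \<bar>\<sigma>\<bar> * K" for \<xi>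
    unfolding crefl_def by (simp add: norm_mult mult_left_mono)
  then show ?thesis
    using integrable_crefl[OF bddD(1)[OF assms]] unfolding bdd_def by blast
qed

lemma synth_crefl:
  assumes "integrable M F"
  shows "synth (crefl \<sigma> F) x = of_real \<sigma> * cnj (synth F x)"
proof -
  have [measurable]: "F \<in> borel_measurable M" using assms by auto
  have "distr M M uminus = M"
  proof (rule measure_eqI)
    fix A assume A: "A \<in> sets (distr M M uminus)"
    then have [measurable]: "A \<in> sets M" by simp
    have "emeasure (distr M M uminus) A = (\<integral>\<^sup>+\<xi>. indicator A (- \<xi>) \<partial>M)"
      by (subst nn_integral_distr[of uminus M M "indicator A", symmetric]) auto
    also have "\<dots> = emeasure M A"
      by (subst nn_refl) auto
    finally show "emeasure (distr M M uminus) A = emeasure M A" .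
  qed simp
  then have "(LINT \<xi>|M. cnj (F \<xi>) * cis (- (x * \<iota> \<xi>))) = (LINT \<xi>|distr M M uminus. cnj (F \<xi>) * cis (- (x * \<iota> \<xi>)))"
    by simp
  also have "\<dots> = (LINT \<xi>|M. cnj (F (- \<xi>)) * cis (x * \<iota> \<xi>))"
    by (subst integral_distr) auto
  finally have "(LINT \<xi>|M. cnj (F (- \<xi>)) * cis (x * \<iota> \<xi>)) = (LINT \<xi>|M. cnj (F \<xi> * cis (x * \<iota> \<xi>)))"
    by (simp add: cis_cnj)
  then have "(LINT \<xi>|M. cnj (F (- \<xi>)) * cis (x * \<iota> \<xi>)) = cnj (synth F x)"
    unfolding synth_def using integral_bounded_linear[OF bounded_linear_cnj integrable_cis[OF assms, of x]] by (simp only:)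
  moreover have "synth (crefl \<sigma> F) x = of_real \<sigma> * (LINT \<xi>|M. cnj (F (- \<xi>)) * cis (x * \<iota> \<xi>))"
    unfolding synth_def crefl_def by (simp add: mult.assoc)
  ultimately show ?thesis
    by simp
qed

lemma synth_continuous:
  assumes f: "integrable M f"
  shows "continuous_on UNIV (synth f)"
  unfolding continuous_on_def
proof
  fix x :: real
  have [measurable]: "f \<in> borel_measurable M" using f by auto
  show "(synth f \<longlongrightarrow> synth f x) (at x within UNIV)"
    unfolding tendsto_at_iff_sequentially o_def
  proof (intro allI impI)
    fix Y :: "nat \<Rightarrow> real" assume Y: "Y \<longlonglongrightarrow> x"
    show "(\<lambda>i. synth f (Y i)) \<longlonglongrightarrow> synth f x"
      unfolding synth_def
    proof (rule integral_dominated_convergence[where w = "\<lambda>\<xi>. norm (f \<xi>)"])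
      show "AE \<xi> in M. (\<lambda>i. f \<xi> * cis (Y i * \<iota> \<xi>)) \<longlonglongrightarrow> f \<xi> * cis (x * \<iota> \<xi>)"
        using Y by (intro AE_I2 tendsto_intros)
    qed (use f in \<open>auto simp: norm_mult\<close>)
  qed
qed

end

subsection \<open>Small Riccati solutions by Picard iteration\<close>

lemma ennreal_le_of_square_le:
  assumes "x\<^sup>2 \<le> ennreal (y\<^sup>2)" "y \<ge> 0"
  shows "x \<le> ennreal y"
proof (cases x)
  case (real r)
  then have "r\<^sup>2 \<le> y\<^sup>2"
    using assms by (simp add: ennreal_power)
  then have "r \<le> y"
    using assms(2) by (rule power2_le_imp_le)
  then show ?thesis
    using real by (simp add: ennreal_leI)
next
  case top
  then show ?thesis
    using assms by (simp add: power2_eq_square ennreal_top_mult top_unique)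
qed

lemma square_one_plus_le: "(1 + t)\<^sup>2 \<le> 2 + 2 * t\<^sup>2" for t :: real
  using sum_squares_bound[of 1 t] by (simp add: power2_sum)

lemma two_ennreal_add: "x \<ge> 0 \<Longrightarrow> y \<ge> 0 \<Longrightarrow> 2 * ennreal x + 2 * ennreal y = ennreal (2 * x + 2 * y)"
  by (simp add: ennreal_mult ennreal_plus)

text \<open>s < 1/2 means 2 (1 - s) > 1, the range in which the bracket weight at scale \<kappa> is
  integrable on the line and summable on the integers, with total mass of order \<kappa>. That mass
  turns the weighted L^2 norm of a solution into a bound of its sup norm.\<close>

locale picard = freq M \<iota> for M :: "'g::ab_group_add measure" and \<iota> +
  fixes \<kappa> s gC :: real
  assumes \<kappa>: "\<kappa> \<ge> 1" and s: "0 < s" "s < 1 / 2" and gC: "gC > 0"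
    and growth: "(\<integral>\<^sup>+\<xi>. ennreal ((1 + \<bar>\<iota> \<xi>\<bar> / \<kappa>) powr (- 2 * (1 - s))) \<partial>M) \<le> ennreal (\<kappa> * gC)"
begin

definition br :: "'g \<Rightarrow> real" where "br \<xi> = 1 + \<bar>\<iota> \<xi>\<bar> / \<kappa>"

lemma br_ge1: "br \<xi> \<ge> 1"
  using \<kappa> by (simp add: br_def)

lemma br_pos: "br \<xi> > 0"
  using br_ge1[of \<xi>] by linarith

lemma br_nz [simp]: "br \<xi> \<noteq> 0"
  using br_pos[of \<xi>] by linarith

lemma br_measurable [measurable]: "br \<in> borel_measurable M"
  unfolding br_def[abs_def] by measurable

lemma br_triangle: "br (\<xi> - \<eta>) \<le> br \<xi> + br \<eta>"
proof -
  have "\<bar>\<iota> \<xi> - \<iota> \<eta>\<bar> / \<kappa> \<le> (\<bar>\<iota> \<xi>\<bar> + \<bar>\<iota> \<eta>\<bar>) / \<kappa>"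
    using \<kappa> by (intro divide_right_mono) auto
  then show ?thesis
    unfolding br_def \<iota>_diff by (simp add: add_divide_distrib)
qed

definition wn :: "real \<Rightarrow> ('g \<Rightarrow> complex) \<Rightarrow> ennreal" where
  "wn e f = (\<integral>\<^sup>+\<xi>. ennreal ((norm (f \<xi>))\<^sup>2 * br \<xi> powr e) \<partial>M)"

lemma growth': "(\<integral>\<^sup>+\<xi>. ennreal ((br \<xi> powr - (1 - s))\<^sup>2) \<partial>M) \<le> ennreal (\<kappa> * gC)"
proof -
  have "(br \<xi> powr - (1 - s))\<^sup>2 = (1 + \<bar>\<iota> \<xi>\<bar> / \<kappa>) powr (- 2 * (1 - s))" for \<xi>
    using br_pos[of \<xi>] by (simp add: power2_eq_square powr_add[symmetric] br_def)
  then show ?thesis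
    using growth by simp
qed

lemma wn_square:
  assumes "e = 2 * d"
  shows "wn e f = (\<integral>\<^sup>+\<xi>. ennreal ((norm (f \<xi>) * br \<xi> powr d)\<^sup>2) \<partial>M)"
proof -
  have "(norm (f \<xi>) * br \<xi> powr d)\<^sup>2 = (norm (f \<xi>))\<^sup>2 * br \<xi> powr e" for \<xi>
    unfolding power_mult_distrib assms by (simp add: powr_power)
  then show ?thesis
    unfolding wn_def by simp
qed

lemma wn_m2s: "wn (- 2 * s) f = (\<integral>\<^sup>+\<xi>. ennreal ((norm (f \<xi>) * br \<xi> powr - s)\<^sup>2) \<partial>M)"
  by (rule wn_square) simp

lemma wn_2s': "wn (2 * (1 - s)) f = (\<integral>\<^sup>+\<xi>. ennreal ((norm (f \<xi>) * br \<xi> powr (1 - s))\<^sup>2) \<partial>M)"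
  by (rule wn_square) simp

lemma L1_le:
  assumes [measurable]: "f \<in> borel_measurable M"
  shows "(\<integral>\<^sup>+\<xi>. norm (f \<xi>) \<partial>M)\<^sup>2 \<le> wn (2 * (1 - s)) f * ennreal (\<kappa> * gC)"
proof -
  have eq: "(\<integral>\<^sup>+\<xi>. norm (f \<xi>) \<partial>M) = (\<integral>\<^sup>+\<xi>. ennreal (norm (f \<xi>) * br \<xi> powr (1 - s)) * ennreal (br \<xi> powr - (1 - s)) \<partial>M)"
    using br_pos by (intro nn_integral_cong) (simp add: ennreal_mult[symmetric] mult.assoc powr_add[symmetric])
  have "(\<integral>\<^sup>+\<xi>. norm (f \<xi>) \<partial>M)\<^sup>2 \<le> (\<integral>\<^sup>+\<xi>. (ennreal (norm (f \<xi>) * br \<xi> powr (1 - s)))\<^sup>2 \<partial>M) * (\<integral>\<^sup>+\<xi>. (ennreal (br \<xi> powr - (1 - s)))\<^sup>2 \<partial>M)"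
    unfolding eq by (rule Cauchy_Schwarz_nn_integral) measurable
  also have "\<dots> \<le> wn (2 * (1 - s)) f * ennreal (\<kappa> * gC)"
  proof (intro mult_mono)
    have "(ennreal (norm (f \<xi>) * br \<xi> powr (1 - s)))\<^sup>2 = ennreal ((norm (f \<xi>) * br \<xi> powr (1 - s))\<^sup>2)" for \<xi>
      by (rule ennreal_power) simp
    then show "(\<integral>\<^sup>+\<xi>. (ennreal (norm (f \<xi>) * br \<xi> powr (1 - s)))\<^sup>2 \<partial>M) \<le> wn (2 * (1 - s)) f"
      unfolding wn_2s' by (simp only: order_refl)
    have "(ennreal (br \<xi> powr - (1 - s)))\<^sup>2 = ennreal ((br \<xi> powr - (1 - s))\<^sup>2)" for \<xi>
      by (rule ennreal_power) simp
    then show "(\<integral>\<^sup>+\<xi>. (ennreal (br \<xi> powr - (1 - s)))\<^sup>2 \<partial>M) \<le> ennreal (\<kappa> * gC)"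
      using growth' by (simp only:)
  qed simp_all
  finally show ?thesis .
qed

text \<open>\<open>bracket_kernel_bound\<close> splits the weighted convolution in two: one part is
  a convolution of L^2 with L^1, treated by \<open>young_12\<close> and \<open>L1_le\<close>; the
  other is bounded pointwise by Cauchy-Schwarz, its remaining weight being square integrable by
  \<open>growth'\<close>. Squaring the sum makes each part cost 8, in total 16.\<close>

lemma wn_conv:
  assumes [measurable]: "f \<in> borel_measurable M" "g \<in> borel_measurable M"
  shows "wn (- 2 * s) (conv f g) \<le> ennreal (16 * \<kappa> * gC) * wn (- 2 * s) f * wn (2 * (1 - s)) g"
proof -
  define \<phi> where "\<phi> \<xi> = norm (f \<xi>) * br \<xi> powr - s" for \<xi>
  define gw where "gw \<xi> = norm (g \<xi>) * br \<xi> powr (1 - s)" for \<xi>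
  have [measurable]: "\<phi> \<in> borel_measurable M" "gw \<in> borel_measurable M"
    unfolding \<phi>_def[abs_def] gw_def[abs_def] by measurable
  have nn: "\<phi> \<xi> \<ge> 0" "gw \<xi> \<ge> 0" for \<xi>
    by (auto simp: \<phi>_def gw_def)
  define I1 where "I1 \<xi> = (\<integral>\<^sup>+\<eta>. ennreal (\<phi> (\<xi> - \<eta>) * norm (g \<eta>)) \<partial>M)" for \<xi>
  define I2 where "I2 \<xi> = (\<integral>\<^sup>+\<eta>. ennreal (\<phi> (\<xi> - \<eta>) * gw \<eta>) \<partial>M)" for \<xi>
  have [measurable]: "I1 \<in> borel_measurable M" "I2 \<in> borel_measurable M"
    unfolding I1_def[abs_def] I2_def[abs_def] by measurable
  have wf: "wn (- 2 * s) f = (\<integral>\<^sup>+\<xi>. ennreal ((\<phi> \<xi>)\<^sup>2) \<partial>M)"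
    unfolding wn_m2s \<phi>_def by simp
  have wg: "wn (2 * (1 - s)) g = (\<integral>\<^sup>+\<xi>. ennreal ((gw \<xi>)\<^sup>2) \<partial>M)"
    unfolding wn_2s' gw_def by simp
  have pt: "ennreal ((norm (conv f g \<xi>) * br \<xi> powr - s)\<^sup>2)
      \<le> 8 * (I1 \<xi>)\<^sup>2 + 8 * (ennreal ((br \<xi> powr - (1 - s))\<^sup>2) * (wn (- 2 * s) f * wn (2 * (1 - s)) g))" for \<xi>
  proof -
    have "ennreal (norm (conv f g \<xi>) * br \<xi> powr - s) = ennreal (norm (conv f g \<xi>)) * ennreal (br \<xi> powr - s)"
      by (simp add: ennreal_mult)
    also have "\<dots> \<le> (\<integral>\<^sup>+\<eta>. ennreal (norm (f (\<xi> - \<eta>)) * norm (g \<eta>)) \<partial>M) * ennreal (br \<xi> powr - s)"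
      by (intro mult_right_mono conv_le) simp_all
    also have "\<dots> = (\<integral>\<^sup>+\<eta>. ennreal (norm (f (\<xi> - \<eta>)) * norm (g \<eta>) * br \<xi> powr - s) \<partial>M)"
      by (subst nn_integral_multc[symmetric]) (auto simp: ennreal_mult)
    also have "\<dots> \<le> (\<integral>\<^sup>+\<eta>. 2 * ennreal (\<phi> (\<xi> - \<eta>) * norm (g \<eta>)) + 2 * ennreal (br \<xi> powr - (1 - s)) * ennreal (\<phi> (\<xi> - \<eta>) * gw \<eta>) \<partial>M)"
    proof (rule nn_integral_mono)
      fix \<eta>
      have "br \<xi> powr - s \<le> 2 * (br \<eta> powr - (1 - s) + br \<xi> powr - (1 - s)) * (br (\<xi> - \<eta>) powr - s * br \<eta> powr (1 - s))"
        using br_ge1 br_triangle s by (intro bracket_kernel_bound) auto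
      then have "norm (f (\<xi> - \<eta>)) * norm (g \<eta>) * br \<xi> powr - s
        \<le> norm (f (\<xi> - \<eta>)) * norm (g \<eta>) * (2 * (br \<eta> powr - (1 - s) + br \<xi> powr - (1 - s)) * (br (\<xi> - \<eta>) powr - s * br \<eta> powr (1 - s)))"
        by (intro mult_left_mono) auto
      also have "\<dots> = 2 * (\<phi> (\<xi> - \<eta>) * (gw \<eta> * br \<eta> powr - (1 - s))) + 2 * (br \<xi> powr - (1 - s) * (\<phi> (\<xi> - \<eta>) * gw \<eta>))"
        unfolding \<phi>_def gw_def by (simp only: algebra_simps)
      also have "gw \<eta> * br \<eta> powr - (1 - s) = norm (g \<eta>)"
        unfolding gw_def using br_pos[of \<eta>] by (simp add: powr_add[symmetric] mult.assoc)
      finally have "ennreal (norm (f (\<xi> - \<eta>)) * norm (g \<eta>) * br \<xi> powr - s)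
          \<le> ennreal (2 * (\<phi> (\<xi> - \<eta>) * norm (g \<eta>)) + 2 * (br \<xi> powr - (1 - s) * (\<phi> (\<xi> - \<eta>) * gw \<eta>)))"
        by (rule ennreal_leI)
      also have "\<dots> = 2 * ennreal (\<phi> (\<xi> - \<eta>) * norm (g \<eta>)) + 2 * ennreal (br \<xi> powr - (1 - s)) * ennreal (\<phi> (\<xi> - \<eta>) * gw \<eta>)"
        using nn by (simp add: ennreal_plus ennreal_mult mult.assoc)
      finally show "ennreal (norm (f (\<xi> - \<eta>)) * norm (g \<eta>) * br \<xi> powr - s)
        \<le> 2 * ennreal (\<phi> (\<xi> - \<eta>) * norm (g \<eta>)) + 2 * ennreal (br \<xi> powr - (1 - s)) * ennreal (\<phi> (\<xi> - \<eta>) * gw \<eta>)" .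
    qed
    also have "\<dots> = 2 * I1 \<xi> + 2 * ennreal (br \<xi> powr - (1 - s)) * I2 \<xi>"
      unfolding I1_def I2_def
      by (subst nn_integral_add) (simp_all add: nn_integral_cmult)
    finally have "ennreal (norm (conv f g \<xi>) * br \<xi> powr - s) \<le> 2 * I1 \<xi> + 2 * ennreal (br \<xi> powr - (1 - s)) * I2 \<xi>" .
    then have "(ennreal (norm (conv f g \<xi>) * br \<xi> powr - s))\<^sup>2 \<le> (2 * I1 \<xi> + 2 * ennreal (br \<xi> powr - (1 - s)) * I2 \<xi>)\<^sup>2"
      by (rule power_mono) simp
    also have "\<dots> \<le> 2 * (2 * I1 \<xi>)\<^sup>2 + 2 * (2 * ennreal (br \<xi> powr - (1 - s)) * I2 \<xi>)\<^sup>2"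
      by (rule ennreal_sum_square_le)
    also have "\<dots> = 8 * (I1 \<xi>)\<^sup>2 + 8 * (ennreal ((br \<xi> powr - (1 - s))\<^sup>2) * (I2 \<xi>)\<^sup>2)"
      by (simp add: power_mult_distrib ennreal_power mult.assoc)
    also have "\<dots> \<le> 8 * (I1 \<xi>)\<^sup>2 + 8 * (ennreal ((br \<xi> powr - (1 - s))\<^sup>2) * (wn (- 2 * s) f * wn (2 * (1 - s)) g))"
      unfolding wf wg I2_def by (intro add_mono mult_left_mono holder_conv nn) simp_all
    finally show ?thesis
      by (simp add: ennreal_power)
  qed
  have "wn (- 2 * s) (conv f g) = (\<integral>\<^sup>+\<xi>. ennreal ((norm (conv f g \<xi>) * br \<xi> powr - s)\<^sup>2) \<partial>M)"
    by (rule wn_m2s)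
  also have "\<dots> \<le> (\<integral>\<^sup>+\<xi>. 8 * (I1 \<xi>)\<^sup>2 + 8 * (ennreal ((br \<xi> powr - (1 - s))\<^sup>2) * (wn (- 2 * s) f * wn (2 * (1 - s)) g)) \<partial>M)"
    by (intro nn_integral_mono pt)
  also have "\<dots> = 8 * (\<integral>\<^sup>+\<xi>. (I1 \<xi>)\<^sup>2 \<partial>M) + 8 * ((\<integral>\<^sup>+\<xi>. ennreal ((br \<xi> powr - (1 - s))\<^sup>2) \<partial>M) * (wn (- 2 * s) f * wn (2 * (1 - s)) g))"
    by (subst nn_integral_add) (simp_all add: nn_integral_cmult nn_integral_multc)
  also have "\<dots> \<le> 8 * (wn (- 2 * s) f * (wn (2 * (1 - s)) g * ennreal (\<kappa> * gC))) + 8 * (ennreal (\<kappa> * gC) * (wn (- 2 * s) f * wn (2 * (1 - s)) g))"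
  proof (intro add_mono mult_left_mono mult_right_mono growth')
    have "(\<integral>\<^sup>+\<xi>. (I1 \<xi>)\<^sup>2 \<partial>M) \<le> wn (- 2 * s) f * (\<integral>\<^sup>+\<xi>. norm (g \<xi>) \<partial>M)\<^sup>2"
      unfolding wf I1_def by (rule young_12) (auto simp: nn)
    also have "\<dots> \<le> wn (- 2 * s) f * (wn (2 * (1 - s)) g * ennreal (\<kappa> * gC))"
      by (intro mult_left_mono L1_le) simp_all
    finally show "(\<integral>\<^sup>+\<xi>. (I1 \<xi>)\<^sup>2 \<partial>M) \<le> wn (- 2 * s) f * (wn (2 * (1 - s)) g * ennreal (\<kappa> * gC))" .
  qed simp_all
  also have "\<dots> = (8 * ennreal (\<kappa> * gC) + 8 * ennreal (\<kappa> * gC)) * (wn (- 2 * s) f * wn (2 * (1 - s)) g)"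
  proof -
    have "8 * (a * (b * k)) + 8 * (k * (a * b)) = (8 * k + 8 * k) * (a * b)" for a b k :: ennreal
      by (simp add: algebra_simps)
    then show ?thesis .
  qed
  also have "8 * ennreal (\<kappa> * gC) + 8 * ennreal (\<kappa> * gC) = ennreal (16 * \<kappa> * gC)"
  proof -
    have "8 * ennreal (\<kappa> * gC) = ennreal (8 * (\<kappa> * gC))"
      using \<kappa> gC by (simp add: ennreal_mult)
    then show ?thesis
      using \<kappa> gC by (simp add: ennreal_plus[symmetric] del: ennreal_plus)
  qed
  finally show ?thesis
    by (simp only: mult.assoc)
qed

text \<open>The Fourier symbol of the inverse of d/dx + \<kappa>, which turns the Riccati equation
  with k = \<kappa> into a fixed point problem.\<close>

definition mul :: "'g \<Rightarrow> complex" where "mul \<xi> = 1 / (of_real \<kappa> + \<i> * of_real (\<iota> \<xi>))"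

lemma mul_measurable [measurable]: "mul \<in> borel_measurable M"
  unfolding mul_def[abs_def] by measurable

lemma mul_nz: "of_real \<kappa> + \<i> * of_real (\<iota> \<xi>) \<noteq> (0 :: complex)"
  using \<kappa> by (auto simp: complex_eq_iff)

lemma norm_mul_square: "(norm (mul \<xi>))\<^sup>2 = 1 / (\<kappa>\<^sup>2 + (\<iota> \<xi>)\<^sup>2)"
  unfolding mul_def by (simp add: norm_divide power_divide cmod_power2)

lemma norm_mul_le: "norm (mul \<xi>) \<le> 1" and norm_\<iota>_mul_le: "norm (of_real (\<iota> \<xi>) * mul \<xi>) \<le> 1"
proof -
  have k: "\<kappa>\<^sup>2 \<ge> 1"
    using \<kappa> by (simp add: one_le_power)
  have pos: "\<kappa>\<^sup>2 + (\<iota> \<xi>)\<^sup>2 \<ge> 1" "\<kappa>\<^sup>2 + (\<iota> \<xi>)\<^sup>2 \<ge> (\<iota> \<xi>)\<^sup>2" "\<kappa>\<^sup>2 + (\<iota> \<xi>)\<^sup>2 > 0"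
    using k zero_le_power2[of "\<iota> \<xi>"] by linarith+
  have "(norm (mul \<xi>))\<^sup>2 \<le> 1\<^sup>2"
    unfolding norm_mul_square using pos by (simp add: divide_le_eq)
  then show "norm (mul \<xi>) \<le> 1"
    by (rule power2_le_imp_le) simp
  have "(norm (of_real (\<iota> \<xi>) * mul \<xi>))\<^sup>2 \<le> 1\<^sup>2"
    unfolding norm_mult power_mult_distrib norm_mul_square using pos
    by (simp add: divide_le_eq)
  then show "norm (of_real (\<iota> \<xi>) * mul \<xi>) \<le> 1"
    by (rule power2_le_imp_le) simp
qed

text \<open>The symbol gains one full power of the bracket, |mul|^2 br^2 <= 2 / \<kappa>^2. This is
  exactly the distance between the weights of potentials and of solutions.\<close>

lemma wn_mul:
  assumes [measurable]: "f \<in> borel_measurable M"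
  shows "wn (2 * (1 - s)) (\<lambda>\<xi>. mul \<xi> * f \<xi>) \<le> ennreal (2 / \<kappa>\<^sup>2) * wn (- 2 * s) f"
proof -
  have "(norm (mul \<xi> * f \<xi>))\<^sup>2 * br \<xi> powr (2 * (1 - s)) \<le> (2 / \<kappa>\<^sup>2) * ((norm (f \<xi>))\<^sup>2 * br \<xi> powr (- 2 * s))" for \<xi>
  proof -
    have "(br \<xi>)\<^sup>2 \<le> 2 / \<kappa>\<^sup>2 * (\<kappa>\<^sup>2 + (\<iota> \<xi>)\<^sup>2)"
    proof -
      have "(1 + \<bar>\<iota> \<xi>\<bar> / \<kappa>)\<^sup>2 \<le> 2 + 2 * (\<bar>\<iota> \<xi>\<bar> / \<kappa>)\<^sup>2"
        by (rule square_one_plus_le)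
      also have "\<dots> = 2 / \<kappa>\<^sup>2 * (\<kappa>\<^sup>2 + (\<iota> \<xi>)\<^sup>2)"
        using \<kappa> by (simp add: field_simps power_divide)
      finally show ?thesis unfolding br_def .
    qed
    moreover have pos: "\<kappa>\<^sup>2 + (\<iota> \<xi>)\<^sup>2 > 0"
      using \<kappa> by (intro add_pos_nonneg) auto
    ultimately have "(norm (mul \<xi>))\<^sup>2 * (br \<xi>)\<^sup>2 \<le> 2 / \<kappa>\<^sup>2"
      unfolding norm_mul_square by (simp add: divide_le_eq)
    then have "((norm (mul \<xi>))\<^sup>2 * (br \<xi>)\<^sup>2) * ((norm (f \<xi>))\<^sup>2 * br \<xi> powr (- 2 * s)) \<le> 2 / \<kappa>\<^sup>2 * ((norm (f \<xi>))\<^sup>2 * br \<xi> powr (- 2 * s))"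
      by (intro mult_right_mono) auto
    moreover have "br \<xi> powr (2 * (1 - s)) = (br \<xi>)\<^sup>2 * br \<xi> powr (- 2 * s)"
    proof -
      have "br \<xi> powr (2 * (1 - s)) = br \<xi> powr (2 + (- 2 * s))"
        by (simp add: algebra_simps)
      then show ?thesis
        using br_pos[of \<xi>] by (simp only: powr_add) simp
    qed
    ultimately show ?thesis
      by (simp add: norm_mult power_mult_distrib mult_ac)
  qed
  then have "wn (2 * (1 - s)) (\<lambda>\<xi>. mul \<xi> * f \<xi>) \<le> (\<integral>\<^sup>+\<xi>. ennreal (2 / \<kappa>\<^sup>2) * ennreal ((norm (f \<xi>))\<^sup>2 * br \<xi> powr (- 2 * s)) \<partial>M)"
    unfolding wn_def by (intro nn_integral_mono) (simp add: ennreal_mult[symmetric] ennreal_leI)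
  also have "\<dots> = ennreal (2 / \<kappa>\<^sup>2) * wn (- 2 * s) f"
    unfolding wn_def by (rule nn_integral_cmult) measurable
  finally show ?thesis .
qed

lemma wn_add: "f \<in> borel_measurable M \<Longrightarrow> g \<in> borel_measurable M \<Longrightarrow> wn e (\<lambda>\<xi>. f \<xi> + g \<xi>) \<le> 2 * wn e f + 2 * wn e g"
proof -
  assume [measurable]: "f \<in> borel_measurable M" "g \<in> borel_measurable M"
  have "wn e (\<lambda>\<xi>. f \<xi> + g \<xi>) \<le> (\<integral>\<^sup>+\<xi>. 2 * ennreal ((norm (f \<xi>))\<^sup>2 * br \<xi> powr e) + 2 * ennreal ((norm (g \<xi>))\<^sup>2 * br \<xi> powr e) \<partial>M)"
    unfolding wn_def
  proof (rule nn_integral_mono)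
    fix \<xi>
    have "ennreal ((norm (f \<xi> + g \<xi>))\<^sup>2) * ennreal (br \<xi> powr e) \<le> (2 * ennreal ((norm (f \<xi>))\<^sup>2) + 2 * ennreal ((norm (g \<xi>))\<^sup>2)) * ennreal (br \<xi> powr e)"
      by (intro mult_right_mono ennreal_norm_sum_square) simp
    then show "ennreal ((norm (f \<xi> + g \<xi>))\<^sup>2 * br \<xi> powr e) \<le> 2 * ennreal ((norm (f \<xi>))\<^sup>2 * br \<xi> powr e) + 2 * ennreal ((norm (g \<xi>))\<^sup>2 * br \<xi> powr e)"
      by (simp add: ennreal_mult distrib_right mult.assoc)
  qed
  also have "\<dots> = 2 * wn e f + 2 * wn e g"
    unfolding wn_def by (subst nn_integral_add) (simp_all add: nn_integral_cmult)
  finally show ?thesis .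
qed

lemma wn_uminus: "wn e (\<lambda>\<xi>. - f \<xi>) = wn e f"
  by (simp add: wn_def)

lemma wn_diff: "f \<in> borel_measurable M \<Longrightarrow> g \<in> borel_measurable M \<Longrightarrow> wn e (\<lambda>\<xi>. f \<xi> - g \<xi>) \<le> 2 * wn e f + 2 * wn e g"
  using wn_add[of f "\<lambda>\<xi>. - g \<xi>" e] by (simp add: wn_uminus)

text \<open>The squared scale-invariant norms: \<open>Z\<close> on solutions, \<open>Bn\<close> on potentials.\<close>

definition Z :: "('g \<Rightarrow> complex) \<Rightarrow> ennreal" where "Z f = ennreal \<kappa> * wn (2 * (1 - s)) f"
definition Bn :: "('g \<Rightarrow> complex) \<Rightarrow> ennreal" where "Bn f = ennreal (1 / \<kappa>) * wn (- 2 * s) f"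

definition tri :: "('g \<Rightarrow> complex) \<Rightarrow> ('g \<Rightarrow> complex) \<Rightarrow> ('g \<Rightarrow> complex) \<Rightarrow> 'g \<Rightarrow> complex" where
  "tri F f g \<xi> = mul \<xi> * conv (conv F f) g \<xi>"

lemma Z_diff: "f \<in> borel_measurable M \<Longrightarrow> g \<in> borel_measurable M \<Longrightarrow> Z (\<lambda>\<xi>. f \<xi> - g \<xi>) \<le> 2 * Z f + 2 * Z g"
  unfolding Z_def using mult_left_mono[OF wn_diff, of f g "ennreal \<kappa>"]
  by (simp add: distrib_left mult_ac)

lemma Z_add: "f \<in> borel_measurable M \<Longrightarrow> g \<in> borel_measurable M \<Longrightarrow> Z (\<lambda>\<xi>. f \<xi> + g \<xi>) \<le> 2 * Z f + 2 * Z g"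
  unfolding Z_def using mult_left_mono[OF wn_add, of f g "ennreal \<kappa>"]
  by (simp add: distrib_left mult_ac)

text \<open>Two applications of \<open>wn_conv\<close> and one of \<open>wn_mul\<close>: 512 = 2 *
  16^2. The powers of \<kappa> match those in \<open>Z\<close> and \<open>Bn\<close>, so the
  constant is independent of \<kappa>.\<close>

lemma Z_tri:
  assumes [measurable]: "F \<in> borel_measurable M" "f \<in> borel_measurable M" "g \<in> borel_measurable M"
  shows "Z (tri F f g) \<le> ennreal (512 * gC\<^sup>2) * Bn F * Z f * Z g"
proof -
  let ?k = "ennreal (16 * \<kappa> * gC)"
  have "Z (tri F f g) \<le> ennreal \<kappa> * (ennreal (2 / \<kappa>\<^sup>2) * wn (- 2 * s) (conv (conv F f) g))"
    unfolding Z_def tri_def[abs_def] by (intro mult_left_mono wn_mul) simp_all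
  also have "\<dots> \<le> ennreal \<kappa> * (ennreal (2 / \<kappa>\<^sup>2) * (?k * (?k * wn (- 2 * s) F * wn (2 * (1 - s)) f) * wn (2 * (1 - s)) g))"
    by (intro mult_left_mono order_trans[OF wn_conv] mult_right_mono wn_conv) simp_all
  also have "\<dots> = (ennreal \<kappa> * ennreal (2 / \<kappa>\<^sup>2) * ?k * ?k) * (wn (- 2 * s) F * wn (2 * (1 - s)) f * wn (2 * (1 - s)) g)"
    by (simp only: mult_ac)
  also have "ennreal \<kappa> * ennreal (2 / \<kappa>\<^sup>2) * ?k * ?k = ennreal (512 * gC\<^sup>2) * ennreal (1 / \<kappa>) * ennreal \<kappa> * ennreal \<kappa>"
    using \<kappa> gC by (simp add: ennreal_mult[symmetric] power2_eq_square field_simps)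
  also have "\<dots> * (wn (- 2 * s) F * wn (2 * (1 - s)) f * wn (2 * (1 - s)) g) = ennreal (512 * gC\<^sup>2) * Bn F * Z f * Z g"
    unfolding Z_def Bn_def by (simp only: mult_ac)
  finally show ?thesis .
qed

lemma L1_le_Z:
  assumes "f \<in> borel_measurable M"
  shows "(\<integral>\<^sup>+\<xi>. norm (f \<xi>) \<partial>M)\<^sup>2 \<le> ennreal gC * Z f"
proof -
  have "(\<integral>\<^sup>+\<xi>. norm (f \<xi>) \<partial>M)\<^sup>2 \<le> wn (2 * (1 - s)) f * ennreal (\<kappa> * gC)"
    by (rule L1_le[OF assms])
  also have "\<dots> = ennreal gC * Z f"
    unfolding Z_def using \<kappa> gC by (simp add: ennreal_mult mult_ac)
  finally show ?thesis .
qed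

lemma L2_le_Z: "ennreal \<kappa> * (\<integral>\<^sup>+\<xi>. ennreal ((norm (f \<xi>))\<^sup>2) \<partial>M) \<le> Z f"
proof -
  have "(norm (f \<xi>))\<^sup>2 * 1 \<le> (norm (f \<xi>))\<^sup>2 * br \<xi> powr (2 * (1 - s))" for \<xi>
    using br_ge1[of \<xi>] s by (intro mult_left_mono ge_one_powr_ge_zero) auto
  then show ?thesis
    unfolding Z_def wn_def by (intro mult_left_mono nn_integral_mono ennreal_leI) auto
qed

lemma bdd_mul:
  assumes "bdd f"
  shows "bdd (\<lambda>\<xi>. mul \<xi> * f \<xi>)"
proof -
  have [measurable]: "f \<in> borel_measurable M" using assms by (auto simp: bdd_def)
  have le: "norm (mul \<xi> * f \<xi>) \<le> norm (f \<xi>)" for \<xi>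
    using norm_mul_le[of \<xi>] by (simp add: norm_mult mult_le_cancel_right2 mult_left_le_one_le)
  have "integrable M (\<lambda>\<xi>. mul \<xi> * f \<xi>)"
    by (rule Bochner_Integration.integrable_bound[of M f]) (use assms le in \<open>auto simp: bdd_def\<close>)
  then show ?thesis
    using assms le unfolding bdd_def by (meson order_trans)
qed

lemma synth_mul_derivative:
  assumes D: "bdd D"
  shows "(synth (\<lambda>\<xi>. mul \<xi> * D \<xi>) has_vector_derivative (synth D x - of_real \<kappa> * synth (\<lambda>\<xi>. mul \<xi> * D \<xi>) x)) (at x)"
proof -
  have [measurable]: "D \<in> borel_measurable M" and Di: "integrable M D" using D by (auto simp: bdd_def)
  let ?f = "\<lambda>\<xi>. mul \<xi> * D \<xi>"
  have fi: "integrable M ?f"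
    using bdd_mul[OF D] by (auto simp: bdd_def)
  have "integrable M (\<lambda>\<xi>. of_real (\<iota> \<xi>) * ?f \<xi>)"
  proof (rule Bochner_Integration.integrable_bound[OF Di])
    show "AE \<xi> in M. norm (of_real (\<iota> \<xi>) * ?f \<xi>) \<le> norm (D \<xi>)"
    proof (rule AE_I2)
      fix \<xi> show "norm (of_real (\<iota> \<xi>) * ?f \<xi>) \<le> norm (D \<xi>)"
        using mult_right_mono[OF norm_\<iota>_mul_le[of \<xi>] norm_ge_zero[of "D \<xi>"]] by (simp add: norm_mult mult.assoc)
    qed
  qed measurable
  from synth_derivative[OF fi this, of x]
  have "(synth ?f has_vector_derivative synth (\<lambda>\<xi>. \<i> * of_real (\<iota> \<xi>) * ?f \<xi>) x) (at x)" .
  moreover have "(\<lambda>\<xi>. \<i> * of_real (\<iota> \<xi>) * ?f \<xi>) = (\<lambda>\<xi>. D \<xi> - of_real \<kappa> * ?f \<xi>)"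
  proof
    fix \<xi> show "\<i> * of_real (\<iota> \<xi>) * ?f \<xi> = D \<xi> - of_real \<kappa> * ?f \<xi>"
      using mul_nz[of \<xi>] unfolding mul_def by (simp add: field_simps)
  qed
  moreover have "synth (\<lambda>\<xi>. D \<xi> - of_real \<kappa> * ?f \<xi>) x = synth D x - of_real \<kappa> * synth ?f x"
    by (subst synth_diff) (use Di fi in \<open>auto simp: synth_cmult\<close>)
  ultimately show ?thesis
    by simp
qed

lemma Z_first:
  assumes "bdd F" "\<sigma> = 1 \<or> \<sigma> = -1"
  shows "Z (\<lambda>\<xi>. mul \<xi> * crefl \<sigma> F \<xi>) \<le> 2 * Bn F"
proof -
  have [measurable]: "F \<in> borel_measurable M" "crefl \<sigma> F \<in> borel_measurable M"
    using assms bdd_crefl[of F \<sigma>] by (auto simp: bdd_def)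
  have "wn (- 2 * s) (crefl \<sigma> F) = (\<integral>\<^sup>+\<xi>. ennreal ((norm (F (- \<xi>)))\<^sup>2 * br (- \<xi>) powr (- 2 * s)) \<partial>M)"
    unfolding wn_def crefl_def using assms(2) by (intro nn_integral_cong) (auto simp: norm_mult br_def)
  also have "\<dots> = wn (- 2 * s) F"
    unfolding wn_def by (rule nn_refl) measurable
  finally have w: "wn (- 2 * s) (crefl \<sigma> F) = wn (- 2 * s) F" .
  have "Z (\<lambda>\<xi>. mul \<xi> * crefl \<sigma> F \<xi>) \<le> ennreal \<kappa> * (ennreal (2 / \<kappa>\<^sup>2) * wn (- 2 * s) F)"
    unfolding Z_def w[symmetric] by (intro mult_left_mono wn_mul) simp_all
  also have "\<dots> = (ennreal \<kappa> * ennreal (2 / \<kappa>\<^sup>2)) * wn (- 2 * s) F"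
    by (simp only: mult_ac)
  also have "ennreal \<kappa> * ennreal (2 / \<kappa>\<^sup>2) = 2 * ennreal (1 / \<kappa>)"
    using \<kappa> by (simp add: ennreal_mult[symmetric] ennreal_mult'[of 2 "1/\<kappa>", simplified, symmetric] power2_eq_square)
  finally show ?thesis
    unfolding Bn_def by (simp only: mult_ac)
qed

end

section \<open>The Picard iterates and their limit\<close>

context picard
begin

text \<open>The Fourier side of the iteration w_(j+1) = (d/dx + \<kappa>)^(-1) (\<sigma> cnj u - u
  w_j^2), started at the linear part.\<close>

primrec pit :: "real \<Rightarrow> ('g \<Rightarrow> complex) \<Rightarrow> nat \<Rightarrow> 'g \<Rightarrow> complex" where
  "pit \<sigma> F 0 = (\<lambda>\<xi>. mul \<xi> * crefl \<sigma> F \<xi>)"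
| "pit \<sigma> F (Suc j) = (\<lambda>\<xi>. mul \<xi> * (crefl \<sigma> F \<xi> - conv (conv F (pit \<sigma> F j)) (pit \<sigma> F j) \<xi>))"

declare pit.simps(2) [simp del]

lemma pit_Suc: "pit \<sigma> F (Suc j) = (\<lambda>\<xi>. pit \<sigma> F 0 \<xi> - tri F (pit \<sigma> F j) (pit \<sigma> F j) \<xi>)"
  by (auto simp: tri_def right_diff_distrib pit.simps(2))

lemma bdd_diff: "bdd f \<Longrightarrow> bdd g \<Longrightarrow> bdd (\<lambda>\<xi>. f \<xi> - g \<xi>)"
proof -
  assume *: "bdd f" "bdd g"
  then obtain K K' where "\<And>\<xi>. norm (f \<xi>) \<le> K" "\<And>\<xi>. norm (g \<xi>) \<le> K'"
    by (auto simp: bdd_def)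
  then have "norm (f \<xi> - g \<xi>) \<le> K + K'" for \<xi>
    by (meson add_mono norm_triangle_ineq4 order_trans)
  with * show ?thesis
    unfolding bdd_def by blast
qed

lemma bdd_pit: "bdd F \<Longrightarrow> bdd (pit \<sigma> F j)"
proof (induction j)
  case (Suc j)
  then have "bdd (conv (conv F (pit \<sigma> F j)) (pit \<sigma> F j))"
    by (meson bddD(1) bdd_conv)
  then show ?case
    using Suc by (simp add: bdd_mul bdd_diff bdd_crefl pit.simps(2))
qed (simp add: bdd_mul bdd_crefl)

lemma pit_measurable: "bdd F \<Longrightarrow> pit \<sigma> F j \<in> borel_measurable M"
  using bddD(2)[OF bdd_pit] .

lemma tri_measurable:
  assumes [measurable]: "F \<in> borel_measurable M" "f \<in> borel_measurable M" "g \<in> borel_measurable M"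
  shows "tri F f g \<in> borel_measurable M"
  unfolding tri_def[abs_def] by measurable

context
  fixes F :: "'g \<Rightarrow> complex" and \<sigma> b :: real
  assumes F: "bdd F" and \<sigma>: "\<sigma> = 1 \<or> \<sigma> = -1" and b: "b \<ge> 0" "256 * gC * b \<le> 1"
    and B: "Bn F \<le> ennreal b"
begin

lemma F_meas: "F \<in> borel_measurable M"
  using bddD(2)[OF F] .

text \<open>512 / 256^2 = 1 / 128. The factor 256 leaves room for a contraction and for sup |w| <=
  1/2, which needs 8 gC b <= 1/4.\<close>

lemma small_const: "512 * gC\<^sup>2 * b\<^sup>2 \<le> 1 / 128"
proof -
  have "(256 * gC * b)\<^sup>2 \<le> 1\<^sup>2"
    using b gC by (intro power_mono) auto
  then show ?thesis
    by (simp add: power_mult_distrib)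
qed

lemma Z_tri_le:
  assumes "f \<in> borel_measurable M" "g \<in> borel_measurable M" "Z f \<le> ennreal zf" "Z g \<le> ennreal zg" "zf \<ge> 0" "zg \<ge> 0"
  shows "Z (tri F f g) \<le> ennreal (512 * gC\<^sup>2 * b * zf * zg)"
proof -
  have "Z (tri F f g) \<le> ennreal (512 * gC\<^sup>2) * Bn F * Z f * Z g"
    by (rule Z_tri[OF F_meas assms(1,2)])
  also have "\<dots> \<le> ennreal (512 * gC\<^sup>2) * ennreal b * ennreal zf * ennreal zg"
    by (intro mult_mono B assms order_refl) simp_all
  also have "\<dots> = ennreal (512 * gC\<^sup>2 * b * zf * zg)"
    using b assms by (simp add: ennreal_mult)
  finally show ?thesis .
qed

lemma Z_pit_0: "Z (pit \<sigma> F 0) \<le> ennreal (2 * b)"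
proof -
  have "Z (pit \<sigma> F 0) \<le> 2 * Bn F"
    using Z_first[OF F \<sigma>] by simp
  also have "\<dots> \<le> 2 * ennreal b"
    by (intro mult_left_mono B) simp
  finally show ?thesis
    using b by (simp add: ennreal_mult)
qed

lemma Z_pit: "Z (pit \<sigma> F j) \<le> ennreal (8 * b)"
proof (induction j)
  case 0
  show ?case
    by (rule order_trans[OF Z_pit_0]) (use b in \<open>simp add: ennreal_leI\<close>)
next
  case (Suc j)
  have t: "Z (tri F (pit \<sigma> F j) (pit \<sigma> F j)) \<le> ennreal (512 * gC\<^sup>2 * b * (8 * b) * (8 * b))"
    using b by (intro Z_tri_le pit_measurable F Suc) auto
  have "Z (pit \<sigma> F (Suc j)) \<le> 2 * Z (pit \<sigma> F 0) + 2 * Z (tri F (pit \<sigma> F j) (pit \<sigma> F j))"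
    unfolding pit_Suc by (intro Z_diff pit_measurable tri_measurable F F_meas)
  also have "\<dots> \<le> 2 * ennreal (2 * b) + 2 * ennreal (512 * gC\<^sup>2 * b * (8 * b) * (8 * b))"
    by (intro add_mono mult_left_mono Z_pit_0 t) simp_all
  also have "\<dots> = ennreal (2 * (2 * b) + 2 * (512 * gC\<^sup>2 * b * (8 * b) * (8 * b)))"
    using b by (intro two_ennreal_add) (auto intro!: mult_nonneg_nonneg)
  also have "\<dots> \<le> ennreal (8 * b)"
  proof (rule ennreal_leI)
    have "(512 * gC\<^sup>2 * b\<^sup>2) * (64 * b) \<le> 1 / 128 * (64 * b)"
      using b by (intro mult_right_mono small_const) auto
    then show "2 * (2 * b) + 2 * (512 * gC\<^sup>2 * b * (8 * b) * (8 * b)) \<le> 8 * b"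
      using b by (simp add: power2_eq_square mult_ac)
  qed
  finally show ?case .
qed

text \<open>The difference of the cubic terms telescopes into \<open>tri F d f\<close> and
  \<open>tri F g d\<close>, where d is the previous difference. With \<open>small_const\<close> the
  squared norm contracts by 1/4, hence the norm by 1/2.\<close>

lemma Z_pit_diff: "Z (\<lambda>\<xi>. pit \<sigma> F (Suc j) \<xi> - pit \<sigma> F j \<xi>) \<le> ennreal (32 * b * (1 / 4) ^ j)"
proof (induction j)
  case 0
  have "Z (\<lambda>\<xi>. pit \<sigma> F (Suc 0) \<xi> - pit \<sigma> F 0 \<xi>) \<le> 2 * Z (pit \<sigma> F (Suc 0)) + 2 * Z (pit \<sigma> F 0)"
    by (intro Z_diff pit_measurable F)
  also have "\<dots> \<le> 2 * ennreal (8 * b) + 2 * ennreal (8 * b)"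
    by (intro add_mono mult_left_mono Z_pit) simp_all
  also have "\<dots> = ennreal (2 * (8 * b) + 2 * (8 * b))"
    using b by (intro two_ennreal_add) auto
  finally show ?case by simp
next
  case (Suc j)
  let ?f = "pit \<sigma> F (Suc j)" and ?g = "pit \<sigma> F j"
  let ?d = "\<lambda>\<xi>. ?f \<xi> - ?g \<xi>"
  have bf: "bdd ?f" "bdd ?g" "integrable M ?f" "integrable M ?g" "integrable M ?d"
    using bdd_pit[OF F] bddD(1) bdd_diff by blast+
  have m: "?f \<in> borel_measurable M" "?g \<in> borel_measurable M" "?d \<in> borel_measurable M"
    using bf by auto
  have "(\<lambda>\<xi>. pit \<sigma> F (Suc (Suc j)) \<xi> - pit \<sigma> F (Suc j) \<xi>) = (\<lambda>\<xi>. - (tri F ?d ?f \<xi> + tri F ?g ?d \<xi>))"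
  proof
    fix \<xi>
    have "conv F ?d = (\<lambda>\<xi>. conv F ?f \<xi> - conv F ?g \<xi>)"
      using conv_diff_right[OF F bf(3,4)] by auto
    then have 1: "conv (conv F ?d) ?f \<xi> = conv (conv F ?f) ?f \<xi> - conv (conv F ?g) ?f \<xi>"
      using conv_diff_left[OF bdd_conv[OF F bf(3)] bdd_conv[OF F bf(4)] bf(3)] by simp
    have 2: "conv (conv F ?g) ?d \<xi> = conv (conv F ?g) ?f \<xi> - conv (conv F ?g) ?g \<xi>"
      by (rule conv_diff_right[OF bdd_conv[OF F bf(4)] bf(3,4)])
    have "pit \<sigma> F (Suc (Suc j)) \<xi> - pit \<sigma> F (Suc j) \<xi> = - (tri F ?f ?f \<xi> - tri F ?g ?g \<xi>)"
      unfolding pit_Suc[of _ _ "Suc j"] pit_Suc[of _ _ j, THEN fun_cong] by simp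
    also have "\<dots> = - (tri F ?d ?f \<xi> + tri F ?g ?d \<xi>)"
      unfolding tri_def 1 2 by (simp only: algebra_simps) simp
    finally show "pit \<sigma> F (Suc (Suc j)) \<xi> - pit \<sigma> F (Suc j) \<xi> = - (tri F ?d ?f \<xi> + tri F ?g ?d \<xi>)" .
  qed
  then have "Z (\<lambda>\<xi>. pit \<sigma> F (Suc (Suc j)) \<xi> - pit \<sigma> F (Suc j) \<xi>) = Z (\<lambda>\<xi>. tri F ?d ?f \<xi> + tri F ?g ?d \<xi>)"
    by (simp only: Z_def wn_uminus)
  also have "\<dots> \<le> 2 * Z (tri F ?d ?f) + 2 * Z (tri F ?g ?d)"
    by (intro Z_add tri_measurable F_meas m)
  also have "\<dots> \<le> 2 * ennreal (512 * gC\<^sup>2 * b * (32 * b * (1 / 4) ^ j) * (8 * b)) + 2 * ennreal (512 * gC\<^sup>2 * b * (8 * b) * (32 * b * (1 / 4) ^ j))"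
    using b by (intro add_mono mult_left_mono Z_tri_le m Z_pit Suc) simp_all
  also have "\<dots> = ennreal (2 * (512 * gC\<^sup>2 * b * (32 * b * (1 / 4) ^ j) * (8 * b)) + 2 * (512 * gC\<^sup>2 * b * (8 * b) * (32 * b * (1 / 4) ^ j)))"
    using b by (intro two_ennreal_add) (auto intro!: mult_nonneg_nonneg)
  also have "\<dots> \<le> ennreal (32 * b * (1 / 4) ^ Suc j)"
  proof (rule ennreal_leI)
    have "(512 * gC\<^sup>2 * b\<^sup>2) * (32 * (32 * b * (1 / 4) ^ j)) \<le> 1 / 128 * (32 * (32 * b * (1 / 4) ^ j))"
      using b by (intro mult_right_mono small_const) auto
    then show "2 * (512 * gC\<^sup>2 * b * (32 * b * (1 / 4) ^ j) * (8 * b)) + 2 * (512 * gC\<^sup>2 * b * (8 * b) * (32 * b * (1 / 4) ^ j)) \<le> 32 * b * (1 / 4) ^ Suc j"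
      by (simp add: power2_eq_square mult_ac)
  qed
  finally show ?case .
qed

text \<open>An iterate differs from the linear part by a single cubic term, bounded with 512 * 8^2 =
  32768. As \<open>Z\<close> and \<open>b\<close> are squared sizes, this is the origin of the error
  Bq^3.\<close>

lemma Z_pit_first: "Z (\<lambda>\<xi>. pit \<sigma> F j \<xi> - pit \<sigma> F 0 \<xi>) \<le> ennreal (32768 * gC\<^sup>2 * b ^ 3)"
proof (cases j)
  case 0
  then show ?thesis by (simp add: Z_def wn_def)
next
  case (Suc i)
  have "(\<lambda>\<xi>. pit \<sigma> F j \<xi> - pit \<sigma> F 0 \<xi>) = (\<lambda>\<xi>. - tri F (pit \<sigma> F i) (pit \<sigma> F i) \<xi>)"
    unfolding Suc pit_Suc by simp
  then have "Z (\<lambda>\<xi>. pit \<sigma> F j \<xi> - pit \<sigma> F 0 \<xi>) = Z (tri F (pit \<sigma> F i) (pit \<sigma> F i))"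
    by (simp only: Z_def wn_uminus)
  also have "\<dots> \<le> ennreal (512 * gC\<^sup>2 * b * (8 * b) * (8 * b))"
    using b by (intro Z_tri_le pit_measurable F Z_pit) auto
  finally show ?thesis
    by (simp add: power3_eq_cube mult_ac)
qed

lemma synth_le_Z:
  assumes "integrable M f" "Z f \<le> ennreal z" "gC * z \<le> r\<^sup>2" "r \<ge> 0" "z \<ge> 0"
  shows "norm (synth f x) \<le> r"
proof -
  have "(\<integral>\<^sup>+\<xi>. norm (f \<xi>) \<partial>M)\<^sup>2 \<le> ennreal gC * Z f"
    using assms(1) by (intro L1_le_Z) auto
  also have "\<dots> \<le> ennreal gC * ennreal z"
    by (intro mult_left_mono assms) simp
  also have "\<dots> \<le> ennreal (r\<^sup>2)"
    using assms gC by (simp add: ennreal_mult[symmetric] ennreal_leI)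
  finally have "(\<integral>\<^sup>+\<xi>. norm (f \<xi>) \<partial>M) \<le> ennreal r"
    using assms(4) by (rule ennreal_le_of_square_le)
  then have "ennreal (norm (synth f x)) \<le> ennreal r"
    using norm_synth_le[OF assms(1)] order_trans by blast
  then show ?thesis
    using assms(4) by simp
qed

lemma pit_sup: "norm (synth (pit \<sigma> F j) x) \<le> 1 / 2"
  by (rule synth_le_Z[OF _ Z_pit]) (use bdd_pit[OF F] bddD(1) b gC in \<open>auto simp: power2_eq_square\<close>)

lemma pit_step: "norm (synth (pit \<sigma> F (Suc j)) x - synth (pit \<sigma> F j) x) \<le> (1 / 2) ^ j"
proof -
  have i: "integrable M (pit \<sigma> F j)" for j
    using bdd_pit[OF F] bddD(1) by blast
  have "norm (synth (\<lambda>\<xi>. pit \<sigma> F (Suc j) \<xi> - pit \<sigma> F j \<xi>) x) \<le> (1 / 2) ^ j"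
  proof (rule synth_le_Z[OF _ Z_pit_diff])
    have "gC * b * (32 * (1 / 4) ^ j) \<le> (1 / 32) * (32 * (1 / 4) ^ j)"
      using b by (intro mult_right_mono) auto
    also have "\<dots> = ((1 / 2) ^ j)\<^sup>2"
      by (simp add: power2_eq_square power_mult_distrib[symmetric])
    finally show "gC * (32 * b * (1 / 4) ^ j) \<le> ((1 / 2) ^ j)\<^sup>2"
      by (simp add: mult_ac)
  qed (use i b in auto)
  then show ?thesis
    using i by (simp only: synth_diff[OF i i])
qed

lemma synth_pit_derivative:
  "(synth (pit \<sigma> F (Suc j)) has_vector_derivative
     (of_real \<sigma> * cnj (synth F x) - synth F x * (synth (pit \<sigma> F j) x)\<^sup>2 - of_real \<kappa> * synth (pit \<sigma> F (Suc j)) x)) (at x)"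
proof -
  let ?p = "pit \<sigma> F j"
  have i: "integrable M ?p" "bdd F" "integrable M F"
    using bdd_pit[OF F] bddD(1) F by blast+
  have bc: "bdd (conv (conv F ?p) ?p)"
    using i by (intro bdd_conv)
  let ?D = "\<lambda>\<xi>. crefl \<sigma> F \<xi> - conv (conv F ?p) ?p \<xi>"
  have D: "bdd ?D"
    by (intro bdd_diff bdd_crefl F bc)
  have "synth ?D x = synth (crefl \<sigma> F) x - synth (conv (conv F ?p) ?p) x"
    by (intro synth_diff bddD(1) bdd_crefl F bc)
  also have "\<dots> = of_real \<sigma> * cnj (synth F x) - synth F x * (synth ?p x)\<^sup>2"
    using i by (simp add: synth_crefl synth_conv integrable_conv power2_eq_square mult.assoc)
  finally show ?thesis
    using synth_mul_derivative[OF D, of x] by (simp add: pit.simps(2))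
qed

text \<open>\<open>Z\<close> dominates the squared sup norm of the synthesis, so the iterates
  converge uniformly in x. The equation passes to the limit because the derivative of an iterate is
  a polynomial in the iterates themselves.\<close>

lemma picard_limit:
  obtains v where
    "\<And>x. (v has_vector_derivative (of_real \<sigma> * cnj (synth F x) - of_real \<kappa> * v x - synth F x * (v x)\<^sup>2)) (at x)"
    "\<And>x. norm (v x) \<le> 1 / 2" "\<And>x. (\<lambda>j. synth (pit \<sigma> F j) x) \<longlonglongrightarrow> v x"
proof -
  let ?f = "\<lambda>j x. synth (pit \<sigma> F j) x"
  define g where "g x = (\<Sum>i. ?f (Suc i) x - ?f i x)" for x
  have "uniform_limit UNIV (\<lambda>n x. \<Sum>i<n. ?f (Suc i) x - ?f i x) g sequentially"
    unfolding g_def by (rule Weierstrass_m_test[where M = "\<lambda>j. (1 / 2) ^ j"])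
       (use pit_step in \<open>auto intro: summable_geometric\<close>)
  then have ul: "uniform_limit UNIV (\<lambda>n x. ?f n x - ?f 0 x) g sequentially"
    using sum_lessThan_telescope[of "\<lambda>n. ?f n _"] by (simp only:)
  define v where "v x = g x + ?f 0 x" for x
  have ul2: "\<forall>\<^sub>F n in sequentially. \<forall>x. norm (?f n x - v x) < e" if "e > 0" for e
  proof -
    have "\<forall>\<^sub>F n in sequentially. \<forall>x\<in>UNIV. dist (?f n x - ?f 0 x) (g x) < e"
      using ul that by (rule uniform_limitD)
    then show ?thesis
      by (simp add: dist_norm v_def algebra_simps)
  qed
  have lim: "(\<lambda>n. ?f n x) \<longlonglongrightarrow> v x" for x
    unfolding tendsto_iff dist_norm
  proof (intro allI impI)
    fix e :: real assume "e > 0"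
    from ul2[OF this] show "\<forall>\<^sub>F n in sequentially. norm (?f n x - v x) < e"
      by (rule eventually_mono) auto
  qed
  have vb: "norm (v x) \<le> 1 / 2" for x
    by (rule tendsto_upperbound[OF tendsto_norm[OF lim]]) (intro always_eventually allI pit_sup, simp)
  obtain KF where KF: "KF > 0" "\<And>x. norm (synth F x) \<le> KF"
  proof -
    have "norm (synth F x) \<le> enn2real (\<integral>\<^sup>+\<xi>. norm (F \<xi>) \<partial>M)" for x
    proof -
      have "(\<integral>\<^sup>+\<xi>. norm (F \<xi>) \<partial>M) < \<infinity>"
        using bddD(1)[OF F] by (auto simp: integrable_iff_bounded)
      then have "(\<integral>\<^sup>+\<xi>. norm (F \<xi>) \<partial>M) = ennreal (enn2real (\<integral>\<^sup>+\<xi>. norm (F \<xi>) \<partial>M))"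
        by simp
      then have "ennreal (norm (synth F x)) \<le> ennreal (enn2real (\<integral>\<^sup>+\<xi>. norm (F \<xi>) \<partial>M))"
        using norm_synth_le[OF bddD(1)[OF F], of x] by simp
      then show ?thesis by (simp add: ennreal_le_iff)
    qed
    then have "norm (synth F x) \<le> enn2real (\<integral>\<^sup>+\<xi>. norm (F \<xi>) \<partial>M) + 1" for x
      by (rule order_trans) simp
    then show ?thesis
      using that[of "enn2real (\<integral>\<^sup>+\<xi>. norm (F \<xi>) \<partial>M) + 1"] by (simp add: add_nonneg_pos)
  qed
  let ?g' = "\<lambda>x. of_real \<sigma> * cnj (synth F x) - synth F x * (v x)\<^sup>2 - of_real \<kappa> * v x"
  let ?f' = "\<lambda>n x. of_real \<sigma> * cnj (synth F x) - synth F x * (?f n x)\<^sup>2 - of_real \<kappa> * ?f (Suc n) x"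
  \<comment> \<open>The sequence is shifted by one, since the derivative of iterate n + 1 is
    expressed through the iterates n and n + 1.\<close>
  have "\<exists>h. \<forall>x\<in>UNIV. (\<lambda>n. ?f (Suc n) x) \<longlonglongrightarrow> h x \<and> (h has_derivative (\<lambda>d. d *\<^sub>R ?g' x)) (at x)"
  proof (rule has_derivative_sequence[where f' = "\<lambda>n x d. d *\<^sub>R ?f' n x"])
    show "(\<lambda>n. ?f (Suc n) 0) \<longlonglongrightarrow> v 0"
      using lim[of 0] by (rule LIMSEQ_Suc)
    show "((\<lambda>x. ?f (Suc n) x) has_derivative (\<lambda>d. d *\<^sub>R ?f' n x)) (at x)" for n x
      using synth_pit_derivative[of n x] unfolding has_vector_derivative_def .
    fix e :: real assume e: "e > 0"
    define e1 where "e1 = e / (KF + \<kappa>)"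
    have "e1 * (KF + \<kappa>) = e"
      using KF(1) \<kappa> by (simp add: e1_def)
    then have "e1 * KF + \<kappa> * e1 = e"
      by (simp only: distrib_left mult.commute)
    moreover have "e1 > 0"
      using e KF(1) \<kappa> by (simp add: e1_def)
    ultimately have e1: "e1 > 0" "e1 * KF + \<kappa> * e1 = e"
      by blast+
    have "\<forall>\<^sub>F n in sequentially. \<forall>x. norm (?f (Suc n) x - v x) < e1"
      using ul2[OF e1(1)] by (subst eventually_sequentially_Suc)
    with ul2[OF e1(1)]
    show "\<forall>\<^sub>F n in sequentially. \<forall>x\<in>UNIV. \<forall>h. norm (h *\<^sub>R ?f' n x - h *\<^sub>R ?g' x) \<le> e * norm h"
    proof eventually_elim
      case (elim n)
      show ?case
      proof (intro ballI allI)
        fix x h :: real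
        have "norm (?f n x + v x) \<le> 1"
          using pit_sup[of n x] vb[of x] norm_triangle_ineq[of "?f n x" "v x"] by linarith
        then have a: "norm (synth F x * ((?f n x - v x) * (?f n x + v x))) \<le> KF * (e1 * 1)"
          unfolding norm_mult using elim(1) KF e1 by (intro mult_mono) (auto intro: less_imp_le)
        have c: "norm (of_real \<kappa> * (?f (Suc n) x - v x)) \<le> \<kappa> * e1"
          unfolding norm_mult using elim(2) \<kappa> e1 by (intro mult_mono) (auto intro: less_imp_le)
        have "?f' n x - ?g' x = - (synth F x * ((?f n x - v x) * (?f n x + v x))) - of_real \<kappa> * (?f (Suc n) x - v x)"
          by (simp only: power2_eq_square algebra_simps) simp
        then have "norm (?f' n x - ?g' x) \<le> KF * (e1 * 1) + \<kappa> * e1"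
          using order_trans[OF norm_triangle_ineq4 add_mono[OF _ c]] a by (metis norm_minus_cancel)
        then have "norm (?f' n x - ?g' x) \<le> e"
          using e1 by (simp add: mult.commute)
        then have "\<bar>h\<bar> * norm (?f' n x - ?g' x) \<le> \<bar>h\<bar> * e"
          by (intro mult_left_mono) auto
        then show "norm (h *\<^sub>R ?f' n x - h *\<^sub>R ?g' x) \<le> e * norm h"
          unfolding scaleR_diff_right[symmetric] norm_scaleR by (simp only: mult.commute real_norm_def)
      qed
    qed
  qed auto
  then obtain h where h: "\<And>x. (\<lambda>n. ?f (Suc n) x) \<longlonglongrightarrow> h x" "\<And>x. (h has_derivative (\<lambda>d. d *\<^sub>R ?g' x)) (at x)"
    by blast
  have "h = v"
    using LIMSEQ_unique[OF h(1) LIMSEQ_Suc[OF lim]] by auto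
  have "(v has_vector_derivative (of_real \<sigma> * cnj (synth F x) - of_real \<kappa> * v x - synth F x * (v x)\<^sup>2)) (at x)" for x
  proof -
    have eq: "?g' x = of_real \<sigma> * cnj (synth F x) - of_real \<kappa> * v x - synth F x * (v x)\<^sup>2"
      by (simp add: algebra_simps)
    show ?thesis
      using h(2)[of x] unfolding \<open>h = v\<close> has_vector_derivative_def eq .
  qed
  then show ?thesis
    using that vb lim by blast
qed

end

end

text \<open>Bessel's inequality holds for every integrable f and is enough for the error term. The
  equality, which on the line is available for a smaller class, enters only for the linear part and
  belongs to \<open>geom\<close>.\<close>

locale static = picard M \<iota> \<kappa> s gC for M :: "'g::ab_group_add measure" and \<iota> \<kappa> s gC +
  fixes X :: "real measure" and L :: real
  assumes sets_X': "sets X = sets borel"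
    and bessel: "\<And>f. integrable M f \<Longrightarrow>
      (\<integral>\<^sup>+x. ennreal ((norm (synth f x))\<^sup>2) \<partial>X) \<le> ennreal (2 * pi) * (\<integral>\<^sup>+\<xi>. ennreal ((norm (f \<xi>))\<^sup>2) \<partial>M)"
    and cis_L: "\<And>\<xi>. cis (L * \<iota> \<xi>) = 1"
begin

lemma synth_periodic: "synth f (x + L) = synth f x"
  unfolding synth_def by (simp add: distrib_right cis_mult[symmetric] cis_L)

text \<open>The L^2 distance to the linear part passes from the iterates to v by Fatou's lemma:
  Bessel's inequality turns \<open>Z_pit_first\<close> into a bound uniform in j, and 65536 pi = 2
  pi * 32768. Periodicity passes to the pointwise limit.\<close>

lemma static_solution:
  assumes F: "bdd F" and \<sigma>: "\<sigma> = 1 \<or> \<sigma> = -1" and b: "b \<ge> 0" "256 * gC * b \<le> 1" "Bn F \<le> ennreal b"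
  obtains v where
    "\<And>x. (v has_vector_derivative (of_real \<sigma> * cnj (synth F x) - of_real \<kappa> * v x - synth F x * (v x)\<^sup>2)) (at x)"
    "\<And>x. norm (v x) \<le> 1 / 2" "\<And>x. v (x + L) = v x"
    "ennreal \<kappa> * (\<integral>\<^sup>+x. ennreal ((norm (v x - synth (\<lambda>\<xi>. mul \<xi> * crefl \<sigma> F \<xi>) x))\<^sup>2) \<partial>X) \<le> ennreal (65536 * pi * gC\<^sup>2 * b ^ 3)"
proof -
  obtain v where v: "\<And>x. (v has_vector_derivative (of_real \<sigma> * cnj (synth F x) - of_real \<kappa> * v x - synth F x * (v x)\<^sup>2)) (at x)"
    "\<And>x. norm (v x) \<le> 1 / 2" "\<And>x. (\<lambda>j. synth (pit \<sigma> F j) x) \<longlonglongrightarrow> v x"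
    using picard_limit[OF F \<sigma> b] by blast
  have i: "integrable M (pit \<sigma> F j)" for j
    using bdd_pit[OF F] bddD(1) by blast
  have per: "v (x + L) = v x" for x
    using LIMSEQ_unique[OF v(3)[of "x + L", unfolded synth_periodic] v(3)[of x]] .
  let ?u = "\<lambda>j x. ennreal ((norm (synth (pit \<sigma> F j) x - synth (pit \<sigma> F 0) x))\<^sup>2)"
  have meas: "?u j \<in> borel_measurable X" for j
  proof -
    have "(\<lambda>x. synth (pit \<sigma> F j) x - synth (pit \<sigma> F 0) x) \<in> borel_measurable borel"
      by (intro borel_measurable_continuous_onI continuous_intros synth_continuous i)
    then have [measurable]: "(\<lambda>x. synth (pit \<sigma> F j) x - synth (pit \<sigma> F 0) x) \<in> borel_measurable X"
      using measurable_cong_sets[OF sets_X' refl] by blast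
    show ?thesis by measurable
  qed
  have lim: "(\<lambda>j. ?u j x) \<longlonglongrightarrow> ennreal ((norm (v x - synth (pit \<sigma> F 0) x))\<^sup>2)" for x
    by (intro tendsto_ennrealI tendsto_intros v(3))
  have bound: "ennreal \<kappa> * (\<integral>\<^sup>+x. ?u j x \<partial>X) \<le> ennreal (65536 * pi * gC\<^sup>2 * b ^ 3)" for j
  proof -
    let ?d = "\<lambda>\<xi>. pit \<sigma> F j \<xi> - pit \<sigma> F 0 \<xi>"
    have "ennreal \<kappa> * (\<integral>\<^sup>+x. ?u j x \<partial>X) = ennreal \<kappa> * (\<integral>\<^sup>+x. ennreal ((norm (synth ?d x))\<^sup>2) \<partial>X)"
      by (simp only: synth_diff[OF i i])
    also have "\<dots> \<le> ennreal \<kappa> * (ennreal (2 * pi) * (\<integral>\<^sup>+\<xi>. ennreal ((norm (?d \<xi>))\<^sup>2) \<partial>M))"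
      by (intro mult_left_mono bessel Bochner_Integration.integrable_diff i) simp
    also have "\<dots> = ennreal (2 * pi) * (ennreal \<kappa> * (\<integral>\<^sup>+\<xi>. ennreal ((norm (?d \<xi>))\<^sup>2) \<partial>M))"
      by (simp only: mult_ac)
    also have "\<dots> \<le> ennreal (2 * pi) * ennreal (32768 * gC\<^sup>2 * b ^ 3)"
      by (intro mult_left_mono order_trans[OF L2_le_Z Z_pit_first[OF F \<sigma> b]]) simp
    also have "\<dots> = ennreal (65536 * pi * gC\<^sup>2 * b ^ 3)"
      using b by (simp add: ennreal_mult[symmetric] mult_ac)
    finally show ?thesis .
  qed
  have "(\<integral>\<^sup>+x. ennreal ((norm (v x - synth (pit \<sigma> F 0) x))\<^sup>2) \<partial>X) = (\<integral>\<^sup>+x. liminf (\<lambda>j. ?u j x) \<partial>X)"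
    using lim_imp_Liminf[OF trivial_limit_sequentially lim] by simp
  also have "\<dots> \<le> liminf (\<lambda>j. \<integral>\<^sup>+x. ?u j x \<partial>X)"
    by (rule nn_integral_liminf) (rule meas)
  also have "\<dots> \<le> ennreal (65536 * pi * gC\<^sup>2 * b ^ 3 / \<kappa>)"
  proof -
    have "(\<integral>\<^sup>+x. ?u j x \<partial>X) \<le> ennreal (65536 * pi * gC\<^sup>2 * b ^ 3 / \<kappa>)" for j
    proof -
      have "ennreal (1 / \<kappa>) * ennreal \<kappa> = 1"
        using \<kappa> by (simp add: ennreal_mult[symmetric])
      then have "(\<integral>\<^sup>+x. ?u j x \<partial>X) = ennreal (1 / \<kappa>) * (ennreal \<kappa> * (\<integral>\<^sup>+x. ?u j x \<partial>X))"
        by (simp add: mult.assoc[symmetric])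
      also have "\<dots> \<le> ennreal (1 / \<kappa>) * ennreal (65536 * pi * gC\<^sup>2 * b ^ 3)"
        by (intro mult_left_mono bound) simp
      also have "\<dots> = ennreal (65536 * pi * gC\<^sup>2 * b ^ 3 / \<kappa>)"
        using \<kappa> b by (simp add: ennreal_mult[symmetric])
      finally show ?thesis .
    qed
    then have "liminf (\<lambda>j. \<integral>\<^sup>+x. ?u j x \<partial>X) \<le> liminf (\<lambda>j::nat. ennreal (65536 * pi * gC\<^sup>2 * b ^ 3 / \<kappa>))"
      by (intro Liminf_mono always_eventually allI)
    then show ?thesis
      by (simp add: Liminf_const)
  qed
  finally have "ennreal \<kappa> * (\<integral>\<^sup>+x. ennreal ((norm (v x - synth (pit \<sigma> F 0) x))\<^sup>2) \<partial>X) \<le> ennreal \<kappa> * ennreal (65536 * pi * gC\<^sup>2 * b ^ 3 / \<kappa>)"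
    by (intro mult_left_mono) auto
  also have "\<dots> = ennreal (65536 * pi * gC\<^sup>2 * b ^ 3)"
    using \<kappa> b by (simp add: ennreal_mult[symmetric])
  finally have "ennreal \<kappa> * (\<integral>\<^sup>+x. ennreal ((norm (v x - synth (pit \<sigma> F 0) x))\<^sup>2) \<partial>X) \<le> ennreal (65536 * pi * gC\<^sup>2 * b ^ 3)" .
  then show ?thesis
    using that[OF v(1,2) per] by simp
qed

end

subsection \<open>Sums of bracket weights\<close>

text \<open>Convexity: the graph of y^P lies above its tangent at l. It is obtained as Young's
  inequality for the product of y / l and 1.\<close>

lemma powr_tangent:
  fixes y l P :: real
  assumes "P \<ge> 1" "y \<ge> 0" "l > 0"
  shows "y * l powr (P - 1) \<le> y powr P / P + (1 - 1 / P) * l powr P"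
proof (cases "P = 1")
  case True
  then show ?thesis using assms by simp
next
  case False
  then have P: "P > 1" using assms by simp
  define q where "q = P / (P - 1)"
  have q: "q > 1" "1 / P + 1 / q = 1"
    using P by (auto simp: q_def field_simps)
  have "(y / l) * 1 \<le> (y / l) powr P / P + 1 powr q / q"
    using assms by (intro Youngs_inequality P q) auto
  also have "1 powr q / q = 1 - 1 / P"
    using q by simp
  finally have "(y / l) * l powr P \<le> ((y / l) powr P / P + (1 - 1 / P)) * l powr P"
    using assms by (intro mult_right_mono) auto
  moreover have "(y / l) * l powr P = y * l powr (P - 1)"
    using assms by (simp add: powr_diff)
  moreover have "(y / l) powr P * l powr P = y powr P"
    using assms by (simp add: powr_divide)
  ultimately show ?thesis
    by (simp add: distrib_right)
qed

text \<open>Jensen's inequality for a weight of mass at most C0, got by integrating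
  \<open>powr_tangent\<close> at the mean l = b / C0. Extended nonnegative integrals allow an
  infinite right-hand side, and b need only be a lower bound of the integral, which suits chains of
  estimates.\<close>

lemma jensen_nn:
  fixes w y :: "'a \<Rightarrow> real"
  assumes [measurable]: "w \<in> borel_measurable M" "y \<in> borel_measurable M"
    and w: "\<And>x. w x \<ge> 0" and y: "\<And>x. y x \<ge> 0" and P: "P \<ge> 1" and C0: "C0 > 0" and b: "b \<ge> 0"
    and tot: "(\<integral>\<^sup>+x. ennreal (w x) \<partial>M) \<le> ennreal C0"
    and le: "ennreal b \<le> (\<integral>\<^sup>+x. ennreal (w x * y x) \<partial>M)"
  shows "ennreal (b powr P) \<le> ennreal (C0 powr (P - 1)) * (\<integral>\<^sup>+x. ennreal (w x * y x powr P) \<partial>M)"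
proof (cases "b = 0")
  case True
  then show ?thesis by simp
next
  case False
  then have b: "b > 0" using b by simp
  define l where "l = b / C0"
  have l: "l > 0" using b C0 by (simp add: l_def)
  let ?S = "\<integral>\<^sup>+x. ennreal (w x * y x powr P) \<partial>M"
  have "ennreal (b * l powr (P - 1)) \<le> (\<integral>\<^sup>+x. ennreal (w x * y x) \<partial>M) * ennreal (l powr (P - 1))"
    using le b by (simp add: ennreal_mult mult_right_mono)
  also have "\<dots> = (\<integral>\<^sup>+x. ennreal (w x * (y x * l powr (P - 1))) \<partial>M)"
    using w y by (subst nn_integral_multc[symmetric]) (auto simp: ennreal_mult[symmetric] mult.assoc)
  also have "\<dots> \<le> (\<integral>\<^sup>+x. ennreal (1 / P) * ennreal (w x * y x powr P) + ennreal ((1 - 1 / P) * l powr P) * ennreal (w x) \<partial>M)"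
  proof (rule nn_integral_mono)
    fix x
    have "w x * (y x * l powr (P - 1)) \<le> w x * (y x powr P / P + (1 - 1 / P) * l powr P)"
      using powr_tangent[OF P y l] w by (intro mult_left_mono)
    also have "\<dots> = 1 / P * (w x * y x powr P) + (1 - 1 / P) * l powr P * w x"
      by (simp add: algebra_simps)
    finally have "ennreal (w x * (y x * l powr (P - 1))) \<le> ennreal (1 / P * (w x * y x powr P) + (1 - 1 / P) * l powr P * w x)"
      by (rule ennreal_leI)
    also have "\<dots> = ennreal (1 / P * (w x * y x powr P)) + ennreal ((1 - 1 / P) * l powr P * w x)"
      using w[of x] P by (intro ennreal_plus) auto
    also have "\<dots> = ennreal (1 / P) * ennreal (w x * y x powr P) + ennreal ((1 - 1 / P) * l powr P) * ennreal (w x)"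
      using w[of x] P by (intro arg_cong2[where f = "(+)"] ennreal_mult) auto
    finally show "ennreal (w x * (y x * l powr (P - 1))) \<le> ennreal (1 / P) * ennreal (w x * y x powr P) + ennreal ((1 - 1 / P) * l powr P) * ennreal (w x)" .
  qed
  also have "\<dots> = ennreal (1 / P) * ?S + ennreal ((1 - 1 / P) * l powr P) * (\<integral>\<^sup>+x. ennreal (w x) \<partial>M)"
    by (subst nn_integral_add) (simp_all add: nn_integral_cmult)
  also have "\<dots> \<le> ennreal (1 / P) * ?S + ennreal ((1 - 1 / P) * l powr P) * ennreal C0"
    by (intro add_left_mono mult_left_mono tot) simp
  finally have main: "ennreal (b * l powr (P - 1)) \<le> ennreal (1 / P) * ?S + ennreal ((1 - 1 / P) * l powr P) * ennreal C0" .
  show ?thesis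
  proof (cases ?S)
    case top
    then show ?thesis
      using C0 by (simp add: ennreal_mult_top)
  next
    case (real S)
    have "ennreal (b * l powr (P - 1)) \<le> ennreal (1 / P * S + (1 - 1 / P) * l powr P * C0)"
      using main real P C0 by (simp add: ennreal_mult[symmetric] ennreal_plus[symmetric] del: ennreal_plus)
    then have "b * l powr (P - 1) \<le> 1 / P * S + (1 - 1 / P) * l powr P * C0"
      using real P C0 by (subst (asm) ennreal_le_iff) auto
    moreover have "l powr P * C0 = b * l powr (P - 1)"
    proof -
      have "l powr P = l powr (P - 1) * l"
        using l by (simp add: powr_diff)
      moreover have "l * C0 = b"
        using C0 by (simp add: l_def)
      ultimately show ?thesis
        by (metis mult.assoc mult.commute)
    qed
    ultimately have "b * l powr (P - 1) \<le> 1 / P * S + (1 - 1 / P) * (b * l powr (P - 1))"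
      by (simp add: mult.assoc)
    then have "1 / P * (b * l powr (P - 1)) \<le> 1 / P * S"
      by (simp add: algebra_simps)
    then have "b * l powr (P - 1) \<le> S"
      using P by (simp add: divide_le_cancel)
    then have "C0 powr (P - 1) * (b * l powr (P - 1)) \<le> C0 powr (P - 1) * S"
      by (intro mult_left_mono) auto
    moreover have "C0 powr (P - 1) * (b * l powr (P - 1)) = b powr P"
    proof -
      have "C0 powr (P - 1) * l powr (P - 1) = b powr (P - 1)"
        using l C0 by (simp add: powr_mult[symmetric] l_def)
      moreover have "b powr (P - 1) * b = b powr P"
        using b by (simp add: powr_diff)
      ultimately show ?thesis
        by (metis mult.assoc mult.commute)
    qed
    ultimately have "ennreal (b powr P) \<le> ennreal (C0 powr (P - 1) * S)"
      by (simp add: ennreal_leI)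
    then show ?thesis
      using real by (simp add: ennreal_mult)
  qed
qed

lemma nn_integral_bracket:
  fixes s :: real
  assumes s: "s > 1"
  shows "(\<integral>\<^sup>+y. ennreal ((1 + \<bar>y\<bar>) powr - s) \<partial>lborel) \<le> ennreal (2 / (s - 1))"
proof -
  let ?f = "\<lambda>y::real. (1 + \<bar>y\<bar>) powr - s"
  have half: "(\<integral>\<^sup>+y. ennreal (?f y) * indicator {0..} y \<partial>lborel) = ennreal (1 / (s - 1))"
  proof -
    have "(\<integral>\<^sup>+y. ennreal (?f y) * indicator {0..} y \<partial>lborel) = ennreal (0 - (- ((1 + 0) powr (1 - s) / (s - 1))))"
    proof (rule nn_integral_FTC_atLeast[where F = "\<lambda>y. - ((1 + y) powr (1 - s) / (s - 1))"])
      show "?f \<in> borel_measurable borel" by measurable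
      fix y :: real assume y: "0 \<le> y"
      have "((\<lambda>y. (1 + y) powr (1 - s)) has_real_derivative ((1 - s) * (1 + y) powr (1 - s - 1))) (at y)"
        using y by (auto intro!: derivative_eq_intros)
      then have "((\<lambda>y. - ((1 + y) powr (1 - s) / (s - 1))) has_real_derivative - (((1 - s) * (1 + y) powr (1 - s - 1)) / (s - 1))) (at y)"
        by (intro DERIV_minus DERIV_cdivide)
      moreover have "- (((1 - s) * (1 + y) powr (1 - s - 1)) / (s - 1)) = ?f y"
        using y s by (simp add: field_simps)
      ultimately show "((\<lambda>y. - ((1 + y) powr (1 - s) / (s - 1))) has_real_derivative ?f y) (at y)"
        by simp
    next
      have "((\<lambda>y. (1 + y) powr (1 - s)) \<longlongrightarrow> 0) at_top"
        using s by real_asymp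
      from tendsto_minus[OF tendsto_divide[OF this tendsto_const, of "s - 1"]]
      show "((\<lambda>y. - ((1 + y) powr (1 - s) / (s - 1))) \<longlongrightarrow> 0) at_top"
        using s by simp
    qed simp
    then show ?thesis by simp
  qed
  have half': "(\<integral>\<^sup>+y. ennreal (?f y) * indicator {..0} y \<partial>lborel) = ennreal (1 / (s - 1))"
  proof -
    have "(\<integral>\<^sup>+y. ennreal (?f y) * indicator {..0} y \<partial>lborel) = (\<integral>\<^sup>+y. ennreal (?f (- y)) * indicator {..0} (- y) \<partial>lborel)"
      using nn_integral_real_affine[of "\<lambda>y. ennreal (?f y) * indicator {..0} y" "-1" 0] by simp
    also have "\<dots> = (\<integral>\<^sup>+y. ennreal (?f y) * indicator {0..} y \<partial>lborel)"
      by (intro nn_integral_cong) (auto simp: indicator_def)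
    finally show ?thesis using half by simp
  qed
  have "(\<integral>\<^sup>+y. ennreal (?f y) \<partial>lborel) \<le> (\<integral>\<^sup>+y. ennreal (?f y) * indicator {..0} y + ennreal (?f y) * indicator {0..} y \<partial>lborel)"
    by (intro nn_integral_mono) (auto simp: indicator_def)
  also have "\<dots> = ennreal (1 / (s - 1)) + ennreal (1 / (s - 1))"
    using half half' by (subst nn_integral_add) auto
  also have "\<dots> = ennreal (2 / (s - 1))"
    using s by (subst ennreal_plus[symmetric]) auto
  finally show ?thesis .
qed

lemma nn_integral_bracket_scaled:
  fixes s \<kappa> x :: real
  assumes s: "s > 1" and \<kappa>: "\<kappa> > 0"
  shows "(\<integral>\<^sup>+y. ennreal ((1 + \<bar>y - x\<bar> / \<kappa>) powr - s) \<partial>lborel) \<le> ennreal (\<kappa> * (2 / (s - 1)))"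
proof -
  have "(\<integral>\<^sup>+y. ennreal ((1 + \<bar>y - x\<bar> / \<kappa>) powr - s) \<partial>lborel)
      = ennreal \<kappa> * (\<integral>\<^sup>+y. ennreal ((1 + \<bar>y\<bar>) powr - s) \<partial>lborel)"
    using nn_integral_real_affine[of "\<lambda>y. ennreal ((1 + \<bar>y - x\<bar> / \<kappa>) powr - s)" \<kappa> x] \<kappa>
    by (simp add: abs_mult)
  also have "\<dots> \<le> ennreal \<kappa> * ennreal (2 / (s - 1))"
    by (intro mult_left_mono nn_integral_bracket s) simp
  also have "\<dots> = ennreal (\<kappa> * (2 / (s - 1)))"
    using s \<kappa> by (intro ennreal_mult[symmetric]) auto
  finally show ?thesis .
qed

text \<open>2 / (s - 1) is the integral of the bracket power over the line; 2^s is the price of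
  replacing an integer by a point of its unit cell.\<close>

definition gz :: "real \<Rightarrow> real" where "gz s = 2 powr s * (2 / (s - 1))"

lemma gz_pos: "s > 1 \<Longrightarrow> gz s > 0"
  by (simp add: gz_def)

lemma nn_integral_floor_partition:
  fixes f :: "'a \<Rightarrow> ennreal" and \<iota> :: "'a \<Rightarrow> real"
  assumes [measurable]: "f \<in> borel_measurable M" "\<iota> \<in> borel_measurable M" and "sigma_finite_measure M"
  shows "(\<integral>\<^sup>+\<xi>. f \<xi> \<partial>M) = (\<integral>\<^sup>+m. (\<integral>\<^sup>+\<xi>. f \<xi> * indicator {\<xi>. \<lfloor>\<iota> \<xi>\<rfloor> = m} \<xi> \<partial>M) \<partial>count_space (UNIV :: int set))"
proof -
  interpret pair_sigma_finite M "count_space (UNIV :: int set)"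
    using assms(3) by (simp add: pair_sigma_finite_def sigma_finite_measure_count_space)
  have [measurable]: "(\<lambda>x. \<lfloor>\<iota> x\<rfloor>) \<in> M \<rightarrow>\<^sub>M count_space UNIV"
    by (rule measurable_compose[OF assms(2) measurable_real_floor])
  have "(\<integral>\<^sup>+\<xi>. f \<xi> \<partial>M) = (\<integral>\<^sup>+\<xi>. (\<integral>\<^sup>+m. f \<xi> * indicator {\<lfloor>\<iota> \<xi>\<rfloor>} m \<partial>count_space UNIV) \<partial>M)"
    by (simp add: nn_integral_cmult nn_integral_indicator)
  also have "\<dots> = (\<integral>\<^sup>+\<xi>. (\<integral>\<^sup>+m. f \<xi> * indicator {\<xi>. \<lfloor>\<iota> \<xi>\<rfloor> = m} \<xi> \<partial>count_space UNIV) \<partial>M)"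
    by (intro nn_integral_cong) (auto simp: indicator_def)
  also have "\<dots> = (\<integral>\<^sup>+m. (\<integral>\<^sup>+\<xi>. f \<xi> * indicator {\<xi>. \<lfloor>\<iota> \<xi>\<rfloor> = m} \<xi> \<partial>M) \<partial>count_space UNIV)"
  proof (rule Fubini'[symmetric])
    have "(\<lambda>(x, y). f x * (if \<lfloor>\<iota> x\<rfloor> = y then 1 else 0)) \<in> borel_measurable (M \<Otimes>\<^sub>M count_space (UNIV :: int set))"
      by measurable
    then show "(\<lambda>(x, y). f x * indicator {\<xi>. \<lfloor>\<iota> \<xi>\<rfloor> = y} x) \<in> borel_measurable (M \<Otimes>\<^sub>M count_space (UNIV :: int set))"
      by (simp add: indicator_def of_bool_def)
  qed
  finally show ?thesis .
qed

lemma floor_abs_le: "\<bar>real_of_int \<lfloor>t\<rfloor> - x\<bar> \<le> \<bar>t - x\<bar> + 1" and abs_le_floor: "\<bar>t - x\<bar> \<le> \<bar>real_of_int \<lfloor>t\<rfloor> - x\<bar> + 1"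
  by linarith+

lemma bracket_double:
  fixes \<kappa> a b :: real
  assumes "\<kappa> \<ge> 1" "\<bar>a\<bar> \<le> \<bar>b\<bar> + 1"
  shows "1 + \<bar>a\<bar> / \<kappa> \<le> 2 * (1 + \<bar>b\<bar> / \<kappa>)"
proof -
  have "\<bar>a\<bar> / \<kappa> \<le> (\<bar>b\<bar> + 1) / \<kappa>"
    using assms by (intro divide_right_mono) auto
  also have "\<dots> = \<bar>b\<bar> / \<kappa> + 1 / \<kappa>"
    by (simp add: add_divide_distrib)
  also have "1 / \<kappa> \<le> 1"
    using assms by simp
  finally have "1 + \<bar>a\<bar> / \<kappa> \<le> 2 + \<bar>b\<bar> / \<kappa>" by simp
  also have "\<dots> \<le> 2 * (1 + \<bar>b\<bar> / \<kappa>)"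
  proof -
    have le: "2 + c \<le> 2 * (1 + c)" if "0 \<le> c" for c :: real
      using that by simp
    show ?thesis using assms by (intro le) simp
  qed
  finally show ?thesis .
qed

lemma bracket_powr_double:
  fixes \<kappa> a b s :: real
  assumes "\<kappa> \<ge> 1" "\<bar>a\<bar> \<le> \<bar>b\<bar> + 1" "s \<ge> 0"
  shows "(1 + \<bar>b\<bar> / \<kappa>) powr - s \<le> 2 powr s * (1 + \<bar>a\<bar> / \<kappa>) powr - s"
proof -
  have p: "1 + \<bar>a\<bar> / \<kappa> > 0" "1 + \<bar>b\<bar> / \<kappa> > 0"
    using assms by (auto intro: add_pos_nonneg)
  have "(2 * (1 + \<bar>b\<bar> / \<kappa>)) powr - s \<le> (1 + \<bar>a\<bar> / \<kappa>) powr - s"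
    using p assms by (intro powr_mono2' bracket_double) auto
  then have "2 powr s * (2 * (1 + \<bar>b\<bar> / \<kappa>)) powr - s \<le> 2 powr s * (1 + \<bar>a\<bar> / \<kappa>) powr - s"
    by (intro mult_left_mono) auto
  moreover have "2 powr s * (2 * (1 + \<bar>b\<bar> / \<kappa>)) powr - s = (1 + \<bar>b\<bar> / \<kappa>) powr - s"
  proof -
    have le: "2 powr s * (2 * c) powr - s = c powr - s" if "0 < c" for c :: real
      using that by (simp add: powr_mult powr_minus)
    show ?thesis using p by (intro le)
  qed
  ultimately show ?thesis by (simp only:)
qed

lemma sum_bracket:
  fixes s \<kappa> x :: real
  assumes s: "s > 1" and \<kappa>: "\<kappa> \<ge> 1"
  shows "(\<integral>\<^sup>+m. ennreal ((1 + \<bar>real_of_int m - x\<bar> / \<kappa>) powr - s) \<partial>count_space (UNIV :: int set)) \<le> ennreal (\<kappa> * gz s)"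
proof -
  have "(\<integral>\<^sup>+m. ennreal ((1 + \<bar>real_of_int m - x\<bar> / \<kappa>) powr - s) \<partial>count_space (UNIV :: int set))
    \<le> (\<integral>\<^sup>+m. (\<integral>\<^sup>+y. ennreal (2 powr s * (1 + \<bar>y - x\<bar> / \<kappa>) powr - s) * indicator {y::real. \<lfloor>y\<rfloor> = m} y \<partial>lborel) \<partial>count_space UNIV)"
  proof (rule nn_integral_mono)
    fix m :: int
    have eq: "{y. \<lfloor>y\<rfloor> = m} = {real_of_int m ..< real_of_int m + 1}"
      by (auto simp: floor_eq_iff)
    have ES: "emeasure lborel {y::real. \<lfloor>y\<rfloor> = m} = 1" "{y::real. \<lfloor>y\<rfloor> = m} \<in> sets borel"
      unfolding eq by simp_all
    then have "ennreal ((1 + \<bar>real_of_int m - x\<bar> / \<kappa>) powr - s)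
      = (\<integral>\<^sup>+y. ennreal ((1 + \<bar>real_of_int m - x\<bar> / \<kappa>) powr - s) * indicator {y::real. \<lfloor>y\<rfloor> = m} y \<partial>lborel)"
      by (subst nn_integral_cmult_indicator) (use ES in simp_all)
    also have "\<dots> \<le> (\<integral>\<^sup>+y. ennreal (2 powr s * (1 + \<bar>y - x\<bar> / \<kappa>) powr - s) * indicator {y::real. \<lfloor>y\<rfloor> = m} y \<partial>lborel)"
      using s \<kappa> abs_le_floor[of _ x]
      by (intro nn_integral_mono) (auto simp: indicator_def intro!: ennreal_leI bracket_powr_double)
    finally show "ennreal ((1 + \<bar>real_of_int m - x\<bar> / \<kappa>) powr - s) \<le> \<dots>" .
  qed
  also have "\<dots> = (\<integral>\<^sup>+y. ennreal (2 powr s * (1 + \<bar>y - x\<bar> / \<kappa>) powr - s) \<partial>lborel)"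
    by (rule nn_integral_floor_partition[symmetric]) (auto simp: sigma_finite_lborel)
  also have "\<dots> = ennreal (2 powr s) * (\<integral>\<^sup>+y. ennreal ((1 + \<bar>y - x\<bar> / \<kappa>) powr - s) \<partial>lborel)"
    by (simp add: ennreal_mult nn_integral_cmult)
  also have "\<dots> \<le> ennreal (2 powr s) * ennreal (\<kappa> * (2 / (s - 1)))"
    using \<kappa> by (intro mult_left_mono nn_integral_bracket_scaled s) auto
  also have "\<dots> = ennreal (\<kappa> * gz s)"
    using s \<kappa> by (simp add: gz_def ennreal_mult[symmetric] mult_ac)
  finally show ?thesis .
qed

text \<open>An interval of length 2 \<kappa> contains at least 2 \<kappa> - 1 integers, and 2
  \<kappa> - 1 >= \<kappa> as \<kappa> >= 1.\<close>

lemma sum_near_ge: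
  fixes t \<kappa> c :: real and f :: "int \<Rightarrow> ennreal"
  assumes \<kappa>: "\<kappa> \<ge> 1" and c: "c \<ge> 0" and f: "\<And>m. \<bar>t - real_of_int m\<bar> \<le> \<kappa> \<Longrightarrow> ennreal c \<le> f m"
  shows "ennreal (\<kappa> * c) \<le> (\<integral>\<^sup>+m. f m \<partial>count_space UNIV)"
proof -
  let ?S = "{\<lceil>t - \<kappa>\<rceil>..\<lfloor>t + \<kappa>\<rfloor>}"
  have "\<kappa> \<le> real_of_int (\<lfloor>t + \<kappa>\<rfloor> - \<lceil>t - \<kappa>\<rceil> + 1)"
    using \<kappa> by linarith
  also have "\<dots> \<le> real (card ?S)"
    by simp
  finally have "ennreal (\<kappa> * c) \<le> ennreal (real (card ?S) * c)"
    using c by (intro ennreal_leI mult_right_mono)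
  also have "\<dots> = (\<integral>\<^sup>+m. ennreal c * indicator ?S m \<partial>count_space UNIV)"
    using c by (simp add: nn_integral_cmult_indicator ennreal_mult ennreal_of_nat_eq_real_of_nat mult.commute del: card_atLeastAtMost_int)
  also have "\<dots> \<le> (\<integral>\<^sup>+m. f m \<partial>count_space UNIV)"
    by (intro nn_integral_mono) (auto simp: indicator_def ceiling_le_iff le_floor_iff intro!: f)
  finally show ?thesis .
qed

text \<open>The embedding of l^1 into l^P: every y is at most S, hence y^P <= S^(P - 1) y.\<close>

lemma powr_superadditive:
  fixes y :: "'a \<Rightarrow> real"
  assumes y: "\<And>x. y x \<ge> 0" and P: "P \<ge> 1" and S: "S \<ge> 0" and M: "countable (UNIV :: 'a set)"
    and le: "(\<integral>\<^sup>+x. ennreal (y x) \<partial>count_space UNIV) \<le> ennreal S"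
  shows "(\<integral>\<^sup>+x. ennreal (y x powr P) \<partial>count_space UNIV) \<le> ennreal (S powr P)"
proof -
  have yS: "y x \<le> S" for x
  proof -
    have "ennreal (y x) = (\<integral>\<^sup>+z. ennreal (y z) * indicator {x} z \<partial>count_space UNIV)"
      by (simp add: nn_integral_indicator_singleton)
    also have "\<dots> \<le> (\<integral>\<^sup>+z. ennreal (y z) \<partial>count_space UNIV)"
      by (intro nn_integral_mono) (auto simp: indicator_def)
    finally have "ennreal (y x) \<le> ennreal S"
      using le by simp
    then show ?thesis using S by simp
  qed
  have "(\<integral>\<^sup>+x. ennreal (y x powr P) \<partial>count_space UNIV) \<le> (\<integral>\<^sup>+x. ennreal (S powr (P - 1)) * ennreal (y x) \<partial>count_space UNIV)"
  proof (rule nn_integral_mono)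
    fix x
    have "y x powr P = y x powr (P - 1) * y x"
      using y[of x] by (cases "y x = 0") (auto simp: powr_diff)
    also have "\<dots> \<le> S powr (P - 1) * y x"
      using y[of x] yS[of x] P by (intro mult_right_mono powr_mono2) auto
    finally show "ennreal (y x powr P) \<le> ennreal (S powr (P - 1)) * ennreal (y x)"
      using y[of x] by (simp add: ennreal_mult[symmetric] ennreal_leI)
  qed
  also have "\<dots> \<le> ennreal (S powr (P - 1)) * ennreal S"
    by (subst nn_integral_cmult) (auto intro!: mult_left_mono le)
  also have "\<dots> = ennreal (S powr P)"
    using S by (cases "S = 0") (auto simp: ennreal_mult[symmetric] powr_diff)
  finally show ?thesis .
qed

lemma powr_sum_le:
  fixes x y P :: real
  assumes "x \<ge> 0" "y \<ge> 0" "P \<ge> 1"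
  shows "(x + y) powr P \<le> 2 powr P * (x powr P + y powr P)"
proof -
  have "(x + y) powr P \<le> (2 * max x y) powr P"
    using assms by (intro powr_mono2) auto
  also have "\<dots> = 2 powr P * max x y powr P"
    using assms by (simp add: powr_mult)
  also have "\<dots> \<le> 2 powr P * (x powr P + y powr P)"
    by (intro mult_left_mono) (auto simp: max_def)
  finally show ?thesis .
qed

text \<open>The continuity argument runs along r -> r t, which serves positive and negative times at
  once. At the first r0 where the level l, with q < l <= \<eta>, is reached, f is still at most
  \<eta> on the whole time interval, so \<open>step\<close> gives f <= q there, a
  contradiction.\<close>

lemma bootstrap_bound:
  fixes f :: "real \<Rightarrow> real"
  assumes c: "continuous_on UNIV f" and q: "q < \<eta>" "f 0 \<le> q"
    and step: "\<And>a b. a \<le> 0 \<Longrightarrow> 0 \<le> b \<Longrightarrow> (\<And>t. t \<in> {a..b} \<Longrightarrow> f t \<le> \<eta>) \<Longrightarrow> (\<forall>t\<in>{a..b}. f t \<le> q)"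
  shows "f t \<le> q"
proof (rule ccontr)
  assume "\<not> f t \<le> q"
  then have ft: "f t > q" by simp
  define g where "g r = f (r * t)" for r
  have cg: "continuous_on UNIV g"
    unfolding g_def by (intro continuous_on_compose2[OF c] continuous_intros) auto
  \<comment> \<open>The minimum with g 1 puts r = 1 into S, so that the infimum exists and is
    attained.\<close>
  define l where "l = min (g 1) \<eta>"
  have l: "l > q" "l \<le> \<eta>" "l \<le> g 1"
    using ft q by (auto simp: l_def g_def)
  define S where "S = {r \<in> {0..1}. g r \<ge> l}"
  have "closed S"
  proof -
    have "S = {0..1} \<inter> {r. l \<le> g r}" by (auto simp: S_def)
    moreover have "closed {r. l \<le> g r}"
      by (intro closed_Collect_le cg continuous_on_const)
    ultimately show ?thesis by auto
  qed
  moreover have "1 \<in> S" "bdd_below S"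
    using l by (auto simp: S_def intro!: bdd_belowI[of _ 0])
  ultimately have r: "Inf S \<in> S"
    using closed_contains_Inf by blast
  define r0 where "r0 = Inf S"
  have r0: "0 \<le> r0" "r0 \<le> 1" "g r0 \<ge> l"
    using r by (auto simp: S_def r0_def)
  have below: "g r \<le> \<eta>" if "0 \<le> r" "r < r0" for r
  proof (rule ccontr)
    assume "\<not> g r \<le> \<eta>"
    then have "r \<in> S" using that r0 l by (auto simp: S_def)
    then have "r0 \<le> r" unfolding r0_def using \<open>bdd_below S\<close> by (rule cInf_lower)
    then show False using that by simp
  qed
  have "g 0 \<le> q" using q by (simp add: g_def)
  then have "r0 > 0"
    using r0 l by (cases "r0 = 0") auto
  have at: "g r0 \<le> \<eta>"
  proof (rule tendsto_upperbound[of g "g r0" "at_left r0"])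
    show "(g \<longlongrightarrow> g r0) (at_left r0)"
      using cg by (simp add: continuous_on_def) (meson tendsto_within_subset subset_UNIV)
    show "\<forall>\<^sub>F r in at_left r0. g r \<le> \<eta>"
      using below \<open>r0 > 0\<close> by (auto simp: eventually_at_left[OF \<open>r0 > 0\<close>] intro!: exI[of _ 0])
  qed (simp add: trivial_limit_at_left_real)
  have all: "g r \<le> \<eta>" if "0 \<le> r" "r \<le> r0" for r
    using below[of r] at that by (cases "r = r0") auto
  let ?a = "min 0 (r0 * t)" and ?b = "max 0 (r0 * t)"
  have "f r \<le> \<eta>" if r: "r \<in> {?a..?b}" for r
  proof (cases "t = 0")
    case True
    then show ?thesis using r all[of 0] r0 by (simp add: g_def)
  next
    case False
    have "0 \<le> r / t" "r / t \<le> r0"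
    proof -
      show "0 \<le> r / t"
        using r r0 False by (cases "t > 0") (auto simp: zero_le_divide_iff mult_le_0_iff min_def max_def zero_le_mult_iff split: if_splits)
      show "r / t \<le> r0"
        using r r0 False by (cases "t > 0") (auto simp: divide_le_eq mult_le_0_iff min_def max_def zero_le_mult_iff split: if_splits)
    qed
    from all[OF this] show ?thesis using False by (simp add: g_def)
  qed
  then have "\<forall>r\<in>{?a..?b}. f r \<le> q"
    by (intro step) auto
  then have "g r0 \<le> q"
    by (simp add: g_def)
  then show False
    using r0 l by simp
qed

subsection \<open>Densities at the frequency scale of the spectral parameter\<close>

lemma ennreal_mult_rearrange:
  assumes "0 \<le> f" "0 \<le> c" "0 \<le> h" "0 \<le> w"
  shows "ennreal f * ennreal (c * (h * w)) = ennreal (c * w) * ennreal (f * h)"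
  using assms by (simp add: ennreal_mult[symmetric] mult_ac)

lemma ennreal_mult_swap:
  assumes "0 \<le> a" "0 \<le> c" "0 \<le> w"
  shows "ennreal (c * w) * ennreal a = ennreal (c * a * w)"
  using assms by (simp add: ennreal_mult[symmetric] mult_ac)

text \<open>\<open>P\<close> stands for p / 2. \<open>emb\<close> places the integers in the
  frequency group, so that integer shifts are available. \<open>nice\<close> is the class in which
  the linear part satisfies Plancherel: continuity on the line, no condition on the circle; it must
  survive shifts and conjugate reflection, by which the linear part is built from F.\<close>

locale geom = freq M \<iota> for M :: "'g::ab_group_add measure" and \<iota> +
  fixes X :: "real measure" and L :: real and emb :: "int \<Rightarrow> 'g" and gc :: "real \<Rightarrow> real"
    and nice :: "('g \<Rightarrow> complex) \<Rightarrow> bool" and P :: real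
  assumes P: "P \<ge> 1"
    and emb: "\<And>n. \<iota> (emb n) = of_int n"
    and growth_gc: "\<And>\<kappa> s. \<kappa> \<ge> 1 \<Longrightarrow> s > 1 \<Longrightarrow> (\<integral>\<^sup>+\<xi>. ennreal ((1 + \<bar>\<iota> \<xi>\<bar> / \<kappa>) powr - s) \<partial>M) \<le> ennreal (\<kappa> * gc s)"
    and gc_pos: "\<And>s. s > 1 \<Longrightarrow> gc s > 0"
    and sets_XX: "sets X = sets borel"
    and bessel_X: "\<And>f. integrable M f \<Longrightarrow>
      (\<integral>\<^sup>+x. ennreal ((norm (synth f x))\<^sup>2) \<partial>X) \<le> ennreal (2 * pi) * (\<integral>\<^sup>+\<xi>. ennreal ((norm (f \<xi>))\<^sup>2) \<partial>M)"
    and plancherel_X: "\<And>f \<kappa>. bdd f \<Longrightarrow> nice f \<Longrightarrow> \<kappa> \<ge> 1 \<Longrightarrow>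
      (\<integral>\<^sup>+x. ennreal ((norm (synth (\<lambda>\<xi>. 1 / (of_real \<kappa> + \<i> * of_real (\<iota> \<xi>)) * f \<xi>) x))\<^sup>2) \<partial>X)
       = ennreal (2 * pi) * (\<integral>\<^sup>+\<xi>. ennreal ((norm (1 / (of_real \<kappa> + \<i> * of_real (\<iota> \<xi>)) * f \<xi>))\<^sup>2) \<partial>M)"
    and nice_shift: "\<And>f c. nice f \<Longrightarrow> nice (\<lambda>\<xi>. f (\<xi> - c))"
    and nice_refl: "\<And>f \<sigma>. nice f \<Longrightarrow> nice (\<lambda>\<xi>. of_real \<sigma> * cnj (f (- \<xi>)))"
    and cis_LX: "\<And>\<xi>. cis (L * \<iota> \<xi>) = 1"
begin

text \<open>With this exponent Jensen's inequality trades the bracket power \<open>2 * s0\<close> for the summable weight of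
  power \<open>1 + 1 / (4 * P)\<close> and leaves the power \<open>1 / 2\<close> on the \<open>P\<close>-th powers.\<close>

definition s0 :: real where "s0 = (1 - 1 / (4 * P)) / 2"
definition gC0 :: real where "gC0 = gc (2 * (1 - s0))"
definition K1 :: real where "K1 = 65536 * pi * gC0\<^sup>2"

lemma s0: "0 < s0" "s0 < 1 / 2" "2 * (1 - s0) > 1" "2 * s0 = 1 - 1 / (4 * P)" "2 * s0 \<le> 1" "0 < 2 * s0"
proof -
  define x where "x = 1 / (4 * P)"
  have "0 < x" "x \<le> 1 / 4"
    using P by (auto simp: x_def field_simps)
  moreover have "s0 = (1 - x) / 2"
    by (simp add: s0_def x_def)
  ultimately show "0 < s0" "s0 < 1 / 2" "2 * (1 - s0) > 1" "2 * s0 = 1 - 1 / (4 * P)" "2 * s0 \<le> 1" "0 < 2 * s0"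
    unfolding x_def[symmetric] by auto
qed

lemma gC0_pos: "gC0 > 0"
  unfolding gC0_def by (rule gc_pos[OF s0(3)])

lemma K1_pos: "K1 > 0"
  using gC0_pos by (simp add: K1_def)

lemma static_interp:
  assumes "\<kappa> \<ge> 1" shows "static M \<iota> \<kappa> s0 gC0 X L"
proof -
  have "(\<integral>\<^sup>+\<xi>. ennreal ((1 + \<bar>\<iota> \<xi>\<bar> / \<kappa>) powr (- 2 * (1 - s0))) \<partial>M) \<le> ennreal (\<kappa> * gC0)"
    using growth_gc[OF assms s0(3)] by (simp add: gC0_def)
  then show ?thesis
    by (intro static.intro picard.intro static_axioms.intro picard_axioms.intro freq_axioms assms s0 gC0_pos sets_XX bessel_X cis_LX)
qed

text \<open>By Plancherel this is \<kappa> times the squared L^2 norm of the linear part of w for k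
  = \<kappa> + i n (the step \<open>U1\<close> of \<open>riccati_exists\<close>).\<close>

definition A :: "('g \<Rightarrow> complex) \<Rightarrow> real \<Rightarrow> int \<Rightarrow> real" where
  "A F \<kappa> n = 2 * pi / \<kappa> * (LINT \<xi>|M. (norm (F \<xi>))\<^sup>2 * (1 / (1 + ((\<iota> \<xi> - of_int n) / \<kappa>)\<^sup>2)))"

text \<open>The norm \<open>Bn\<close> of the potential shifted by n: it governs both the smallness
  needed by the iteration and the cubic error.\<close>

definition Bq :: "('g \<Rightarrow> complex) \<Rightarrow> real \<Rightarrow> int \<Rightarrow> real" where
  "Bq F \<kappa> n = 1 / \<kappa> * (LINT \<xi>|M. (norm (F \<xi>))\<^sup>2 * (1 + \<bar>\<iota> \<xi> - of_int n\<bar> / \<kappa>) powr (- 2 * s0))"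

definition Nn :: "('g \<Rightarrow> complex) \<Rightarrow> real \<Rightarrow> ennreal" where
  "Nn F \<kappa> = (\<integral>\<^sup>+n. ennreal (1 / \<kappa> * A F \<kappa> n powr P) \<partial>count_space UNIV)"

lemma bdd_square:
  assumes "bdd F"
  shows "integrable M (\<lambda>\<xi>. (norm (F \<xi>))\<^sup>2)"
proof -
  have [measurable]: "F \<in> borel_measurable M" and F: "integrable M F" using assms by (auto simp: bdd_def)
  obtain K where K: "\<And>\<xi>. norm (F \<xi>) \<le> K" using assms by (auto simp: bdd_def)
  show ?thesis
    by (rule Bochner_Integration.integrable_bound[of M "\<lambda>\<xi>. K * norm (F \<xi>)"])
       (use F K in \<open>auto intro!: AE_I2 mult_right_mono simp: power2_eq_square abs_mult intro: order_trans[OF _ abs_ge_self]\<close>)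
qed

lemma bdd_square_weight:
  assumes F: "bdd F" and [measurable]: "w \<in> borel_measurable M" and w: "\<And>\<xi>. 0 \<le> w \<xi>" "\<And>\<xi>. w \<xi> \<le> 1"
  shows "integrable M (\<lambda>\<xi>. (norm (F \<xi>))\<^sup>2 * w \<xi>)"
    and "ennreal (LINT \<xi>|M. (norm (F \<xi>))\<^sup>2 * w \<xi>) = (\<integral>\<^sup>+\<xi>. ennreal ((norm (F \<xi>))\<^sup>2 * w \<xi>) \<partial>M)"
proof -
  have [measurable]: "F \<in> borel_measurable M" using F by (auto simp: bdd_def)
  show i: "integrable M (\<lambda>\<xi>. (norm (F \<xi>))\<^sup>2 * w \<xi>)"
    by (rule Bochner_Integration.integrable_bound[OF bdd_square[OF F]])
       (use w in \<open>auto intro!: AE_I2 mult_left_le\<close>)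
  show "ennreal (LINT \<xi>|M. (norm (F \<xi>))\<^sup>2 * w \<xi>) = (\<integral>\<^sup>+\<xi>. ennreal ((norm (F \<xi>))\<^sup>2 * w \<xi>) \<partial>M)"
    using w by (intro nn_integral_eq_integral[symmetric] i) auto
qed

lemma bracket_le1:
  fixes \<kappa> e x :: real
  shows "\<kappa> > 0 \<Longrightarrow> e \<ge> 0 \<Longrightarrow> (1 + \<bar>x\<bar> / \<kappa>) powr - e \<le> 1"
proof -
  assume "\<kappa> > 0" "e \<ge> 0"
  then have "(1 + \<bar>x\<bar> / \<kappa>) powr - e \<le> (1 + \<bar>x\<bar> / \<kappa>) powr 0"
    by (intro powr_mono) auto
  then show ?thesis using \<open>\<kappa> > 0\<close> by (simp split: if_splits)
qed

lemma lorentz_le1: "1 / (1 + (x::real)\<^sup>2) \<le> 1"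
  by (simp add: divide_le_eq add_pos_nonneg)

lemma A_nonneg: "\<kappa> > 0 \<Longrightarrow> A F \<kappa> n \<ge> 0"
  unfolding A_def by (intro mult_nonneg_nonneg integral_nonneg_AE) (auto intro!: AE_I2)

lemma Bq_nonneg: "\<kappa> > 0 \<Longrightarrow> Bq F \<kappa> n \<ge> 0"
  unfolding Bq_def by (intro mult_nonneg_nonneg integral_nonneg_AE) (auto intro!: AE_I2)

lemma A_nn:
  assumes "bdd F" "\<kappa> > 0"
  shows "ennreal (A F \<kappa> n) = ennreal (2 * pi / \<kappa>) * (\<integral>\<^sup>+\<xi>. ennreal ((norm (F \<xi>))\<^sup>2 * (1 / (1 + ((\<iota> \<xi> - of_int n) / \<kappa>)\<^sup>2))) \<partial>M)"
proof -
  let ?w = "\<lambda>\<xi>. 1 / (1 + ((\<iota> \<xi> - of_int n) / \<kappa>)\<^sup>2)"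
  have "ennreal (A F \<kappa> n) = ennreal (2 * pi / \<kappa>) * ennreal (LINT \<xi>|M. (norm (F \<xi>))\<^sup>2 * ?w \<xi>)"
    unfolding A_def using assms by (intro ennreal_mult integral_nonneg_AE AE_I2) auto
  also have "ennreal (LINT \<xi>|M. (norm (F \<xi>))\<^sup>2 * ?w \<xi>) = (\<integral>\<^sup>+\<xi>. ennreal ((norm (F \<xi>))\<^sup>2 * ?w \<xi>) \<partial>M)"
    by (rule bdd_square_weight(2)[OF assms(1)]) (use lorentz_le1 in auto)
  finally show ?thesis .
qed

lemma Bq_nn:
  assumes "bdd F" "\<kappa> > 0"
  shows "ennreal (Bq F \<kappa> n) = ennreal (1 / \<kappa>) * (\<integral>\<^sup>+\<xi>. ennreal ((norm (F \<xi>))\<^sup>2 * (1 + \<bar>\<iota> \<xi> - of_int n\<bar> / \<kappa>) powr (- 2 * s0)) \<partial>M)"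
proof -
  let ?w = "\<lambda>\<xi>. (1 + \<bar>\<iota> \<xi> - of_int n\<bar> / \<kappa>) powr (- 2 * s0)"
  have le: "?w \<xi> \<le> 1" for \<xi>
    using bracket_le1[of \<kappa> "2 * s0"] assms s0 by simp
  have "ennreal (Bq F \<kappa> n) = ennreal (1 / \<kappa>) * ennreal (LINT \<xi>|M. (norm (F \<xi>))\<^sup>2 * ?w \<xi>)"
    unfolding Bq_def using assms by (intro ennreal_mult integral_nonneg_AE AE_I2) auto
  also have "ennreal (LINT \<xi>|M. (norm (F \<xi>))\<^sup>2 * ?w \<xi>) = (\<integral>\<^sup>+\<xi>. ennreal ((norm (F \<xi>))\<^sup>2 * ?w \<xi>) \<partial>M)"
    by (rule bdd_square_weight(2)[OF assms(1)]) (use le in auto)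
  finally show ?thesis .
qed

text \<open>The slowly decaying weight of \<open>Bq\<close> is dominated by an average of
  Lorentzians. For each \<xi> at least \<kappa> integers m lie within \<kappa> of it; at those the
  Lorentzian centred at m is at least 1/2 and the bracket of m - n is at most twice that of \<xi> -
  n, which together gives the factor 1/4. Tonelli then exchanges sum and integral.\<close>

lemma B_le_A:
  assumes F: "bdd F" and \<kappa>: "\<kappa> \<ge> 1"
  shows "ennreal (Bq F \<kappa> n) \<le> (\<integral>\<^sup>+m. ennreal (1 / \<kappa> * A F \<kappa> m * (1 + \<bar>of_int m - of_int n\<bar> / \<kappa>) powr (- 2 * s0)) \<partial>count_space UNIV)"
proof -
  have [measurable]: "F \<in> borel_measurable M" using F by (auto simp: bdd_def)
  let ?h = "\<lambda>\<xi> m. 1 / (1 + ((\<iota> \<xi> - of_int m) / \<kappa>)\<^sup>2)"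
  let ?w = "\<lambda>m. (1 + \<bar>real_of_int m - of_int n\<bar> / \<kappa>) powr (- 2 * s0)"
  let ?b = "\<lambda>\<xi>. (1 + \<bar>\<iota> \<xi> - of_int n\<bar> / \<kappa>) powr (- 2 * s0)"
  have near: "ennreal (1 / 4 * ?b \<xi>) \<le> (\<integral>\<^sup>+m. ennreal (1 / \<kappa> * (?h \<xi> m * ?w m)) \<partial>count_space UNIV)" for \<xi>
  proof -
    have "ennreal (\<kappa> * (1 / \<kappa> * (1 / 4 * ?b \<xi>))) \<le> (\<integral>\<^sup>+m. ennreal (1 / \<kappa> * (?h \<xi> m * ?w m)) \<partial>count_space UNIV)"
    proof (rule sum_near_ge[OF \<kappa>])
      show "0 \<le> 1 / \<kappa> * (1 / 4 * ?b \<xi>)" using \<kappa> by simp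
      fix m :: int assume m: "\<bar>\<iota> \<xi> - of_int m\<bar> \<le> \<kappa>"
      have "\<bar>(\<iota> \<xi> - of_int m) / \<kappa>\<bar> \<le> 1"
        using m \<kappa> by (simp add: abs_divide)
      then have "((\<iota> \<xi> - of_int m) / \<kappa>)\<^sup>2 \<le> 1"
        by (simp add: abs_square_le_1)
      then have h: "1 / 2 \<le> ?h \<xi> m"
        by (intro frac_le) (auto simp: add_pos_nonneg)
      have "\<bar>real_of_int m - of_int n\<bar> / \<kappa> \<le> (\<bar>\<iota> \<xi> - of_int n\<bar> + \<kappa>) / \<kappa>"
        using m \<kappa> by (intro divide_right_mono) linarith+
      also have "\<dots> = \<bar>\<iota> \<xi> - of_int n\<bar> / \<kappa> + 1"
        using \<kappa> by (simp add: add_divide_distrib)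
      finally have le: "1 + \<bar>real_of_int m - of_int n\<bar> / \<kappa> \<le> 2 + \<bar>\<iota> \<xi> - of_int n\<bar> / \<kappa>"
        by simp
      have "2 + \<bar>\<iota> \<xi> - of_int n\<bar> / \<kappa> \<le> 2 * (1 + \<bar>\<iota> \<xi> - of_int n\<bar> / \<kappa>)"
      proof -
        have le: "2 + c \<le> 2 * (1 + c)" if "0 \<le> c" for c :: real using that by simp
        show ?thesis using \<kappa> by (intro le) simp
      qed
      with le have "1 + \<bar>real_of_int m - of_int n\<bar> / \<kappa> \<le> 2 * (1 + \<bar>\<iota> \<xi> - of_int n\<bar> / \<kappa>)"
        by linarith
      then have "(2 * (1 + \<bar>\<iota> \<xi> - of_int n\<bar> / \<kappa>)) powr (- 2 * s0) \<le> ?w m"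
        using s0 \<kappa> by (intro powr_mono2') (auto intro: add_pos_nonneg)
      moreover have "1 / 2 * ?b \<xi> \<le> (2 * (1 + \<bar>\<iota> \<xi> - of_int n\<bar> / \<kappa>)) powr (- 2 * s0)"
      proof -
        have "(2::real) powr - 1 \<le> 2 powr (- 2 * s0)"
          using s0 by (intro powr_mono) auto
        then have "1 / 2 * ?b \<xi> \<le> 2 powr (- 2 * s0) * ?b \<xi>"
          by (intro mult_right_mono) (auto simp: powr_minus)
        also have "\<dots> = (2 * (1 + \<bar>\<iota> \<xi> - of_int n\<bar> / \<kappa>)) powr (- 2 * s0)"
          using \<kappa> by (intro powr_mult[symmetric])
        finally show ?thesis .
      qed
      ultimately have "1 / 2 * (1 / 2 * ?b \<xi>) \<le> ?h \<xi> m * ?w m"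
        by (intro mult_mono h) auto
      then show "ennreal (1 / \<kappa> * (1 / 4 * ?b \<xi>)) \<le> ennreal (1 / \<kappa> * (?h \<xi> m * ?w m))"
        using \<kappa> by (intro ennreal_leI mult_left_mono) auto
    qed
    then show ?thesis using \<kappa> by simp
  qed
  have "ennreal (Bq F \<kappa> n) = ennreal (1 / \<kappa>) * (\<integral>\<^sup>+\<xi>. ennreal ((norm (F \<xi>))\<^sup>2 * ?b \<xi>) \<partial>M)"
    using \<kappa> by (intro Bq_nn F) auto
  also have "\<dots> \<le> ennreal (2 * pi / \<kappa>) * (\<integral>\<^sup>+\<xi>. ennreal ((norm (F \<xi>))\<^sup>2) * ennreal (1 / 4 * ?b \<xi>) \<partial>M)"
  proof -
    have "ennreal (1 / \<kappa>) \<le> ennreal (2 * pi / \<kappa>) * ennreal (1 / 4)"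
      using \<kappa> pi_gt3 by (auto simp: ennreal_mult[symmetric] divide_simps intro!: ennreal_leI)
    then have "ennreal (1 / \<kappa>) * (\<integral>\<^sup>+\<xi>. ennreal ((norm (F \<xi>))\<^sup>2 * ?b \<xi>) \<partial>M)
        \<le> ennreal (2 * pi / \<kappa>) * ennreal (1 / 4) * (\<integral>\<^sup>+\<xi>. ennreal ((norm (F \<xi>))\<^sup>2 * ?b \<xi>) \<partial>M)"
      by (intro mult_right_mono) auto
    also have "\<dots> = ennreal (2 * pi / \<kappa>) * (\<integral>\<^sup>+\<xi>. ennreal (1 / 4) * ennreal ((norm (F \<xi>))\<^sup>2 * ?b \<xi>) \<partial>M)"
      by (subst nn_integral_cmult) (auto simp: mult.assoc)
    also have "(\<lambda>\<xi>. ennreal (1 / 4) * ennreal ((norm (F \<xi>))\<^sup>2 * ?b \<xi>)) = (\<lambda>\<xi>. ennreal ((norm (F \<xi>))\<^sup>2) * ennreal (1 / 4 * ?b \<xi>))"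
      by (rule ext) (simp add: ennreal_mult[symmetric])
    finally show ?thesis .
  qed
  also have "\<dots> \<le> ennreal (2 * pi / \<kappa>) * (\<integral>\<^sup>+\<xi>. ennreal ((norm (F \<xi>))\<^sup>2) * (\<integral>\<^sup>+m. ennreal (1 / \<kappa> * (?h \<xi> m * ?w m)) \<partial>count_space UNIV) \<partial>M)"
    by (intro mult_left_mono nn_integral_mono near) simp_all
  also have "(\<integral>\<^sup>+\<xi>. ennreal ((norm (F \<xi>))\<^sup>2) * (\<integral>\<^sup>+m. ennreal (1 / \<kappa> * (?h \<xi> m * ?w m)) \<partial>count_space UNIV) \<partial>M)
      = (\<integral>\<^sup>+\<xi>. (\<integral>\<^sup>+m. ennreal (1 / \<kappa> * ?w m) * ennreal ((norm (F \<xi>))\<^sup>2 * ?h \<xi> m) \<partial>count_space UNIV) \<partial>M)"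
  proof (rule nn_integral_cong)
    fix \<xi>
    have "ennreal ((norm (F \<xi>))\<^sup>2) * ennreal (1 / \<kappa> * (?h \<xi> m * ?w m)) = ennreal (1 / \<kappa> * ?w m) * ennreal ((norm (F \<xi>))\<^sup>2 * ?h \<xi> m)" for m
      using \<kappa> by (intro ennreal_mult_rearrange) auto
    then show "ennreal ((norm (F \<xi>))\<^sup>2) * (\<integral>\<^sup>+m. ennreal (1 / \<kappa> * (?h \<xi> m * ?w m)) \<partial>count_space UNIV)
      = (\<integral>\<^sup>+m. ennreal (1 / \<kappa> * ?w m) * ennreal ((norm (F \<xi>))\<^sup>2 * ?h \<xi> m) \<partial>count_space UNIV)"
      by (subst nn_integral_cmult[symmetric]) simp_all
  qed
  also have "\<dots> = (\<integral>\<^sup>+m. (\<integral>\<^sup>+\<xi>. ennreal (1 / \<kappa> * ?w m) * ennreal ((norm (F \<xi>))\<^sup>2 * ?h \<xi> m) \<partial>M) \<partial>count_space UNIV)"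
    by (rule nn_integral_count_space_nn_integral) auto
  also have "\<dots> = (\<integral>\<^sup>+m. ennreal (1 / \<kappa> * ?w m) * (\<integral>\<^sup>+\<xi>. ennreal ((norm (F \<xi>))\<^sup>2 * ?h \<xi> m) \<partial>M) \<partial>count_space UNIV)"
    by (intro nn_integral_cong nn_integral_cmult) measurable
  also have "ennreal (2 * pi / \<kappa>) * \<dots> = (\<integral>\<^sup>+m. ennreal (1 / \<kappa> * ?w m) * (ennreal (2 * pi / \<kappa>) * (\<integral>\<^sup>+\<xi>. ennreal ((norm (F \<xi>))\<^sup>2 * ?h \<xi> m) \<partial>M)) \<partial>count_space UNIV)"
    by (subst nn_integral_cmult[symmetric]) (simp_all only: mult.left_commute, simp)
  also have "\<dots> = (\<integral>\<^sup>+m. ennreal (1 / \<kappa> * ?w m) * ennreal (A F \<kappa> m) \<partial>count_space UNIV)"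
    using \<kappa> by (intro nn_integral_cong arg_cong2[where f = "(*)"] refl A_nn[OF F, symmetric]) auto
  also have "\<dots> = (\<integral>\<^sup>+m. ennreal (1 / \<kappa> * A F \<kappa> m * ?w m) \<partial>count_space UNIV)"
  proof (rule nn_integral_cong)
    fix m
    show "ennreal (1 / \<kappa> * ?w m) * ennreal (A F \<kappa> m) = ennreal (1 / \<kappa> * A F \<kappa> m * ?w m)"
      using \<kappa> A_nonneg[of \<kappa> F m] by (intro ennreal_mult_swap) auto
  qed
  finally show ?thesis .
qed

definition CB :: real where "CB = gz (1 + 1 / (4 * P)) powr (P - 1)"

lemma CB_pos: "CB > 0"
  using gz_pos[of "1 + 1 / (4 * P)"] P unfolding CB_def by simp

text \<open>The weight in \<open>B_le_A\<close> has power 2 s0 < 1 and is not summable. Jensen's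
  inequality is applied with a summable part of it, the rest being attached to \<open>A\<close>. The
  decay 1/2 that survives the P-th power still does not sum over n, but its cube does
  (\<open>sum_B_powr_le\<close>).\<close>

lemma B_powr_le:
  assumes F: "bdd F" and \<kappa>: "\<kappa> \<ge> 1"
  shows "ennreal (Bq F \<kappa> n powr P) \<le> ennreal CB * (\<integral>\<^sup>+m. ennreal (1 / \<kappa> * A F \<kappa> m powr P * (1 + \<bar>of_int m - of_int n\<bar> / \<kappa>) powr (- (1 / 2))) \<partial>count_space UNIV)"
proof -
  \<comment> \<open>The powers recombine as -(1 + \<gamma>) + 2 \<gamma> = -2 s0, and 2 \<gamma> P =
    1/2 is the growth created by the P-th power.\<close>
  define \<gamma> where "\<gamma> = 1 / (4 * P)"
  have \<gamma>: "\<gamma> > 0" "2 * \<gamma> * P = 1 / 2" "2 * s0 = 1 - \<gamma>"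
    using P s0 by (auto simp: \<gamma>_def)
  define br where "br m = 1 + \<bar>real_of_int m - of_int n\<bar> / \<kappa>" for m
  have br: "br m \<ge> 1" for m using \<kappa> by (simp add: br_def)
  have br0: "br m > 0" for m using br[of m] by linarith
  let ?w = "\<lambda>m. 1 / \<kappa> * br m powr - (1 + \<gamma>)"
  let ?y = "\<lambda>m. A F \<kappa> m * br m powr (2 * \<gamma>)"
  have A0: "A F \<kappa> m \<ge> 0" for m using \<kappa> by (intro A_nonneg) auto
  have tot: "(\<integral>\<^sup>+m. ennreal (?w m) \<partial>count_space UNIV) \<le> ennreal (gz (1 + \<gamma>))"
  proof -
    have "(\<integral>\<^sup>+m. ennreal (?w m) \<partial>count_space UNIV) = ennreal (1 / \<kappa>) * (\<integral>\<^sup>+m. ennreal (br m powr - (1 + \<gamma>)) \<partial>count_space UNIV)"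
      using \<kappa> by (subst nn_integral_cmult[symmetric]) (auto simp: ennreal_mult[symmetric])
    also have "\<dots> \<le> ennreal (1 / \<kappa>) * ennreal (\<kappa> * gz (1 + \<gamma>))"
      unfolding br_def using \<gamma> \<kappa> by (intro mult_left_mono sum_bracket) auto
    also have "\<dots> = ennreal (gz (1 + \<gamma>))"
      using \<kappa> gz_pos[of "1 + \<gamma>"] \<gamma> by (simp add: ennreal_mult[symmetric])
    finally show ?thesis .
  qed
  have wy: "?w m * ?y m = 1 / \<kappa> * A F \<kappa> m * br m powr (- 2 * s0)" for m
  proof -
    have "- (1 + \<gamma>) + 2 * \<gamma> = - 2 * s0"
      using \<gamma>(3) by simp
    then have "br m powr - (1 + \<gamma>) * br m powr (2 * \<gamma>) = br m powr (- 2 * s0)"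
      by (simp only: powr_add[symmetric])
    then show ?thesis by (metis (no_types, opaque_lifting) mult.assoc mult.left_commute)
  qed
  have "ennreal (Bq F \<kappa> n powr P) \<le> ennreal (gz (1 + \<gamma>) powr (P - 1)) * (\<integral>\<^sup>+m. ennreal (?w m * ?y m powr P) \<partial>count_space UNIV)"
  proof (rule jensen_nn[OF _ _ _ _ P _ _ tot])
    show "ennreal (Bq F \<kappa> n) \<le> (\<integral>\<^sup>+m. ennreal (?w m * ?y m) \<partial>count_space UNIV)"
      unfolding wy unfolding br_def by (rule B_le_A[OF F \<kappa>])
  qed (use \<kappa> A0 gz_pos[of "1 + \<gamma>"] \<gamma> Bq_nonneg[of \<kappa> F n] in auto)
  also have "\<dots> \<le> ennreal CB * (\<integral>\<^sup>+m. ennreal (1 / \<kappa> * A F \<kappa> m powr P * br m powr (- (1 / 2))) \<partial>count_space UNIV)"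
    unfolding CB_def \<gamma>_def[symmetric]
  proof (intro mult_left_mono nn_integral_mono ennreal_leI)
    fix m
    have "?y m powr P = A F \<kappa> m powr P * br m powr (1 / 2)"
    proof -
      have "(br m powr (2 * \<gamma>)) powr P = br m powr (1 / 2)"
        unfolding powr_powr \<gamma>(2) ..
      then show ?thesis
        using A0[of m] by (simp add: powr_mult)
    qed
    then have "?w m * ?y m powr P = 1 / \<kappa> * A F \<kappa> m powr P * (br m powr - (1 + \<gamma>) * br m powr (1 / 2))"
      by (simp only: mult_ac)
    also have "br m powr - (1 + \<gamma>) * br m powr (1 / 2) = br m powr (- (1 / 2) - \<gamma>)"
      by (simp add: powr_add[symmetric])
    also have "1 / \<kappa> * A F \<kappa> m powr P * br m powr (- (1 / 2) - \<gamma>) \<le> 1 / \<kappa> * A F \<kappa> m powr P * br m powr (- (1 / 2))"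
      using \<gamma> br[of m] \<kappa> by (intro mult_left_mono powr_mono) auto
    finally show "?w m * ?y m powr P \<le> 1 / \<kappa> * A F \<kappa> m powr P * br m powr (- (1 / 2))" .
  qed simp
  finally show ?thesis by (simp add: br_def)
qed

lemma B_powr_le_N:
  assumes F: "bdd F" and \<kappa>: "\<kappa> \<ge> 1" and N: "Nn F \<kappa> \<le> ennreal N" "N \<ge> 0"
  shows "Bq F \<kappa> n powr P \<le> CB * N"
proof -
  have "ennreal (Bq F \<kappa> n powr P) \<le> ennreal CB * (\<integral>\<^sup>+m. ennreal (1 / \<kappa> * A F \<kappa> m powr P * (1 + \<bar>of_int m - of_int n\<bar> / \<kappa>) powr (- (1 / 2))) \<partial>count_space UNIV)"
    by (rule B_powr_le[OF F \<kappa>])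
  also have "\<dots> \<le> ennreal CB * Nn F \<kappa>"
    unfolding Nn_def using bracket_le1[of \<kappa> "1 / 2"] \<kappa>
    by (intro mult_left_mono nn_integral_mono ennreal_leI mult_left_le) auto
  also have "\<dots> \<le> ennreal CB * ennreal N"
    by (intro mult_left_mono N) simp
  finally have "ennreal (Bq F \<kappa> n powr P) \<le> ennreal (CB * N)"
    using CB_pos N by (simp add: ennreal_mult)
  then show ?thesis
    using CB_pos N by (simp add: ennreal_le_iff)
qed

text \<open>Jensen's inequality once more, with exponent 3 and the measure A_m^P / \<kappa> of mass
  at most N, yields N^2 times a sum with bracket power 3/2. Summed over n this weight has mass of
  order \<kappa>, and the sum over m gives the third factor N.\<close>

lemma sum_B_powr_le:
  assumes F: "bdd F" and \<kappa>: "\<kappa> \<ge> 1" and N: "Nn F \<kappa> \<le> ennreal N" "N \<ge> 0"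
  shows "(\<integral>\<^sup>+n. ennreal (1 / \<kappa> * (Bq F \<kappa> n powr P) ^ 3) \<partial>count_space UNIV) \<le> ennreal (CB ^ 3 * gz (3 / 2) * N ^ 3)"
proof (cases "N = 0")
  \<comment> \<open>\<open>jensen_nn\<close> asks for a positive total mass, so N = 0 is treated
    apart.\<close>
  case True
  have "Bq F \<kappa> n powr P = 0" for n
    using B_powr_le_N[OF F \<kappa> N, of n] True by simp
  then show ?thesis using P by simp
next
  case False
  then have N0: "N > 0" using N by simp
  let ?a = "\<lambda>m. 1 / \<kappa> * A F \<kappa> m powr P"
  let ?b = "\<lambda>m n. 1 + \<bar>real_of_int m - of_int n\<bar> / \<kappa>"
  interpret psf: pair_sigma_finite "count_space (UNIV :: int set)" "count_space (UNIV :: int set)"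
    by (simp add: pair_sigma_finite_def sigma_finite_measure_count_space)
  have cube: "ennreal ((Bq F \<kappa> n powr P) ^ 3) \<le> ennreal (CB ^ 3 * N ^ 2) * (\<integral>\<^sup>+m. ennreal (?a m * ?b m n powr (- (3 / 2))) \<partial>count_space UNIV)" for n
  proof -
    let ?c = "Bq F \<kappa> n powr P / CB"
    have "ennreal CB * ennreal ?c \<le> ennreal CB * (\<integral>\<^sup>+m. ennreal (?a m * ?b m n powr (- (1 / 2))) \<partial>count_space UNIV)"
      using B_powr_le[OF F \<kappa>, of n] CB_pos by (simp add: ennreal_mult[symmetric])
    then have le: "ennreal ?c \<le> (\<integral>\<^sup>+m. ennreal (?a m * ?b m n powr (- (1 / 2))) \<partial>count_space UNIV)"
      using CB_pos by (subst (asm) ennreal_mult_le_mult_iff) auto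
    have "ennreal (?c powr 3) \<le> ennreal (N powr (3 - 1)) * (\<integral>\<^sup>+m. ennreal (?a m * (?b m n powr (- (1 / 2))) powr 3) \<partial>count_space UNIV)"
      by (rule jensen_nn[OF _ _ _ _ _ N0 _ N(1)[unfolded Nn_def] le]) (use \<kappa> CB_pos in auto)
    also have "(\<lambda>m. (?b m n powr (- (1 / 2))) powr 3) = (\<lambda>m. ?b m n powr (- (3 / 2)))"
      by (simp add: powr_powr)
    finally have "ennreal (?c ^ 3) \<le> ennreal (N ^ 2) * (\<integral>\<^sup>+m. ennreal (?a m * ?b m n powr (- (3 / 2))) \<partial>count_space UNIV)"
      using N0 CB_pos by (simp add: powr_numeral[symmetric] del: powr_numeral)
    then have "ennreal (CB ^ 3) * ennreal (?c ^ 3) \<le> ennreal (CB ^ 3) * (ennreal (N ^ 2) * (\<integral>\<^sup>+m. ennreal (?a m * ?b m n powr (- (3 / 2))) \<partial>count_space UNIV))"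
      by (intro mult_left_mono) auto
    moreover have "ennreal (CB ^ 3) * ennreal (?c ^ 3) = ennreal ((Bq F \<kappa> n powr P) ^ 3)"
      using CB_pos by (subst ennreal_mult[symmetric]) (auto simp: power_divide)
    moreover have "ennreal (CB ^ 3 * N ^ 2) = ennreal (CB ^ 3) * ennreal (N ^ 2)"
      using CB_pos N by (intro ennreal_mult) auto
    ultimately show ?thesis by (simp only: mult.assoc)
  qed
  have "(\<integral>\<^sup>+n. ennreal (1 / \<kappa> * (Bq F \<kappa> n powr P) ^ 3) \<partial>count_space UNIV)
    \<le> (\<integral>\<^sup>+n. ennreal (CB ^ 3 * N ^ 2) * (\<integral>\<^sup>+m. ennreal (1 / \<kappa>) * ennreal (?a m * ?b m n powr (- (3 / 2))) \<partial>count_space UNIV) \<partial>count_space UNIV)"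
  proof (rule nn_integral_mono)
    fix n
    have "ennreal (1 / \<kappa> * (Bq F \<kappa> n powr P) ^ 3) = ennreal (1 / \<kappa>) * ennreal ((Bq F \<kappa> n powr P) ^ 3)"
      using \<kappa> by (intro ennreal_mult) auto
    also have "\<dots> \<le> ennreal (1 / \<kappa>) * (ennreal (CB ^ 3 * N ^ 2) * (\<integral>\<^sup>+m. ennreal (?a m * ?b m n powr (- (3 / 2))) \<partial>count_space UNIV))"
      by (intro mult_left_mono cube) auto
    also have "\<dots> = ennreal (CB ^ 3 * N ^ 2) * (\<integral>\<^sup>+m. ennreal (1 / \<kappa>) * ennreal (?a m * ?b m n powr (- (3 / 2))) \<partial>count_space UNIV)"
      by (subst nn_integral_cmult) (auto simp: mult_ac)
    finally show "ennreal (1 / \<kappa> * (Bq F \<kappa> n powr P) ^ 3) \<le> \<dots>" .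
  qed
  also have "\<dots> = ennreal (CB ^ 3 * N ^ 2) * (\<integral>\<^sup>+n. (\<integral>\<^sup>+m. ennreal (1 / \<kappa>) * ennreal (?a m * ?b m n powr (- (3 / 2))) \<partial>count_space UNIV) \<partial>count_space UNIV)"
    by (rule nn_integral_cmult) auto
  also have "(\<integral>\<^sup>+n. (\<integral>\<^sup>+m. ennreal (1 / \<kappa>) * ennreal (?a m * ?b m n powr (- (3 / 2))) \<partial>count_space UNIV) \<partial>count_space UNIV)
      = (\<integral>\<^sup>+m. (\<integral>\<^sup>+n. ennreal (1 / \<kappa>) * ennreal (?a m * ?b m n powr (- (3 / 2))) \<partial>count_space UNIV) \<partial>count_space UNIV)"
    by (rule psf.Fubini') (auto simp: pair_measure_countable)
  also have "\<dots> \<le> (\<integral>\<^sup>+m. ennreal (?a m) * ennreal (gz (3 / 2)) \<partial>count_space UNIV)"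
  proof (rule nn_integral_mono)
    fix m
    have "(\<integral>\<^sup>+n. ennreal (1 / \<kappa>) * ennreal (?a m * ?b m n powr (- (3 / 2))) \<partial>count_space UNIV)
       = ennreal (?a m) * (ennreal (1 / \<kappa>) * (\<integral>\<^sup>+n. ennreal ((1 + \<bar>real_of_int n - of_int m\<bar> / \<kappa>) powr - (3 / 2)) \<partial>count_space UNIV))"
      using \<kappa> by (simp add: nn_integral_cmult[symmetric] ennreal_mult[symmetric] mult_ac abs_minus_commute)
    also have "\<dots> \<le> ennreal (?a m) * (ennreal (1 / \<kappa>) * ennreal (\<kappa> * gz (3 / 2)))"
      using \<kappa> by (intro mult_left_mono sum_bracket) auto
    also have "ennreal (1 / \<kappa>) * ennreal (\<kappa> * gz (3 / 2)) = ennreal (gz (3 / 2))"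
      using \<kappa> gz_pos[of "3 / 2"] by (simp add: ennreal_mult[symmetric])
    finally show "(\<integral>\<^sup>+n. ennreal (1 / \<kappa>) * ennreal (?a m * ?b m n powr (- (3 / 2))) \<partial>count_space UNIV) \<le> ennreal (?a m) * ennreal (gz (3 / 2))" .
  qed
  also have "\<dots> = Nn F \<kappa> * ennreal (gz (3 / 2))"
    unfolding Nn_def by (rule nn_integral_multc) auto
  also have "\<dots> \<le> ennreal N * ennreal (gz (3 / 2))"
    by (intro mult_right_mono N) auto
  finally have "(\<integral>\<^sup>+n. ennreal (1 / \<kappa> * (Bq F \<kappa> n powr P) ^ 3) \<partial>count_space UNIV) \<le> ennreal (CB ^ 3 * N ^ 2) * (ennreal N * ennreal (gz (3 / 2)))"
    by (simp add: mult_left_mono)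
  also have "\<dots> = ennreal (CB ^ 3 * gz (3 / 2) * N ^ 3)"
    using N CB_pos gz_pos[of "3 / 2"] by (simp add: ennreal_mult[symmetric] power2_eq_square power3_eq_cube mult_ac)
  finally show ?thesis .
qed

end

section \<open>Riccati solutions at all integer frequencies\<close>

context geom
begin

lemma integral_shift:
  fixes f :: "'g \<Rightarrow> complex"
  assumes [measurable]: "f \<in> borel_measurable M"
  shows "(LINT \<xi>|M. f (\<xi> - c)) = (LINT \<xi>|M. f \<xi>)"
proof -
  have "distr M M (\<lambda>\<xi>. \<xi> - c) = M"
  proof (rule measure_eqI)
    fix S assume S: "S \<in> sets (distr M M (\<lambda>\<xi>. \<xi> - c))"
    then have [measurable]: "S \<in> sets M" by simp
    have "emeasure (distr M M (\<lambda>\<xi>. \<xi> - c)) S = (\<integral>\<^sup>+\<xi>. indicator S (\<xi> - c) \<partial>M)"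
      by (subst nn_integral_distr[of "\<lambda>\<xi>. \<xi> - c" M M "indicator S", symmetric]) auto
    also have "\<dots> = emeasure M S"
      by (subst nn_shift) auto
    finally show "emeasure (distr M M (\<lambda>\<xi>. \<xi> - c)) S = emeasure M S" .
  qed simp
  then have "(LINT \<xi>|M. f \<xi>) = (LINT \<xi>|distr M M (\<lambda>\<xi>. \<xi> - c). f \<xi>)"
    by simp
  also have "\<dots> = (LINT \<xi>|M. f (\<xi> - c))"
    by (rule integral_distr) measurable
  finally show ?thesis by simp
qed

lemma bdd_shift:
  assumes "bdd F" shows "bdd (\<lambda>\<xi>. F (\<xi> - c))"
proof -
  have [measurable]: "F \<in> borel_measurable M" and F: "integrable M F" using assms by (auto simp: bdd_def)
  have "(\<integral>\<^sup>+\<xi>. ennreal (norm (F (\<xi> - c))) \<partial>M) = (\<integral>\<^sup>+\<xi>. ennreal (norm (F \<xi>)) \<partial>M)"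
    by (rule nn_shift) measurable
  then have "integrable M (\<lambda>\<xi>. F (\<xi> - c))"
    using F unfolding integrable_iff_bounded by simp
  then show ?thesis
    using assms unfolding bdd_def by blast
qed

lemma synth_shift:
  assumes "bdd F"
  shows "synth (\<lambda>\<xi>. F (\<xi> - c)) x = cis (x * \<iota> c) * synth F x"
proof -
  have [measurable]: "F \<in> borel_measurable M" using assms by (auto simp: bdd_def)
  have "synth (\<lambda>\<xi>. F (\<xi> - c)) x = (LINT \<xi>|M. cis (x * \<iota> c) * (F (\<xi> - c) * cis (x * \<iota> (\<xi> - c))))"
    unfolding synth_def
    by (intro Bochner_Integration.integral_cong) (simp_all add: \<iota>_diff right_diff_distrib cis_mult mult_ac)
  also have "\<dots> = cis (x * \<iota> c) * (LINT \<xi>|M. F (\<xi> - c) * cis (x * \<iota> (\<xi> - c)))"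
    by simp
  also have "(LINT \<xi>|M. F (\<xi> - c) * cis (x * \<iota> (\<xi> - c))) = synth F x"
    unfolding synth_def by (rule integral_shift) measurable
  finally show ?thesis .
qed

lemma nn_sq_add_le:
  fixes f g :: "real \<Rightarrow> complex"
  assumes [measurable]: "f \<in> borel_measurable X" "g \<in> borel_measurable X"
  shows "(\<integral>\<^sup>+x. ennreal ((norm (f x))\<^sup>2) \<partial>X) \<le> 2 * (\<integral>\<^sup>+x. ennreal ((norm (g x))\<^sup>2) \<partial>X) + 2 * (\<integral>\<^sup>+x. ennreal ((norm (f x - g x))\<^sup>2) \<partial>X)"
proof -
  have "(\<integral>\<^sup>+x. ennreal ((norm (f x))\<^sup>2) \<partial>X) \<le> (\<integral>\<^sup>+x. 2 * ennreal ((norm (g x))\<^sup>2) + 2 * ennreal ((norm (f x - g x))\<^sup>2) \<partial>X)"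
  proof (rule nn_integral_mono)
    fix x show "ennreal ((norm (f x))\<^sup>2) \<le> 2 * ennreal ((norm (g x))\<^sup>2) + 2 * ennreal ((norm (f x - g x))\<^sup>2)"
      using ennreal_norm_sum_square[of "g x" "f x - g x"] by simp
  qed
  also have "\<dots> = 2 * (\<integral>\<^sup>+x. ennreal ((norm (g x))\<^sup>2) \<partial>X) + 2 * (\<integral>\<^sup>+x. ennreal ((norm (f x - g x))\<^sup>2) \<partial>X)"
    by (subst nn_integral_add) (simp_all add: nn_integral_cmult)
  finally show ?thesis .
qed

text \<open>Modulation reduces k = \<kappa> + i n to k = \<kappa>: if w solves the equation for u,
  then e^(i x n) w solves it for e^(-i x n) u, whose transform is F shifted by n. As n is an
  integer, the modulation keeps the period 2 pi. The two comparisons are |a|^2 <= 2 |b|^2 + 2 |a -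
  b|^2 for the solution and its linear part.\<close>

lemma riccati_exists:
  fixes \<sigma> \<kappa> :: real and n :: int
  assumes F: "bdd F" "nice F" and \<sigma>: "\<sigma> = 1 \<or> \<sigma> = -1" and \<kappa>: "\<kappa> \<ge> 1"
    and small: "256 * gC0 * Bq F \<kappa> n \<le> 1"
  obtains w where "riccati \<sigma> (of_real \<kappa> + \<i> * of_int n) (synth F) w" "\<And>x. w (x + L) = w x"
    "ennreal (A F \<kappa> n) \<le> 2 * (ennreal \<kappa> * (\<integral>\<^sup>+x. ennreal ((norm (w x))\<^sup>2) \<partial>X)) + 2 * ennreal (K1 * Bq F \<kappa> n ^ 3)"
    "ennreal \<kappa> * (\<integral>\<^sup>+x. ennreal ((norm (w x))\<^sup>2) \<partial>X) \<le> 2 * ennreal (A F \<kappa> n) + 2 * ennreal (K1 * Bq F \<kappa> n ^ 3)"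
proof -
  interpret st: static M \<iota> \<kappa> s0 gC0 X L
    by (rule static_interp[OF \<kappa>])
  have [measurable]: "F \<in> borel_measurable M" using F by (auto simp: bdd_def)
  define Fn where "Fn \<xi> = F (\<xi> - (- emb n))" for \<xi>
  have Fn: "bdd Fn" "nice Fn"
    unfolding Fn_def using bdd_shift nice_shift F by blast+
  have [measurable]: "Fn \<in> borel_measurable M" using Fn by (auto simp: bdd_def)
  have sFn: "synth Fn x = cis (- (x * of_int n)) * synth F x" for x
    unfolding Fn_def by (subst synth_shift[OF F(1)]) (simp add: emb)
  have \<iota>s: "\<iota> (\<xi> - (- emb n)) - of_int n = \<iota> \<xi>" for \<xi>
    using \<iota>_diff[of \<xi> "- emb n"] by (simp add: emb)
  have Bn: "st.Bn Fn = ennreal (Bq F \<kappa> n)"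
  proof -
    let ?g = "\<lambda>\<xi>. ennreal ((norm (F \<xi>))\<^sup>2 * (1 + \<bar>\<iota> \<xi> - of_int n\<bar> / \<kappa>) powr (- 2 * s0))"
    have "st.wn (- 2 * s0) Fn = (\<integral>\<^sup>+\<xi>. ?g (\<xi> - (- emb n)) \<partial>M)"
      unfolding st.wn_def st.br_def Fn_def \<iota>s ..
    also have "\<dots> = (\<integral>\<^sup>+\<xi>. ?g \<xi> \<partial>M)"
      by (rule nn_shift) measurable
    finally show ?thesis
      unfolding st.Bn_def using Bq_nn[OF F(1), of \<kappa> n] \<kappa> by simp
  qed
  obtain v where v:
    "\<And>x. (v has_vector_derivative (of_real \<sigma> * cnj (synth Fn x) - of_real \<kappa> * v x - synth Fn x * (v x)\<^sup>2)) (at x)"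
    "\<And>x. norm (v x) \<le> 1 / 2" "\<And>x. v (x + L) = v x"
    "ennreal \<kappa> * (\<integral>\<^sup>+x. ennreal ((norm (v x - synth (\<lambda>\<xi>. st.mul \<xi> * crefl \<sigma> Fn \<xi>) x))\<^sup>2) \<partial>X) \<le> ennreal (65536 * pi * gC0\<^sup>2 * Bq F \<kappa> n ^ 3)"
    using st.static_solution[OF Fn(1) \<sigma> Bq_nonneg small eq_refl[OF Bn]] \<kappa> by auto
  let ?w1 = "synth (\<lambda>\<xi>. st.mul \<xi> * crefl \<sigma> Fn \<xi>)"
  \<comment> \<open>Here an equality is needed, since A is bounded by the energy as well as bounding
    it; this is why F has to be \<open>nice\<close>.\<close>
  have U1: "ennreal \<kappa> * (\<integral>\<^sup>+x. ennreal ((norm (?w1 x))\<^sup>2) \<partial>X) = ennreal (A F \<kappa> n)"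
  proof -
    let ?g = "\<lambda>\<xi>. ennreal ((norm (F \<xi>))\<^sup>2 * (1 / (1 + ((\<iota> \<xi> - of_int n) / \<kappa>)\<^sup>2)))"
    have "nice (crefl \<sigma> Fn)"
      unfolding crefl_def[abs_def] by (rule nice_refl[OF Fn(2)])
    from plancherel_X[OF bdd_crefl[OF Fn(1)] this \<kappa>]
    have "(\<integral>\<^sup>+x. ennreal ((norm (?w1 x))\<^sup>2) \<partial>X) = ennreal (2 * pi) * (\<integral>\<^sup>+\<xi>. ennreal ((norm (st.mul \<xi> * crefl \<sigma> Fn \<xi>))\<^sup>2) \<partial>M)"
      unfolding st.mul_def .
    also have "(\<integral>\<^sup>+\<xi>. ennreal ((norm (st.mul \<xi> * crefl \<sigma> Fn \<xi>))\<^sup>2) \<partial>M) = (\<integral>\<^sup>+\<xi>. ennreal (1 / \<kappa>\<^sup>2) * ?g (- \<xi> - (- emb n)) \<partial>M)"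
    proof (rule nn_integral_cong)
      fix \<xi>
      have "(norm (st.mul \<xi> * crefl \<sigma> Fn \<xi>))\<^sup>2 = (1 / (\<kappa>\<^sup>2 + (\<iota> \<xi>)\<^sup>2)) * (norm (Fn (- \<xi>)))\<^sup>2"
        unfolding norm_mult power_mult_distrib st.norm_mul_square using \<sigma> by (auto simp: crefl_def norm_mult)
      also have "1 / (\<kappa>\<^sup>2 + (\<iota> \<xi>)\<^sup>2) = 1 / \<kappa>\<^sup>2 * (1 / (1 + (\<iota> (- \<xi>) / \<kappa>)\<^sup>2))"
        using \<kappa> by (simp add: power_divide field_simps)
      finally have "(norm (st.mul \<xi> * crefl \<sigma> Fn \<xi>))\<^sup>2 = 1 / \<kappa>\<^sup>2 * ((norm (F (- \<xi> - (- emb n))))\<^sup>2 * (1 / (1 + ((\<iota> (- \<xi> - (- emb n)) - of_int n) / \<kappa>)\<^sup>2)))"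
        unfolding Fn_def \<iota>s by (simp only: mult_ac)
      then show "ennreal ((norm (st.mul \<xi> * crefl \<sigma> Fn \<xi>))\<^sup>2) = ennreal (1 / \<kappa>\<^sup>2) * ?g (- \<xi> - (- emb n))"
        using \<kappa> by (simp only: ennreal_mult[symmetric] zero_le_divide_1_iff zero_le_power2 mult_nonneg_nonneg) (subst ennreal_mult[symmetric], auto)
    qed
    also have "\<dots> = (\<integral>\<^sup>+\<xi>. ennreal (1 / \<kappa>\<^sup>2) * ?g (\<xi> - (- emb n)) \<partial>M)"
      by (rule nn_refl[of "\<lambda>\<xi>. ennreal (1 / \<kappa>\<^sup>2) * ?g (\<xi> - (- emb n))"]) measurable
    also have "\<dots> = (\<integral>\<^sup>+\<xi>. ennreal (1 / \<kappa>\<^sup>2) * ?g \<xi> \<partial>M)"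
      by (rule nn_shift[of "\<lambda>\<xi>. ennreal (1 / \<kappa>\<^sup>2) * ?g \<xi>"]) measurable
    also have "\<dots> = ennreal (1 / \<kappa>\<^sup>2) * (\<integral>\<^sup>+\<xi>. ?g \<xi> \<partial>M)"
      by (rule nn_integral_cmult) measurable
    finally have "ennreal \<kappa> * (\<integral>\<^sup>+x. ennreal ((norm (?w1 x))\<^sup>2) \<partial>X) = ennreal \<kappa> * (ennreal (2 * pi) * (ennreal (1 / \<kappa>\<^sup>2) * (\<integral>\<^sup>+\<xi>. ?g \<xi> \<partial>M)))"
      by simp
    also have "\<dots> = ennreal (2 * pi / \<kappa>) * (\<integral>\<^sup>+\<xi>. ?g \<xi> \<partial>M)"
    proof -
      have "ennreal \<kappa> * ennreal (2 * pi) * ennreal (1 / \<kappa>\<^sup>2) = ennreal (2 * pi / \<kappa>)"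
        using \<kappa> by (simp add: ennreal_mult[symmetric] power2_eq_square)
      then show ?thesis by (simp only: mult.assoc[symmetric])
    qed
    also have "\<dots> = ennreal (A F \<kappa> n)"
      using \<kappa> by (intro A_nn[OF F(1), symmetric]) auto
    finally show ?thesis .
  qed
  have D: "ennreal \<kappa> * (\<integral>\<^sup>+x. ennreal ((norm (v x - ?w1 x))\<^sup>2) \<partial>X) \<le> ennreal (K1 * Bq F \<kappa> n ^ 3)"
    using v(4) by (simp add: K1_def)
  have cv: "continuous_on UNIV v"
    by (meson v(1) continuous_at_imp_continuous_on has_vector_derivative_continuous)
  have cw1: "continuous_on UNIV ?w1"
    by (intro synth_continuous bddD(1) st.bdd_mul bdd_crefl Fn)
  have [measurable]: "v \<in> borel_measurable X" "?w1 \<in> borel_measurable X"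
    using borel_measurable_continuous_onI[OF cv] borel_measurable_continuous_onI[OF cw1] measurable_cong_sets[OF sets_XX refl] by blast+
  \<comment> \<open>The modulation is undone; its derivative produces the term i n w of k w.\<close>
  define w where "w x = cis (- (x * of_int n)) * v x" for x
  have nw: "norm (w x) = norm (v x)" for x
    by (simp add: w_def norm_mult)
  show ?thesis
  proof (rule that[of w])
    show "riccati \<sigma> (of_real \<kappa> + \<i> * of_int n) (synth F) w"
      unfolding riccati_def
    proof (intro conjI allI)
      fix x :: real
      have "((\<lambda>x. cis (- (x * of_int n))) has_vector_derivative (- \<i> * of_int n * cis (- (x * of_int n)))) (at x)"
        unfolding has_vector_derivative_def
        by (auto intro!: derivative_eq_intros simp: scaleR_conv_of_real algebra_simps)
      from has_vector_derivative_mult[OF this v(1)[of x]]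
      have "(w has_vector_derivative (cis (- (x * of_int n)) * (of_real \<sigma> * cnj (synth Fn x) - of_real \<kappa> * v x - synth Fn x * (v x)\<^sup>2)
          + - \<i> * of_int n * cis (- (x * of_int n)) * v x)) (at x)"
        unfolding w_def .
      moreover have "cis (- (x * of_int n)) * (of_real \<sigma> * cnj (synth Fn x) - of_real \<kappa> * v x - synth Fn x * (v x)\<^sup>2)
          + - \<i> * of_int n * cis (- (x * of_int n)) * v x
          = of_real \<sigma> * cnj (synth F x) - (of_real \<kappa> + \<i> * of_int n) * w x - synth F x * (w x)\<^sup>2"
      proof -
        let ?e = "cis (- (x * of_int n))"
        have e: "?e * cnj ?e = 1"
          by (simp add: cis_cnj cis_mult)
        have "?e * (of_real \<sigma> * (cnj ?e * q') - of_real \<kappa> * v' - ?e * q * v'\<^sup>2) + - \<i> * of_int n * ?e * v'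
          = (?e * cnj ?e) * of_real \<sigma> * q' - (of_real \<kappa> + \<i> * of_int n) * (?e * v') - q * (?e * v')\<^sup>2" for q q' v'
          by (simp only: algebra_simps power2_eq_square) simp
        from this[of "cnj (synth F x)" "v x" "synth F x"] show ?thesis
          unfolding sFn w_def e complex_cnj_mult by simp
      qed
      ultimately show "(w has_vector_derivative (of_real \<sigma> * cnj (synth F x) - (of_real \<kappa> + \<i> * of_int n) * w x - synth F x * (w x)\<^sup>2)) (at x)"
        by (simp only:)
      show "norm (w x) \<le> 1 / 2"
        unfolding nw by (rule v(2))
    qed
    show "w (x + L) = w x" for x
    proof -
      have "cis (- ((x + L) * of_int n)) = cis (- (x * of_int n)) * cis (L * \<iota> (- emb n))"
        by (simp add: cis_mult emb algebra_simps)
      then show ?thesis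
        by (simp add: w_def v(3) cis_LX del: \<iota>_minus)
    qed
    let ?V = "ennreal \<kappa> * (\<integral>\<^sup>+x. ennreal ((norm (v x))\<^sup>2) \<partial>X)"
    have "ennreal (A F \<kappa> n) \<le> ennreal \<kappa> * (2 * (\<integral>\<^sup>+x. ennreal ((norm (v x))\<^sup>2) \<partial>X) + 2 * (\<integral>\<^sup>+x. ennreal ((norm (?w1 x - v x))\<^sup>2) \<partial>X))"
      unfolding U1[symmetric] by (intro mult_left_mono nn_sq_add_le) simp_all
    also have "\<dots> = 2 * ?V + 2 * (ennreal \<kappa> * (\<integral>\<^sup>+x. ennreal ((norm (v x - ?w1 x))\<^sup>2) \<partial>X))"
      by (simp only: distrib_left mult.left_commute norm_minus_commute[of "?w1 _"])
    also have "\<dots> \<le> 2 * ?V + 2 * ennreal (K1 * Bq F \<kappa> n ^ 3)"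
      by (intro add_left_mono mult_left_mono D) simp
    finally show "ennreal (A F \<kappa> n) \<le> 2 * (ennreal \<kappa> * (\<integral>\<^sup>+x. ennreal ((norm (w x))\<^sup>2) \<partial>X)) + 2 * ennreal (K1 * Bq F \<kappa> n ^ 3)"
      unfolding nw .
    have "?V \<le> ennreal \<kappa> * (2 * (\<integral>\<^sup>+x. ennreal ((norm (?w1 x))\<^sup>2) \<partial>X) + 2 * (\<integral>\<^sup>+x. ennreal ((norm (v x - ?w1 x))\<^sup>2) \<partial>X))"
      by (intro mult_left_mono nn_sq_add_le) simp_all
    also have "\<dots> = 2 * ennreal (A F \<kappa> n) + 2 * (ennreal \<kappa> * (\<integral>\<^sup>+x. ennreal ((norm (v x - ?w1 x))\<^sup>2) \<partial>X))"
      unfolding U1[symmetric] by (simp only: distrib_left mult.left_commute)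
    also have "\<dots> \<le> 2 * ennreal (A F \<kappa> n) + 2 * ennreal (K1 * Bq F \<kappa> n ^ 3)"
      by (intro add_left_mono mult_left_mono D) simp
    finally show "ennreal \<kappa> * (\<integral>\<^sup>+x. ennreal ((norm (w x))\<^sup>2) \<partial>X) \<le> 2 * ennreal (A F \<kappa> n) + 2 * ennreal (K1 * Bq F \<kappa> n ^ 3)"
      unfolding nw .
  qed
qed

definition DD :: real where "DD = K1 powr P * (CB ^ 3 * gz (3 / 2))"

lemma DD_pos: "DD > 0"
  using K1_pos CB_pos gz_pos[of "3 / 2"] by (simp add: DD_def)

text \<open>Stated for abstract sequences because it is used in both directions: with a = A and e
  the energy at time t, and with the roles exchanged at time 0. The factor 6^P is 2^P from splitting
  a P-th power times 3^P.\<close>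

lemma sum_powr_perturb:
  assumes F: "bdd F" and \<kappa>: "\<kappa> \<ge> 1" and N: "Nn F \<kappa> \<le> ennreal N" "N \<ge> 0"
    and a: "\<And>n. 0 \<le> a n" and e: "\<And>n. 0 \<le> e n"
    and le: "\<And>n. a n \<le> 3 * e n + 3 * (K1 * Bq F \<kappa> n ^ 3)"
  shows "(\<integral>\<^sup>+n. ennreal (1 / \<kappa> * a n powr P) \<partial>count_space UNIV)
     \<le> ennreal (6 powr P) * (\<integral>\<^sup>+n. ennreal (1 / \<kappa> * e n powr P) \<partial>count_space (UNIV :: int set)) + ennreal (6 powr P * (DD * N ^ 3))"
proof -
  have B0: "Bq F \<kappa> n \<ge> 0" for n using \<kappa> by (intro Bq_nonneg) auto
  have pt: "1 / \<kappa> * a n powr P \<le> 6 powr P * (1 / \<kappa> * e n powr P) + 6 powr P * K1 powr P * (1 / \<kappa> * (Bq F \<kappa> n powr P) ^ 3)" for n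
  proof -
    have "a n powr P \<le> (3 * e n + 3 * (K1 * Bq F \<kappa> n ^ 3)) powr P"
      using a le P by (intro powr_mono2) auto
    also have "\<dots> \<le> 2 powr P * ((3 * e n) powr P + (3 * (K1 * Bq F \<kappa> n ^ 3)) powr P)"
      using e B0 K1_pos P by (intro powr_sum_le) auto
    also have "\<dots> = 6 powr P * e n powr P + 6 powr P * K1 powr P * (Bq F \<kappa> n powr P) ^ 3"
    proof -
      have "(6::real) powr P = 2 powr P * 3 powr P"
        by (simp add: powr_mult[symmetric])
      moreover have "(Bq F \<kappa> n ^ 3) powr P = (Bq F \<kappa> n powr P) ^ 3"
        using B0[of n] by (simp add: power3_eq_cube powr_mult)
      ultimately show ?thesis
        using e B0 K1_pos by (simp add: powr_mult distrib_left)
    qed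
    finally have "1 / \<kappa> * a n powr P \<le> 1 / \<kappa> * (6 powr P * e n powr P + 6 powr P * K1 powr P * (Bq F \<kappa> n powr P) ^ 3)"
      using \<kappa> by (intro mult_left_mono) auto
    then show ?thesis by (simp only: distrib_left mult_ac)
  qed
  have "(\<integral>\<^sup>+n. ennreal (1 / \<kappa> * a n powr P) \<partial>count_space UNIV)
    \<le> (\<integral>\<^sup>+n. ennreal (6 powr P) * ennreal (1 / \<kappa> * e n powr P) + ennreal (6 powr P * K1 powr P) * ennreal (1 / \<kappa> * (Bq F \<kappa> n powr P) ^ 3) \<partial>count_space UNIV)"
    using pt \<kappa> by (intro nn_integral_mono) (simp add: ennreal_mult[symmetric] ennreal_plus[symmetric] ennreal_leI del: ennreal_plus)
  also have "\<dots> = ennreal (6 powr P) * (\<integral>\<^sup>+n. ennreal (1 / \<kappa> * e n powr P) \<partial>count_space UNIV)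
     + ennreal (6 powr P * K1 powr P) * (\<integral>\<^sup>+n. ennreal (1 / \<kappa> * (Bq F \<kappa> n powr P) ^ 3) \<partial>count_space UNIV)"
    by (subst nn_integral_add) (simp_all add: nn_integral_cmult)
  also have "\<dots> \<le> ennreal (6 powr P) * (\<integral>\<^sup>+n. ennreal (1 / \<kappa> * e n powr P) \<partial>count_space UNIV)
     + ennreal (6 powr P * K1 powr P) * ennreal (CB ^ 3 * gz (3 / 2) * N ^ 3)"
    by (intro add_left_mono mult_left_mono sum_B_powr_le F \<kappa> N) auto
  also have "ennreal (6 powr P * K1 powr P) * ennreal (CB ^ 3 * gz (3 / 2) * N ^ 3) = ennreal (6 powr P * (DD * N ^ 3))"
    using K1_pos CB_pos gz_pos[of "3 / 2"] N by (subst ennreal_mult[symmetric]) (auto simp: DD_def mult_ac)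
  finally show ?thesis .
qed

end

lemma lorentz_le_bracket:
  fixes a \<kappa> :: real
  assumes "\<kappa> > 0"
  shows "1 / (1 + (a / \<kappa>)\<^sup>2) \<le> 2 * (1 + \<bar>a\<bar> / \<kappa>) powr - 2"
proof -
  define t where "t = \<bar>a\<bar> / \<kappa>"
  have t: "t \<ge> 0" using assms by (simp add: t_def)
  have "(1 + t)\<^sup>2 \<le> 2 * (1 + t\<^sup>2)"
    using square_one_plus_le[of t] by simp
  then have "1 / (1 + t\<^sup>2) \<le> 2 / (1 + t)\<^sup>2"
    using t by (simp add: field_simps add_pos_nonneg)
  moreover have "(1 + t) powr - 2 = 1 / (1 + t)\<^sup>2"
    using t by (simp add: powr_minus_divide)
  moreover have "(a / \<kappa>)\<^sup>2 = t\<^sup>2"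
    by (simp add: t_def power_divide)
  ultimately show ?thesis
    by (simp add: t_def)
qed

section \<open>Finiteness and continuity of the sum N, and its comparison with unit-cell
  masses\<close>

context geom
begin

definition NR :: "('g \<Rightarrow> complex) \<Rightarrow> real \<Rightarrow> real" where
  "NR F \<kappa> = 1 / \<kappa> * (LINT n|count_space UNIV. A F \<kappa> n powr P)"

lemma sum_A_finite:
  assumes F: "bdd F" and \<kappa>: "\<kappa> \<ge> 1"
  obtains S where "S \<ge> 0" "(\<integral>\<^sup>+n. ennreal (A F \<kappa> n) \<partial>count_space UNIV) \<le> ennreal S"
proof -
  have [measurable]: "F \<in> borel_measurable M" using F by (auto simp: bdd_def)
  let ?h = "\<lambda>\<xi> n. 1 / (1 + ((\<iota> \<xi> - of_int n) / \<kappa>)\<^sup>2)"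
  have h: "(\<integral>\<^sup>+n. ennreal (?h \<xi> n) \<partial>count_space UNIV) \<le> ennreal (2 * (\<kappa> * gz 2))" for \<xi>
  proof -
    have "(\<integral>\<^sup>+n. ennreal (?h \<xi> n) \<partial>count_space UNIV) \<le> (\<integral>\<^sup>+n. ennreal 2 * ennreal ((1 + \<bar>of_int n - \<iota> \<xi>\<bar> / \<kappa>) powr - 2) \<partial>count_space UNIV)"
    proof (rule nn_integral_mono)
      fix n :: int
      have "?h \<xi> n \<le> 2 * (1 + \<bar>of_int n - \<iota> \<xi>\<bar> / \<kappa>) powr - 2"
        unfolding abs_minus_commute[of "of_int n"] using \<kappa> by (intro lorentz_le_bracket) auto
      then have "ennreal (?h \<xi> n) \<le> ennreal (2 * (1 + \<bar>of_int n - \<iota> \<xi>\<bar> / \<kappa>) powr - 2)"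
        by (rule ennreal_leI)
      then show "ennreal (?h \<xi> n) \<le> ennreal 2 * ennreal ((1 + \<bar>of_int n - \<iota> \<xi>\<bar> / \<kappa>) powr - 2)"
        by (subst ennreal_mult[symmetric]) auto
    qed
    also have "\<dots> = ennreal 2 * (\<integral>\<^sup>+n. ennreal ((1 + \<bar>of_int n - \<iota> \<xi>\<bar> / \<kappa>) powr - 2) \<partial>count_space UNIV)"
      by (rule nn_integral_cmult) simp
    also have "\<dots> \<le> ennreal 2 * ennreal (\<kappa> * gz 2)"
      by (intro mult_left_mono sum_bracket \<kappa>) auto
    also have "\<dots> = ennreal (2 * (\<kappa> * gz 2))"
      using \<kappa> gz_pos[of 2] by (intro ennreal_mult[symmetric]) auto
    finally show ?thesis .
  qed
  have "(\<integral>\<^sup>+n. ennreal (A F \<kappa> n) \<partial>count_space UNIV)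
      = (\<integral>\<^sup>+n. ennreal (2 * pi / \<kappa>) * (\<integral>\<^sup>+\<xi>. ennreal ((norm (F \<xi>))\<^sup>2 * ?h \<xi> n) \<partial>M) \<partial>count_space UNIV)"
    using \<kappa> by (intro nn_integral_cong A_nn F) auto
  also have "\<dots> = ennreal (2 * pi / \<kappa>) * (\<integral>\<^sup>+n. (\<integral>\<^sup>+\<xi>. ennreal ((norm (F \<xi>))\<^sup>2 * ?h \<xi> n) \<partial>M) \<partial>count_space UNIV)"
    by (rule nn_integral_cmult) simp
  also have "(\<integral>\<^sup>+n. (\<integral>\<^sup>+\<xi>. ennreal ((norm (F \<xi>))\<^sup>2 * ?h \<xi> n) \<partial>M) \<partial>count_space UNIV)
     = (\<integral>\<^sup>+\<xi>. (\<integral>\<^sup>+n. ennreal ((norm (F \<xi>))\<^sup>2 * ?h \<xi> n) \<partial>count_space UNIV) \<partial>M)"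
    by (rule nn_integral_count_space_nn_integral[symmetric]) auto
  also have "\<dots> \<le> (\<integral>\<^sup>+\<xi>. ennreal ((norm (F \<xi>))\<^sup>2) * ennreal (2 * (\<kappa> * gz 2)) \<partial>M)"
  proof (rule nn_integral_mono)
    fix \<xi>
    have "(\<integral>\<^sup>+n. ennreal ((norm (F \<xi>))\<^sup>2 * ?h \<xi> n) \<partial>count_space UNIV) = ennreal ((norm (F \<xi>))\<^sup>2) * (\<integral>\<^sup>+n. ennreal (?h \<xi> n) \<partial>count_space UNIV)"
    proof -
      have e: "ennreal ((norm (F \<xi>))\<^sup>2 * ?h \<xi> n) = ennreal ((norm (F \<xi>))\<^sup>2) * ennreal (?h \<xi> n)" for n
        by (intro ennreal_mult) auto
      show ?thesis
        unfolding e by (rule nn_integral_cmult) simp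
    qed
    also have "\<dots> \<le> ennreal ((norm (F \<xi>))\<^sup>2) * ennreal (2 * (\<kappa> * gz 2))"
      by (intro mult_left_mono h) simp
    finally show "(\<integral>\<^sup>+n. ennreal ((norm (F \<xi>))\<^sup>2 * ?h \<xi> n) \<partial>count_space UNIV) \<le> \<dots>" .
  qed
  also have "\<dots> = (\<integral>\<^sup>+\<xi>. ennreal ((norm (F \<xi>))\<^sup>2) \<partial>M) * ennreal (2 * (\<kappa> * gz 2))"
    by (rule nn_integral_multc) simp
  also have "(\<integral>\<^sup>+\<xi>. ennreal ((norm (F \<xi>))\<^sup>2) \<partial>M) = ennreal (LINT \<xi>|M. (norm (F \<xi>))\<^sup>2)"
    by (rule nn_integral_eq_integral[OF bdd_square[OF F]]) simp
  finally have "(\<integral>\<^sup>+n. ennreal (A F \<kappa> n) \<partial>count_space UNIV) \<le> ennreal (2 * pi / \<kappa>) * (ennreal (LINT \<xi>|M. (norm (F \<xi>))\<^sup>2) * ennreal (2 * (\<kappa> * gz 2)))"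
    by (simp add: mult_left_mono)
  also have "\<dots> = ennreal (2 * pi / \<kappa> * ((LINT \<xi>|M. (norm (F \<xi>))\<^sup>2) * (2 * (\<kappa> * gz 2))))"
    using \<kappa> gz_pos[of 2] by (subst ennreal_mult[symmetric], simp, simp, subst ennreal_mult[symmetric]) auto
  finally have f: "(\<integral>\<^sup>+n. ennreal (A F \<kappa> n) \<partial>count_space UNIV) \<le> ennreal (2 * pi / \<kappa> * ((LINT \<xi>|M. (norm (F \<xi>))\<^sup>2) * (2 * (\<kappa> * gz 2))))" .
  show ?thesis
    by (rule that[OF _ f]) (use \<kappa> gz_pos[of 2] in auto)
qed

lemma A_powr_integrable:
  assumes F: "bdd F" and \<kappa>: "\<kappa> \<ge> 1"
  shows "integrable (count_space UNIV) (\<lambda>n. A F \<kappa> n powr P)"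
proof -
  obtain S where S: "S \<ge> 0" "(\<integral>\<^sup>+n. ennreal (A F \<kappa> n) \<partial>count_space UNIV) \<le> ennreal S"
    using sum_A_finite[OF F \<kappa>] by blast
  have A0: "A F \<kappa> n \<ge> 0" for n using \<kappa> by (intro A_nonneg) auto
  have "(\<integral>\<^sup>+n. ennreal (A F \<kappa> n powr P) \<partial>count_space UNIV) \<le> ennreal (S powr P)"
    by (rule powr_superadditive[OF A0 P S(1) _ S(2)]) simp
  then show ?thesis
    by (intro integrableI_bounded) (auto simp: order_le_less_trans)
qed

lemma Nn_eq:
  assumes F: "bdd F" and \<kappa>: "\<kappa> \<ge> 1"
  shows "Nn F \<kappa> = ennreal (NR F \<kappa>)"
proof -
  have "Nn F \<kappa> = ennreal (LINT n|count_space UNIV. 1 / \<kappa> * A F \<kappa> n powr P)"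
    unfolding Nn_def using \<kappa> by (intro nn_integral_eq_integral integrable_mult_right A_powr_integrable F) auto
  then show ?thesis
    by (simp add: NR_def)
qed

lemma NR_nonneg: "\<kappa> \<ge> 1 \<Longrightarrow> NR F \<kappa> \<ge> 0"
  unfolding NR_def by (intro mult_nonneg_nonneg integral_nonneg_AE) auto

lemma bdd_decay: "bdd (\<lambda>\<xi>. of_real (K * (1 + \<bar>\<iota> \<xi>\<bar>) powr - 2))"
proof -
  have "(\<integral>\<^sup>+\<xi>. ennreal ((1 + \<bar>\<iota> \<xi>\<bar>) powr - 2) \<partial>M) \<le> ennreal (gc 2)"
    using growth_gc[of 1 2] by simp
  then have "integrable M (\<lambda>\<xi>. (1 + \<bar>\<iota> \<xi>\<bar>) powr - 2)"
    by (intro integrableI_bounded) (auto simp: order_le_less_trans)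
  then have "integrable M (\<lambda>\<xi>. complex_of_real (K * (1 + \<bar>\<iota> \<xi>\<bar>) powr - 2))"
    by (intro integrable_of_real integrable_mult_right)
  moreover have "norm (complex_of_real (K * (1 + \<bar>\<iota> \<xi>\<bar>) powr - 2)) \<le> \<bar>K\<bar>" for \<xi>
    using bracket_le1[of 1 2 "\<iota> \<xi>"] by (simp add: norm_mult abs_mult mult_left_le)
  ultimately show ?thesis
    unfolding bdd_def by blast
qed

lemma A_mono:
  assumes F: "F \<in> borel_measurable M" and H: "bdd H" and le: "\<And>\<xi>. norm (F \<xi>) \<le> norm (H \<xi>)" and \<kappa>: "\<kappa> > 0"
  shows "A F \<kappa> n \<le> A H \<kappa> n"
proof -
  have [measurable]: "F \<in> borel_measurable M" "H \<in> borel_measurable M" using F H by (auto simp: bdd_def)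
  let ?h = "\<lambda>\<xi>. 1 / (1 + ((\<iota> \<xi> - of_int n) / \<kappa>)\<^sup>2)"
  have iH: "integrable M (\<lambda>\<xi>. (norm (H \<xi>))\<^sup>2 * ?h \<xi>)"
    by (rule bdd_square_weight(1)[OF H]) (use lorentz_le1 in auto)
  have pt: "(norm (F \<xi>))\<^sup>2 * ?h \<xi> \<le> (norm (H \<xi>))\<^sup>2 * ?h \<xi>" for \<xi>
    using le by (intro mult_right_mono power_mono) auto
  have iF: "integrable M (\<lambda>\<xi>. (norm (F \<xi>))\<^sup>2 * ?h \<xi>)"
    by (rule Bochner_Integration.integrable_bound[OF iH]) (use pt in \<open>auto intro!: AE_I2\<close>)
  show ?thesis
    unfolding A_def using \<kappa> by (intro mult_left_mono integral_mono iF iH pt) auto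
qed

lemma A_LIMSEQ:
  fixes G :: "nat \<Rightarrow> 'g \<Rightarrow> complex"
  assumes [measurable]: "\<And>i. G i \<in> borel_measurable M" "G0 \<in> borel_measurable M"
    and dom: "\<And>i \<xi>. norm (G i \<xi>) \<le> K * (1 + \<bar>\<iota> \<xi>\<bar>) powr - 2"
    and lim: "\<And>\<xi>. (\<lambda>i. G i \<xi>) \<longlonglongrightarrow> G0 \<xi>"
  shows "(\<lambda>i. A (G i) \<kappa> n) \<longlonglongrightarrow> A G0 \<kappa> n"
  unfolding A_def
proof (rule tendsto_mult_left, rule integral_dominated_convergence)
  let ?H = "\<lambda>\<xi>. complex_of_real (K * (1 + \<bar>\<iota> \<xi>\<bar>) powr - 2)"
  show "integrable M (\<lambda>\<xi>. (norm (?H \<xi>))\<^sup>2)"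
    by (rule bdd_square[OF bdd_decay])
  show "AE \<xi> in M. (\<lambda>i. (norm (G i \<xi>))\<^sup>2 * (1 / (1 + ((\<iota> \<xi> - of_int n) / \<kappa>)\<^sup>2))) \<longlonglongrightarrow> (norm (G0 \<xi>))\<^sup>2 * (1 / (1 + ((\<iota> \<xi> - of_int n) / \<kappa>)\<^sup>2))"
    by (intro AE_I2 tendsto_mult_right tendsto_power tendsto_norm lim)
  fix i
  show "AE \<xi> in M. norm ((norm (G i \<xi>))\<^sup>2 * (1 / (1 + ((\<iota> \<xi> - of_int n) / \<kappa>)\<^sup>2))) \<le> (norm (?H \<xi>))\<^sup>2"
  proof (rule AE_I2)
    fix \<xi>
    have "norm (G i \<xi>) \<le> norm (?H \<xi>)"
      using dom[of i \<xi>] by (simp add: norm_mult) (metis abs_mult abs_ge_self order_trans abs_of_nonneg powr_ge_zero)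
    then have "(norm (G i \<xi>))\<^sup>2 * (1 / (1 + ((\<iota> \<xi> - of_int n) / \<kappa>)\<^sup>2)) \<le> (norm (?H \<xi>))\<^sup>2 * 1"
      by (intro mult_mono power_mono lorentz_le1) auto
    then show "norm ((norm (G i \<xi>))\<^sup>2 * (1 / (1 + ((\<iota> \<xi> - of_int n) / \<kappa>)\<^sup>2))) \<le> (norm (?H \<xi>))\<^sup>2"
      by simp
  qed
qed measurable

text \<open>Dominated convergence twice: under the frequency integral (\<open>A_LIMSEQ\<close>), and
  in the sum over n, where the powers of \<open>A\<close> for the profile K (1 + |\<xi>|)^(-2)
  dominate.\<close>

lemma NR_LIMSEQ:
  fixes G :: "nat \<Rightarrow> 'g \<Rightarrow> complex"
  assumes [measurable]: "\<And>i. G i \<in> borel_measurable M" "G0 \<in> borel_measurable M"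
    and dom: "\<And>i \<xi>. norm (G i \<xi>) \<le> K * (1 + \<bar>\<iota> \<xi>\<bar>) powr - 2"
    and lim: "\<And>\<xi>. (\<lambda>i. G i \<xi>) \<longlonglongrightarrow> G0 \<xi>" and \<kappa>: "\<kappa> \<ge> 1"
  shows "(\<lambda>i. NR (G i) \<kappa>) \<longlonglongrightarrow> NR G0 \<kappa>"
  unfolding NR_def
proof (rule tendsto_mult_left, rule integral_dominated_convergence)
  let ?H = "\<lambda>\<xi>. complex_of_real (K * (1 + \<bar>\<iota> \<xi>\<bar>) powr - 2)"
  have A0: "A F \<kappa> n \<ge> 0" for F n using \<kappa> by (intro A_nonneg) auto
  show "integrable (count_space UNIV) (\<lambda>n. A ?H \<kappa> n powr P)"
    by (rule A_powr_integrable[OF bdd_decay \<kappa>])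
  show "AE n in count_space UNIV. (\<lambda>i. A (G i) \<kappa> n powr P) \<longlonglongrightarrow> A G0 \<kappa> n powr P"
    using P A0 by (intro AE_I2 tendsto_powr' A_LIMSEQ[OF assms(1,2) dom lim] tendsto_const) (auto intro!: always_eventually)
  fix i
  have le: "norm (G i \<xi>) \<le> norm (?H \<xi>)" for \<xi>
    using dom[of i \<xi>] by (simp add: norm_mult) (metis abs_mult abs_ge_self order_trans abs_of_nonneg powr_ge_zero)
  show "AE n in count_space UNIV. norm (A (G i) \<kappa> n powr P) \<le> A ?H \<kappa> n powr P"
    using A_mono[OF assms(1)[of i] bdd_decay le] \<kappa> A0 P by (intro AE_I2) (auto intro!: powr_mono2)
qed auto

definition Gm :: "('g \<Rightarrow> complex) \<Rightarrow> int \<Rightarrow> real" where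
  "Gm F m = (LINT \<xi>|M. (norm (F \<xi>))\<^sup>2 * indicator {\<xi>. \<lfloor>\<iota> \<xi>\<rfloor> = m} \<xi>)"

text \<open>On the integers each cell is a single frequency, so this is the p-th power of the
  Fourier-Lebesgue norm up to a constant; on the line it is comparable to the p-th power of the
  modulation norm.\<close>

definition SG :: "('g \<Rightarrow> complex) \<Rightarrow> ennreal" where
  "SG F = (\<integral>\<^sup>+m. ennreal (Gm F m powr P) \<partial>count_space UNIV)"

lemma floor_measurable [measurable]: "(\<lambda>\<xi>. \<lfloor>\<iota> \<xi>\<rfloor>) \<in> M \<rightarrow>\<^sub>M count_space UNIV"
  by (rule measurable_compose[OF \<iota>_meas measurable_real_floor])

lemma cell_sets [measurable]: "{\<xi>. \<lfloor>\<iota> \<xi>\<rfloor> = m} \<in> sets M"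
proof -
  have "{\<xi> \<in> space M. \<lfloor>\<iota> \<xi>\<rfloor> = m} \<in> sets M"
    by measurable
  then show ?thesis by (simp add: space_M)
qed

lemma Gm_nn:
  assumes "bdd F"
  shows "ennreal (Gm F m) = (\<integral>\<^sup>+\<xi>. ennreal ((norm (F \<xi>))\<^sup>2) * indicator {\<xi>. \<lfloor>\<iota> \<xi>\<rfloor> = m} \<xi> \<partial>M)"
proof -
  have "ennreal (Gm F m) = (\<integral>\<^sup>+\<xi>. ennreal ((norm (F \<xi>))\<^sup>2 * indicator {\<xi>. \<lfloor>\<iota> \<xi>\<rfloor> = m} \<xi>) \<partial>M)"
    unfolding Gm_def by (rule bdd_square_weight(2)[OF assms]) (auto simp: indicator_def)
  then show ?thesis
    by (simp add: ennreal_mult'' ennreal_indicator)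
qed

lemma Gm_nonneg: "Gm F m \<ge> 0"
  unfolding Gm_def by (intro integral_nonneg_AE AE_I2) auto

definition C2 :: real where "C2 = (16 * pi) powr P * gz 2 powr P"

lemma C2_pos: "C2 > 0"
  using gz_pos[of 2] by (simp add: C2_def)

text \<open>A_n is bounded by an average of the cell masses against (1 + |m - n| / \<kappa>)^(-2) /
  \<kappa>, whose sum over m, and likewise over n, is at most \<open>gz 2\<close>. Jensen's
  inequality uses the first and the exchanged sum the second, so the prefactor 1 / \<kappa>
  survives. Here 16 pi = 2 pi * 8, and 8 = 2 * 2^2 compares the Lorentzian at \<xi> with the bracket
  at its cell.\<close>

lemma Nn_le_SG:
  assumes F: "bdd F" and \<kappa>: "\<kappa> \<ge> 1"
  shows "Nn F \<kappa> \<le> ennreal (C2 / \<kappa>) * SG F"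
proof -
  have [measurable]: "F \<in> borel_measurable M" using F by (auto simp: bdd_def)
  let ?w = "\<lambda>n m. 1 / \<kappa> * (1 + \<bar>real_of_int m - of_int n\<bar> / \<kappa>) powr - 2"
  have A0: "A F \<kappa> n \<ge> 0" for n using \<kappa> by (intro A_nonneg) auto
  have A_le: "ennreal (A F \<kappa> n) \<le> (\<integral>\<^sup>+m. ennreal (?w n m * (16 * pi * Gm F m)) \<partial>count_space UNIV)" for n
  proof -
    let ?h = "\<lambda>\<xi>. 1 / (1 + ((\<iota> \<xi> - of_int n) / \<kappa>)\<^sup>2)"
    have "(\<integral>\<^sup>+\<xi>. ennreal ((norm (F \<xi>))\<^sup>2 * ?h \<xi>) \<partial>M) = (\<integral>\<^sup>+m. (\<integral>\<^sup>+\<xi>. ennreal ((norm (F \<xi>))\<^sup>2 * ?h \<xi>) * indicator {\<xi>. \<lfloor>\<iota> \<xi>\<rfloor> = m} \<xi> \<partial>M) \<partial>count_space UNIV)"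
      by (rule nn_integral_floor_partition[OF _ \<iota>_meas sigma_finite_measure_axioms]) measurable
    also have "\<dots> \<le> (\<integral>\<^sup>+m. ennreal (8 * (1 + \<bar>real_of_int m - of_int n\<bar> / \<kappa>) powr - 2) * ennreal (Gm F m) \<partial>count_space UNIV)"
    proof (rule nn_integral_mono)
      fix m
      let ?c = "8 * (1 + \<bar>real_of_int m - of_int n\<bar> / \<kappa>) powr - 2"
      have "(\<integral>\<^sup>+\<xi>. ennreal ((norm (F \<xi>))\<^sup>2 * ?h \<xi>) * indicator {\<xi>. \<lfloor>\<iota> \<xi>\<rfloor> = m} \<xi> \<partial>M)
        \<le> (\<integral>\<^sup>+\<xi>. ennreal ?c * (ennreal ((norm (F \<xi>))\<^sup>2) * indicator {\<xi>. \<lfloor>\<iota> \<xi>\<rfloor> = m} \<xi>) \<partial>M)"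
      proof (rule nn_integral_mono)
        fix \<xi>
        have "?h \<xi> \<le> ?c" if "\<lfloor>\<iota> \<xi>\<rfloor> = m"
        proof -
          have "?h \<xi> \<le> 2 * (1 + \<bar>\<iota> \<xi> - of_int n\<bar> / \<kappa>) powr - 2"
            using \<kappa> by (intro lorentz_le_bracket) auto
          also have "(1 + \<bar>\<iota> \<xi> - of_int n\<bar> / \<kappa>) powr - 2 \<le> 2 powr 2 * (1 + \<bar>real_of_int m - of_int n\<bar> / \<kappa>) powr - 2"
            using floor_abs_le[of "\<iota> \<xi>" "of_int n"] that by (intro bracket_powr_double \<kappa>) auto
          finally show ?thesis by simp
        qed
        then have "ennreal ((norm (F \<xi>))\<^sup>2 * ?h \<xi>) \<le> ennreal (?c * (norm (F \<xi>))\<^sup>2)" if "\<lfloor>\<iota> \<xi>\<rfloor> = m"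
          using that by (subst mult.commute) (intro ennreal_leI mult_right_mono, auto)
        then show "ennreal ((norm (F \<xi>))\<^sup>2 * ?h \<xi>) * indicator {\<xi>. \<lfloor>\<iota> \<xi>\<rfloor> = m} \<xi>
            \<le> ennreal ?c * (ennreal ((norm (F \<xi>))\<^sup>2) * indicator {\<xi>. \<lfloor>\<iota> \<xi>\<rfloor> = m} \<xi>)"
          by (auto simp: indicator_def ennreal_mult)
      qed
      also have "\<dots> = ennreal ?c * ennreal (Gm F m)"
        unfolding Gm_nn[OF F] by (rule nn_integral_cmult) measurable
      finally show "(\<integral>\<^sup>+\<xi>. ennreal ((norm (F \<xi>))\<^sup>2 * ?h \<xi>) * indicator {\<xi>. \<lfloor>\<iota> \<xi>\<rfloor> = m} \<xi> \<partial>M) \<le> ennreal ?c * ennreal (Gm F m)" .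
    qed
    finally have "ennreal (A F \<kappa> n) \<le> ennreal (2 * pi / \<kappa>) * (\<integral>\<^sup>+m. ennreal (8 * (1 + \<bar>real_of_int m - of_int n\<bar> / \<kappa>) powr - 2) * ennreal (Gm F m) \<partial>count_space UNIV)"
      using A_nn[OF F, of \<kappa> n] \<kappa> by (simp add: mult_left_mono)
    also have "\<dots> = (\<integral>\<^sup>+m. ennreal (?w n m * (16 * pi * Gm F m)) \<partial>count_space UNIV)"
    proof (subst nn_integral_cmult[symmetric], simp, rule nn_integral_cong)
      fix m
      let ?p = "(1 + \<bar>real_of_int m - of_int n\<bar> / \<kappa>) powr - 2"
      have "ennreal (2 * pi / \<kappa>) * (ennreal (8 * ?p) * ennreal (Gm F m)) = ennreal (2 * pi / \<kappa> * (8 * ?p * Gm F m))"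
        using \<kappa> Gm_nonneg[of F m] by (subst ennreal_mult[symmetric], simp, simp, subst ennreal_mult[symmetric]) auto
      also have "2 * pi / \<kappa> * (8 * ?p * Gm F m) = ?w n m * (16 * pi * Gm F m)"
        by simp
      finally show "ennreal (2 * pi / \<kappa>) * (ennreal (8 * ?p) * ennreal (Gm F m)) = ennreal (?w n m * (16 * pi * Gm F m))" .
    qed
    finally show ?thesis .
  qed
  have tot: "(\<integral>\<^sup>+m. ennreal (1 / \<kappa> * (1 + \<bar>real_of_int m - x\<bar> / \<kappa>) powr - 2) \<partial>count_space UNIV) \<le> ennreal (gz 2)" for x
  proof -
    have "(\<integral>\<^sup>+m. ennreal (1 / \<kappa> * (1 + \<bar>real_of_int m - x\<bar> / \<kappa>) powr - 2) \<partial>count_space UNIV)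
      = ennreal (1 / \<kappa>) * (\<integral>\<^sup>+m. ennreal ((1 + \<bar>real_of_int m - x\<bar> / \<kappa>) powr - 2) \<partial>count_space UNIV)"
      using \<kappa> by (subst nn_integral_cmult[symmetric]) (auto simp: ennreal_mult[symmetric])
    also have "\<dots> \<le> ennreal (1 / \<kappa>) * ennreal (\<kappa> * gz 2)"
      by (intro mult_left_mono sum_bracket \<kappa>) auto
    also have "\<dots> = ennreal (gz 2)"
      using \<kappa> gz_pos[of 2] by (simp add: ennreal_mult[symmetric])
    finally show ?thesis .
  qed
  let ?C = "gz 2 powr (P - 1) * (16 * pi) powr P"
  have A_powr: "ennreal (A F \<kappa> n powr P) \<le> ennreal ?C * (\<integral>\<^sup>+m. ennreal (?w n m * Gm F m powr P) \<partial>count_space UNIV)" for n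
  proof -
    have "ennreal (A F \<kappa> n powr P) \<le> ennreal (gz 2 powr (P - 1)) * (\<integral>\<^sup>+m. ennreal (?w n m * (16 * pi * Gm F m) powr P) \<partial>count_space UNIV)"
      by (rule jensen_nn[OF _ _ _ _ P _ A0 tot A_le]) (use \<kappa> Gm_nonneg gz_pos[of 2] in auto)
    also have "(\<integral>\<^sup>+m. ennreal (?w n m * (16 * pi * Gm F m) powr P) \<partial>count_space UNIV) = (\<integral>\<^sup>+m. ennreal ((16 * pi) powr P) * ennreal (?w n m * Gm F m powr P) \<partial>count_space UNIV)"
    proof (rule nn_integral_cong)
      fix m
      have "?w n m * (16 * pi * Gm F m) powr P = (16 * pi) powr P * (?w n m * Gm F m powr P)"
        using Gm_nonneg[of F m] by (simp add: powr_mult)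
      then show "ennreal (?w n m * (16 * pi * Gm F m) powr P) = ennreal ((16 * pi) powr P) * ennreal (?w n m * Gm F m powr P)"
        using \<kappa> by (simp only:) (intro ennreal_mult, auto)
    qed
    also have "\<dots> = ennreal ((16 * pi) powr P) * (\<integral>\<^sup>+m. ennreal (?w n m * Gm F m powr P) \<partial>count_space UNIV)"
      by (rule nn_integral_cmult) simp
    finally show ?thesis
      by (simp add: ennreal_mult mult.assoc)
  qed
  have "Nn F \<kappa> \<le> (\<integral>\<^sup>+n. ennreal (?C / \<kappa>) * (\<integral>\<^sup>+m. ennreal (?w n m * Gm F m powr P) \<partial>count_space UNIV) \<partial>count_space UNIV)"
    unfolding Nn_def
  proof (rule nn_integral_mono)
    fix n
    have "ennreal (1 / \<kappa> * A F \<kappa> n powr P) = ennreal (1 / \<kappa>) * ennreal (A F \<kappa> n powr P)"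
      using \<kappa> by (intro ennreal_mult) auto
    also have "\<dots> \<le> ennreal (1 / \<kappa>) * (ennreal ?C * (\<integral>\<^sup>+m. ennreal (?w n m * Gm F m powr P) \<partial>count_space UNIV))"
      by (intro mult_left_mono A_powr) auto
    also have "\<dots> = ennreal (?C / \<kappa>) * (\<integral>\<^sup>+m. ennreal (?w n m * Gm F m powr P) \<partial>count_space UNIV)"
      using \<kappa> by (simp add: mult.assoc[symmetric] ennreal_mult[symmetric])
    finally show "ennreal (1 / \<kappa> * A F \<kappa> n powr P) \<le> \<dots>" .
  qed
  also have "\<dots> = ennreal (?C / \<kappa>) * (\<integral>\<^sup>+n. (\<integral>\<^sup>+m. ennreal (?w n m * Gm F m powr P) \<partial>count_space UNIV) \<partial>count_space UNIV)"
    by (rule nn_integral_cmult) simp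
  also have "(\<integral>\<^sup>+n. (\<integral>\<^sup>+m. ennreal (?w n m * Gm F m powr P) \<partial>count_space UNIV) \<partial>count_space UNIV)
     = (\<integral>\<^sup>+m. (\<integral>\<^sup>+n. ennreal (?w n m * Gm F m powr P) \<partial>count_space UNIV) \<partial>count_space UNIV)"
    by (rule nn_integral_count_space_nn_integral) auto
  also have "\<dots> \<le> (\<integral>\<^sup>+m. ennreal (gz 2) * ennreal (Gm F m powr P) \<partial>count_space UNIV)"
  proof (rule nn_integral_mono)
    fix m
    have "(\<integral>\<^sup>+n. ennreal (?w n m * Gm F m powr P) \<partial>count_space UNIV) = (\<integral>\<^sup>+n. ennreal (?w m n) \<partial>count_space UNIV) * ennreal (Gm F m powr P)"
      using \<kappa> by (subst nn_integral_multc[symmetric]) (auto simp: ennreal_mult[symmetric] abs_minus_commute)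
    also have "\<dots> \<le> ennreal (gz 2) * ennreal (Gm F m powr P)"
      by (intro mult_right_mono tot) auto
    finally show "(\<integral>\<^sup>+n. ennreal (?w n m * Gm F m powr P) \<partial>count_space UNIV) \<le> ennreal (gz 2) * ennreal (Gm F m powr P)" .
  qed
  also have "\<dots> = ennreal (gz 2) * SG F"
    unfolding SG_def by (rule nn_integral_cmult) simp
  finally have "Nn F \<kappa> \<le> ennreal (?C / \<kappa>) * (ennreal (gz 2) * SG F)"
    by (simp add: mult_left_mono)
  also have "\<dots> = ennreal (?C / \<kappa>) * ennreal (gz 2) * SG F"
    by (simp only: mult.assoc)
  also have "ennreal (?C / \<kappa>) * ennreal (gz 2) = ennreal (C2 / \<kappa>)"
  proof -
    have "?C / \<kappa> * gz 2 = C2 / \<kappa>"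
      using gz_pos[of 2] by (simp add: C2_def powr_diff)
    then show ?thesis
      using \<kappa> gz_pos[of 2] by (subst ennreal_mult[symmetric]) auto
  qed
  finally show ?thesis .
qed

text \<open>Cells with |m - n| <= \<kappa> lie within 2 \<kappa> of n, where the Lorentzian is at
  least 1/5 and 2 pi / 5 >= 1; so their masses over \<kappa> sum to at most A_n, and l^1 in l^P
  bounds the sum of P-th powers. Each m is near at least \<kappa> integers n. The loss against
  \<open>Nn_le_SG\<close> is \<kappa>^(P - 1), the origin of the growth factor in the
  theorem.\<close>

lemma SG_le_Nn:
  assumes F: "bdd F" and \<kappa>: "\<kappa> \<ge> 1"
  shows "SG F \<le> ennreal (\<kappa> powr P) * Nn F \<kappa>"
proof -
  have [measurable]: "F \<in> borel_measurable M" using F by (auto simp: bdd_def)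
  have A0: "A F \<kappa> n \<ge> 0" for n using \<kappa> by (intro A_nonneg) auto
  let ?I = "\<lambda>n m. if \<bar>real_of_int m - of_int n\<bar> \<le> \<kappa> then 1 else 0 :: real"
  have sum_le: "(\<integral>\<^sup>+m. ennreal (Gm F m / \<kappa> * ?I n m) \<partial>count_space UNIV) \<le> ennreal (A F \<kappa> n)" for n
  proof -
    let ?h = "\<lambda>\<xi>. 1 / (1 + ((\<iota> \<xi> - of_int n) / \<kappa>)\<^sup>2)"
    have "ennreal (Gm F m / \<kappa> * ?I n m) \<le> ennreal (2 * pi / \<kappa>) * (\<integral>\<^sup>+\<xi>. ennreal ((norm (F \<xi>))\<^sup>2 * ?h \<xi>) * indicator {\<xi>. \<lfloor>\<iota> \<xi>\<rfloor> = m} \<xi> \<partial>M)" for m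
    proof (cases "\<bar>real_of_int m - of_int n\<bar> \<le> \<kappa>")
      case True
      have "ennreal (Gm F m / \<kappa> * ?I n m) = ennreal (1 / \<kappa>) * ennreal (Gm F m)"
        using True \<kappa> Gm_nonneg[of F m] by (simp add: ennreal_mult[symmetric])
      also have "\<dots> \<le> ennreal (1 / \<kappa>) * (\<integral>\<^sup>+\<xi>. ennreal (2 * pi) * (ennreal ((norm (F \<xi>))\<^sup>2 * ?h \<xi>) * indicator {\<xi>. \<lfloor>\<iota> \<xi>\<rfloor> = m} \<xi>) \<partial>M)"
        unfolding Gm_nn[OF F]
      proof (intro mult_left_mono nn_integral_mono)
        fix \<xi>
        have "ennreal ((norm (F \<xi>))\<^sup>2) \<le> ennreal (2 * pi) * ennreal ((norm (F \<xi>))\<^sup>2 * ?h \<xi>)" if m: "\<lfloor>\<iota> \<xi>\<rfloor> = m"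
        proof -
          have "\<bar>\<iota> \<xi> - of_int n\<bar> \<le> 2 * \<kappa>"
            using abs_le_floor[of "\<iota> \<xi>" "of_int n"] True \<kappa> unfolding m by linarith
          then have "\<bar>(\<iota> \<xi> - of_int n) / \<kappa>\<bar> \<le> 2"
            using \<kappa> by (simp add: abs_divide divide_le_eq)
          then have "((\<iota> \<xi> - of_int n) / \<kappa>)\<^sup>2 \<le> 2\<^sup>2"
            by (metis abs_le_square_iff abs_numeral)
          then have "1 / 5 \<le> ?h \<xi>"
            by (intro frac_le) (auto simp: add_pos_nonneg)
          then have "2 * pi * ?h \<xi> \<ge> 2 * pi * (1 / 5)"
            by (intro mult_left_mono) auto
          then have "1 \<le> 2 * pi * ?h \<xi>"
            using pi_gt3 by linarith
          then have "(norm (F \<xi>))\<^sup>2 * 1 \<le> (norm (F \<xi>))\<^sup>2 * (2 * pi * ?h \<xi>)"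
            by (intro mult_left_mono) auto
          then have "ennreal ((norm (F \<xi>))\<^sup>2) \<le> ennreal (2 * pi * ((norm (F \<xi>))\<^sup>2 * ?h \<xi>))"
            by (intro ennreal_leI) (simp only: mult_1_right mult_ac)
          also have "\<dots> = ennreal (2 * pi) * ennreal ((norm (F \<xi>))\<^sup>2 * ?h \<xi>)"
            by (intro ennreal_mult) auto
          finally show ?thesis .
        qed
        then show "ennreal ((norm (F \<xi>))\<^sup>2) * indicator {\<xi>. \<lfloor>\<iota> \<xi>\<rfloor> = m} \<xi> \<le> ennreal (2 * pi) * (ennreal ((norm (F \<xi>))\<^sup>2 * ?h \<xi>) * indicator {\<xi>. \<lfloor>\<iota> \<xi>\<rfloor> = m} \<xi>)"
          by (cases "\<lfloor>\<iota> \<xi>\<rfloor> = m") auto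
      qed simp
      also have "\<dots> = ennreal (1 / \<kappa>) * (ennreal (2 * pi) * (\<integral>\<^sup>+\<xi>. ennreal ((norm (F \<xi>))\<^sup>2 * ?h \<xi>) * indicator {\<xi>. \<lfloor>\<iota> \<xi>\<rfloor> = m} \<xi> \<partial>M))"
        by (subst nn_integral_cmult) auto
      also have "\<dots> = ennreal (2 * pi / \<kappa>) * (\<integral>\<^sup>+\<xi>. ennreal ((norm (F \<xi>))\<^sup>2 * ?h \<xi>) * indicator {\<xi>. \<lfloor>\<iota> \<xi>\<rfloor> = m} \<xi> \<partial>M)"
        using \<kappa> by (simp add: mult.assoc[symmetric] ennreal_mult[symmetric])
      finally show ?thesis .
    qed auto
    then have "(\<integral>\<^sup>+m. ennreal (Gm F m / \<kappa> * ?I n m) \<partial>count_space UNIV)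
      \<le> (\<integral>\<^sup>+m. ennreal (2 * pi / \<kappa>) * (\<integral>\<^sup>+\<xi>. ennreal ((norm (F \<xi>))\<^sup>2 * ?h \<xi>) * indicator {\<xi>. \<lfloor>\<iota> \<xi>\<rfloor> = m} \<xi> \<partial>M) \<partial>count_space UNIV)"
      by (intro nn_integral_mono)
    also have "\<dots> = ennreal (2 * pi / \<kappa>) * (\<integral>\<^sup>+m. (\<integral>\<^sup>+\<xi>. ennreal ((norm (F \<xi>))\<^sup>2 * ?h \<xi>) * indicator {\<xi>. \<lfloor>\<iota> \<xi>\<rfloor> = m} \<xi> \<partial>M) \<partial>count_space UNIV)"
      by (rule nn_integral_cmult) simp
    also have "(\<integral>\<^sup>+m. (\<integral>\<^sup>+\<xi>. ennreal ((norm (F \<xi>))\<^sup>2 * ?h \<xi>) * indicator {\<xi>. \<lfloor>\<iota> \<xi>\<rfloor> = m} \<xi> \<partial>M) \<partial>count_space UNIV) = (\<integral>\<^sup>+\<xi>. ennreal ((norm (F \<xi>))\<^sup>2 * ?h \<xi>) \<partial>M)"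
      by (rule nn_integral_floor_partition[OF _ \<iota>_meas sigma_finite_measure_axioms, symmetric]) measurable
    finally show ?thesis
      using A_nn[OF F, of \<kappa> n] \<kappa> by simp
  qed
  have powr_le: "(\<integral>\<^sup>+m. ennreal ((Gm F m / \<kappa>) powr P * ?I n m) \<partial>count_space UNIV) \<le> ennreal (A F \<kappa> n powr P)" for n
  proof -
    have "(\<integral>\<^sup>+m. ennreal ((Gm F m / \<kappa> * ?I n m) powr P) \<partial>count_space UNIV) \<le> ennreal (A F \<kappa> n powr P)"
      by (rule powr_superadditive[OF _ P A0 _ sum_le]) (use \<kappa> Gm_nonneg in auto)
    moreover have "(Gm F m / \<kappa> * ?I n m) powr P = (Gm F m / \<kappa>) powr P * ?I n m" for m
      using P by auto
    ultimately show ?thesis by (simp only:)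
  qed
  have "SG F = (\<integral>\<^sup>+m. ennreal (\<kappa> powr P) * ennreal ((Gm F m / \<kappa>) powr P) \<partial>count_space UNIV)"
    unfolding SG_def using \<kappa> Gm_nonneg by (intro nn_integral_cong) (simp add: ennreal_mult[symmetric] powr_divide)
  also have "\<dots> = ennreal (\<kappa> powr P) * (\<integral>\<^sup>+m. ennreal ((Gm F m / \<kappa>) powr P) \<partial>count_space UNIV)"
    by (rule nn_integral_cmult) simp
  also have "(\<integral>\<^sup>+m. ennreal ((Gm F m / \<kappa>) powr P) \<partial>count_space UNIV) \<le> (\<integral>\<^sup>+m. (\<integral>\<^sup>+n. ennreal (1 / \<kappa>) * ennreal ((Gm F m / \<kappa>) powr P * ?I n m) \<partial>count_space UNIV) \<partial>count_space UNIV)"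
  proof (rule nn_integral_mono)
    fix m
    have "ennreal (\<kappa> * (1 / \<kappa> * (Gm F m / \<kappa>) powr P)) \<le> (\<integral>\<^sup>+n. ennreal (1 / \<kappa>) * ennreal ((Gm F m / \<kappa>) powr P * ?I n m) \<partial>count_space UNIV)"
      by (rule sum_near_ge[OF \<kappa>, where t = "of_int m"]) (use \<kappa> in \<open>auto simp: ennreal_mult[symmetric]\<close>)
    then show "ennreal ((Gm F m / \<kappa>) powr P) \<le> (\<integral>\<^sup>+n. ennreal (1 / \<kappa>) * ennreal ((Gm F m / \<kappa>) powr P * ?I n m) \<partial>count_space UNIV)"
      using \<kappa> by simp
  qed
  also have "(\<integral>\<^sup>+m. (\<integral>\<^sup>+n. ennreal (1 / \<kappa>) * ennreal ((Gm F m / \<kappa>) powr P * ?I n m) \<partial>count_space UNIV) \<partial>count_space UNIV)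
      = (\<integral>\<^sup>+n. (\<integral>\<^sup>+m. ennreal (1 / \<kappa>) * ennreal ((Gm F m / \<kappa>) powr P * ?I n m) \<partial>count_space UNIV) \<partial>count_space UNIV)"
    by (rule nn_integral_count_space_nn_integral) auto
  also have "\<dots> \<le> Nn F \<kappa>"
    unfolding Nn_def
  proof (rule nn_integral_mono)
    fix n
    have "(\<integral>\<^sup>+m. ennreal (1 / \<kappa>) * ennreal ((Gm F m / \<kappa>) powr P * ?I n m) \<partial>count_space UNIV) = ennreal (1 / \<kappa>) * (\<integral>\<^sup>+m. ennreal ((Gm F m / \<kappa>) powr P * ?I n m) \<partial>count_space UNIV)"
      by (rule nn_integral_cmult) simp
    also have "\<dots> \<le> ennreal (1 / \<kappa>) * ennreal (A F \<kappa> n powr P)"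
      by (intro mult_left_mono powr_le) simp
    also have "\<dots> = ennreal (1 / \<kappa> * A F \<kappa> n powr P)"
      using \<kappa> by (intro ennreal_mult[symmetric]) auto
    finally show "(\<integral>\<^sup>+m. ennreal (1 / \<kappa>) * ennreal ((Gm F m / \<kappa>) powr P * ?I n m) \<partial>count_space UNIV) \<le> ennreal (1 / \<kappa> * A F \<kappa> n powr P)" .
  qed
  finally show ?thesis
    by (simp add: mult_left_mono)
qed

end

lemma ennreal_le_realE:
  assumes "x \<le> ennreal y" "0 \<le> y"
  obtains e where "x = ennreal e" "0 \<le> e" "e \<le> y"
  using assms by (cases x) (auto simp: ennreal_le_iff top_unique)

section \<open>Smallness thresholds and final constants\<close>

context geom
begin

text \<open>36^P collects the two passages between \<open>A\<close> and the energy, 6^P each; 4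
  collects one factor 2 from absorbing the cubic term at time t and one from the cubic term at time
  0.\<close>

definition Qc :: real where "Qc = 4 * 36 powr P"

text \<open>The first entry makes every \<open>Bq\<close> small enough for the Riccati solutions to
  exist, since Bq^P <= CB N. The other two make the cubic term 6^P DD N^3 at most N / 2: one bounds
  \<eta>c, the other gives the required bound on \<eta>c^2.\<close>

definition \<eta>c :: real where
  "\<eta>c = min ((1 / (256 * gC0)) powr P / CB) (min 1 (1 / (2 * 6 powr P * DD)))"

lemma \<eta>c: "\<eta>c > 0" "CB * \<eta>c \<le> (1 / (256 * gC0)) powr P" "6 powr P * (DD * \<eta>c\<^sup>2) \<le> 1 / 2"
proof -
  show pos: "\<eta>c > 0"
    using CB_pos gC0_pos DD_pos by (simp add: \<eta>c_def)
  have "\<eta>c \<le> (1 / (256 * gC0)) powr P / CB"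
    by (simp add: \<eta>c_def)
  then show "CB * \<eta>c \<le> (1 / (256 * gC0)) powr P"
    using CB_pos by (simp add: pos_le_divide_eq mult.commute)
  have "\<eta>c \<le> 1" "\<eta>c \<le> 1 / (2 * 6 powr P * DD)"
    by (simp_all add: \<eta>c_def)
  then have "\<eta>c * \<eta>c \<le> 1 * (1 / (2 * 6 powr P * DD))"
    using pos by (intro mult_mono) auto
  then have "(6 powr P * DD) * \<eta>c\<^sup>2 \<le> (6 powr P * DD) * (1 / (2 * 6 powr P * DD))"
    using DD_pos by (intro mult_left_mono) (auto simp: power2_eq_square)
  then show "6 powr P * (DD * \<eta>c\<^sup>2) \<le> 1 / 2"
    using DD_pos by (simp add: mult.assoc)
qed

lemma Qc_ge: "Qc \<ge> 1"
proof -
  have "(1::real) \<le> 36 powr P"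
    using P by (intro ge_one_powr_ge_zero) auto
  then show ?thesis by (simp add: Qc_def)
qed

text \<open>Chosen so that Qc C2 / Kc <= \<eta>c / 2, which starts the continuity argument strictly
  below the threshold.\<close>

definition Kc :: real where "Kc = max 1 (2 * Qc * C2 / \<eta>c)"

definition Cf :: real where "Cf = (Qc * C2) powr (1 / (2 * P)) * Kc powr ((P - 1) / (2 * P))"

lemma Cf_pos: "Cf > 0"
proof -
  have "Qc * C2 > 0" "Kc > 0"
    using Qc_ge C2_pos by (auto simp: Kc_def)
  then show ?thesis
    unfolding Cf_def by (metis mult_pos_pos powr_gt_zero less_irrefl)
qed

lemma small_of_N:
  assumes F: "bdd F" and \<kappa>: "\<kappa> \<ge> 1" and N: "NR F \<kappa> \<le> \<eta>c"
  shows "256 * gC0 * Bq F \<kappa> n \<le> 1"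
proof -
  have B0: "Bq F \<kappa> n \<ge> 0" using \<kappa> by (intro Bq_nonneg) auto
  have "Bq F \<kappa> n powr P \<le> CB * \<eta>c"
    using N \<eta>c(1) by (intro B_powr_le_N[OF F \<kappa>]) (auto simp: Nn_eq[OF F \<kappa>] ennreal_leI)
  also have "\<dots> \<le> (1 / (256 * gC0)) powr P"
    by (rule \<eta>c(2))
  finally have "Bq F \<kappa> n \<le> 1 / (256 * gC0)"
  proof (rule contrapos_pp)
    assume "\<not> Bq F \<kappa> n \<le> 1 / (256 * gC0)"
    then have "(1 / (256 * gC0)) powr P < Bq F \<kappa> n powr P"
      using P gC0_pos by (intro powr_less_mono2) auto
    then show "\<not> Bq F \<kappa> n powr P \<le> (1 / (256 * gC0)) powr P" by simp
  qed
  then show ?thesis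
    using gC0_pos by (simp add: pos_le_divide_eq mult_ac)
qed

end

text \<open>\<open>Ft t\<close> is the Fourier transform of u t. The last two assumptions, pointwise
  continuity in time and decay of order -2 uniformly for nearby times, are what
  \<open>NR_LIMSEQ\<close> needs for N to be continuous in time.\<close>

locale flow_geom = mkdv_flow X L \<rho> \<sigma> u c + geom M \<iota> X L emb gc nice P
  for X :: "real measure" and L \<rho> \<sigma> u c and M :: "'g::ab_group_add measure" and \<iota> emb gc nice P +
  fixes Ft :: "real \<Rightarrow> 'g \<Rightarrow> complex"
  assumes bdd_Ft: "\<And>t. bdd (Ft t)" and nice_Ft: "\<And>t. nice (Ft t)"
    and repr: "\<And>t. u t = synth (Ft t)"
    and Ft_lim: "\<And>t \<xi>. ((\<lambda>s. Ft s \<xi>) \<longlongrightarrow> Ft t \<xi>) (at t)"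
    and Ft_dom: "\<And>t. \<exists>K d. d > 0 \<and> (\<forall>s \<xi>. \<bar>s - t\<bar> < d \<longrightarrow> norm (Ft s \<xi>) \<le> K * (1 + \<bar>\<iota> \<xi>\<bar>) powr - 2)"
begin

lemma NR_continuous:
  assumes \<kappa>: "\<kappa> \<ge> 1"
  shows "continuous_on UNIV (\<lambda>t. NR (Ft t) \<kappa>)"
  unfolding continuous_on_sequentially
proof (intro ballI allI impI, elim conjE)
  fix t :: real and T :: "nat \<Rightarrow> real" assume T: "T \<longlonglongrightarrow> t"
  obtain K d where d: "d > 0" "\<And>s \<xi>. \<bar>s - t\<bar> < d \<Longrightarrow> norm (Ft s \<xi>) \<le> K * (1 + \<bar>\<iota> \<xi>\<bar>) powr - 2"
    using Ft_dom[of t] by blast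
  obtain n0 where n0: "\<And>i. i \<ge> n0 \<Longrightarrow> \<bar>T i - t\<bar> < d"
    using T d(1) by (auto simp: LIMSEQ_iff)
  have "(\<lambda>i. NR (Ft (T (i + n0))) \<kappa>) \<longlonglongrightarrow> NR (Ft t) \<kappa>"
  proof (rule NR_LIMSEQ[OF _ _ _ _ \<kappa>])
    show "Ft (T (i + n0)) \<in> borel_measurable M" "Ft t \<in> borel_measurable M" for i
      using bddD(2)[OF bdd_Ft] by auto
    show "norm (Ft (T (i + n0)) \<xi>) \<le> K * (1 + \<bar>\<iota> \<xi>\<bar>) powr - 2" for i \<xi>
      by (intro d n0) simp
    show "(\<lambda>i. Ft (T (i + n0)) \<xi>) \<longlonglongrightarrow> Ft t \<xi>" for \<xi>
    proof -
      have "isCont (\<lambda>s. Ft s \<xi>) t"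
        using Ft_lim by (simp add: isCont_def)
      then show ?thesis
        using LIMSEQ_ignore_initial_segment[OF T] by (rule isCont_tendsto_compose)
    qed
  qed
  then show "((\<lambda>t. NR (Ft t) \<kappa>) \<circ> T) \<longlonglongrightarrow> NR (Ft t) \<kappa>"
    unfolding o_def by (rule LIMSEQ_offset)
qed

text \<open>By |w| <= 1/2 the denominator 1 - \<sigma> |w|^2 lies in [3/4, 5/4], so the energy is
  between 4/5 and 4/3 of \<kappa> times the squared L^2 norm of w. With the factors 2 from
  \<open>riccati_exists\<close> this gives 5/2 and 8/3, both below 3.\<close>

lemma energy_compare:
  assumes \<kappa>: "\<kappa> \<ge> 1" and w: "riccati \<sigma> (of_real \<kappa> + \<i> * of_int n) (u t) w"
    and le1: "ennreal (A (Ft t) \<kappa> n) \<le> 2 * (ennreal \<kappa> * (\<integral>\<^sup>+x. ennreal ((norm (w x))\<^sup>2) \<partial>X)) + 2 * ennreal (K1 * Bq (Ft t) \<kappa> n ^ 3)"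
    and le2: "ennreal \<kappa> * (\<integral>\<^sup>+x. ennreal ((norm (w x))\<^sup>2) \<partial>X) \<le> 2 * ennreal (A (Ft t) \<kappa> n) + 2 * ennreal (K1 * Bq (Ft t) \<kappa> n ^ 3)"
  defines "E \<equiv> \<kappa> * (LINT x|X. (norm (w x))\<^sup>2 / (1 - \<sigma> * (norm (w x))\<^sup>2))"
  shows "0 \<le> E" "A (Ft t) \<kappa> n \<le> 3 * E + 3 * (K1 * Bq (Ft t) \<kappa> n ^ 3)" "E \<le> 3 * A (Ft t) \<kappa> n + 3 * (K1 * Bq (Ft t) \<kappa> n ^ 3)"
proof -
  let ?N = "\<lambda>x. (norm (w x))\<^sup>2" and ?r = "\<lambda>x. (norm (w x))\<^sup>2 / (1 - \<sigma> * (norm (w x))\<^sup>2)"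
  let ?A = "A (Ft t) \<kappa> n" and ?B = "K1 * Bq (Ft t) \<kappa> n ^ 3"
  have AB: "?A \<ge> 0" "?B \<ge> 0"
    using A_nonneg[of \<kappa> "Ft t" n] Bq_nonneg[of \<kappa> "Ft t" n] \<kappa> K1_pos by auto
  have b: "3 / 4 \<le> 1 - \<sigma> * ?N x" "1 - \<sigma> * ?N x \<le> 5 / 4" for x
    using sigma_bounds[OF \<sigma>, of "norm (w x)"] riccatiD(2)[OF w, of x] by simp_all
  have cw: "continuous_on UNIV w"
    by (rule riccati_continuous[OF w])
  have k: "Re (of_real \<kappa> + \<i> * of_int n) > 0"
    using \<kappa> by simp
  have "dec (u t)"
    using dec_u[of 0 t] by simp
  then have decw: "dec w"
    by (rule dec_riccati[OF w _ k \<sigma>])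
  obtain Kw where Kw: "Kw > 0" "\<And>x. norm (w x) \<le> Kw * \<rho> x" "\<And>x. norm (w x) \<le> Kw"
    using decE[OF decw] by metis
  have N: "?N x \<le> (Kw * Kw) * \<rho> x" for x
    unfolding power2_eq_square using mult_mono[OF Kw(3)[of x] Kw(2)[of x]] Kw(1) by (simp add: mult.assoc)
  have iN: "integrable X ?N"
    by (rule integrable_dec[OF _ decI[of _ "Kw * Kw"]]) (use N in \<open>auto intro!: continuous_intros cw\<close>)
  have r: "?r x \<le> 4 / 3 * ?N x" "4 / 5 * ?N x \<le> ?r x" for x
  proof -
    have "?N x / (1 - \<sigma> * ?N x) \<le> ?N x / (3 / 4)"
      using b[of x] by (intro divide_left_mono) (auto intro!: mult_pos_pos)
    then show "?r x \<le> 4 / 3 * ?N x" by simp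
    have "?N x / (5 / 4) \<le> ?N x / (1 - \<sigma> * ?N x)"
      using b[of x] by (intro divide_left_mono) auto
    then show "4 / 5 * ?N x \<le> ?r x" by simp
  qed
  have r0: "?r x \<ge> 0" for x
    using r(2)[of x] by (rule order_trans[rotated]) simp
  have nz: "1 - \<sigma> * ?N x \<noteq> 0" for x
    using b(1)[of x] by linarith
  have ir: "integrable X ?r"
  proof (rule integrable_dec[OF _ decI[of _ "4 / 3 * (Kw * Kw)"]])
    show "continuous_on UNIV ?r"
      by (intro continuous_intros cw) (use nz in auto)
    fix x
    have "?r x \<le> 4 / 3 * ((Kw * Kw) * \<rho> x)"
      by (rule order_trans[OF r(1)]) (intro mult_left_mono N, simp)
    then show "norm (?r x) \<le> 4 / 3 * (Kw * Kw) * \<rho> x"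
      unfolding real_norm_def abs_of_nonneg[OF r0] by (simp only: mult.assoc)
  qed
  define W where "W = \<kappa> * (LINT x|X. ?N x)"
  have W0: "W \<ge> 0"
    unfolding W_def using \<kappa> by (intro mult_nonneg_nonneg integral_nonneg_AE) auto
  have nnW: "ennreal \<kappa> * (\<integral>\<^sup>+x. ennreal (?N x) \<partial>X) = ennreal W"
  proof -
    have "(\<integral>\<^sup>+x. ennreal (?N x) \<partial>X) = ennreal (LINT x|X. ?N x)"
      by (rule nn_integral_eq_integral[OF iN]) simp
    then show ?thesis
      unfolding W_def using \<kappa> by (simp add: ennreal_mult'')
  qed
  have "ennreal ?A \<le> ennreal (2 * W + 2 * ?B)"
    using le1 unfolding nnW two_ennreal_add[OF W0 AB(2)] .
  moreover have "ennreal W \<le> ennreal (2 * ?A + 2 * ?B)"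
    using le2 unfolding nnW two_ennreal_add[OF AB] .
  moreover have "0 \<le> 2 * W + 2 * ?B" "0 \<le> 2 * ?A + 2 * ?B"
    using AB W0 by linarith+
  ultimately have WA: "?A \<le> 2 * W + 2 * ?B" "W \<le> 2 * ?A + 2 * ?B"
    by (simp_all only: ennreal_le_iff)
  have "E \<le> \<kappa> * (LINT x|X. 4 / 3 * ?N x)"
    unfolding E_def by (intro mult_left_mono integral_mono ir integrable_mult_right iN r) (use \<kappa> in linarith)
  then have EW: "E \<le> 4 / 3 * W"
    by (simp add: W_def)
  have "\<kappa> * (LINT x|X. 4 / 5 * ?N x) \<le> E"
    unfolding E_def by (intro mult_left_mono integral_mono ir integrable_mult_right iN r) (use \<kappa> in linarith)
  then have WE: "4 / 5 * W \<le> E"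
    by (simp add: W_def)
  show "0 \<le> E" using WE W0 by linarith
  show "?A \<le> 3 * E + 3 * ?B" using WA(1) WE AB W0 by linarith
  show "E \<le> 3 * ?A + 3 * ?B" using WA(2) EW AB W0 by linarith
qed

text \<open>N at time t is compared with the conserved energies, and these with N at time 0. The
  cubic term at time t is at most half of N, by the choice of \<eta>c, and is absorbed on the
  left.\<close>

lemma N_step:
  assumes \<kappa>: "\<kappa> \<ge> 1" and ab: "a \<le> 0" "0 \<le> b" and small: "\<And>t. t \<in> {a..b} \<Longrightarrow> NR (Ft t) \<kappa> \<le> \<eta>c"
    and t: "t \<in> {a..b}"
  shows "NR (Ft t) \<kappa> \<le> Qc * NR (Ft 0) \<kappa>"
proof -
  let ?k = "\<lambda>n. of_real \<kappa> + \<i> * of_int n :: complex"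
  have k: "Re (?k n) > 0" for n
    using \<kappa> by simp
  define good where "good n t w \<longleftrightarrow> riccati \<sigma> (?k n) (u t) w \<and> (\<forall>x. w (x + L) = w x)
     \<and> ennreal (A (Ft t) \<kappa> n) \<le> 2 * (ennreal \<kappa> * (\<integral>\<^sup>+x. ennreal ((norm (w x))\<^sup>2) \<partial>X)) + 2 * ennreal (K1 * Bq (Ft t) \<kappa> n ^ 3)
     \<and> ennreal \<kappa> * (\<integral>\<^sup>+x. ennreal ((norm (w x))\<^sup>2) \<partial>X) \<le> 2 * ennreal (A (Ft t) \<kappa> n) + 2 * ennreal (K1 * Bq (Ft t) \<kappa> n ^ 3)"
    for n t w
  \<comment> \<open>Solutions are picked at each time with no link between them;
    \<open>energy_conserved\<close> allows for that.\<close>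
  define W where "W n t = (SOME w. good n t w)" for n t
  have W: "good n t (W n t)" if "t \<in> {a..b}" for n t
  proof -
    have "\<exists>w. good n t w"
    proof (rule riccati_exists[OF bdd_Ft[of t] nice_Ft[of t] \<sigma> \<kappa> small_of_N[OF bdd_Ft[of t] \<kappa> small[OF that], of n]])
      fix w
      assume "riccati \<sigma> (?k n) (synth (Ft t)) w" "\<And>x. w (x + L) = w x"
        "ennreal (A (Ft t) \<kappa> n) \<le> 2 * (ennreal \<kappa> * (\<integral>\<^sup>+x. ennreal ((norm (w x))\<^sup>2) \<partial>X)) + 2 * ennreal (K1 * Bq (Ft t) \<kappa> n ^ 3)"
        "ennreal \<kappa> * (\<integral>\<^sup>+x. ennreal ((norm (w x))\<^sup>2) \<partial>X) \<le> 2 * ennreal (A (Ft t) \<kappa> n) + 2 * ennreal (K1 * Bq (Ft t) \<kappa> n ^ 3)"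
      then have "good n t w"
        unfolding good_def repr[of t] by blast
      then show "\<exists>w. good n t w" by blast
    qed
    then show ?thesis
      unfolding W_def by (rule someI_ex)
  qed
  define E where "E n t = \<kappa> * (LINT x|X. (norm (W n t x))\<^sup>2 / (1 - \<sigma> * (norm (W n t x))\<^sup>2))" for n t
  have Econs: "E n t = E n 0" for n
  proof -
    have "(LINT x|X. (norm (W n t x))\<^sup>2 / (1 - \<sigma> * (norm (W n t x))\<^sup>2)) = (LINT x|X. (norm (W n 0 x))\<^sup>2 / (1 - \<sigma> * (norm (W n 0 x))\<^sup>2))"
      by (rule energy_conserved[OF k[of n], of a b "\<lambda>t. W n t"]) (use W t ab in \<open>auto simp: good_def\<close>)
    then show ?thesis by (simp add: E_def)
  qed
  have cmp: "0 \<le> E n s" "A (Ft s) \<kappa> n \<le> 3 * E n s + 3 * (K1 * Bq (Ft s) \<kappa> n ^ 3)" "E n s \<le> 3 * A (Ft s) \<kappa> n + 3 * (K1 * Bq (Ft s) \<kappa> n ^ 3)"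
    if "s \<in> {a..b}" for n s
    using energy_compare[OF \<kappa>, of n s "W n s"] W[OF that, of n] unfolding good_def E_def by blast+
  have z: "0 \<in> {a..b}" using ab by simp
  have A0: "A F \<kappa> n \<ge> 0" for F n using \<kappa> by (intro A_nonneg) auto
  have N0: "NR F \<kappa> \<ge> 0" for F by (rule NR_nonneg[OF \<kappa>])
  define ES where "ES = (\<integral>\<^sup>+n. ennreal (1 / \<kappa> * E n 0 powr P) \<partial>count_space (UNIV :: int set))"
  have half: "6 powr P * (DD * NR (Ft s) \<kappa> ^ 3) \<le> NR (Ft s) \<kappa> / 2" if s: "s \<in> {a..b}" for s
  proof -
    let ?N = "NR (Ft s) \<kappa>"
    have "?N\<^sup>2 \<le> \<eta>c\<^sup>2"
      using small[OF s] N0 by (intro power_mono)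
    then have "6 powr P * (DD * ?N\<^sup>2) \<le> 6 powr P * (DD * \<eta>c\<^sup>2)"
      using DD_pos by (intro mult_left_mono) auto
    also have "\<dots> \<le> 1 / 2" by (rule \<eta>c(3))
    finally have "(6 powr P * (DD * ?N\<^sup>2)) * ?N \<le> 1 / 2 * ?N"
      using N0 by (intro mult_right_mono) auto
    then show ?thesis
      by (simp add: power2_eq_square power3_eq_cube mult_ac)
  qed
  have "Nn (Ft t) \<kappa> \<le> ennreal (6 powr P) * ES + ennreal (6 powr P * (DD * NR (Ft t) \<kappa> ^ 3))"
    unfolding Nn_def ES_def
    by (rule sum_powr_perturb[OF bdd_Ft \<kappa> eq_refl[OF Nn_eq[OF bdd_Ft \<kappa>]] N0 A0 cmp(1)[OF z]]) (use cmp(2)[OF t] in \<open>simp only: Econs\<close>)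
  then have "ennreal (NR (Ft t) \<kappa>) \<le> ennreal (6 powr P) * ES + ennreal (6 powr P * (DD * NR (Ft t) \<kappa> ^ 3))"
    using Nn_eq[OF bdd_Ft \<kappa>] by simp
  moreover have "ES \<le> ennreal (6 powr P) * Nn (Ft 0) \<kappa> + ennreal (6 powr P * (DD * NR (Ft 0) \<kappa> ^ 3))"
    unfolding Nn_def ES_def
    by (rule sum_powr_perturb[OF bdd_Ft \<kappa> eq_refl[OF Nn_eq[OF bdd_Ft \<kappa>]] N0 cmp(1)[OF z] A0 cmp(3)[OF z]])
  then have "ES \<le> ennreal (6 powr P * NR (Ft 0) \<kappa> + 6 powr P * (DD * NR (Ft 0) \<kappa> ^ 3))"
    using Nn_eq[OF bdd_Ft \<kappa>, of 0] N0[of "Ft 0"] DD_pos by (simp add: ennreal_mult[symmetric])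
  then have "ES \<le> ennreal (6 powr P * NR (Ft 0) \<kappa> + NR (Ft 0) \<kappa> / 2)"
    by (rule order_trans) (intro ennreal_leI add_left_mono half z)
  then obtain e where e: "ES = ennreal e" "0 \<le> e" "e \<le> 6 powr P * NR (Ft 0) \<kappa> + NR (Ft 0) \<kappa> / 2"
    by (rule ennreal_le_realE) (use N0[of "Ft 0"] in auto)
  ultimately have "ennreal (NR (Ft t) \<kappa>) \<le> ennreal (6 powr P * e + 6 powr P * (DD * NR (Ft t) \<kappa> ^ 3))"
    using N0[of "Ft t"] DD_pos by (simp add: ennreal_mult'[symmetric])
  then have "NR (Ft t) \<kappa> \<le> 6 powr P * e + 6 powr P * (DD * NR (Ft t) \<kappa> ^ 3)"
    using e(2) N0[of "Ft t"] DD_pos by (subst (asm) ennreal_le_iff) auto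
  then have "NR (Ft t) \<kappa> \<le> 2 * (6 powr P * e)"
    using half[OF t] by linarith
  also have "\<dots> \<le> 2 * (6 powr P * (2 * (6 powr P * NR (Ft 0) \<kappa>)))"
  proof (intro mult_left_mono)
    have "(1::real) \<le> 6 powr P"
      using P by (intro ge_one_powr_ge_zero) auto
    then have "1 * NR (Ft 0) \<kappa> \<le> 6 powr P * NR (Ft 0) \<kappa>"
      using N0 by (intro mult_right_mono)
    then show "e \<le> 2 * (6 powr P * NR (Ft 0) \<kappa>)"
      using e(3) N0[of "Ft 0"] by linarith
  qed auto
  also have "\<dots> = Qc * NR (Ft 0) \<kappa>"
  proof -
    have "(36::real) powr P = 6 powr P * 6 powr P"
      by (simp add: powr_mult[symmetric])
    then show ?thesis by (simp add: Qc_def)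
  qed
  finally show ?thesis .
qed

lemma N_bound:
  assumes \<kappa>: "\<kappa> \<ge> 1" and small: "Qc * NR (Ft 0) \<kappa> < \<eta>c"
  shows "NR (Ft t) \<kappa> \<le> Qc * NR (Ft 0) \<kappa>"
proof (rule bootstrap_bound[where f = "\<lambda>t. NR (Ft t) \<kappa>" and \<eta> = \<eta>c])
  show "NR (Ft 0) \<kappa> \<le> Qc * NR (Ft 0) \<kappa>"
    using mult_right_mono[OF Qc_ge NR_nonneg[OF \<kappa>]] by simp
qed (use NR_continuous[OF \<kappa>] small N_step[OF \<kappa>] in auto)

text \<open>Finiteness follows from the comparison at \<kappa> = 1. For the bound, S(t) <=
  \<kappa>^P N(t), N(t) <= Qc N(0) and N(0) <= C2 S(0) / \<kappa> give S(t) <= Qc C2 \<kappa>^(P -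
  1) S(0). As \<kappa> is a multiple of (1 + r)^(2 P), the power 1 / (2 P) produces the factor (1 +
  r)^(P - 1).\<close>

theorem SG_bound:
  "SG (Ft t) < \<infinity>"
  "enn2real (SG (Ft t)) powr (1 / (2 * P))
    \<le> Cf * (1 + enn2real (SG (Ft 0)) powr (1 / (2 * P))) powr (P - 1) * enn2real (SG (Ft 0)) powr (1 / (2 * P))"
proof -
  show fin: "SG (Ft t) < \<infinity>" for t
    by (rule order_le_less_trans[OF SG_le_Nn[OF bdd_Ft order_refl]]) (simp add: Nn_eq[OF bdd_Ft] ennreal_mult_less_top)
  define S where "S t = enn2real (SG (Ft t))" for t
  have S: "SG (Ft t) = ennreal (S t)" "S t \<ge> 0" for t
    using fin[of t] by (auto simp: S_def)
  define r where "r = S 0 powr (1 / (2 * P))"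
  have r0: "r \<ge> 0" by (simp add: r_def)
  have rS: "r powr (2 * P) = S 0"
    using S(2)[of 0] P by (simp add: r_def powr_powr)
  \<comment> \<open>(1 + r)^(2 P) dominates r^(2 P) = S 0, so N(0) <= C2 / Kc whatever the size of
    the data; the 1 keeps \<kappa> >= 1 for small data.\<close>
  define \<kappa> where "\<kappa> = Kc * (1 + r) powr (2 * P)"
  have Kc1: "Kc \<ge> 1" by (simp add: Kc_def)
  have big: "(1 + r) powr (2 * P) \<ge> 1"
    using r0 P by (intro ge_one_powr_ge_zero) auto
  have \<kappa>: "\<kappa> \<ge> 1"
    unfolding \<kappa>_def using mult_mono[OF Kc1 big] Kc1 by simp
  have N0: "NR (Ft 0) \<kappa> \<le> C2 / \<kappa> * S 0"
  proof -
    have "ennreal (NR (Ft 0) \<kappa>) \<le> ennreal (C2 / \<kappa>) * ennreal (S 0)"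
      using Nn_le_SG[OF bdd_Ft \<kappa>, of 0] unfolding Nn_eq[OF bdd_Ft \<kappa>] S(1) .
    also have "\<dots> = ennreal (C2 / \<kappa> * S 0)"
      using \<kappa> C2_pos S(2) by (intro ennreal_mult[symmetric]) auto
    finally show ?thesis
      using \<kappa> C2_pos S(2)[of 0] by (subst (asm) ennreal_le_iff) auto
  qed
  have "S 0 \<le> (1 + r) powr (2 * P)"
    unfolding rS[symmetric] using r0 P by (intro powr_mono2) auto
  then have "C2 / \<kappa> * S 0 \<le> C2 / \<kappa> * (1 + r) powr (2 * P)"
    using \<kappa> C2_pos by (intro mult_left_mono) auto
  also have "\<dots> = C2 / Kc"
    using r0 Kc1 by (simp add: \<kappa>_def add_nonneg_eq_0_iff)
  finally have "NR (Ft 0) \<kappa> \<le> C2 / Kc"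
    using N0 by simp
  then have "Qc * NR (Ft 0) \<kappa> \<le> Qc * (C2 / Kc)"
    using Qc_ge by (intro mult_left_mono) auto
  also have "\<dots> \<le> \<eta>c / 2"
  proof -
    have "2 * Qc * C2 / \<eta>c \<le> Kc" by (simp add: Kc_def)
    then have "2 * Qc * C2 \<le> Kc * \<eta>c"
      using \<eta>c(1) by (simp add: divide_le_eq)
    then show ?thesis
      using Kc1 by (simp add: field_simps)
  qed
  also have "\<dots> < \<eta>c"
    using \<eta>c(1) by simp
  finally have Nt: "NR (Ft t) \<kappa> \<le> Qc * NR (Ft 0) \<kappa>"
    by (rule N_bound[OF \<kappa>])
  have "ennreal (S t) \<le> ennreal (\<kappa> powr P) * ennreal (NR (Ft t) \<kappa>)"
    using SG_le_Nn[OF bdd_Ft \<kappa>, of t] unfolding Nn_eq[OF bdd_Ft \<kappa>] S(1) .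
  also have "\<dots> = ennreal (\<kappa> powr P * NR (Ft t) \<kappa>)"
    using NR_nonneg[OF \<kappa>] by (intro ennreal_mult[symmetric]) auto
  finally have "S t \<le> \<kappa> powr P * NR (Ft t) \<kappa>"
    using NR_nonneg[OF \<kappa>, of "Ft t"] by (subst (asm) ennreal_le_iff) auto
  also have "\<dots> \<le> \<kappa> powr P * (Qc * (C2 / \<kappa> * S 0))"
    using Nt N0 Qc_ge by (intro mult_left_mono order_trans[OF Nt]) auto
  also have "\<dots> = Qc * C2 * \<kappa> powr (P - 1) * S 0"
    using \<kappa> by (simp add: powr_diff)
  finally have St: "S t \<le> Qc * C2 * \<kappa> powr (P - 1) * S 0" .
  have "S t powr (1 / (2 * P)) \<le> (Qc * C2 * \<kappa> powr (P - 1) * S 0) powr (1 / (2 * P))"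
    using St S(2) P by (intro powr_mono2) auto
  also have "\<dots> = (Qc * C2) powr (1 / (2 * P)) * (\<kappa> powr (P - 1)) powr (1 / (2 * P)) * r"
    using Qc_ge C2_pos S(2)[of 0] by (simp add: powr_mult r_def)
  also have "(\<kappa> powr (P - 1)) powr (1 / (2 * P)) = Kc powr ((P - 1) / (2 * P)) * (1 + r) powr (P - 1)"
  proof -
    have "(\<kappa> powr (P - 1)) powr (1 / (2 * P)) = \<kappa> powr ((P - 1) / (2 * P))"
      by (simp add: powr_powr)
    also have "\<dots> = Kc powr ((P - 1) / (2 * P)) * ((1 + r) powr (2 * P)) powr ((P - 1) / (2 * P))"
      unfolding \<kappa>_def using Kc1 by (intro powr_mult)
    also have "((1 + r) powr (2 * P)) powr ((P - 1) / (2 * P)) = (1 + r) powr (P - 1)"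
      using P by (simp add: powr_powr)
    finally show ?thesis .
  qed
  finally show "enn2real (SG (Ft t)) powr (1 / (2 * P))
    \<le> Cf * (1 + enn2real (SG (Ft 0)) powr (1 / (2 * P))) powr (P - 1) * enn2real (SG (Ft 0)) powr (1 / (2 * P))"
    unfolding S_def[symmetric] r_def[symmetric] Cf_def by (simp add: mult_ac)
qed

end

section \<open>The multiplication formula and autocorrelations\<close>

context freq begin

text \<open>The multiplication formula of Fourier analysis, by Fubini. It is used with Gaussians on
  the line, and on the circle with the constant 1 and with a bounded function.\<close>

lemma synth_pairing:
  fixes N :: "real measure" and g :: "real \<Rightarrow> complex"
  assumes N: "sigma_finite_measure N" "sets N = sets borel" and h: "integrable M h" and g: "integrable N g"
  shows "(LINT x|N. synth h x * g x) = (LINT \<xi>|M. h \<xi> * (LINT x|N. g x * cis (x * \<iota> \<xi>)))"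
    and "integrable N (\<lambda>x. synth h x * g x)"
proof -
  interpret N: sigma_finite_measure N by (rule N)
  interpret P: pair_sigma_finite N M ..
  have [measurable]: "h \<in> borel_measurable M" "g \<in> borel_measurable N" using h g by auto
  have [measurable]: "(\<lambda>x. x) \<in> borel_measurable N"
    by (rule measurable_ident_sets[OF N(2)])
  let ?f = "\<lambda>x \<xi>. g x * (h \<xi> * cis (x * \<iota> \<xi>))"
  have m: "case_prod ?f \<in> borel_measurable (N \<Otimes>\<^sub>M M)"
    by measurable
  have i: "integrable (N \<Otimes>\<^sub>M M) (case_prod ?f)"
  proof (rule P.Fubini_integrable[OF m])
    show "integrable N (\<lambda>x. LINT \<xi>|M. norm (case_prod ?f (x, \<xi>)))"
      using g by (simp add: norm_mult)
    show "AE x in N. integrable M (\<lambda>\<xi>. case_prod ?f (x, \<xi>))"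
      using integrable_cis[OF h] by (intro AE_I2) simp
  qed
  have e: "(LINT \<xi>|M. ?f x \<xi>) = synth h x * g x" for x
    unfolding synth_def by simp
  have e': "(LINT x|N. ?f x \<xi>) = h \<xi> * (LINT x|N. g x * cis (x * \<iota> \<xi>))" for \<xi>
  proof -
    have "?f x \<xi> = h \<xi> * (g x * cis (x * \<iota> \<xi>))" for x by simp
    then show ?thesis by (simp only: integral_mult_right_zero)
  qed
  show "(LINT x|N. synth h x * g x) = (LINT \<xi>|M. h \<xi> * (LINT x|N. g x * cis (x * \<iota> \<xi>)))"
    using P.Fubini_integral[OF i] by (simp only: e e')
  show "integrable N (\<lambda>x. synth h x * g x)"
    using P.integrable_fst'[OF i] by (simp only: prod.case e)
qed

text \<open>The squared modulus of a synthesis is again a synthesis, that of the autocorrelation.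
  L^2 identities thus reduce to computing the integral of a synthesis from the value of its
  transform at 0.\<close>

lemma synth_autocorrelation:
  assumes "integrable M f"
  shows "synth (conv f (crefl 1 f)) x = of_real ((norm (synth f x))\<^sup>2)"
  using assms by (simp add: synth_conv integrable_crefl synth_crefl complex_of_norm_squared)

lemma autocorrelation_0:
  assumes "integrable M (\<lambda>\<xi>. (norm (f \<xi>))\<^sup>2)"
  shows "conv f (crefl 1 f) 0 = of_real (LINT \<xi>|M. (norm (f \<xi>))\<^sup>2)"
proof -
  have [measurable]: "(\<lambda>\<xi>. (norm (f \<xi>))\<^sup>2) \<in> borel_measurable M"
    using assms by auto
  have "(LINT \<xi>|M. (norm (f (- \<xi>)))\<^sup>2) = (LINT \<xi>|M. (norm (f \<xi>))\<^sup>2)"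
    using nn_refl[of "\<lambda>\<xi>. ennreal ((norm (f \<xi>))\<^sup>2)"] by (simp add: integral_eq_nn_integral)
  moreover have "f (0 - \<xi>) * crefl 1 f \<xi> = of_real ((norm (f (- \<xi>)))\<^sup>2)" for \<xi>
    by (simp add: crefl_def complex_of_norm_squared)
  ultimately show ?thesis
    by (simp only: conv_def integral_complex_of_real)
qed

lemma autocorrelation_le:
  assumes f: "integrable M f" and S: "(\<integral>\<^sup>+\<xi>. ennreal ((norm (f \<xi>))\<^sup>2) \<partial>M) = ennreal S" "S \<ge> 0"
  shows "norm (conv f (crefl 1 f) \<xi>) \<le> S"
proof -
  have m [measurable]: "f \<in> borel_measurable M" "crefl 1 f \<in> borel_measurable M"
    using f integrable_crefl by auto
  have r: "(\<integral>\<^sup>+\<xi>. ennreal ((norm (crefl 1 f \<xi>))\<^sup>2) \<partial>M) = ennreal S"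
    using nn_refl[of "\<lambda>\<xi>. ennreal ((norm (f \<xi>))\<^sup>2)"] S by (simp add: crefl_def)
  have "(\<integral>\<^sup>+\<eta>. ennreal (norm (f (\<xi> - \<eta>)) * norm (crefl 1 f \<eta>)) \<partial>M)\<^sup>2 \<le> ennreal (S\<^sup>2)"
    using holder_conv[of "\<lambda>\<xi>. norm (f \<xi>)" "\<lambda>\<xi>. norm (crefl 1 f \<xi>)" \<xi>] S r by (simp add: power2_eq_square ennreal_mult)
  then have "(\<integral>\<^sup>+\<eta>. ennreal (norm (f (\<xi> - \<eta>)) * norm (crefl 1 f \<eta>)) \<partial>M) \<le> ennreal S"
    by (rule ennreal_le_of_square_le[OF _ S(2)])
  then have "ennreal (norm (conv f (crefl 1 f) \<xi>)) \<le> ennreal S"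
    by (rule order_trans[OF conv_le[OF m]])
  then show ?thesis
    using S by (simp add: ennreal_le_iff)
qed

end

subsection \<open>The Fourier transform on the line\<close>

interpretation line: freq lborel "\<lambda>\<xi>. \<xi> :: real"
proof unfold_locales
  show "(\<lambda>p. fst p - snd p) \<in> (lborel :: real measure) \<Otimes>\<^sub>M lborel \<rightarrow>\<^sub>M lborel"
    by measurable
  fix f :: "real \<Rightarrow> ennreal" and c :: real assume "f \<in> borel_measurable lborel"
  then have [measurable]: "f \<in> borel_measurable borel" by simp
  show "(\<integral>\<^sup>+\<xi>. f (\<xi> - c) \<partial>lborel) = (\<integral>\<^sup>+\<xi>. f \<xi> \<partial>lborel)"
    using nn_integral_real_affine[of f 1 "- c"] by simp
  show "(\<integral>\<^sup>+\<xi>. f (- \<xi>) \<partial>lborel) = (\<integral>\<^sup>+\<xi>. f \<xi> \<partial>lborel)"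
    using nn_integral_real_affine[of f "- 1" 0] by simp
qed simp_all

text \<open>With \<open>\<iota>\<close> the identity these two rules read \<open>0 = 0\<close> and \<open>- a = - a\<close>, and the simplifier loops on them.\<close>

declare line.\<iota>_0 [simp del] line.\<iota>_minus [simp del]

lemma gaussian_fourier:
  assumes "\<epsilon> > 0"
  shows "(LINT x|lborel. of_real (std_normal_density (\<epsilon> * x)) * cis (x * \<xi>))
    = complex_of_real (sqrt (2 * pi) / \<epsilon> * std_normal_density (\<xi> / \<epsilon>))"
proof -
  let ?n = "\<lambda>x. complex_of_real (std_normal_density x)"
  have "char std_normal_distribution (\<xi> / \<epsilon>) = (LINT x|lborel. std_normal_density x *\<^sub>R cis (\<xi> / \<epsilon> * x))"
    unfolding char_def cis_conv_exp[symmetric]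
  proof (rule integral_density)
    show "(\<lambda>x. cis (\<xi> / \<epsilon> * x)) \<in> borel_measurable lborel"
      unfolding measurable_lborel2 by (intro borel_measurable_continuous_onI continuous_intros)
    show "AE x in lborel. 0 \<le> std_normal_density x"
      by (intro AE_I2 normal_density_nonneg)
  qed measurable
  then have e1: "char std_normal_distribution (\<xi> / \<epsilon>) = (LINT x|lborel. ?n x * cis (\<xi> / \<epsilon> * x))"
    by (simp only: scaleR_conv_of_real)
  have "\<epsilon> \<noteq> 0"
    using assms by simp
  note lborel_integral_real_affine[OF this, of "\<lambda>x. ?n x * cis (\<xi> / \<epsilon> * x)" 0]
  moreover have "?n (0 + \<epsilon> * x) * cis (\<xi> / \<epsilon> * (0 + \<epsilon> * x)) = ?n (\<epsilon> * x) * cis (x * \<xi>)" for x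
    using assms by (simp add: mult.commute)
  ultimately have e2: "(LINT x|lborel. ?n x * cis (\<xi> / \<epsilon> * x)) = \<bar>\<epsilon>\<bar> *\<^sub>R (LINT x|lborel. ?n (\<epsilon> * x) * cis (x * \<xi>))"
    by (simp only:)
  have "complex_of_real (exp (- (\<xi> / \<epsilon>)\<^sup>2 / 2)) = of_real \<epsilon> * (LINT x|lborel. ?n (\<epsilon> * x) * cis (x * \<xi>))"
    using e1 assms unfolding e2 char_std_normal_distribution by (simp only: scaleR_conv_of_real abs_of_pos)
  moreover have "exp (- (\<xi> / \<epsilon>)\<^sup>2 / 2) = \<epsilon> * (sqrt (2 * pi) / \<epsilon> * std_normal_density (\<xi> / \<epsilon>))"
    using assms by (simp add: std_normal_density_def)
  ultimately have "of_real \<epsilon> * (LINT x|lborel. ?n (\<epsilon> * x) * cis (x * \<xi>))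
      = of_real \<epsilon> * complex_of_real (sqrt (2 * pi) / \<epsilon> * std_normal_density (\<xi> / \<epsilon>))"
    by (simp only: of_real_mult)
  then show ?thesis
    using assms by (simp only: mult_cancel_left of_real_eq_0_iff) simp
qed

text \<open>\<open>synth_pairing\<close> against a Gaussian of width 1 / \<epsilon>, followed by the
  substitution \<xi> = \<epsilon> z. As \<epsilon> tends to 0 the left side approaches the integral
  of the synthesis over sqrt (2 pi), while the right side sees h only near 0.\<close>

lemma gaussian_summation:
  fixes h :: "real \<Rightarrow> complex"
  assumes h: "integrable lborel h" and \<epsilon>: "\<epsilon> > 0"
  shows "(LINT x|lborel. line.synth h x * of_real (std_normal_density (\<epsilon> * x)))
    = of_real (sqrt (2 * pi)) * (LINT z|lborel. h (\<epsilon> * z) * of_real (std_normal_density z))"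
    and "integrable lborel (\<lambda>x. line.synth h x * of_real (std_normal_density (\<epsilon> * x)))"
proof -
  have g: "integrable lborel (\<lambda>x. complex_of_real (std_normal_density (\<epsilon> * x)))"
    using lborel_integrable_real_affine[of std_normal_density \<epsilon> 0] \<epsilon> by simp
  note sp = line.synth_pairing[OF lborel.sigma_finite_measure_axioms _ h g]
  show "integrable lborel (\<lambda>x. line.synth h x * of_real (std_normal_density (\<epsilon> * x)))"
    by (rule sp(2)) simp
  let ?g = "\<lambda>\<xi>. h \<xi> * complex_of_real (sqrt (2 * pi) / \<epsilon> * std_normal_density (\<xi> / \<epsilon>))"
  have e1: "(LINT x|lborel. line.synth h x * of_real (std_normal_density (\<epsilon> * x))) = (LINT \<xi>|lborel. ?g \<xi>)"
    using sp(1) by (simp only: gaussian_fourier[OF \<epsilon>] sets_lborel)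
  have "\<epsilon> \<noteq> 0"
    using \<epsilon> by simp
  note lborel_integral_real_affine[OF this, of ?g 0]
  moreover have "?g (0 + \<epsilon> * z) = of_real (sqrt (2 * pi) / \<epsilon>) * (h (\<epsilon> * z) * of_real (std_normal_density z))" for z
    using \<epsilon> by simp
  ultimately have "(LINT \<xi>|lborel. ?g \<xi>) = \<bar>\<epsilon>\<bar> *\<^sub>R (of_real (sqrt (2 * pi) / \<epsilon>) * (LINT z|lborel. h (\<epsilon> * z) * of_real (std_normal_density z)))"
    by (simp only: integral_mult_right_zero)
  then show "(LINT x|lborel. line.synth h x * of_real (std_normal_density (\<epsilon> * x)))
    = of_real (sqrt (2 * pi)) * (LINT z|lborel. h (\<epsilon> * z) * of_real (std_normal_density z))"
    unfolding e1 using \<epsilon> by (simp add: scaleR_conv_of_real)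
qed

lemma std_normal_density_le: "std_normal_density x \<le> 1 / sqrt (2 * pi)"
  by (simp add: std_normal_density_def divide_right_mono)

lemma std_normal_density_LIMSEQ: "(\<lambda>n. std_normal_density (1 / real (Suc n) * x)) \<longlonglongrightarrow> 1 / sqrt (2 * pi)"
proof -
  have "(\<lambda>n. std_normal_density (1 / real (Suc n) * x)) \<longlonglongrightarrow> (1 / sqrt (2 * pi)) * exp (- (0 * x)\<^sup>2 / 2)"
    unfolding std_normal_density_def by (intro tendsto_intros LIMSEQ_Suc lim_1_over_n) auto
  then show ?thesis by simp
qed

text \<open>Dominated convergence on both sides of \<open>gaussian_summation\<close>. Continuity at
  0 gives the limit on the right; on the left the synthesis itself must be integrable.\<close>

lemma integral_synth_line:
  fixes h :: "real \<Rightarrow> complex"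
  assumes h: "integrable lborel h" and K: "\<And>\<xi>. norm (h \<xi>) \<le> K" and c: "isCont h 0"
    and i: "integrable lborel (line.synth h)"
  shows "(LINT x|lborel. line.synth h x) = 2 * pi * h 0"
proof -
  have [measurable]: "h \<in> borel_measurable borel" "line.synth h \<in> borel_measurable borel"
    using h i by auto
  let ?\<epsilon> = "\<lambda>n. 1 / real (Suc n)"
  have "(\<lambda>n. LINT x|lborel. line.synth h x * of_real (std_normal_density (?\<epsilon> n * x)))
      \<longlonglongrightarrow> (LINT x|lborel. line.synth h x * of_real (1 / sqrt (2 * pi)))"
  proof (rule integral_dominated_convergence[where w = "\<lambda>x. norm (line.synth h x) * (1 / sqrt (2 * pi))"])
    show "AE x in lborel. (\<lambda>n. line.synth h x * of_real (std_normal_density (?\<epsilon> n * x)))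
        \<longlonglongrightarrow> line.synth h x * of_real (1 / sqrt (2 * pi))"
      by (intro AE_I2 tendsto_intros std_normal_density_LIMSEQ)
    show "AE x in lborel. norm (line.synth h x * of_real (std_normal_density (?\<epsilon> n * x)))
        \<le> norm (line.synth h x) * (1 / sqrt (2 * pi))" for n
      unfolding norm_mult norm_of_real by (intro AE_I2 mult_left_mono) (auto intro!: std_normal_density_le)
    show "integrable lborel (\<lambda>x. norm (line.synth h x) * (1 / sqrt (2 * pi)))"
      using i by auto
  qed measurable
  moreover have "(\<lambda>n. of_real (sqrt (2 * pi)) * (LINT z|lborel. h (?\<epsilon> n * z) * of_real (std_normal_density z)))
      \<longlonglongrightarrow> of_real (sqrt (2 * pi)) * (LINT z|lborel. h 0 * of_real (std_normal_density z))"
  proof (intro tendsto_mult_left integral_dominated_convergence[where w = "\<lambda>z. K * std_normal_density z"])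
    have "(\<lambda>n. ?\<epsilon> n * z) \<longlonglongrightarrow> 0" for z
      by (intro tendsto_mult_left_zero LIMSEQ_Suc lim_1_over_n)
    then show "AE z in lborel. (\<lambda>n. h (?\<epsilon> n * z) * of_real (std_normal_density z)) \<longlonglongrightarrow> h 0 * of_real (std_normal_density z)"
      using c by (intro AE_I2 tendsto_mult_right isCont_tendsto_compose[of 0 h])
    show "AE z in lborel. norm (h (?\<epsilon> n * z) * of_real (std_normal_density z)) \<le> K * std_normal_density z" for n
      using K by (intro AE_I2) (simp add: norm_mult mult_right_mono)
  qed auto
  ultimately have "(LINT x|lborel. line.synth h x * of_real (1 / sqrt (2 * pi)))
      = of_real (sqrt (2 * pi)) * (LINT z|lborel. h 0 * of_real (std_normal_density z))"
    by (simp only: gaussian_summation(1)[OF h] zero_less_divide_1_iff of_nat_0_less_iff zero_less_Suc LIMSEQ_unique)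
  then have "(LINT x|lborel. line.synth h x) * of_real (1 / sqrt (2 * pi)) = of_real (sqrt (2 * pi)) * h 0"
    by (simp only: integral_mult_left_zero integral_mult_right_zero integral_complex_of_real integral_normal_density of_real_1 mult_1_right)
  then have "(LINT x|lborel. line.synth h x) = of_real (sqrt (2 * pi)) * (of_real (sqrt (2 * pi)) * h 0)"
    by (simp add: divide_eq_eq mult.commute del: real_sqrt_mult)
  also have "\<dots> = of_real (sqrt (2 * pi) * sqrt (2 * pi)) * h 0"
    by (simp only: of_real_mult mult.assoc)
  finally show ?thesis
    by (simp only: real_sqrt_mult_self abs_of_pos[of "2 * pi"] pi_gt_zero mult_pos_pos zero_less_numeral)
qed

text \<open>The autocorrelation is bounded by the squared L^2 norm S, so the Gaussian means of
  |synth f|^2 are bounded uniformly, and Fatou's lemma removes the Gaussian. For f without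
  continuity this route yields only an inequality.\<close>

lemma bessel_line:
  fixes f :: "real \<Rightarrow> complex"
  assumes f: "integrable lborel f"
  shows "(\<integral>\<^sup>+x. ennreal ((norm (line.synth f x))\<^sup>2) \<partial>lborel) \<le> ennreal (2 * pi) * (\<integral>\<^sup>+\<xi>. ennreal ((norm (f \<xi>))\<^sup>2) \<partial>lborel)"
proof (cases "\<integral>\<^sup>+\<xi>. ennreal ((norm (f \<xi>))\<^sup>2) \<partial>lborel")
  case top
  then show ?thesis by (simp add: ennreal_mult_top)
next
  case (real S)
  define h where "h = line.conv f (line.crefl 1 f)"
  define w where "w = (\<lambda>x. (norm (line.synth f x))\<^sup>2)"
  have h: "integrable lborel h"
    unfolding h_def by (intro line.integrable_conv line.integrable_crefl f)
  have hS: "norm (h \<xi>) \<le> S" for \<xi>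
    unfolding h_def by (rule line.autocorrelation_le[OF f real(2) real(1)])
  have sh: "line.synth h x = of_real (w x)" for x
    unfolding h_def w_def by (rule line.synth_autocorrelation[OF f])
  have wm: "w \<in> borel_measurable lborel"
    unfolding w_def measurable_lborel2 by (intro borel_measurable_continuous_onI continuous_intros line.synth_continuous f)
  let ?g = "\<lambda>n x. w x * std_normal_density (1 / real (Suc n) * x)"
  have w0: "w x \<ge> 0" for x
    by (simp add: w_def)
  have e: "1 / real (Suc n) > 0" for n by simp
  have eq: "line.synth h x * of_real (std_normal_density (1 / real (Suc n) * x)) = complex_of_real (?g n x)" for n x
    by (simp add: sh)
  have ig: "integrable lborel (?g n)" for n
    using gaussian_summation(2)[OF h e] unfolding eq by (simp only: complex_of_real_integrable_eq)
  have le: "(\<integral>\<^sup>+x. ennreal (?g n x) \<partial>lborel) \<le> ennreal (sqrt (2 * pi) * S)" for n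
  proof -
    have ih: "integrable lborel (\<lambda>z. h (1 / real (Suc n) * z) * complex_of_real (std_normal_density z))"
    proof (rule Bochner_Integration.integrable_bound[of _ "\<lambda>z. S * std_normal_density z"])
      show "(\<lambda>z. h (1 / real (Suc n) * z) * complex_of_real (std_normal_density z)) \<in> borel_measurable lborel"
        using h[THEN borel_measurable_integrable] by measurable
      show "AE z in lborel. norm (h (1 / real (Suc n) * z) * complex_of_real (std_normal_density z)) \<le> norm (S * std_normal_density z)"
        using hS real(1) by (intro AE_I2) (simp add: norm_mult mult_right_mono)
    qed simp
    have "norm (LINT z|lborel. h (1 / real (Suc n) * z) * complex_of_real (std_normal_density z)) \<le> (LINT z|lborel. S * std_normal_density z)"
      by (rule Bochner_Integration.integral_norm_bound_integral[OF ih]) (use hS in \<open>simp_all add: norm_mult mult_right_mono\<close>)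
    then have b: "norm (LINT z|lborel. h (1 / real (Suc n) * z) * complex_of_real (std_normal_density z)) \<le> S"
      by simp
    have "(LINT x|lborel. ?g n x) = norm (LINT x|lborel. complex_of_real (?g n x))"
      using w0 by (simp only: integral_complex_of_real norm_of_real)
        (simp add: abs_of_nonneg Bochner_Integration.integral_nonneg)
    also have "\<dots> = sqrt (2 * pi) * norm (LINT z|lborel. h (1 / real (Suc n) * z) * of_real (std_normal_density z))"
      using gaussian_summation(1)[OF h e] unfolding eq by (simp add: norm_mult)
    also have "\<dots> \<le> sqrt (2 * pi) * S"
      by (intro mult_left_mono b) simp
    finally show ?thesis
      using w0 ig by (subst nn_integral_eq_integral) (auto intro!: ennreal_leI)
  qed
  have lim: "(\<lambda>n. ennreal (?g n x)) \<longlonglongrightarrow> ennreal (w x * (1 / sqrt (2 * pi)))" for x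
    by (intro tendsto_ennrealI tendsto_mult_left std_normal_density_LIMSEQ)
  have mg: "(\<lambda>x. ennreal (?g n x)) \<in> borel_measurable lborel" for n
    by (rule measurable_compose[OF borel_measurable_integrable[OF ig] measurable_ennreal])
  have l: "liminf (\<lambda>n. ennreal (?g n x)) = ennreal (w x * (1 / sqrt (2 * pi)))" for x
    by (rule lim_imp_Liminf[OF _ lim]) simp
  have "(\<integral>\<^sup>+x. liminf (\<lambda>n. ennreal (?g n x)) \<partial>lborel) \<le> liminf (\<lambda>n. \<integral>\<^sup>+x. ennreal (?g n x) \<partial>lborel)"
    by (rule nn_integral_liminf[OF mg])
  moreover have "liminf (\<lambda>n. \<integral>\<^sup>+x. ennreal (?g n x) \<partial>lborel) \<le> liminf (\<lambda>n. ennreal (sqrt (2 * pi) * S))"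
    by (rule Liminf_mono, rule always_eventually, rule allI, rule le)
  moreover have "liminf (\<lambda>n::nat. ennreal (sqrt (2 * pi) * S)) = ennreal (sqrt (2 * pi) * S)"
    by (rule Liminf_const) simp
  ultimately have m: "(\<integral>\<^sup>+x. ennreal (w x * (1 / sqrt (2 * pi))) \<partial>lborel) \<le> ennreal (sqrt (2 * pi) * S)"
    unfolding l by (simp only:)
  have "(\<integral>\<^sup>+x. ennreal (w x) \<partial>lborel) = (\<integral>\<^sup>+x. ennreal (sqrt (2 * pi)) * ennreal (w x * (1 / sqrt (2 * pi))) \<partial>lborel)"
  proof (intro nn_integral_cong)
    fix x
    have "w x = sqrt (2 * pi) * (w x * (1 / sqrt (2 * pi)))"
      by simp
    then show "ennreal (w x) = ennreal (sqrt (2 * pi)) * ennreal (w x * (1 / sqrt (2 * pi)))"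
      by (metis ennreal_mult' real_sqrt_ge_zero mult_nonneg_nonneg pi_ge_zero zero_le_numeral)
  qed
  also have "\<dots> = ennreal (sqrt (2 * pi)) * (\<integral>\<^sup>+x. ennreal (w x * (1 / sqrt (2 * pi))) \<partial>lborel)"
    by (rule nn_integral_cmult[OF measurable_compose[OF borel_measurable_times[OF wm borel_measurable_const] measurable_ennreal]])
  also have "\<dots> \<le> ennreal (sqrt (2 * pi)) * ennreal (sqrt (2 * pi) * S)"
    by (intro mult_left_mono m) simp
  also have "\<dots> = ennreal (sqrt (2 * pi) * (sqrt (2 * pi) * S))"
    using real(1) by (intro ennreal_mult[symmetric]) auto
  also have "sqrt (2 * pi) * (sqrt (2 * pi) * S) = 2 * pi * S"
    using real_sqrt_mult_self[of "2 * pi"] by (simp only: mult.assoc[symmetric]) simp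
  also have "ennreal (2 * pi * S) = ennreal (2 * pi) * ennreal S"
    using real(1) by (intro ennreal_mult) auto
  finally show ?thesis
    unfolding w_def real(2) .
qed

text \<open>Continuity and boundedness of f make the autocorrelation continuous at 0, and
  \<open>bessel_line\<close> makes |synth f|^2 integrable. These are the two conditions under which
  \<open>integral_synth_line\<close> applies to the autocorrelation.\<close>

lemma plancherel_line:
  assumes f: "line.bdd f" and c: "continuous_on UNIV f"
  shows "(\<integral>\<^sup>+x. ennreal ((norm (line.synth f x))\<^sup>2) \<partial>lborel) = ennreal (2 * pi) * (\<integral>\<^sup>+\<xi>. ennreal ((norm (f \<xi>))\<^sup>2) \<partial>lborel)"
    and "integrable lborel (\<lambda>x. (norm (line.synth f x))\<^sup>2)"
proof -
  have i: "integrable lborel f" and i2: "integrable lborel (\<lambda>\<xi>. (norm (f \<xi>))\<^sup>2)"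
  proof -
    show i: "integrable lborel f" using f by (rule line.bddD)
    obtain K where K: "\<And>\<xi>. norm (f \<xi>) \<le> K" using f by (auto simp: line.bdd_def)
    show "integrable lborel (\<lambda>\<xi>. (norm (f \<xi>))\<^sup>2)"
    proof (rule Bochner_Integration.integrable_bound[of _ "\<lambda>\<xi>. K * norm (f \<xi>)"])
      show "AE \<xi> in lborel. norm ((norm (f \<xi>))\<^sup>2) \<le> norm (K * norm (f \<xi>))"
        using K by (intro AE_I2) (auto simp: power2_eq_square abs_mult intro!: mult_right_mono order_trans[OF K abs_ge_self])
    qed (use i in auto)
  qed
  define h where "h = line.conv f (line.crefl 1 f)"
  define S where "S = (LINT \<xi>|lborel. (norm (f \<xi>))\<^sup>2)"
  have S: "(\<integral>\<^sup>+\<xi>. ennreal ((norm (f \<xi>))\<^sup>2) \<partial>lborel) = ennreal S" "S \<ge> 0"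
    unfolding S_def using i2 by (auto intro!: nn_integral_eq_integral Bochner_Integration.integral_nonneg)
  have h: "integrable lborel h"
    unfolding h_def by (intro line.integrable_conv line.integrable_crefl i)
  have hS: "norm (h \<xi>) \<le> S" for \<xi>
    unfolding h_def by (rule line.autocorrelation_le[OF i S])
  have sh: "line.synth h = (\<lambda>x. of_real ((norm (line.synth f x))\<^sup>2))"
    unfolding h_def by (intro ext line.synth_autocorrelation[OF i])
  have hc: "isCont h 0"
    unfolding isCont_def tendsto_at_iff_sequentially o_def
  proof (intro allI impI)
    fix Y :: "nat \<Rightarrow> real" assume Y: "Y \<longlonglongrightarrow> 0"
    obtain K where K: "\<And>\<xi>. norm (f \<xi>) \<le> K" using f by (auto simp: line.bdd_def)
    have cr: "integrable lborel (line.crefl 1 f)"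
      by (rule line.integrable_crefl[OF i])
    have [measurable]: "f \<in> borel_measurable borel" "line.crefl 1 f \<in> borel_measurable borel"
      using i cr by auto
    show "(\<lambda>n. h (Y n)) \<longlonglongrightarrow> h 0"
      unfolding h_def line.conv_def
    proof (rule integral_dominated_convergence[where w = "\<lambda>\<eta>. K * norm (line.crefl 1 f \<eta>)"])
      show "AE \<eta> in lborel. (\<lambda>n. f (Y n - \<eta>) * line.crefl 1 f \<eta>) \<longlonglongrightarrow> f (0 - \<eta>) * line.crefl 1 f \<eta>"
      proof (intro AE_I2 tendsto_mult_right)
        fix \<eta> :: real
        have "isCont f (0 - \<eta>)"
          using c continuous_on_eq_continuous_at open_UNIV by blast
        then show "(\<lambda>n. f (Y n - \<eta>)) \<longlonglongrightarrow> f (0 - \<eta>)"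
          using Y by (intro isCont_tendsto_compose[of _ f] tendsto_intros)
      qed
      show "AE \<eta> in lborel. norm (f (Y n - \<eta>) * line.crefl 1 f \<eta>) \<le> K * norm (line.crefl 1 f \<eta>)" for n
        using K by (intro AE_I2) (simp add: norm_mult mult_right_mono)
    qed (use cr in auto)
  qed
  have "(\<integral>\<^sup>+x. ennreal ((norm (line.synth f x))\<^sup>2) \<partial>lborel) < \<infinity>"
    using bessel_line[OF i] unfolding S by (rule le_less_trans) (simp add: ennreal_mult_less_top)
  moreover have [measurable]: "line.synth f \<in> borel_measurable borel"
    by (intro borel_measurable_continuous_onI line.synth_continuous i)
  ultimately show i3: "integrable lborel (\<lambda>x. (norm (line.synth f x))\<^sup>2)"
    by (intro integrableI_nonneg) auto
  then have "integrable lborel (line.synth h)"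
    unfolding sh by (simp only: complex_of_real_integrable_eq)
  then have "(LINT x|lborel. line.synth h x) = 2 * pi * h 0"
    by (rule integral_synth_line[OF h hS hc])
  moreover have "h 0 = of_real S"
    unfolding h_def S_def by (rule line.autocorrelation_0[OF i2])
  ultimately have "complex_of_real (LINT x|lborel. (norm (line.synth f x))\<^sup>2) = of_real (2 * pi * S)"
    unfolding sh integral_complex_of_real by simp
  then have "(LINT x|lborel. (norm (line.synth f x))\<^sup>2) = 2 * pi * S"
    by (simp only: of_real_eq_iff)
  then show "(\<integral>\<^sup>+x. ennreal ((norm (line.synth f x))\<^sup>2) \<partial>lborel) = ennreal (2 * pi) * (\<integral>\<^sup>+\<xi>. ennreal ((norm (f \<xi>))\<^sup>2) \<partial>lborel)"
    using i3 S by (simp add: nn_integral_eq_integral ennreal_mult)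
qed

subsection \<open>Fourier series\<close>

interpretation torus: freq "count_space (UNIV :: int set)" real_of_int
proof unfold_locales
  show "\<exists>A. countable A \<and> A \<subseteq> sets (count_space (UNIV :: int set)) \<and> \<Union> A = space (count_space UNIV) \<and>
      (\<forall>a\<in>A. emeasure (count_space UNIV) a \<noteq> \<infinity>)"
    by (rule sigma_finite_measure.sigma_finite_countable[OF sigma_finite_measure_count_space])
  show "(\<lambda>p. fst p - snd p) \<in> count_space (UNIV :: int set) \<Otimes>\<^sub>M count_space UNIV \<rightarrow>\<^sub>M count_space UNIV"
    by (simp add: pair_measure_countable)
  fix f :: "int \<Rightarrow> ennreal" and c :: int
  show "(\<integral>\<^sup>+\<xi>. f (\<xi> - c) \<partial>count_space UNIV) = (\<integral>\<^sup>+\<xi>. f \<xi> \<partial>count_space UNIV)"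
    by (rule nn_integral_bij_count_space) (auto intro!: bij_betwI[where g = "\<lambda>\<xi>. \<xi> + c"])
  show "(\<integral>\<^sup>+\<xi>. f (- \<xi>) \<partial>count_space UNIV) = (\<integral>\<^sup>+\<xi>. f \<xi> \<partial>count_space UNIV)"
    by (rule nn_integral_bij_count_space) (auto intro!: bij_betwI[where g = uminus])
qed auto

text \<open>A density on the whole line, not a measure on a subspace: periodic functions on the line
  and Borel measurability there can then be used directly.\<close>

definition circle :: "real measure" where
  "circle = density lborel (\<lambda>x. ennreal (indicator {0..2 * pi} x))"

lemma sets_circle [measurable_cong]: "sets circle = sets borel"
  by (simp add: circle_def)

lemma integral_circle:
  fixes f :: "real \<Rightarrow> 'a::{banach, second_countable_topology}"
  assumes "f \<in> borel_measurable borel"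
  shows "(LINT x|circle. f x) = (LINT x:{0..2 * pi}|lborel. f x)"
  unfolding circle_def set_lebesgue_integral_def using assms by (intro integral_density) auto

lemma emeasure_circle: "emeasure circle UNIV = ennreal (2 * pi)"
  by (simp add: circle_def emeasure_density ennreal_indicator)

lemma finite_circle: "finite_measure circle"
  by (intro finite_measureI) (simp add: emeasure_circle sets_eq_imp_space_eq[OF sets_circle])

lemma measure_circle: "measure circle (space circle) = 2 * pi"
  by (simp add: measure_def emeasure_circle sets_eq_imp_space_eq[OF sets_circle])

lemma has_vector_derivative_cis:
  "((\<lambda>x. cis (x * a)) has_vector_derivative \<i> * of_real a * cis (x * a)) (at x)"
proof -
  have "((\<lambda>z. exp (\<i> * of_real a * z)) has_field_derivative \<i> * of_real a * exp (\<i> * of_real a * of_real x)) (at (of_real x))"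
    by (auto intro!: derivative_eq_intros)
  from has_vector_derivative_real_field[OF this] show ?thesis
    by (simp add: cis_conv_exp mult_ac)
qed

interpretation circle: phys circle "2 * pi" "\<lambda>_. 1"
proof unfold_locales
  show "sets circle = sets borel"
    by (rule sets_circle)
  show "1 \<le> 2 * (1 + (x - y)\<^sup>2) * (1::real)" for x y :: real
    by simp
  show "integrable circle (\<lambda>_. 1 :: real)"
    using finite_circle by (simp add: finite_measure.integrable_const)
  fix g g' :: "real \<Rightarrow> complex"
  assume g: "\<And>x. (g has_vector_derivative g' x) (at x)" "continuous_on UNIV g'" "\<And>x. g (x + 2 * pi) = g x"
  have "(LINT x|circle. g' x) = (LINT x|lborel. indicator {0..2 * pi} x *\<^sub>R g' x)"
    using g(2) by (simp add: integral_circle set_lebesgue_integral_def borel_measurable_continuous_onI)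
  also have "\<dots> = g (2 * pi) - g 0"
    using g(1) by (intro integral_FTC_Icc continuous_on_subset[OF g(2)]) (auto intro: has_vector_derivative_at_within)
  finally show "(LINT x|circle. g' x) = 0"
    using g(3)[of 0] by simp
qed auto

lemma integral_cis_circle: "(LINT x|circle. cis (x * of_int k)) = (if k = 0 then 2 * pi else 0)"
proof (cases "k = 0")
  case True
  then show ?thesis
    by (simp add: measure_circle scaleR_conv_of_real)
next
  case False
  have "(LINT x|circle. cis (x * of_int k)) = 0"
  proof (rule circle.int_deriv[where g = "\<lambda>x. cis (x * of_int k) / (\<i> * of_int k)" and c = 0 and K = 1])
    show "((\<lambda>x. cis (x * of_int k) / (\<i> * of_int k)) has_vector_derivative cis (x * of_int k)) (at x)" for x
      by (rule has_vector_derivative_eq_rhs[OF has_vector_derivative_divide[OF has_vector_derivative_cis]]) (use False in simp)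
    show "continuous_on UNIV (\<lambda>x. cis (x * of_int k))"
      by (intro continuous_intros)
    show "cis ((x + 2 * pi) * of_int k) / (\<i> * of_int k) = cis (x * of_int k) / (\<i> * of_int k)" for x
      using cis_multiple_2pi[of "of_int k"] by (simp add: ring_distribs mult_ac flip: cis_mult)
    show "norm (cis (x * of_int k) / (\<i> * of_int k) - 0) \<le> 1 * 1" for x
      using False by (simp add: norm_divide norm_mult divide_le_eq_1)
  qed simp
  then show ?thesis
    using False by simp
qed

lemma integral_count_space_indicator:
  fixes f :: "int \<Rightarrow> 'a::{banach, second_countable_topology}"
  assumes "finite A"
  shows "(LINT k|count_space UNIV. indicator A k *\<^sub>R f k) = sum f A"
proof -
  have fin: "finite {k. indicator A k *\<^sub>R f k \<noteq> 0}"
    using assms by (rule rev_finite_subset) (auto simp: indicator_def split: if_splits)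
  have "(LINT k|count_space UNIV. indicator A k *\<^sub>R f k) = (\<Sum>k | indicator A k *\<^sub>R f k \<noteq> 0. indicator A k *\<^sub>R f k)"
    using lebesgue_integral_count_space_finite_support[of UNIV "\<lambda>k. indicator A k *\<^sub>R f k"] fin by simp
  also have "\<dots> = (\<Sum>k\<in>A. indicator A k *\<^sub>R f k)"
    using assms by (intro sum.mono_neutral_left) (auto simp: indicator_def split: if_splits)
  also have "\<dots> = sum f A"
    by (intro sum.cong) auto
  finally show ?thesis .
qed

lemma integrable_count_space_indicator:
  fixes f :: "int \<Rightarrow> complex"
  assumes "finite A"
  shows "integrable (count_space UNIV) (\<lambda>k. indicator A k *\<^sub>R f k)"
proof (rule integrableI_bounded)
  have "(\<integral>\<^sup>+k. ennreal (norm (indicator A k *\<^sub>R f k)) \<partial>count_space UNIV) = (\<Sum>k\<in>A. ennreal (norm (indicator A k *\<^sub>R f k)))"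
    by (rule nn_integral_count_space'[OF assms]) auto
  also have "\<dots> = ennreal (\<Sum>k\<in>A. norm (indicator A k *\<^sub>R f k))"
    by (rule sum_ennreal) simp
  finally show "(\<integral>\<^sup>+k. ennreal (norm (indicator A k *\<^sub>R f k)) \<partial>count_space UNIV) < \<infinity>"
    by simp
qed simp

lemma bdd_torus:
  fixes f :: "int \<Rightarrow> complex"
  assumes "integrable (count_space UNIV) f"
  shows "torus.bdd f"
proof -
  obtain K where K: "(\<integral>\<^sup>+k. ennreal (norm (f k)) \<partial>count_space UNIV) = ennreal K" "K \<ge> 0"
    using assms unfolding integrable_iff_bounded
    by (cases "\<integral>\<^sup>+k. ennreal (norm (f k)) \<partial>count_space UNIV") auto
  have "ennreal (norm (f k)) \<le> (\<integral>\<^sup>+k. ennreal (norm (f k)) \<partial>count_space UNIV)" for k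
    by (rule nn_integral_ge_point) simp
  then have "norm (f k) \<le> K" for k
    unfolding K(1) using K(2) by (simp add: ennreal_le_iff)
  then show ?thesis
    using assms unfolding torus.bdd_def by blast
qed

lemma integral_synth_torus:
  fixes h :: "int \<Rightarrow> complex"
  assumes h: "integrable (count_space UNIV) h"
  shows "(LINT x|circle. torus.synth h x) = 2 * pi * h 0"
    and "integrable circle (torus.synth h)"
proof -
  interpret finite_measure circle by (rule finite_circle)
  have one: "integrable circle (\<lambda>_. 1 :: complex)"
    by (rule integrable_const)
  note sp = torus.synth_pairing[OF sigma_finite_measure_axioms sets_circle h one]
  show "integrable circle (torus.synth h)"
    using sp(2) by simp
  have "(LINT x|circle. torus.synth h x) = (LINT k|count_space UNIV. h k * (LINT x|circle. cis (x * of_int k)))"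
    using sp(1) by simp
  also have "\<dots> = (LINT k|count_space UNIV. indicator {0} k *\<^sub>R (2 * pi * h k))"
    unfolding integral_cis_circle by (intro Bochner_Integration.integral_cong) auto
  also have "\<dots> = 2 * pi * h 0"
    by (subst integral_count_space_indicator) auto
  finally show "(LINT x|circle. torus.synth h x) = 2 * pi * h 0" .
qed

lemma parseval_torus:
  fixes f :: "int \<Rightarrow> complex"
  assumes f: "integrable (count_space UNIV) f"
  shows "(\<integral>\<^sup>+x. ennreal ((norm (torus.synth f x))\<^sup>2) \<partial>circle) = ennreal (2 * pi) * (\<integral>\<^sup>+k. ennreal ((norm (f k))\<^sup>2) \<partial>count_space UNIV)"
    and "integrable circle (\<lambda>x. (norm (torus.synth f x))\<^sup>2)"
    and "integrable (count_space UNIV) (\<lambda>k. (norm (f k))\<^sup>2)"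
    and "(LINT x|circle. (norm (torus.synth f x))\<^sup>2) = 2 * pi * (LINT k|count_space UNIV. (norm (f k))\<^sup>2)"
proof -
  obtain K where K: "\<And>k. norm (f k) \<le> K" using bdd_torus[OF f] by (auto simp: torus.bdd_def)
  show i2: "integrable (count_space UNIV) (\<lambda>k. (norm (f k))\<^sup>2)"
  proof (rule Bochner_Integration.integrable_bound[of _ "\<lambda>k. K * norm (f k)"])
    show "AE k in count_space UNIV. norm ((norm (f k))\<^sup>2) \<le> norm (K * norm (f k))"
      using K by (intro AE_I2) (auto simp: power2_eq_square abs_mult intro!: mult_right_mono order_trans[OF K abs_ge_self])
  qed (use f in auto)
  define h where "h = torus.conv f (torus.crefl 1 f)"
  have h: "integrable (count_space UNIV) h"
    unfolding h_def by (intro torus.integrable_conv torus.integrable_crefl f)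
  have sh: "torus.synth h = (\<lambda>x. of_real ((norm (torus.synth f x))\<^sup>2))"
    unfolding h_def by (intro ext torus.synth_autocorrelation[OF f])
  show i3: "integrable circle (\<lambda>x. (norm (torus.synth f x))\<^sup>2)"
    using integral_synth_torus(2)[OF h] unfolding sh by (simp only: complex_of_real_integrable_eq)
  have "h 0 = of_real (LINT k|count_space UNIV. (norm (f k))\<^sup>2)"
    unfolding h_def by (rule torus.autocorrelation_0[OF i2])
  then have "complex_of_real (LINT x|circle. (norm (torus.synth f x))\<^sup>2) = of_real (2 * pi * (LINT k|count_space UNIV. (norm (f k))\<^sup>2))"
    using integral_synth_torus(1)[OF h] unfolding sh integral_complex_of_real by simp
  then show e: "(LINT x|circle. (norm (torus.synth f x))\<^sup>2) = 2 * pi * (LINT k|count_space UNIV. (norm (f k))\<^sup>2)"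
    by (simp only: of_real_eq_iff)
  then show "(\<integral>\<^sup>+x. ennreal ((norm (torus.synth f x))\<^sup>2) \<partial>circle) = ennreal (2 * pi) * (\<integral>\<^sup>+k. ennreal ((norm (f k))\<^sup>2) \<partial>count_space UNIV)"
    by (simp add: nn_integral_eq_integral i2 i3 ennreal_mult Bochner_Integration.integral_nonneg)
qed

section \<open>Fourier coefficients of functions with decay\<close>

context phys
begin

text \<open>The factor 1 / (2 pi) makes \<open>coef\<close> the inverse of the unnormalised
  \<open>synth\<close>.\<close>

definition coef :: "(real \<Rightarrow> complex) \<Rightarrow> real \<Rightarrow> complex" where
  "coef f \<xi> = of_real (1 / (2 * pi)) * (LINT x|X. f x * cis (- (x * \<xi>)))"

lemma cis_continuous: "continuous_on UNIV (\<lambda>x. cis (- (x * \<xi>)))"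
  by (intro continuous_intros)

lemma integrable_coef:
  assumes "continuous_on UNIV f" "dec f"
  shows "integrable X (\<lambda>x. f x * cis (- (x * \<xi>)))"
  using assms by (intro integrable_dec continuous_intros cis_continuous dec_mult_bounded[where B = 1]) auto

lemma norm_coef_le:
  assumes f: "continuous_on UNIV f" and K: "\<And>x. norm (f x) \<le> K * \<rho> x"
  shows "norm (coef f \<xi>) \<le> K * (LINT x|X. \<rho> x)"
proof -
  have "norm (LINT x|X. f x * cis (- (x * \<xi>))) \<le> (LINT x|X. K * \<rho> x)"
    by (rule Bochner_Integration.integral_norm_bound_integral[OF integrable_coef])
      (use f K \<rho>_int in \<open>auto intro!: decI[where K = K] simp: norm_mult\<close>)
  then have "1 / (2 * pi) * norm (LINT x|X. f x * cis (- (x * \<xi>))) \<le> 1 / (2 * pi) * (K * (LINT x|X. \<rho> x))"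
    unfolding integral_mult_right_zero by (rule mult_left_mono) simp
  moreover have "norm (coef f \<xi>) = 1 / (2 * pi) * norm (LINT x|X. f x * cis (- (x * \<xi>)))"
    by (simp add: coef_def norm_mult norm_divide)
  moreover have "0 \<le> K * (LINT x|X. \<rho> x)"
  proof (intro mult_nonneg_nonneg Bochner_Integration.integral_nonneg)
    show "K \<ge> 0"
      using order_trans[OF norm_ge_zero K[of 0]] \<rho>_pos[of 0] by (simp add: zero_le_mult_iff)
  qed (use \<rho>_pos in \<open>simp add: less_imp_le\<close>)
  moreover have "1 / (2 * pi) \<le> 1"
    using pi_ge_two by simp
  ultimately show ?thesis
    using mult_right_mono[of "1 / (2 * pi)" 1 "K * (LINT x|X. \<rho> x)"] by linarith
qed

lemma coef_diff:
  assumes "continuous_on UNIV f" "dec f" "continuous_on UNIV g" "dec g"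
  shows "coef f \<xi> - coef g \<xi> = coef (\<lambda>x. f x - g x) \<xi>"
  unfolding coef_def using integrable_coef[OF assms(1,2)] integrable_coef[OF assms(3,4)]
  by (simp add: left_diff_distrib right_diff_distrib diff_divide_distrib)

text \<open>Integration by parts in the form \<open>int_deriv\<close>. The condition on L makes the
  exponential L-periodic; on the line L = 0 and every frequency satisfies it.\<close>

lemma coef_deriv:
  assumes f: "\<And>x. (f has_vector_derivative f' x) (at x)" and f': "continuous_on UNIV f'"
    and d: "dec f" "dec f'" and p: "\<And>x. f (x + L) = f x" and L: "cis (L * \<xi>) = 1"
  shows "coef f' \<xi> = \<i> * of_real \<xi> * coef f \<xi>"
proof -
  let ?e = "\<lambda>x. cis (- (x * \<xi>))"
  have cf: "continuous_on UNIV f"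
    using f by (meson continuous_at_imp_continuous_on has_vector_derivative_continuous)
  have de: "(?e has_vector_derivative - (\<i> * of_real \<xi> * ?e x)) (at x)" for x
    using has_vector_derivative_cis[of "- \<xi>" x] by simp
  have dg: "((\<lambda>x. f x * ?e x) has_vector_derivative (f x * - (\<i> * of_real \<xi> * ?e x) + f' x * ?e x)) (at x)" for x
    by (intro has_vector_derivative_mult f de)
  let ?g' = "\<lambda>x. f x * - (\<i> * of_real \<xi> * ?e x) + f' x * ?e x"
  have "dec (\<lambda>x. f x * ?e x)" and dg': "dec ?g'"
    by (intro d dec_add dec_mult_bounded[where B = "\<bar>\<xi>\<bar>"] dec_mult_bounded[where B = 1]; simp add: norm_mult)+
  then obtain K1 K2 where K: "\<And>x. norm (f x * ?e x) \<le> K1 * \<rho> x" "\<And>x. norm (?g' x) \<le> K2 * \<rho> x"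
    unfolding dec_def by blast
  have "cis (- (L * \<xi>)) = 1"
    using L by (metis cis_cnj complex_cnj_one)
  moreover have "?e (x + L) = ?e x * cis (- (L * \<xi>))" for x
    by (simp add: cis_mult ring_distribs)
  ultimately have per: "f (x + L) * ?e (x + L) = f x * ?e x" for x
    using p by simp
  have "(LINT x|X. ?g' x) = 0"
  proof (rule int_deriv[OF dg _ per, where K = "max K1 K2" and c = 0])
    show "continuous_on UNIV ?g'"
      by (intro continuous_intros cf f' cis_continuous)
    show "norm (?g' x) \<le> max K1 K2 * \<rho> x" "norm (f x * ?e x - 0) \<le> max K1 K2 * \<rho> x" for x
      using K[of x] \<rho>_pos[of x] by (auto intro: order_trans[OF _ mult_right_mono])
  qed
  moreover have "?g' x = f' x * ?e x - \<i> * of_real \<xi> * (f x * ?e x)" for x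
    by simp
  ultimately have "(LINT x|X. f' x * ?e x - \<i> * of_real \<xi> * (f x * ?e x)) = 0"
    by (simp only:)
  then have "(LINT x|X. f' x * ?e x) = \<i> * of_real \<xi> * (LINT x|X. f x * ?e x)"
    using integrable_coef[OF cf d(1)] integrable_coef[OF f' d(2)] by simp
  then show ?thesis
    unfolding coef_def by simp
qed

text \<open>Two integrations by parts bound (1 + \<xi>^2) |coef f| by 2 K times the integral of
  \<rho>; another factor 2 comes from (1 + |\<xi>|)^2 <= 2 (1 + \<xi>^2).\<close>

lemma coef_decay:
  assumes f: "\<And>x. (f has_vector_derivative f' x) (at x)" and f': "\<And>x. (f' has_vector_derivative f'' x) (at x)"
    and f'': "continuous_on UNIV f''" and d: "dec f'" and p: "\<And>x. f (x + L) = f x" "\<And>x. f' (x + L) = f' x"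
    and K: "\<And>x. norm (f x) \<le> K * \<rho> x" "\<And>x. norm (f'' x) \<le> K * \<rho> x" and L: "cis (L * \<xi>) = 1"
  shows "norm (coef f \<xi>) \<le> 4 * K * (LINT x|X. \<rho> x) * (1 + \<bar>\<xi>\<bar>) powr - 2"
proof -
  have c: "continuous_on UNIV f" "continuous_on UNIV f'"
    using f f' by (meson continuous_at_imp_continuous_on has_vector_derivative_continuous)+
  have df: "dec f" "dec f''"
    using K by (auto intro: decI)
  have "coef f'' \<xi> = \<i> * of_real \<xi> * (\<i> * of_real \<xi> * coef f \<xi>)"
    unfolding coef_deriv[OF f' f'' d df(2) p(2) L] coef_deriv[OF f c(2) df(1) d p(1) L] ..
  then have "norm (coef f'' \<xi>) = \<xi>\<^sup>2 * norm (coef f \<xi>)"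
    by (simp add: norm_mult power2_eq_square)
  moreover have "norm (coef f \<xi>) \<le> K * (LINT x|X. \<rho> x)" "norm (coef f'' \<xi>) \<le> K * (LINT x|X. \<rho> x)"
    using K f'' c by (auto intro!: norm_coef_le)
  ultimately have b: "(1 + \<xi>\<^sup>2) * norm (coef f \<xi>) \<le> 2 * (K * (LINT x|X. \<rho> x))"
    by (simp add: distrib_right)
  have "(1 + \<bar>\<xi>\<bar>)\<^sup>2 \<le> 2 * (1 + \<xi>\<^sup>2)"
    using square_one_plus_le[of "\<bar>\<xi>\<bar>"] by simp
  then have "(1 + \<bar>\<xi>\<bar>)\<^sup>2 * norm (coef f \<xi>) \<le> 2 * (1 + \<xi>\<^sup>2) * norm (coef f \<xi>)"
    by (rule mult_right_mono) simp
  then have "(1 + \<bar>\<xi>\<bar>)\<^sup>2 * norm (coef f \<xi>) \<le> 4 * K * (LINT x|X. \<rho> x)"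
    using b by linarith
  then have "norm (coef f \<xi>) \<le> 4 * K * (LINT x|X. \<rho> x) / (1 + \<bar>\<xi>\<bar>)\<^sup>2"
    by (subst pos_le_divide_eq) (auto simp: mult.commute add_pos_nonneg)
  moreover have "(1 + \<bar>\<xi>\<bar>) powr - 2 = 1 / (1 + \<bar>\<xi>\<bar>)\<^sup>2"
    by (simp add: powr_minus powr_numeral inverse_eq_divide)
  ultimately show ?thesis
    by simp
qed

lemma coef_tendsto:
  assumes f: "wcont f" "\<And>t. continuous_on UNIV (f t)"
  shows "((\<lambda>s. coef (f s) \<xi>) \<longlongrightarrow> coef (f t) \<xi>) (at t)"
proof (rule LIM_I)
  fix r :: real assume r: "r > 0"
  define I where "I = (LINT x|X. \<rho> x)"
  have I: "I \<ge> 0"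
    unfolding I_def using \<rho>_pos by (intro Bochner_Integration.integral_nonneg) (simp add: less_imp_le)
  have e: "r / (I + 1) > 0"
    using r I by simp
  obtain d where d: "d > 0" "\<And>s x. \<bar>s - t\<bar> < d \<Longrightarrow> norm (f s x - f t x) \<le> r / (I + 1) * \<rho> x"
    using wcontD(2)[OF f(1) e, of t] by blast
  have "norm (coef (f s) \<xi> - coef (f t) \<xi>) < r" if "\<bar>s - t\<bar> < d" for s
  proof -
    have "norm (coef (\<lambda>x. f s x - f t x) \<xi>) \<le> r / (I + 1) * (LINT x|X. \<rho> x)"
      by (rule norm_coef_le) (use f(2) d(2)[OF that] in \<open>auto intro!: continuous_intros\<close>)
    then have "norm (coef (f s) \<xi> - coef (f t) \<xi>) \<le> r / (I + 1) * I"
      unfolding coef_diff[OF f(2) wcontD(1)[OF f(1)] f(2) wcontD(1)[OF f(1)]] I_def[symmetric] .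
    also have "\<dots> < r"
      using r I by (simp add: divide_less_eq)
    finally show ?thesis .
  qed
  then show "\<exists>d>0. \<forall>s. s \<noteq> t \<and> norm (s - t) < d \<longrightarrow> norm (coef (f s) \<xi> - coef (f t) \<xi>) < r"
    using d(1) by auto
qed

end

context mkdv_flow
begin

text \<open>Continuity in the weighted norm makes the constants for u and its second derivative
  uniform for times near t, and \<open>coef_decay\<close> then applies with one constant.\<close>

lemma coef_dominated:
  "\<exists>K d. d > 0 \<and> (\<forall>s \<xi>. \<bar>s - t\<bar> < d \<longrightarrow> cis (L * \<xi>) = 1 \<longrightarrow> norm (coef (u s) \<xi>) \<le> K * (1 + \<bar>\<xi>\<bar>) powr - 2)"
proof -
  have "\<exists>K d. d > 0 \<and> (\<forall>s x. \<bar>s - t\<bar> < d \<longrightarrow> norm ((dx ^^ j) (u s) x) \<le> K * \<rho> x)" for j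
  proof -
    obtain K where K: "\<And>x. norm ((dx ^^ j) (u t) x) \<le> K * \<rho> x"
      using wcontD(1)[OF wcont_u[of j], of t] by (auto simp: dec_def)
    obtain d where d: "d > 0" "\<And>s x. \<bar>s - t\<bar> < d \<Longrightarrow> norm ((dx ^^ j) (u s) x - (dx ^^ j) (u t) x) \<le> 1 * \<rho> x"
      using wcontD(2)[OF wcont_u[of j], of 1 t] by auto
    have "norm ((dx ^^ j) (u s) x) \<le> (K + 1) * \<rho> x" if "\<bar>s - t\<bar> < d" for s x
      using norm_triangle_sub[of "(dx ^^ j) (u s) x" "(dx ^^ j) (u t) x"] K[of x] d(2)[OF that, of x]
      by (simp add: distrib_right)
    then show ?thesis
      using d(1) by blast
  qed
  note b = this
  obtain K d where 1: "d > 0" "\<And>s x. \<bar>s - t\<bar> < d \<Longrightarrow> norm (u s x) \<le> K * \<rho> x"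
    using b[of 0] by auto
  obtain K' d' where 2: "d' > 0" "\<And>s x. \<bar>s - t\<bar> < d' \<Longrightarrow> norm ((dx ^^ 2) (u s) x) \<le> K' * \<rho> x"
    using b[of 2] by blast
  have "norm (coef (u s) \<xi>) \<le> 4 * max K K' * (LINT x|X. \<rho> x) * (1 + \<bar>\<xi>\<bar>) powr - 2"
    if s: "\<bar>s - t\<bar> < min d d'" and L: "cis (L * \<xi>) = 1" for s \<xi>
  proof (rule coef_decay[where f' = "dx (u s)" and f'' = "(dx ^^ 2) (u s)", OF _ _ _ _ _ _ _ _ L])
    show "(u s has_vector_derivative dx (u s) x) (at x)" "(dx (u s) has_vector_derivative (dx ^^ 2) (u s) x) (at x)" for x
      using smooth_u[of 0 s x] smooth_u[of 1 s x] by (simp_all add: numeral_2_eq_2)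
    show "dec (dx (u s))"
      using wcontD(1)[OF wcont_u1] .
    show "u s (x + L) = u s x" "dx (u s) (x + L) = dx (u s) x" for x
      using per_u[of 0 s x] per_u[of 1 s x] by simp_all
    show "norm (u s x) \<le> max K K' * \<rho> x" "norm ((dx ^^ 2) (u s) x) \<le> max K K' * \<rho> x" for x
      using 1(2)[of s x] 2(2)[of s x] s \<rho>_pos[of x] by (auto intro: order_trans[OF _ mult_right_mono])
  qed (rule cont_u)
  then show ?thesis
    using 1(1) 2(1) by (meson min_less_iff_conj)
qed

end

text \<open>|cis t - 1| = 2 sin (|t| / 2), and sin s >= s / 2 on [0, 8/5], an interval containing
  [0, pi / 2], follows from the Taylor bound |sin s - s| <= s^3 / 6 and s^2 <= 3.\<close>

lemma norm_cis_minus_one: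
  assumes "\<bar>t\<bar> \<le> pi"
  shows "\<bar>t\<bar> \<le> 2 * norm (cis t - 1)"
proof -
  define s where "s = \<bar>t\<bar> / 2"
  have s: "0 \<le> s" "s \<le> 8 / 5"
    using assms pi_less_4 pi_approx by (auto simp: s_def)
  have "\<bar>sin s - s\<bar> \<le> s ^ 3 / 6"
    using Maclaurin_sin_bound[of s 3] s(1) by (simp add: sin_coeff_def eval_nat_numeral fact_numeral field_simps)
  moreover have "s\<^sup>2 \<le> (8 / 5)\<^sup>2"
    using s by (intro power_mono)
  then have "s * s\<^sup>2 \<le> s * 3"
    using s(1) by (intro mult_left_mono) (auto simp: power2_eq_square)
  then have "s ^ 3 \<le> 3 * s"
    by (simp add: power3_eq_cube power2_eq_square mult_ac)
  ultimately have sn: "s / 2 \<le> sin s"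
    by linarith
  have "(norm (cis t - 1))\<^sup>2 = (2 * sin s)\<^sup>2"
  proof -
    have "cos \<bar>t\<bar> = 1 - 2 * (sin s)\<^sup>2"
      using cos_double_sin[of s] by (simp add: s_def)
    then have "cos t = 1 - 2 * (sin s)\<^sup>2"
      by simp
    moreover have "(norm (cis t - 1))\<^sup>2 = (cos t - 1)\<^sup>2 + (sin t)\<^sup>2"
      by (simp add: cmod_power2)
    moreover have "(sin t)\<^sup>2 + (cos t)\<^sup>2 = 1"
      by simp
    ultimately show ?thesis
      by (simp add: power2_eq_square algebra_simps)
  qed
  then have "norm (cis t - 1) = 2 * sin s"
    using sn s(1) by (subst (asm) power2_eq_iff_nonneg) auto
  then show ?thesis
    using sn by (simp add: s_def)
qed

lemma periodic_of_int:
  fixes u :: "real \<Rightarrow> 'a"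
  assumes p: "\<And>x. u (x + L) = u x"
  shows "u (z + L * of_int n) = u z"
proof (induction n arbitrary: z rule: int_induct[where k = 0])
  case (step1 i)
  then show ?case using p[of "z + L * of_int i"] by (simp add: algebra_simps)
next
  case (step2 i)
  then show ?case using p[of "z + L * of_int (i - 1)"] by (simp add: algebra_simps)
qed simp

text \<open>Shifting y by a multiple of 2 pi brings y - x into [-pi, pi], where |y - x| is at most
  twice |cis (y - x) - 1|. This bounds the quotient g in Chernoff's argument.\<close>

lemma periodic_lipschitz:
  fixes u :: "real \<Rightarrow> complex"
  assumes d: "\<And>x. (u has_vector_derivative u' x) (at x)" and K: "\<And>x. norm (u' x) \<le> K" and p: "\<And>x. u (x + 2 * pi) = u x"
  shows "norm (u y - u x) \<le> 2 * K * norm (cis (y - x) - 1)"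
proof -
  have K0: "K \<ge> 0"
    using order_trans[OF norm_ge_zero K[of 0]] .
  have lip: "norm (u b - u a) \<le> K * \<bar>b - a\<bar>" for a b
    using differentiable_bound[of UNIV u "\<lambda>x h. h *\<^sub>R u' x" K b a] d K
    by (simp add: has_vector_derivative_def onorm_scaleR_left real_norm_def mult.commute onorm_id)
  have pn: "u (z + 2 * pi * of_int n) = u z" for z n
    by (rule periodic_of_int[of u "2 * pi", OF p])
  define n where "n = round ((y - x) / (2 * pi))"
  define t where "t = y - x - 2 * pi * of_int n"
  have "\<bar>(y - x) / (2 * pi) - of_int n\<bar> \<le> 1 / 2"
    using of_int_round_abs_le[of "(y - x) / (2 * pi)"] by (simp add: n_def abs_minus_commute)
  then have "2 * pi * \<bar>(y - x) / (2 * pi) - of_int n\<bar> \<le> 2 * pi * (1 / 2)"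
    by (intro mult_left_mono) auto
  moreover have "t = 2 * pi * ((y - x) / (2 * pi) - of_int n)"
    by (simp add: t_def field_simps)
  ultimately have t: "\<bar>t\<bar> \<le> pi"
    by (simp add: abs_mult)
  have "u y = u (x + t)"
    using pn[of "x + t" n] by (simp add: t_def)
  moreover have "cis (y - x) = cis t"
  proof -
    have "y - x = t + 2 * pi * of_int n"
      by (simp add: t_def)
    then show ?thesis
      using cis_multiple_2pi[of "of_int n"] by (simp flip: cis_mult)
  qed
  moreover have "norm (u (x + t) - u x) \<le> K * \<bar>t\<bar>"
    using lip[of "x + t" x] by simp
  moreover have "K * \<bar>t\<bar> \<le> K * (2 * norm (cis t - 1))"
    by (intro mult_left_mono norm_cis_minus_one t K0)
  ultimately show ?thesis
    by simp
qed

text \<open>By duality, since g is merely bounded: the trigonometric polynomial with the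
  coefficients of g on A is paired with cnj g. The pairing equals 2 pi a, with a the sum to be
  bounded, and by Parseval and the arithmetic-geometric mean inequality it is at most (2 pi a + 2 pi
  C^2) / 2.\<close>

lemma bessel_circle:
  fixes g :: "real \<Rightarrow> complex"
  assumes g: "g \<in> borel_measurable borel" and C: "\<And>x. norm (g x) \<le> C" and A: "finite (A :: int set)"
  shows "(\<Sum>k\<in>A. (norm (circle.coef g (of_int k)))\<^sup>2) \<le> C\<^sup>2"
proof -
  interpret finite_measure circle by (rule finite_circle)
  have gm: "g \<in> borel_measurable circle"
    using g measurable_cong_sets[OF sets_circle refl] by blast
  have bi: "integrable circle f" if "f \<in> borel_measurable circle" "\<And>x. norm (f x) \<le> B" for f :: "real \<Rightarrow> complex" and B
    using that by (intro integrable_const_bound[where B = B]) auto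
  define \<gamma> where "\<gamma> k = circle.coef g (of_int k)" for k :: int
  define f where "f k = indicator A k *\<^sub>R \<gamma> k" for k
  define a where "a = (\<Sum>k\<in>A. (norm (\<gamma> k))\<^sup>2)"
  have f: "integrable (count_space UNIV) f"
    unfolding f_def by (rule integrable_count_space_indicator[OF A])
  have gc: "integrable circle (\<lambda>x. cnj (g x))"
    by (rule integrable_cnj[OF bi[OF gm C]])
  have "(norm (f k))\<^sup>2 = indicator A k * (norm (\<gamma> k))\<^sup>2" for k
    by (simp add: f_def indicator_def)
  moreover have "(LINT k|count_space UNIV. indicator A k * (norm (\<gamma> k))\<^sup>2) = a"
  proof -
    have "complex_of_real (LINT k|count_space UNIV. indicator A k * (norm (\<gamma> k))\<^sup>2)
        = (LINT k|count_space UNIV. indicator A k *\<^sub>R of_real ((norm (\<gamma> k))\<^sup>2))"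
      unfolding integral_complex_of_real[symmetric] by (intro Bochner_Integration.integral_cong) (auto simp: indicator_def)
    also have "\<dots> = of_real a"
      unfolding a_def by (simp add: integral_count_space_indicator[OF A])
    finally show ?thesis
      by (simp only: of_real_eq_iff)
  qed
  ultimately have fa: "(LINT k|count_space UNIV. (norm (f k))\<^sup>2) = a"
    by (simp only:)
  have "(LINT x|circle. torus.synth f x * cnj (g x)) = (LINT k|count_space UNIV. f k * (LINT x|circle. cnj (g x) * cis (x * of_int k)))"
    by (rule torus.synth_pairing(1)[OF sigma_finite_measure_axioms sets_circle f gc])
  also have "\<dots> = (LINT k|count_space UNIV. indicator A k *\<^sub>R of_real (2 * pi * (norm (\<gamma> k))\<^sup>2))"
  proof (rule Bochner_Integration.integral_cong[OF refl])
    fix k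
    have "(LINT x|circle. cnj (g x) * cis (x * of_int k)) = (LINT x|circle. cnj (g x * cis (- (x * of_int k))))"
      by (simp add: cis_cnj)
    also have "\<dots> = cnj (2 * pi * \<gamma> k)"
      unfolding Bochner_Integration.integral_cnj by (simp add: \<gamma>_def circle.coef_def)
    finally have e: "(LINT x|circle. cnj (g x) * cis (x * of_int k)) = cnj (2 * pi * \<gamma> k)" .
    have "\<gamma> k * cnj (2 * pi * \<gamma> k) = of_real (2 * pi * (norm (\<gamma> k))\<^sup>2)"
      by (simp add: complex_of_norm_squared)
    then show "f k * (LINT x|circle. cnj (g x) * cis (x * of_int k)) = indicator A k *\<^sub>R of_real (2 * pi * (norm (\<gamma> k))\<^sup>2)"
      unfolding e f_def by (simp add: indicator_def)
  qed
  also have "\<dots> = of_real (2 * pi * a)"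
    unfolding integral_count_space_indicator[OF A] a_def by (simp add: sum_distrib_left)
  finally have "2 * pi * a = Re (LINT x|circle. torus.synth f x * cnj (g x))"
    by simp
  also have "\<dots> \<le> norm (LINT x|circle. torus.synth f x * cnj (g x))"
    by (rule complex_Re_le_cmod)
  also have "\<dots> \<le> (LINT x|circle. ((norm (torus.synth f x))\<^sup>2 + C\<^sup>2) / 2)"
  proof (rule Bochner_Integration.integral_norm_bound_integral)
    show "integrable circle (\<lambda>x. torus.synth f x * cnj (g x))"
      by (rule torus.synth_pairing(2)[OF sigma_finite_measure_axioms sets_circle f gc])
    show "integrable circle (\<lambda>x. ((norm (torus.synth f x))\<^sup>2 + C\<^sup>2) / 2)"
      using parseval_torus(2)[OF f] integrable_const by auto
    fix x
    have "norm (torus.synth f x * cnj (g x)) \<le> norm (torus.synth f x) * C"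
      using C by (simp add: norm_mult mult_left_mono)
    also have "\<dots> \<le> ((norm (torus.synth f x))\<^sup>2 + C\<^sup>2) / 2"
      using sum_squares_bound[of "norm (torus.synth f x)" C] by simp
    finally show "norm (torus.synth f x * cnj (g x)) \<le> ((norm (torus.synth f x))\<^sup>2 + C\<^sup>2) / 2" .
  qed
  also have "\<dots> = (2 * pi * a + 2 * pi * C\<^sup>2) / 2"
    using parseval_torus(2,4)[OF f] integrable_const fa by (simp add: measure_circle)
  finally have "a \<le> C\<^sup>2"
    by (simp add: field_simps)
  then show ?thesis
    unfolding a_def \<gamma>_def .
qed

text \<open>The squares of the coefficients are summable by \<open>bessel_circle\<close>;
  injectivity of e ensures that none is counted twice.\<close>

lemma riemann_lebesgue_circle:
  fixes g :: "real \<Rightarrow> complex" and e :: "nat \<Rightarrow> int"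
  assumes g: "g \<in> borel_measurable borel" and C: "\<And>x. norm (g x) \<le> C" and e: "inj e"
  shows "(\<lambda>n. circle.coef g (of_int (e n))) \<longlonglongrightarrow> 0"
proof -
  have "(\<Sum>n<N. (norm (circle.coef g (of_int (e n))))\<^sup>2) \<le> C\<^sup>2" for N
    using bessel_circle[OF g C, of "e ` {..<N}"] e by (simp add: sum.reindex inj_on_subset)
  then have "summable (\<lambda>n. (norm (circle.coef g (of_int (e n))))\<^sup>2)"
    by (intro summableI_nonneg_bounded[where x = "C\<^sup>2"]) auto
  then have "(\<lambda>n. (norm (circle.coef g (of_int (e n))))\<^sup>2) \<longlonglongrightarrow> 0"
    by (rule summable_LIMSEQ_zero)
  then have "(\<lambda>n. sqrt ((norm (circle.coef g (of_int (e n))))\<^sup>2)) \<longlonglongrightarrow> sqrt 0"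
    by (rule tendsto_real_sqrt)
  then show ?thesis
    by (simp add: tendsto_norm_zero_iff)
qed

text \<open>Chernoff's argument: the difference quotient \<open>g\<close> is bounded, and the Fourier coefficients
  of \<open>u\<close> telescope in terms of those of \<open>g\<close>.\<close>

lemma fourier_inversion_torus:
  fixes u :: "real \<Rightarrow> complex"
  assumes d: "\<And>x. (u has_vector_derivative u' x) (at x)" and K: "\<And>x. norm (u' x) \<le> K" and p: "\<And>x. u (x + 2 * pi) = u x"
    and B: "\<And>x. norm (u x) \<le> B"
    and F: "integrable (count_space UNIV) (\<lambda>k. circle.coef u (of_int k))"
  shows "u = torus.synth (\<lambda>k. circle.coef u (of_int k))"
proof
  fix x
  interpret finite_measure circle by (rule finite_circle)
  \<comment> \<open>Where cis (y - x) = 1 the quotient is 0 by the convention on division. There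
    \<open>lip\<close> gives u y = u x, so the identity \<open>gu\<close> holds at these points
    too.\<close>
  define g where "g y = (u y - u x) / (cis (y - x) - 1)" for y
  note lip = periodic_lipschitz[OF d K p]
  have K0: "K \<ge> 0"
    using order_trans[OF norm_ge_zero K[of 0]] .
  have cu: "continuous_on UNIV u"
    using d by (meson continuous_at_imp_continuous_on has_vector_derivative_continuous)
  have [measurable]: "u \<in> borel_measurable borel"
    by (rule borel_measurable_continuous_onI[OF cu])
  have [measurable]: "(\<lambda>y. cis (y - x)) \<in> borel_measurable borel"
    by (intro borel_measurable_continuous_onI continuous_intros)
  have g: "g \<in> borel_measurable borel"
    unfolding g_def by measurable
  have gC: "norm (g y) \<le> 2 * K" for y
    using lip[of y x] K0 by (cases "cis (y - x) = 1") (auto simp: g_def norm_divide divide_le_eq)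
  have gu: "u y - u x = g y * (cis (y - x) - 1)" for y
    using lip[of y x] by (cases "cis (y - x) = 1") (auto simp: g_def)
  define b where "b k = cis (x * of_int k) * circle.coef g (of_int k)" for k :: int
  let ?F = "\<lambda>k. circle.coef u (of_int k) * cis (x * of_int k)"
  have bi: "integrable circle f" if "f \<in> borel_measurable borel" "\<And>x. norm (f x) \<le> B" for f :: "real \<Rightarrow> complex" and B
    using that measurable_cong_sets[OF sets_circle refl] by (intro integrable_const_bound[where B = B]) auto
  have step: "?F k - (if k = 0 then u x else 0) = b (k - 1) - b k" for k
  proof -
    let ?e = "\<lambda>k y. cis (- (y * real_of_int k))"
    have m [measurable]: "?e k \<in> borel_measurable borel" for k
      by (intro borel_measurable_continuous_onI continuous_intros)
    have ig: "integrable circle (\<lambda>y. g y * ?e k y)" for k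
      using gC g by (intro bi[where B = "2 * K"]) (auto simp: norm_mult)
    have iu: "integrable circle (\<lambda>y. u y * ?e k y)" for k
      using B by (intro bi[where B = B]) (auto simp: norm_mult)
    have ic: "integrable circle (\<lambda>y. u x * ?e k y)" for k
      by (intro bi[where B = "norm (u x)"]) (auto simp: norm_mult)
    have zero: "(LINT y|circle. ?e k y) = (if k = 0 then 2 * pi else 0)"
      using integral_cis_circle[of "- k"] by simp
    have "(LINT y|circle. u y * ?e k y) - (LINT y|circle. u x * ?e k y) = (LINT y|circle. (u y - u x) * ?e k y)"
      using iu ic by (simp add: left_diff_distrib)
    also have "\<dots> = (LINT y|circle. cis (- x) * (g y * ?e (k - 1) y) - g y * ?e k y)"
    proof (rule Bochner_Integration.integral_cong[OF refl])
      fix y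
      have "cis (y - x) * ?e k y = cis (- x) * ?e (k - 1) y"
        by (simp add: cis_mult algebra_simps)
      then show "(u y - u x) * ?e k y = cis (- x) * (g y * ?e (k - 1) y) - g y * ?e k y"
        unfolding gu[of y] by (metis (no_types, opaque_lifting) left_diff_distrib mult.assoc mult.left_commute mult_1 right_diff_distrib)
    qed
    also have "\<dots> = cis (- x) * (LINT y|circle. g y * ?e (k - 1) y) - (LINT y|circle. g y * ?e k y)"
      by (simp only: Bochner_Integration.integral_diff[OF integrable_mult_right[OF ig] ig] integral_mult_right_zero)
    finally have "(LINT y|circle. u y * ?e k y) - u x * (if k = 0 then 2 * pi else 0)
        = cis (- x) * (LINT y|circle. g y * ?e (k - 1) y) - (LINT y|circle. g y * ?e k y)"
      using zero by simp
    then have "of_real (1 / (2 * pi)) * ((LINT y|circle. u y * ?e k y) - u x * (if k = 0 then 2 * pi else 0))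
        = of_real (1 / (2 * pi)) * (cis (- x) * (LINT y|circle. g y * ?e (k - 1) y) - (LINT y|circle. g y * ?e k y))"
      by simp
    then have e: "circle.coef u k - (if k = 0 then u x else 0) = cis (- x) * circle.coef g (of_int (k - 1)) - circle.coef g (of_int k)"
      unfolding circle.coef_def by (cases "k = 0") (simp_all add: right_diff_distrib mult_ac)
    have "cis (x * of_int k) * cis (- x) = cis (x * of_int (k - 1))"
      by (simp add: cis_mult algebra_simps)
    then have "b (k - 1) - b k = cis (x * of_int k) * (cis (- x) * circle.coef g (of_int (k - 1)) - circle.coef g (of_int k))"
      unfolding b_def by (simp add: right_diff_distrib mult.assoc[symmetric])
    then show ?thesis
      unfolding e[symmetric] by (cases "k = 0") (simp_all add: right_diff_distrib mult.commute)
  qed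
  have partial: "(\<Sum>k\<in>{- int N..int N}. ?F k) - u x = b (- 1 - int N) - b (int N)" for N
  proof (induction N)
    case 0
    show ?case using step[of 0] by simp
  next
    case (Suc N)
    have "{- int (Suc N)..int (Suc N)} = insert (int (Suc N)) (insert (- int (Suc N)) {- int N..int N})"
      by auto
    then have sm: "(\<Sum>k\<in>{- int (Suc N)..int (Suc N)}. ?F k) = ?F (int (Suc N)) + (?F (- int (Suc N)) + (\<Sum>k\<in>{- int N..int N}. ?F k))"
      by (simp del: of_nat_Suc)
    have s1: "?F (int (Suc N)) = b (int N) - b (int (Suc N))"
      using step[of "int (Suc N)"] by simp
    have s2: "?F (- int (Suc N)) = b (- 1 - int (Suc N)) - b (- 1 - int N)"
    proof -
      have "- int (Suc N) - 1 = - 1 - int (Suc N)" "- int (Suc N) = - 1 - int N" "- int (Suc N) \<noteq> 0"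
        by simp_all
      then show ?thesis
        using step[of "- int (Suc N)"] by (metis diff_zero)
    qed
    have gen: "A + (B' + S) - U = s - r" if "S - U = q - t" "A = t - r" "B' = s - q" for A B' S U q r s t :: complex
    proof -
      have "A + (B' + S) - U = A + B' + (S - U)"
        by (simp add: algebra_simps)
      then show ?thesis
        by (simp only: that) simp
    qed
    show ?case
      unfolding sm by (rule gen[OF Suc.IH s1 s2])
  qed
  have bn: "norm (b k) = norm (circle.coef g (of_int k))" for k
    by (simp add: b_def norm_mult)
  have bl: "(\<lambda>N. b (e N)) \<longlonglongrightarrow> 0" if "inj e" for e :: "nat \<Rightarrow> int"
  proof -
    have "(\<lambda>N. norm (b (e N))) \<longlonglongrightarrow> 0"
      unfolding bn by (rule tendsto_norm_zero[OF riemann_lebesgue_circle[OF g gC that]])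
    then show ?thesis
      by (rule tendsto_norm_zero_cancel)
  qed
  have "(\<lambda>N. b (- 1 - int N) - b (int N)) \<longlonglongrightarrow> 0 - 0"
    by (intro tendsto_diff bl) (auto simp: inj_def)
  then have l1: "(\<lambda>N. (\<Sum>k\<in>{- int N..int N}. ?F k) - u x) \<longlonglongrightarrow> 0"
    by (simp only: partial diff_zero)
  have "(\<lambda>N. LINT k|count_space UNIV. indicator {- int N..int N} k *\<^sub>R ?F k) \<longlonglongrightarrow> (LINT k|count_space UNIV. ?F k)"
  proof (rule integral_dominated_convergence[where w = "\<lambda>k. norm (circle.coef u (of_int k))"])
    show "AE k in count_space UNIV. (\<lambda>N. indicator {- int N..int N} k *\<^sub>R ?F k) \<longlonglongrightarrow> ?F k"
    proof (rule AE_I2)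
      fix k :: int
      have "\<forall>\<^sub>F N in sequentially. indicator {- int N..int N} k *\<^sub>R ?F k = ?F k"
        using eventually_ge_at_top[of "nat \<bar>k\<bar>"] by eventually_elim (auto simp: indicator_def)
      then show "(\<lambda>N. indicator {- int N..int N} k *\<^sub>R ?F k) \<longlonglongrightarrow> ?F k"
        by (rule tendsto_eventually)
    qed
    show "AE k in count_space UNIV. norm (indicator {- int N..int N} k *\<^sub>R ?F k) \<le> norm (circle.coef u (of_int k))" for N
      by (intro AE_I2) (auto simp: norm_mult indicator_def)
  qed (use F in auto)
  then have "(\<lambda>N. \<Sum>k\<in>{- int N..int N}. ?F k) \<longlonglongrightarrow> torus.synth (\<lambda>k. circle.coef u (of_int k)) x"
    unfolding torus.synth_def by (simp only: integral_count_space_indicator finite_atLeastAtMost_int)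
  moreover have "(\<lambda>N. \<Sum>k\<in>{- int N..int N}. ?F k) \<longlonglongrightarrow> u x"
    using l1 by (simp only: LIM_zero_iff)
  ultimately show "u x = torus.synth (\<lambda>k. circle.coef u (of_int k)) x"
    by (metis LIMSEQ_unique)
qed

subsection \<open>The line and the circle as instances\<close>

lemma (in geom) bdd_of_decay:
  assumes "f \<in> borel_measurable M" "\<And>\<xi>. norm (f \<xi>) \<le> K * (1 + \<bar>\<iota> \<xi>\<bar>) powr - 2"
  shows "bdd f"
proof -
  have b: "bdd (\<lambda>\<xi>. of_real (K * (1 + \<bar>\<iota> \<xi>\<bar>) powr - 2))"
    by (rule bdd_decay)
  have le: "norm (f \<xi>) \<le> norm (complex_of_real (K * (1 + \<bar>\<iota> \<xi>\<bar>) powr - 2))" for \<xi>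
    using assms(2)[of \<xi>] by (simp only: norm_of_real)
  have "integrable M f"
    by (rule Bochner_Integration.integrable_bound[OF bddD(1)[OF b] assms(1)]) (use le in \<open>auto intro: AE_I2\<close>)
  moreover obtain B where "\<And>\<xi>. norm (complex_of_real (K * (1 + \<bar>\<iota> \<xi>\<bar>) powr - 2)) \<le> B"
    using b unfolding bdd_def by blast
  ultimately show ?thesis
    unfolding bdd_def using le by (meson order_trans)
qed

lemma (in freq) bdd_resolvent:
  assumes f: "bdd f" and \<kappa>: "\<kappa> \<ge> 1"
  shows "bdd (\<lambda>\<xi>. 1 / (of_real \<kappa> + \<i> * of_real (\<iota> \<xi>)) * f \<xi>)"
proof -
  have [measurable]: "f \<in> borel_measurable M"
    by (rule bddD(2)[OF f])
  have "1 \<le> norm (of_real \<kappa> + \<i> * of_real (\<iota> \<xi>))" for \<xi>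
    using complex_Re_le_cmod[of "of_real \<kappa> + \<i> * of_real (\<iota> \<xi>)"] \<kappa> by simp
  then have le: "norm (1 / (of_real \<kappa> + \<i> * of_real (\<iota> \<xi>)) * f \<xi>) \<le> norm (f \<xi>)" for \<xi>
    unfolding norm_mult norm_divide norm_one by (intro mult_left_le_one_le) (auto simp: divide_le_eq_1 intro: order_trans)
  have "integrable M (\<lambda>\<xi>. 1 / (of_real \<kappa> + \<i> * of_real (\<iota> \<xi>)) * f \<xi>)"
  proof (rule Bochner_Integration.integrable_bound[OF bddD(1)[OF f]])
    have "of_real \<kappa> + \<i> * of_real x \<noteq> 0" for x
      using \<kappa> by (auto simp: complex_eq_iff)
    then have "(\<lambda>x. 1 / (of_real \<kappa> + \<i> * of_real x)) \<in> borel_measurable borel"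
      by (intro borel_measurable_continuous_onI continuous_intros) auto
    from measurable_compose[OF \<iota>_meas this]
    show "(\<lambda>\<xi>. 1 / (of_real \<kappa> + \<i> * of_real (\<iota> \<xi>)) * f \<xi>) \<in> borel_measurable M"
      by (rule borel_measurable_times) (rule bddD(2)[OF f])
  qed (use le in \<open>auto intro: AE_I2\<close>)
  moreover obtain B where "\<And>\<xi>. norm (f \<xi>) \<le> B"
    using f unfolding bdd_def by blast
  ultimately show ?thesis
    unfolding bdd_def using le by (meson order_trans)
qed

lemma geom_torus:
  assumes "P \<ge> 1"
  shows "geom (count_space (UNIV :: int set)) real_of_int circle (2 * pi) id gz (\<lambda>_. True) P"
proof (intro geom.intro torus.freq_axioms geom_axioms.intro)
  fix \<kappa> s :: real assume "\<kappa> \<ge> 1" "s > 1"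
  then show "(\<integral>\<^sup>+\<xi>. ennreal ((1 + \<bar>real_of_int \<xi>\<bar> / \<kappa>) powr - s) \<partial>count_space UNIV) \<le> ennreal (\<kappa> * gz s)"
    using sum_bracket[of s \<kappa> 0] by simp
next
  fix f :: "int \<Rightarrow> complex" and \<kappa> :: real
  assume "torus.bdd f" "\<kappa> \<ge> 1"
  then show "(\<integral>\<^sup>+x. ennreal ((norm (torus.synth (\<lambda>\<xi>. 1 / (of_real \<kappa> + \<i> * of_real (real_of_int \<xi>)) * f \<xi>) x))\<^sup>2) \<partial>circle)
       = ennreal (2 * pi) * (\<integral>\<^sup>+\<xi>. ennreal ((norm (1 / (of_real \<kappa> + \<i> * of_real (real_of_int \<xi>)) * f \<xi>))\<^sup>2) \<partial>count_space UNIV)"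
    by (rule parseval_torus(1)[OF torus.bddD(1)[OF torus.bdd_resolvent]])
next
  fix f :: "int \<Rightarrow> complex" assume "integrable (count_space UNIV) f"
  then show "(\<integral>\<^sup>+x. ennreal ((norm (torus.synth f x))\<^sup>2) \<partial>circle) \<le> ennreal (2 * pi) * (\<integral>\<^sup>+\<xi>. ennreal ((norm (f \<xi>))\<^sup>2) \<partial>count_space UNIV)"
    by (simp only: parseval_torus(1) order_refl)
next
  show "cis (2 * pi * real_of_int \<xi>) = 1" for \<xi>
    by (rule cis_multiple_2pi) simp
qed (use assms gz_pos sets_circle in auto)

lemma geom_line:
  assumes "P \<ge> 1"
  shows "geom lborel (\<lambda>\<xi>. \<xi>) lborel 0 real_of_int (\<lambda>s. 2 / (s - 1)) (continuous_on UNIV) P"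
proof (intro geom.intro line.freq_axioms geom_axioms.intro)
  fix \<kappa> s :: real assume "\<kappa> \<ge> 1" "s > 1"
  then show "(\<integral>\<^sup>+\<xi>. ennreal ((1 + \<bar>\<xi>\<bar> / \<kappa>) powr - s) \<partial>lborel) \<le> ennreal (\<kappa> * (2 / (s - 1)))"
    using nn_integral_bracket_scaled[of s \<kappa> 0] by simp
next
  fix f :: "real \<Rightarrow> complex" and \<kappa> :: real
  assume f: "line.bdd f" "continuous_on UNIV f" and \<kappa>: "\<kappa> \<ge> 1"
  show "(\<integral>\<^sup>+x. ennreal ((norm (line.synth (\<lambda>\<xi>. 1 / (of_real \<kappa> + \<i> * of_real \<xi>) * f \<xi>) x))\<^sup>2) \<partial>lborel)
       = ennreal (2 * pi) * (\<integral>\<^sup>+\<xi>. ennreal ((norm (1 / (of_real \<kappa> + \<i> * of_real \<xi>) * f \<xi>))\<^sup>2) \<partial>lborel)"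
  proof (rule plancherel_line(1)[OF line.bdd_resolvent[OF f(1) \<kappa>]])
    have "of_real \<kappa> + \<i> * of_real \<xi> \<noteq> 0" for \<xi>
      using \<kappa> by (auto simp: complex_eq_iff)
    then show "continuous_on UNIV (\<lambda>\<xi>. 1 / (of_real \<kappa> + \<i> * of_real \<xi>) * f \<xi>)"
      by (intro continuous_intros f(2)) auto
  qed
next
  fix f :: "real \<Rightarrow> complex" assume f: "continuous_on UNIV f"
  show "continuous_on UNIV (\<lambda>\<xi>. f (\<xi> - c))" for c
    by (rule continuous_on_compose2[OF f]) (auto intro!: continuous_intros)
  show "continuous_on UNIV (\<lambda>\<xi>. of_real \<sigma> * cnj (f (- \<xi>)))" for \<sigma>
    by (intro continuous_intros continuous_on_compose2[OF f]) auto
qed (use assms bessel_line in auto)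

text \<open>The shift property is a Peetre inequality for the bracket 1 + x^2.
  \<open>int_deriv\<close> is the limit of the fundamental theorem of calculus on [-n, n]: both
  boundary values tend to the same constant c.\<close>

interpretation cauchy: phys lborel 0 "\<lambda>x. 1 / (1 + x\<^sup>2)"
proof unfold_locales
  show "1 / (1 + y\<^sup>2) \<le> 2 * (1 + (x - y)\<^sup>2) * (1 / (1 + x\<^sup>2))" for x y :: real
  proof -
    have "1 + x\<^sup>2 \<le> 2 * (1 + (x - y)\<^sup>2) * (1 + y\<^sup>2)"
    proof -
      have "x\<^sup>2 \<le> 2 * (x - y)\<^sup>2 + 2 * y\<^sup>2"
        using sum_squares_bound[of "x - y" y] by (simp add: power2_eq_square algebra_simps)
      moreover have "2 * (1 + (x - y)\<^sup>2) * (1 + y\<^sup>2) = 2 + 2 * (x - y)\<^sup>2 + 2 * y\<^sup>2 + 2 * ((x - y)\<^sup>2 * y\<^sup>2)"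
        by (simp only: distrib_left distrib_right mult_1_left mult_1_right mult.assoc add.assoc)
      moreover have "0 \<le> (x - y)\<^sup>2 * y\<^sup>2"
        by (intro mult_nonneg_nonneg zero_le_power2)
      ultimately show ?thesis
        by linarith
    qed
    moreover have "1 + x\<^sup>2 > 0" "1 + y\<^sup>2 > 0"
      by (simp_all add: add_pos_nonneg)
    ultimately show ?thesis
      by (simp add: divide_simps)
  qed
  show pos: "0 < 1 / (1 + x\<^sup>2)" and "1 / (1 + x\<^sup>2) \<le> 1" for x :: real
    by (simp_all add: add_pos_nonneg divide_le_eq_1)
  have le: "1 / (1 + x\<^sup>2) \<le> 2 * (1 + \<bar>x\<bar>) powr - 2" for x :: real
    using lorentz_le_bracket[of 1 x] by simp
  have "(\<integral>\<^sup>+x. ennreal (1 / (1 + x\<^sup>2)) \<partial>lborel) \<le> (\<integral>\<^sup>+x. 2 * ennreal ((1 + \<bar>x\<bar>) powr - 2) \<partial>lborel)"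
    by (intro nn_integral_mono order_trans[OF ennreal_leI[OF le]]) (simp add: ennreal_mult)
  also have "\<dots> = 2 * (\<integral>\<^sup>+x. ennreal ((1 + \<bar>x\<bar>) powr - 2) \<partial>lborel)"
    by (rule nn_integral_cmult) measurable
  also have "\<dots> \<le> 2 * ennreal (2 / (2 - 1))"
    by (intro mult_left_mono nn_integral_bracket) auto
  also have "\<dots> < \<infinity>"
    by (simp add: ennreal_mult_less_top)
  finally show int: "integrable lborel (\<lambda>x. 1 / (1 + x\<^sup>2) :: real)"
    using pos by (intro integrableI_nonneg) (auto simp: less_imp_le)
  fix g g' :: "real \<Rightarrow> complex" and K c
  assume g: "\<And>x. (g has_vector_derivative g' x) (at x)" "continuous_on UNIV g'"
    and K: "\<And>x. norm (g' x) \<le> K * (1 / (1 + x\<^sup>2))" "\<And>x. norm (g x - c) \<le> K * (1 / (1 + x\<^sup>2))"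
  have [measurable]: "g' \<in> borel_measurable borel"
    by (rule borel_measurable_continuous_onI[OF g(2)])
  have "(\<lambda>n. LINT x|lborel. indicator {- real n..real n} x *\<^sub>R g' x) \<longlonglongrightarrow> (LINT x|lborel. g' x)"
  proof (rule integral_dominated_convergence[where w = "\<lambda>x. K * (1 / (1 + x\<^sup>2))"])
    show "AE x in lborel. (\<lambda>n. indicator {- real n..real n} x *\<^sub>R g' x) \<longlonglongrightarrow> g' x"
    proof (rule AE_I2)
      fix x :: real
      have "\<forall>\<^sub>F n in sequentially. \<bar>x\<bar> \<le> real n"
        using eventually_ge_at_top[of "nat \<lceil>\<bar>x\<bar>\<rceil>"] by eventually_elim linarith
      then have "\<forall>\<^sub>F n in sequentially. indicator {- real n..real n} x *\<^sub>R g' x = g' x"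
        by eventually_elim (auto simp: indicator_def)
      then show "(\<lambda>n. indicator {- real n..real n} x *\<^sub>R g' x) \<longlonglongrightarrow> g' x"
        by (rule tendsto_eventually)
    qed
    show "AE x in lborel. norm (indicator {- real n..real n} x *\<^sub>R g' x) \<le> K * (1 / (1 + x\<^sup>2))" for n
      using K(1) order_trans[OF norm_ge_zero K(1)] by (intro AE_I2) (auto simp: indicator_def)
    show "integrable lborel (\<lambda>x. K * (1 / (1 + x\<^sup>2)))"
      by (rule integrable_mult_right[OF int])
  qed measurable
  moreover have "(LINT x|lborel. indicator {- real n..real n} x *\<^sub>R g' x) = (g (real n) - c) - (g (- real n) - c)" for n
    using g(1) by (subst integral_FTC_Icc[where F = g]) (auto intro: has_vector_derivative_at_within continuous_on_subset[OF g(2)])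
  moreover have "(\<lambda>n. (g (real n) - c) - (g (- real n) - c)) \<longlonglongrightarrow> 0 - 0"
  proof (rule tendsto_diff)
    have l: "(\<lambda>n. K * (1 / (1 + (real n)\<^sup>2))) \<longlonglongrightarrow> 0"
      by real_asymp
    show "(\<lambda>n. g (real n) - c) \<longlonglongrightarrow> 0" "(\<lambda>n. g (- real n) - c) \<longlonglongrightarrow> 0"
      by (rule Lim_null_comparison[OF always_eventually[OF allI[OF K(2)]]], use l in simp)+
  qed
  ultimately show "(LINT x|lborel. g' x) = 0"
    using LIMSEQ_unique by force
qed auto

lemma smooth_derivative:
  assumes "smooth f"
  shows "((dx ^^ j) f has_vector_derivative (dx ^^ Suc j) f x) (at x)"
  using assms by (simp add: smooth_def dx_def vector_derivative_works)

lemma dx_periodic: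
  assumes f: "smooth f" and p: "\<And>x. f (x + L) = f x"
  shows "(dx ^^ j) f (x + L) = (dx ^^ j) f x"
proof (induction j arbitrary: x)
  case 0
  show ?case using p by simp
next
  case (Suc j)
  have "(((dx ^^ j) f \<circ> (\<lambda>x. x + L)) has_vector_derivative 1 *\<^sub>R (dx ^^ Suc j) f (x + L)) (at x)"
    by (rule vector_diff_chain_at[OF _ smooth_derivative[OF f]]) (auto intro!: derivative_eq_intros)
  moreover have "(dx ^^ j) f \<circ> (\<lambda>x. x + L) = (dx ^^ j) f"
    using Suc.IH by (simp add: fun_eq_iff)
  ultimately have "((dx ^^ j) f has_vector_derivative (dx ^^ Suc j) f (x + L)) (at x)"
    by simp
  then show ?case
    using vector_derivative_unique_at smooth_derivative[OF f] by blast
qed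

lemma periodic_bounded:
  fixes f :: "real \<Rightarrow> complex"
  assumes c: "continuous_on UNIV f" and p: "\<And>x. f (x + 2 * pi) = f x"
  shows "\<exists>K. \<forall>x. norm (f x) \<le> K"
proof -
  have pn: "f (z + 2 * pi * of_int n) = f z" for z n
    by (rule periodic_of_int[of f "2 * pi", OF p])
  have "bounded (f ` {0..2 * pi})"
    by (intro compact_imp_bounded compact_continuous_image continuous_on_subset[OF c]) auto
  then obtain K where K: "\<And>x. x \<in> {0..2 * pi} \<Longrightarrow> norm (f x) \<le> K"
    by (metis bounded_iff imageI)
  have "norm (f x) \<le> K" for x
  proof -
    define y where "y = x / (2 * pi)"
    have "f (2 * pi * (y - \<lfloor>y\<rfloor>)) = f x"
      using pn[of "2 * pi * (y - \<lfloor>y\<rfloor>)" "\<lfloor>y\<rfloor>"] by (simp add: y_def right_diff_distrib)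
    moreover have "2 * pi * (y - \<lfloor>y\<rfloor>) \<le> 2 * pi * 1" "0 \<le> 2 * pi * (y - \<lfloor>y\<rfloor>)"
      by (intro mult_left_mono) (auto, linarith)
    ultimately show ?thesis
      using K[of "2 * pi * (y - \<lfloor>y\<rfloor>)"] by simp
  qed
  then show ?thesis by blast
qed

text \<open>The filter \<open>at t\<close> leaves out s = t, where the required inequality is just 0
  < e.\<close>

lemma uniform_limit_at_iff:
  "uniform_limit UNIV f (f t) (at t) \<longleftrightarrow> (\<forall>e>0. \<exists>d>0. \<forall>s. \<bar>s - t\<bar> < d \<longrightarrow> (\<forall>x. norm (f s x - f t x) < e))"
  for f :: "real \<Rightarrow> real \<Rightarrow> complex"
proof -
  have "(\<forall>s. s \<noteq> t \<and> \<bar>s - t\<bar> < d \<longrightarrow> (\<forall>x. norm (f s x - f t x) < e)) \<longleftrightarrow> (\<forall>s. \<bar>s - t\<bar> < d \<longrightarrow> (\<forall>x. norm (f s x - f t x) < e))"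
    if "e > 0" for d e
    using that by (metis norm_zero diff_self)
  then show ?thesis
    unfolding uniform_limit_iff eventually_at by (simp add: dist_norm)
qed

lemma wcont_torus:
  assumes u: "\<And>t. smooth_torus (u t)" and c: "continuous_into_smooth_torus u"
  shows "circle.wcont (\<lambda>t. (dx ^^ j) (u t))"
  unfolding circle.wcont_def
proof (intro allI conjI impI)
  fix t :: real
  have "continuous_on UNIV ((dx ^^ j) (u t))"
    using u[of t] smooth_derivative unfolding smooth_torus_def
    by (meson continuous_at_imp_continuous_on has_vector_derivative_continuous)
  moreover have "(dx ^^ j) (u t) (x + 2 * pi) = (dx ^^ j) (u t) x" for x
    using u[of t] unfolding smooth_torus_def by (intro dx_periodic) auto
  ultimately show "circle.dec ((dx ^^ j) (u t))"
    using periodic_bounded unfolding circle.dec_def by simp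
  fix e :: real assume "e > 0"
  have "uniform_limit UNIV (\<lambda>s. (dx ^^ j) (u s)) ((dx ^^ j) (u t)) (at t)"
    using c unfolding continuous_into_smooth_torus_def by blast
  then show "\<exists>d>0. \<forall>s. \<bar>s - t\<bar> < d \<longrightarrow> (\<forall>x. norm ((dx ^^ j) (u s) x - (dx ^^ j) (u t) x) \<le> e * 1)"
    unfolding uniform_limit_at_iff[of "\<lambda>s. (dx ^^ j) (u s)"] using \<open>e > 0\<close> by (fastforce simp: less_imp_le)
qed

text \<open>The seminorms with k = 0 and k = 2 add up to the weight 1 + x^2, the reciprocal of
  \<rho>.\<close>

lemma wcont_line:
  assumes u: "\<And>t. schwartz (u t)" and c: "continuous_into_schwartz u"
  shows "cauchy.wcont (\<lambda>t. (dx ^^ j) (u t))"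
  unfolding cauchy.wcont_def
proof (intro allI conjI impI)
  fix t :: real
  have comb: "norm z \<le> e * (1 / (1 + x\<^sup>2))" if "norm z \<le> a" "norm (x\<^sup>2 *\<^sub>R z) \<le> b" "a + b \<le> e" for z :: complex and a b e x
  proof -
    have "norm z * (1 + x\<^sup>2) \<le> e"
      using that by (simp add: distrib_left mult.commute)
    then show ?thesis
      by (simp add: pos_le_divide_eq add_pos_nonneg)
  qed
  have "bounded (range (\<lambda>x. x ^ k *\<^sub>R (dx ^^ j) (u t) x))" for k
    using u[of t] unfolding schwartz_def by blast
  then have "\<forall>k. \<exists>B. \<forall>x. norm (x ^ k *\<^sub>R (dx ^^ j) (u t) x) \<le> B"
    unfolding bounded_iff by blast
  then obtain B where B: "\<And>k x. norm (x ^ k *\<^sub>R (dx ^^ j) (u t) x) \<le> B k"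
    by (metis choice_iff)
  have "norm ((dx ^^ j) (u t) x) \<le> (B 0 + B 2) * (1 / (1 + x\<^sup>2))" for x
    using B[of x 0] B[of x 2] by (intro comb[of _ "B 0" x "B 2"]) auto
  then show "cauchy.dec ((dx ^^ j) (u t))"
    by (rule cauchy.decI)
  fix e :: real assume e: "e > 0"
  have ul: "uniform_limit UNIV (\<lambda>s x. x ^ k *\<^sub>R (dx ^^ j) (u s) x) (\<lambda>x. x ^ k *\<^sub>R (dx ^^ j) (u t) x) (at t)" for k
    using c unfolding continuous_into_schwartz_def by blast
  have l: "\<exists>d>0. \<forall>s. \<bar>s - t\<bar> < d \<longrightarrow> (\<forall>x. norm (x ^ k *\<^sub>R (dx ^^ j) (u s) x - x ^ k *\<^sub>R (dx ^^ j) (u t) x) < e / 2)" for k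
    using ul[of k] e unfolding uniform_limit_at_iff[of "\<lambda>s x. x ^ k *\<^sub>R (dx ^^ j) (u s) x"] by (meson half_gt_zero)
  obtain d0 where d0: "d0 > 0" "\<And>s x. \<bar>s - t\<bar> < d0 \<Longrightarrow> norm ((dx ^^ j) (u s) x - (dx ^^ j) (u t) x) < e / 2"
    using l[of 0] by auto
  obtain d2 where d2: "d2 > 0" "\<And>s x. \<bar>s - t\<bar> < d2 \<Longrightarrow> norm (x\<^sup>2 *\<^sub>R (dx ^^ j) (u s) x - x\<^sup>2 *\<^sub>R (dx ^^ j) (u t) x) < e / 2"
    using l[of 2] by blast
  have "norm ((dx ^^ j) (u s) x - (dx ^^ j) (u t) x) \<le> e * (1 / (1 + x\<^sup>2))" if "\<bar>s - t\<bar> < min d0 d2" for s x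
    using d0(2)[of s x] d2(2)[of s x] that
    by (intro comb[of _ "e / 2" x "e / 2"]) (auto simp: scaleR_diff_right less_imp_le)
  then show "\<exists>d>0. \<forall>s. \<bar>s - t\<bar> < d \<longrightarrow> (\<forall>x. norm ((dx ^^ j) (u s) x - (dx ^^ j) (u t) x) \<le> e * (1 / (1 + x\<^sup>2)))"
    using d0(1) d2(1) by (intro exI[of _ "min d0 d2"]) auto
qed

text \<open>Everything on the frequency side comes from the decay of order -2 of the coefficients:
  summability, hence Fourier inversion, and the domination needed for continuity in time.\<close>

lemma flow_geom_torus:
  assumes P: "P \<ge> 1" and \<sigma>: "\<sigma> = 1 \<or> \<sigma> = -1"
    and u: "\<And>t. smooth_torus (u t)" "continuous_into_smooth_torus u" and c: "continuous_on UNIV c"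
    and flow: "\<And>t x. ((\<lambda>s. u s x) has_vector_derivative
      - (dx ^^ 3) (u t) x + of_real (\<sigma> * 6 * (norm (u t x))\<^sup>2 - c t) * dx (u t) x) (at t)"
  shows "flow_geom circle (2 * pi) (\<lambda>_. 1) \<sigma> u c (count_space UNIV) real_of_int id gz (\<lambda>_. True) P
    (\<lambda>t k. circle.coef (u t) (of_int k))"
proof -
  have sm: "smooth (u t)" and per: "u t (x + 2 * pi) = u t x" for t x
    using u(1)[of t] by (auto simp: smooth_torus_def)
  interpret geom "count_space (UNIV :: int set)" real_of_int circle "2 * pi" id gz "\<lambda>_. True" P
    by (rule geom_torus[OF P])
  interpret mkdv_flow circle "2 * pi" "\<lambda>_. 1" \<sigma> u c
    by unfold_locales (use \<sigma> smooth_derivative[OF sm] dx_periodic[OF sm per] wcont_torus[OF u] c flow in auto)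
  have cis1: "cis (2 * pi * real_of_int k) = 1" for k
    by (rule cis_multiple_2pi) simp
  have dom: "\<exists>K d. d > 0 \<and> (\<forall>s \<xi>. \<bar>s - t\<bar> < d \<longrightarrow> norm (circle.coef (u s) (real_of_int \<xi>)) \<le> K * (1 + \<bar>real_of_int \<xi>\<bar>) powr - 2)" for t
    using coef_dominated[of t] cis1 by meson
  have bd: "torus.bdd (\<lambda>k. circle.coef (u t) (of_int k))" for t
  proof -
    obtain K d where "d > 0" "\<And>s \<xi>. \<bar>s - t\<bar> < d \<Longrightarrow> norm (circle.coef (u s) (real_of_int \<xi>)) \<le> K * (1 + \<bar>real_of_int \<xi>\<bar>) powr - 2"
      using dom[of t] by blast
    then show ?thesis
      by (intro bdd_of_decay[where K = K]) auto
  qed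
  obtain K0 K1 where K: "\<And>t x. norm (u t x) \<le> K0 t" "\<And>t x. norm (dx (u t) x) \<le> K1 t"
    using circle.wcontD(1)[OF wcont_u0] circle.wcontD(1)[OF wcont_u1] unfolding circle.dec_def by (metis mult.right_neutral)
  show ?thesis
  proof unfold_locales
    show "u t = torus.synth (\<lambda>k. circle.coef (u t) (of_int k))" for t
      using smooth_derivative[OF sm, of 0 t]
      by (intro fourier_inversion_torus[OF _ K(2) per K(1) torus.bddD(1)[OF bd]]) simp
    show "((\<lambda>s. circle.coef (u s) (real_of_int \<xi>)) \<longlongrightarrow> circle.coef (u t) (real_of_int \<xi>)) (at t)" for t \<xi>
      by (rule circle.coef_tendsto[OF wcont_u0 cont_u0])
  qed (use bd dom in auto)
qed

lemma coef_line: "cauchy.coef f \<xi> = of_real (1 / (2 * pi)) * line.synth f (- \<xi>)"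
  unfolding cauchy.coef_def line.synth_def by (simp add: mult.commute)

text \<open>\<open>integral_synth_line\<close> for the reflected translate h(y) = u(x0 - y): its
  synthesis is 2 pi times the integrand of the inversion formula at x0, and its value at 0 is
  u(x0).\<close>

lemma fourier_inversion_line:
  fixes u :: "real \<Rightarrow> complex"
  assumes i: "integrable lborel u" and B: "\<And>x. norm (u x) \<le> B" and c: "continuous_on UNIV u" and F: "integrable lborel (cauchy.coef u)"
  shows "u = line.synth (cauchy.coef u)"
proof
  fix x0
  define h where "h y = u (x0 - y)" for y
  have sh: "line.synth h \<xi> = 2 * pi * (cauchy.coef u \<xi> * cis (x0 * \<xi>))" for \<xi>
  proof -
    have "line.synth h \<xi> = (LINT y|lborel. u (x0 - y) * cis (\<xi> * (x0 - (x0 - y))))"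
      unfolding line.synth_def h_def by simp
    also have "\<dots> = (LINT z|lborel. u z * cis (\<xi> * (x0 - z)))"
      using lborel_integral_real_affine[of "-1" "\<lambda>z. u z * cis (\<xi> * (x0 - z))" x0] by simp
    also have "\<dots> = (LINT z|lborel. cis (x0 * \<xi>) * (u z * cis (- (z * \<xi>))))"
    proof (rule Bochner_Integration.integral_cong[OF refl])
      fix z
      have "cis (\<xi> * (x0 - z)) = cis (x0 * \<xi>) * cis (- (z * \<xi>))"
        by (simp add: cis_mult algebra_simps)
      then show "u z * cis (\<xi> * (x0 - z)) = cis (x0 * \<xi>) * (u z * cis (- (z * \<xi>)))"
        by (simp only: mult_ac)
    qed
    also have "\<dots> = cis (x0 * \<xi>) * (LINT z|lborel. u z * cis (- (z * \<xi>)))"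
      by (rule integral_mult_right_zero)
    finally show ?thesis
      by (simp add: cauchy.coef_def)
  qed
  have ih: "integrable lborel h"
    using lborel_integrable_real_affine[OF i, of "-1" x0] by (simp add: h_def[abs_def])
  have ci: "integrable lborel (\<lambda>\<xi>. cauchy.coef u \<xi> * cis (x0 * \<xi>))"
    by (rule line.integrable_cis[OF F])
  have "(LINT \<xi>|lborel. line.synth h \<xi>) = 2 * pi * h 0"
  proof (rule integral_synth_line[OF ih])
    show "norm (h \<xi>) \<le> B" for \<xi>
      using B by (simp add: h_def)
    have "continuous_on UNIV h"
      unfolding h_def by (rule continuous_on_compose2[OF c]) (auto intro!: continuous_intros)
    then show "isCont h 0"
      by (simp add: continuous_on_eq_continuous_at)
    show "integrable lborel (line.synth h)"
      unfolding sh[abs_def] by (rule integrable_mult_right[OF ci])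
  qed
  then have "2 * pi * line.synth (cauchy.coef u) x0 = 2 * pi * u x0"
    unfolding sh integral_mult_right_zero by (simp add: line.synth_def h_def)
  then show "u x0 = line.synth (cauchy.coef u) x0"
    by simp
qed

lemma flow_geom_line:
  assumes P: "P \<ge> 1" and \<sigma>: "\<sigma> = 1 \<or> \<sigma> = -1" and u: "schwartz_mkdv_solution \<sigma> u"
  shows "flow_geom lborel 0 (\<lambda>x. 1 / (1 + x\<^sup>2)) \<sigma> u (\<lambda>_. 0) lborel (\<lambda>\<xi>. \<xi>) real_of_int (\<lambda>s. 2 / (s - 1)) (continuous_on UNIV) P
    (\<lambda>t. cauchy.coef (u t))"
proof -
  have sw: "schwartz (u t)" and ci: "continuous_into_schwartz u" and eq: "mkdv \<sigma> u" for t
    using u by (auto simp: schwartz_mkdv_solution_def)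
  have sm: "smooth (u t)" for t
    using sw by (simp add: schwartz_def)
  interpret geom lborel "\<lambda>\<xi>. \<xi> :: real" lborel 0 real_of_int "\<lambda>s. 2 / (s - 1)" "continuous_on UNIV" P
    by (rule geom_line[OF P])
  interpret mkdv_flow lborel 0 "\<lambda>x. 1 / (1 + x\<^sup>2)" \<sigma> u "\<lambda>_. 0"
  proof (intro mkdv_flow.intro cauchy.phys_axioms mkdv_flow_axioms.intro)
    show "((\<lambda>s. u s x) has_vector_derivative
      - (dx ^^ 3) (u t) x + of_real (\<sigma> * 6 * (norm (u t x))\<^sup>2 - 0) * dx (u t) x) (at t)" for t x
      using eq unfolding mkdv_def by (simp only: diff_zero)
    show "(dx ^^ j) (u t) (x + 0) = (dx ^^ j) (u t) x" for t j x
      by (simp only: add_0_right)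
  qed (rule \<sigma> smooth_derivative[OF sm] wcont_line[OF sw ci] continuous_on_const)+
  have dom: "\<exists>K d. d > 0 \<and> (\<forall>s \<xi>. \<bar>s - t\<bar> < d \<longrightarrow> norm (cauchy.coef (u s) \<xi>) \<le> K * (1 + \<bar>\<xi>\<bar>) powr - 2)" for t
    using coef_dominated[of t] by simp
  have iu: "integrable lborel (u t)" for t
    by (rule cauchy.integrable_dec[OF cont_u0 cauchy.wcontD(1)[OF wcont_u0]])
  have cF: "continuous_on UNIV (cauchy.coef (u t))" for t
    unfolding coef_line[abs_def]
    by (intro continuous_intros continuous_on_compose2[OF line.synth_continuous[OF iu]]) auto
  have bd: "line.bdd (cauchy.coef (u t))" for t
  proof -
    obtain K d where "d > 0" "\<And>s \<xi>. \<bar>s - t\<bar> < d \<Longrightarrow> norm (cauchy.coef (u s) \<xi>) \<le> K * (1 + \<bar>\<xi>\<bar>) powr - 2"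
      using dom[of t] by blast
    then show ?thesis
      using borel_measurable_continuous_onI[OF cF] by (intro bdd_of_decay[where K = K]) auto
  qed
  show ?thesis
  proof unfold_locales
    show "u t = line.synth (cauchy.coef (u t))" for t
    proof -
      from cauchy.decE[OF cauchy.wcontD(1)[OF wcont_u0, of t]] obtain B where "\<And>x. norm (u t x) \<le> B"
        by blast
      then show ?thesis
        by (intro fourier_inversion_line iu cont_u0 line.bddD(1)[OF bd])
    qed
    show "((\<lambda>s. cauchy.coef (u s) \<xi>) \<longlongrightarrow> cauchy.coef (u t) \<xi>) (at t)" for t \<xi>
      by (rule cauchy.coef_tendsto[OF wcont_u0 cont_u0])
  qed (use bd cF dom in auto)
qed

subsection \<open>Norms\<close>

lemma smooth_continuous:
  assumes "smooth f"
  shows "continuous_on UNIV f"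
proof -
  have "(f has_vector_derivative dx f x) (at x)" for x
    using smooth_derivative[OF assms, of 0 x] by simp
  then show ?thesis
    by (meson continuous_at_imp_continuous_on has_vector_derivative_continuous)
qed

lemma nn_integral_eq_infsum:
  fixes g :: "int \<Rightarrow> real"
  assumes g: "\<And>n. g n \<ge> 0" and fin: "(\<integral>\<^sup>+n. ennreal (g n) \<partial>count_space UNIV) < \<infinity>"
  shows "enn2real (\<integral>\<^sup>+n. ennreal (g n) \<partial>count_space UNIV) = infsum g UNIV"
proof -
  have "integrable (count_space UNIV) g"
    using g fin by (intro integrableI_nonneg) auto
  moreover have "integral\<^sup>L (count_space UNIV) g = enn2real (\<integral>\<^sup>+n. ennreal (g n) \<partial>count_space UNIV)"
    using g by (intro integral_eq_nn_integral) auto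
  ultimately show ?thesis
    using infsetsum_infsum[of g UNIV] by (simp add: infsetsum_def abs_summable_on_def)
qed

lemma powr_sum_double:
  fixes a b K P :: real
  assumes "a \<ge> 0" "b \<ge> 0" "K \<ge> 0" "P \<ge> 1"
  shows "(K * (a + b)) powr P \<le> (2 * K) powr P * (a powr P + b powr P)"
proof -
  have "(K * (a + b)) powr P \<le> (2 * K * max a b) powr P"
  proof (rule powr_mono2)
    have "K * (a + b) \<le> K * (2 * max a b)"
      using assms by (intro mult_left_mono) auto
    then show "K * (a + b) \<le> 2 * K * max a b"
      by (simp add: mult_ac)
  qed (use assms in auto)
  also have "\<dots> = (2 * K) powr P * max a b powr P"
    using assms by (intro powr_mult)
  also have "\<dots> \<le> (2 * K) powr P * (a powr P + b powr P)"
    by (intro mult_left_mono) (auto simp: max_def)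
  finally show ?thesis .
qed

text \<open>For windows and unit cells, which overlap only with neighbours. Shift invariance of the
  counting measure makes both terms of the bound contribute equally.\<close>

lemma nn_integral_powr_neighbours:
  fixes a b :: "int \<Rightarrow> real"
  assumes a: "\<And>n. a n \<ge> 0" and b: "\<And>n. b n \<ge> 0" and K: "K \<ge> 0" and P: "P \<ge> 1"
    and le: "\<And>n. a n \<le> K * (b n + b (n - j))"
  shows "(\<integral>\<^sup>+n. ennreal (a n powr P) \<partial>count_space UNIV)
    \<le> ennreal (2 * (2 * K) powr P) * (\<integral>\<^sup>+n. ennreal (b n powr P) \<partial>count_space UNIV)"
proof -
  let ?S = "\<integral>\<^sup>+n. ennreal (b n powr P) \<partial>count_space UNIV"
  have "a n powr P \<le> (2 * K) powr P * (b n powr P + b (n - j) powr P)" for n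
    using a b K P le by (intro order_trans[OF powr_mono2 powr_sum_double]) auto
  then have "(\<integral>\<^sup>+n. ennreal (a n powr P) \<partial>count_space UNIV)
      \<le> (\<integral>\<^sup>+n. ennreal ((2 * K) powr P) * (ennreal (b n powr P) + ennreal (b (n - j) powr P)) \<partial>count_space UNIV)"
    by (intro nn_integral_mono) (simp only: ennreal_plus[symmetric] ennreal_mult[symmetric] powr_ge_zero add_nonneg_nonneg ennreal_leI)
  also have "\<dots> = ennreal ((2 * K) powr P) * (?S + (\<integral>\<^sup>+n. ennreal (b (n - j) powr P) \<partial>count_space UNIV))"
    by (simp add: nn_integral_cmult nn_integral_add)
  also have "(\<integral>\<^sup>+n. ennreal (b (n - j) powr P) \<partial>count_space UNIV) = ?S"
    by (rule torus.nn_shift[of "\<lambda>n. ennreal (b n powr P)"]) simp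
  also have "ennreal ((2 * K) powr P) * (?S + ?S) = ennreal (2 * (2 * K) powr P) * ?S"
    by (simp add: ennreal_mult mult_2[symmetric] mult_ac)
  finally show ?thesis .
qed

text \<open>Carries a growth bound between comparable quantities: r and s stand for the cell sums at
  times t and 0, y and x for the norms. b >= 1 gives 1 + s <= b (1 + x).\<close>

lemma growth_transfer:
  fixes a b C e x y s r :: real
  assumes "y \<le> a * r" "r \<le> C * (1 + s) powr e * s" "s \<le> b * x"
    and "a \<ge> 0" "b \<ge> 1" "C \<ge> 0" "e \<ge> 0" "s \<ge> 0" "x \<ge> 0"
  shows "y \<le> a * C * b powr e * b * (1 + x) powr e * x"
proof -
  have "1 + s \<le> b * (1 + x)"
    using assms by (simp add: distrib_left)
  then have "(1 + s) powr e \<le> b powr e * (1 + x) powr e"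
    using assms by (subst powr_mult[symmetric]) (auto intro!: powr_mono2)
  then have "C * (1 + s) powr e * s \<le> C * (b powr e * (1 + x) powr e) * (b * x)"
    using assms by (intro mult_mono) auto
  then have "a * r \<le> a * (C * (b powr e * (1 + x) powr e) * (b * x))"
    using assms by (intro mult_left_mono) auto
  then show ?thesis
    using assms(1) by (simp add: mult_ac)
qed

text \<open>On the integers a unit cell is one point, so the cell mass is |F|^2 and there is
  equality. The factor sqrt (2 pi) is the ratio of the normalisations 1 / sqrt (2 pi) and 1 / (2
  pi).\<close>

lemma fourier_lebesgue_norm_eq:
  assumes P: "P \<ge> 1" and u: "continuous_on UNIV u"
    and fin: "geom.SG (count_space UNIV) real_of_int P (\<lambda>k. circle.coef u (of_int k)) < \<infinity>"
  shows "fourier_lebesgue_norm (2 * P) u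
    = sqrt (2 * pi) * enn2real (geom.SG (count_space UNIV) real_of_int P (\<lambda>k. circle.coef u (of_int k))) powr (1 / (2 * P))"
proof -
  interpret geom "count_space (UNIV :: int set)" real_of_int circle "2 * pi" id gz "\<lambda>_. True" P
    by (rule geom_torus[OF P])
  define F where "F k = circle.coef u (of_int k)" for k :: int
  have "Gm F m = (norm (F m))\<^sup>2" for m
  proof -
    have "Gm F m = (LINT k|count_space UNIV. indicator {m} k *\<^sub>R (norm (F k))\<^sup>2)"
      unfolding Gm_def by (intro Bochner_Integration.integral_cong) (auto simp: indicator_def)
    then show ?thesis
      by (simp only: integral_count_space_indicator finite.intros sum.insert sum.empty empty_iff not_False_eq_True add_0_right)
  qed
  moreover have "((norm z)\<^sup>2) powr P = norm z powr (2 * P)" for z :: complex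
    by (cases "z = 0") (simp_all add: powr_powr flip: powr_numeral)
  ultimately have SG: "SG F = (\<integral>\<^sup>+k. ennreal (norm (F k) powr (2 * P)) \<partial>count_space UNIV)"
    unfolding SG_def by simp
  have "SG F < \<infinity>"
    using fin by (simp add: F_def[abs_def])
  then have S: "enn2real (SG F) = infsum (\<lambda>k. norm (F k) powr (2 * P)) UNIV"
    unfolding SG by (intro nn_integral_eq_infsum) auto
  have ft: "fourier_torus u k = of_real (sqrt (2 * pi)) * F k" for k
  proof -
    have "(\<lambda>x. u x * cis (- (x * of_int k))) \<in> borel_measurable borel"
      by (intro borel_measurable_continuous_onI continuous_intros u)
    then have "fourier_torus u k = of_real (1 / sqrt (2 * pi)) * (LINT x|circle. u x * cis (- (x * of_int k)))"
      by (simp add: fourier_torus_def integral_circle)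
    moreover have "1 / sqrt (2 * pi) = sqrt (2 * pi) * (1 / (2 * pi))"
      using real_sqrt_mult_self[of "2 * pi"] by (simp add: field_simps)
    ultimately show ?thesis
      unfolding F_def circle.coef_def by (simp only: of_real_mult mult.assoc)
  qed
  have "norm (fourier_torus u k) powr (2 * P) = sqrt (2 * pi) powr (2 * P) * norm (F k) powr (2 * P)" for k
    unfolding ft norm_mult norm_of_real abs_of_nonneg[OF real_sqrt_ge_zero[OF mult_nonneg_nonneg[OF zero_le_numeral pi_ge_zero]]]
    by (rule powr_mult)
  then have "fourier_lebesgue_norm (2 * P) u = (sqrt (2 * pi) powr (2 * P) * enn2real (SG F)) powr (1 / (2 * P))"
    unfolding fourier_lebesgue_norm_def S by (simp add: infsum_cmult_right')
  also have "\<dots> = (sqrt (2 * pi) powr (2 * P)) powr (1 / (2 * P)) * enn2real (SG F) powr (1 / (2 * P))"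
    by (rule powr_mult)
  also have "(sqrt (2 * pi) powr (2 * P)) powr (1 / (2 * P)) = sqrt (2 * pi)"
    using P by (simp add: powr_powr)
  finally show ?thesis
    by (simp add: F_def[abs_def])
qed

text \<open>The endpoints are included: outside [-1, 1] the support condition applies, and
  continuity extends the vanishing to -1 and 1. Therefore at most two windows are nonzero at any
  point of a cell [m, m + 1).\<close>

lemma window_vanishes:
  assumes \<psi>: "modulation_window \<psi>" and x: "\<bar>x\<bar> \<ge> 1"
  shows "\<psi> x = 0"
proof -
  have out: "\<psi> y = 0" if "\<bar>y\<bar> > 1" for y
  proof (rule ccontr)
    assume "\<psi> y \<noteq> 0"
    then have "y \<in> closure {\<xi>. \<psi> \<xi> \<noteq> 0}"
      using closure_subset[of "{\<xi>. \<psi> \<xi> \<noteq> 0}"] by auto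
    then have "y \<in> {-1..1}"
      using \<psi> unfolding modulation_window_def by blast
    then show False
      using that by auto
  qed
  have "isCont \<psi> x"
    using \<psi> smooth_continuous unfolding modulation_window_def schwartz_def
    by (simp add: continuous_on_eq_continuous_at)
  moreover have "(\<lambda>n. x * (1 + 1 / real (Suc n))) \<longlonglongrightarrow> x * (1 + 0)"
    by (intro tendsto_intros LIMSEQ_Suc lim_1_over_n)
  ultimately have "(\<lambda>n. \<psi> (x * (1 + 1 / real (Suc n)))) \<longlonglongrightarrow> \<psi> x"
    by (intro isCont_tendsto_compose[of x \<psi>]) auto
  moreover have "\<psi> (x * (1 + 1 / real (Suc n))) = 0" for n
  proof (rule out)
    have "1 < (1 + 1 / real (Suc n))"
      by simp
    also have "\<dots> \<le> \<bar>x\<bar> * (1 + 1 / real (Suc n))"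
      using x by (intro mult_right_mono[of 1 "\<bar>x\<bar>", simplified]) auto
    finally show "1 < \<bar>x * (1 + 1 / real (Suc n))\<bar>"
      by (simp add: abs_mult)
  qed
  ultimately have "(\<lambda>n::nat. 0) \<longlonglongrightarrow> \<psi> x"
    by simp
  then show ?thesis
    by (simp add: LIMSEQ_const_iff)
qed

lemma window_partition:
  assumes \<psi>: "modulation_window \<psi>" and m: "\<lfloor>\<xi>\<rfloor> = m"
  shows "\<psi> (\<xi> - of_int m) + \<psi> (\<xi> - of_int (m + 1)) = 1"
proof -
  have b: "of_int m \<le> \<xi>" "\<xi> < of_int m + 1"
    using m by linarith+
  \<comment> \<open>At \<xi> = m the window centred at m - 1 is at distance exactly 1, so vanishing
    at the endpoint is used.\<close>
  have z: "\<psi> (\<xi> - of_int k) = 0" if "k \<notin> {m, m + 1}" for k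
  proof (rule window_vanishes[OF \<psi>])
    have "k \<le> m - 1 \<or> k \<ge> m + 2"
      using that by auto
    then have "real_of_int k \<le> real_of_int m - 1 \<or> real_of_int k \<ge> real_of_int m + 2"
      by linarith
    then show "1 \<le> \<bar>\<xi> - of_int k\<bar>"
      using b by linarith
  qed
  have "((\<lambda>k::int. \<psi> (\<xi> - of_int k)) has_sum 1) UNIV"
    using \<psi> unfolding modulation_window_def by blast
  moreover have "((\<lambda>k::int. \<psi> (\<xi> - of_int k)) has_sum 1) UNIV \<longleftrightarrow> ((\<lambda>k. \<psi> (\<xi> - of_int k)) has_sum 1) {m, m + 1}"
    using z by (intro has_sum_cong_neutral) auto
  moreover have "((\<lambda>k. \<psi> (\<xi> - of_int k)) has_sum (\<Sum>k\<in>{m, m + 1}. \<psi> (\<xi> - of_int k))) {m, m + 1}"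
    by (rule has_sum_finite) simp
  ultimately have "(\<Sum>k\<in>{m, m + 1}. \<psi> (\<xi> - of_int k)) = 1"
    using has_sum_unique by blast
  then show ?thesis
    by simp
qed

text \<open>The normalisations of \<open>fourier\<close> and \<open>inverse_fourier\<close> cancel
  against that of \<open>coef\<close>, so the multiplier operator is exactly \<open>synth\<close> of
  m times the coefficient function, and \<open>plancherel_line\<close> applies.\<close>

lemma fourier_multiplier_L2:
  assumes m: "continuous_on UNIV m" "\<And>\<xi>. norm (m \<xi>) \<le> B"
    and F: "line.bdd (cauchy.coef u)" "continuous_on UNIV (cauchy.coef u)"
  shows "ennreal ((L2_norm (fourier_multiplier m u))\<^sup>2)
    = ennreal (2 * pi) * (\<integral>\<^sup>+\<xi>. ennreal ((norm (m \<xi> * cauchy.coef u \<xi>))\<^sup>2) \<partial>lborel)"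
proof -
  let ?f = "\<lambda>\<xi>. m \<xi> * cauchy.coef u \<xi>"
  let ?s = "complex_of_real (sqrt (2 * pi))"
  have s0: "?s \<noteq> 0"
    by simp
  have cf: "continuous_on UNIV ?f"
    by (intro continuous_intros m F)
  have le: "norm (?f \<xi>) \<le> norm (of_real B * cauchy.coef u \<xi>)" for \<xi>
    using m(2)[of \<xi>] by (simp add: norm_mult mult_right_mono order_trans[OF _ abs_ge_self])
  have bf: "line.bdd ?f"
  proof -
    have "integrable lborel ?f"
    proof (rule Bochner_Integration.integrable_bound[OF integrable_mult_right[OF line.bddD(1)[OF F(1)], of "of_real B"]])
      show "?f \<in> borel_measurable lborel"
        unfolding measurable_lborel2 by (rule borel_measurable_continuous_onI[OF cf])
      show "AE \<xi> in lborel. norm (?f \<xi>) \<le> norm (of_real B * cauchy.coef u \<xi>)"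
        using le by (intro AE_I2)
    qed
    moreover obtain K where K: "\<And>\<xi>. norm (cauchy.coef u \<xi>) \<le> K"
      using F(1) unfolding line.bdd_def by blast
    have "norm (?f \<xi>) \<le> \<bar>B\<bar> * K" for \<xi>
      using le[of \<xi>] mult_left_mono[OF K[of \<xi>], of "\<bar>B\<bar>"] by (simp add: norm_mult)
    ultimately show ?thesis
      unfolding line.bdd_def by blast
  qed
  have ft: "fourier u \<xi> = ?s * cauchy.coef u \<xi>" for \<xi>
  proof -
    have "1 / sqrt (2 * pi) = sqrt (2 * pi) * (1 / (2 * pi))"
      using real_sqrt_mult_self[of "2 * pi"] by (simp add: field_simps)
    then show ?thesis
      unfolding fourier_def cauchy.coef_def by (simp only: of_real_mult mult.assoc)
  qed
  have "fourier_multiplier m u = line.synth ?f"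
  proof
    fix x
    have "m \<xi> * fourier u \<xi> * cis (x * \<xi>) = ?s * (?f \<xi> * cis (x * \<xi>))" for \<xi>
      unfolding ft by (simp only: mult_ac)
    then have "fourier_multiplier m u x = of_real (1 / sqrt (2 * pi)) * (?s * line.synth ?f x)"
      unfolding fourier_multiplier_def inverse_fourier_def line.synth_def by (simp only: integral_mult_right_zero)
    then show "fourier_multiplier m u x = line.synth ?f x"
      using s0 by (simp add: of_real_divide)
  qed
  moreover have "(LINT x|lborel. (norm (line.synth ?f x))\<^sup>2) \<ge> 0"
    by (rule Bochner_Integration.integral_nonneg) simp
  ultimately have "(L2_norm (fourier_multiplier m u))\<^sup>2 = (LINT x|lborel. (norm (line.synth ?f x))\<^sup>2)"
    unfolding L2_norm_def by simp
  then have "ennreal ((L2_norm (fourier_multiplier m u))\<^sup>2) = (\<integral>\<^sup>+x. ennreal ((norm (line.synth ?f x))\<^sup>2) \<partial>lborel)"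
    using nn_integral_eq_integral[OF plancherel_line(2)[OF bf cf]] by simp
  then show ?thesis
    unfolding plancherel_line(1)[OF bf cf] .
qed

text \<open>Window n lives on the cells n - 1 and n, which gives the upper bound (shift j = 1); cell
  m is covered by the windows m and m + 1, which sum to 1 there, and this gives the lower bound
  (shift j = -1). Both go through \<open>nn_integral_powr_neighbours\<close> at the level of squared
  L^2 norms, whence the exponent P = p / 2.\<close>

lemma modulation_norm_compare:
  assumes P: "P \<ge> 1" and \<psi>: "modulation_window \<psi>" and B: "\<And>\<xi>. norm (\<psi> \<xi>) \<le> B"
    and F: "line.bdd (cauchy.coef u)" "continuous_on UNIV (cauchy.coef u)"
    and fin: "geom.SG lborel (\<lambda>\<xi>. \<xi>) P (cauchy.coef u) < \<infinity>"
  defines "S \<equiv> enn2real (geom.SG lborel (\<lambda>\<xi>. \<xi>) P (cauchy.coef u))"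
  shows "modulation_norm \<psi> (2 * P) u \<le> (2 * (2 * (2 * pi * B\<^sup>2)) powr P) powr (1 / (2 * P)) * S powr (1 / (2 * P))"
    and "S powr (1 / (2 * P)) \<le> (2 * 2 powr P) powr (1 / (2 * P)) * modulation_norm \<psi> (2 * P) u"
proof -
  interpret geom lborel "\<lambda>\<xi>. \<xi> :: real" lborel 0 real_of_int "\<lambda>s. 2 / (s - 1)" "continuous_on UNIV" P
    by (rule geom_line[OF P])
  let ?F = "cauchy.coef u"
  define Q where "Q n = (L2_norm (fourier_multiplier (\<lambda>\<xi>. \<psi> (\<xi> - of_int n)) u))\<^sup>2" for n :: int
  have c\<psi>: "continuous_on UNIV \<psi>"
    using \<psi> smooth_continuous unfolding modulation_window_def schwartz_def by blast
  have Fm [measurable]: "?F \<in> borel_measurable borel"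
    by (rule borel_measurable_continuous_onI[OF F(2)])
  have \<psi>m [measurable]: "\<psi> \<in> borel_measurable borel"
    by (rule borel_measurable_continuous_onI[OF c\<psi>])
  let ?W = "\<lambda>n. \<integral>\<^sup>+\<xi>. ennreal ((norm (\<psi> (\<xi> - of_int n) * ?F \<xi>))\<^sup>2) \<partial>lborel"
  let ?i = "\<lambda>m \<xi>. indicator {\<xi>. \<lfloor>\<xi>\<rfloor> = m} \<xi> :: ennreal"
  have Q: "ennreal (Q n) = ennreal (2 * pi) * ?W n" for n
    unfolding Q_def
    by (rule fourier_multiplier_L2[OF continuous_on_compose2[OF c\<psi>] B F]) (auto intro!: continuous_intros)
  have Q0: "Q n \<ge> 0" for n
    by (simp add: Q_def)
  have cm: "{\<xi> :: real. \<lfloor>\<xi>\<rfloor> = m} \<in> sets lborel" for m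
    using cell_sets[of m] by simp
  have Wm: "(\<lambda>\<xi>. ennreal ((norm (\<psi> (\<xi> - of_int n) * ?F \<xi>))\<^sup>2)) \<in> borel_measurable lborel" for n
    by measurable
  have Fi: "(\<lambda>\<xi>. ennreal ((norm (?F \<xi>))\<^sup>2) * ?i m \<xi>) \<in> borel_measurable lborel" for m
    using cm by measurable
  have "Q n \<le> 2 * pi * B\<^sup>2 * (Gm ?F n + Gm ?F (n - 1))" for n
  proof -
    have "?W n \<le> (\<integral>\<^sup>+\<xi>. ennreal (B\<^sup>2) * (ennreal ((norm (?F \<xi>))\<^sup>2) * ?i n \<xi> + ennreal ((norm (?F \<xi>))\<^sup>2) * ?i (n - 1) \<xi>) \<partial>lborel)"
    proof (rule nn_integral_mono)
      fix \<xi>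
      have le: "(norm (\<psi> (\<xi> - of_int n) * ?F \<xi>))\<^sup>2 \<le> B\<^sup>2 * (norm (?F \<xi>))\<^sup>2"
        unfolding norm_mult power_mult_distrib by (intro mult_right_mono power_mono B) auto
      consider "\<lfloor>\<xi>\<rfloor> = n" | "\<lfloor>\<xi>\<rfloor> = n - 1" | "\<xi> \<ge> of_int n + 1 \<or> \<xi> < of_int n - 1"
        by linarith
      then show "ennreal ((norm (\<psi> (\<xi> - of_int n) * ?F \<xi>))\<^sup>2)
          \<le> ennreal (B\<^sup>2) * (ennreal ((norm (?F \<xi>))\<^sup>2) * ?i n \<xi> + ennreal ((norm (?F \<xi>))\<^sup>2) * ?i (n - 1) \<xi>)"
      proof cases
        case 3
        then have "\<psi> (\<xi> - of_int n) = 0"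
          by (intro window_vanishes[OF \<psi>]) auto
        then show ?thesis by simp
      qed (use ennreal_leI[OF le] in \<open>auto simp: ennreal_mult indicator_def\<close>)
    qed
    also have "\<dots> = ennreal (B\<^sup>2) * (ennreal (Gm ?F n) + ennreal (Gm ?F (n - 1)))"
      using Fi by (simp add: nn_integral_cmult nn_integral_add Gm_nn[OF F(1)])
    also have "\<dots> = ennreal (B\<^sup>2 * (Gm ?F n + Gm ?F (n - 1)))"
      using Gm_nonneg by (simp add: ennreal_mult)
    finally have "ennreal (Q n) \<le> ennreal (2 * pi) * ennreal (B\<^sup>2 * (Gm ?F n + Gm ?F (n - 1)))"
      unfolding Q by (rule mult_left_mono) simp
    also have "\<dots> = ennreal (2 * pi * B\<^sup>2 * (Gm ?F n + Gm ?F (n - 1)))"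
      using Gm_nonneg by (subst ennreal_mult[symmetric]) (auto simp: mult.assoc)
    finally show ?thesis
      using Gm_nonneg by (subst (asm) ennreal_le_iff) auto
  qed
  then have up: "(\<integral>\<^sup>+n. ennreal (Q n powr P) \<partial>count_space UNIV) \<le> ennreal (2 * (2 * (2 * pi * B\<^sup>2)) powr P) * SG ?F"
    unfolding SG_def using Q0 Gm_nonneg P by (intro nn_integral_powr_neighbours[where j = 1]) auto
  have "Gm ?F m \<le> 1 * (Q m + Q (m - (- 1)))" for m
  proof -
    have "ennreal (Gm ?F m) \<le> (\<integral>\<^sup>+\<xi>. 2 * ennreal ((norm (\<psi> (\<xi> - of_int m) * ?F \<xi>))\<^sup>2)
        + 2 * ennreal ((norm (\<psi> (\<xi> - of_int (m + 1)) * ?F \<xi>))\<^sup>2) \<partial>lborel)"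
      unfolding Gm_nn[OF F(1)]
    proof (rule nn_integral_mono)
      fix \<xi>
      show "ennreal ((norm (?F \<xi>))\<^sup>2) * ?i m \<xi> \<le> 2 * ennreal ((norm (\<psi> (\<xi> - of_int m) * ?F \<xi>))\<^sup>2)
        + 2 * ennreal ((norm (\<psi> (\<xi> - of_int (m + 1)) * ?F \<xi>))\<^sup>2)"
      proof (cases "\<lfloor>\<xi>\<rfloor> = m")
        case True
        have "\<psi> (\<xi> - of_int m) * ?F \<xi> + \<psi> (\<xi> - of_int (m + 1)) * ?F \<xi> = ?F \<xi>"
          using window_partition[OF \<psi> True] by (metis distrib_right mult_1)
        then show ?thesis
          using ennreal_norm_sum_square[of "\<psi> (\<xi> - of_int m) * ?F \<xi>" "\<psi> (\<xi> - of_int (m + 1)) * ?F \<xi>"] True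
          by (simp only: indicator_def mem_Collect_eq simp_thms of_bool_eq mult_1_right)
      qed simp
    qed
    also have "\<dots> = 2 * ?W m + 2 * ?W (m + 1)"
      using Wm by (simp only: nn_integral_add nn_integral_cmult borel_measurable_times_ennreal borel_measurable_const)
    \<comment> \<open>The factor 2 from squaring a sum is absorbed by the Plancherel factor 2 pi of
      \<open>Q\<close>.\<close>
    also have "\<dots> \<le> ennreal (2 * pi) * ?W m + ennreal (2 * pi) * ?W (m + 1)"
    proof -
      have "(2 :: ennreal) \<le> ennreal (2 * pi)"
        using ennreal_leI[of 2 "2 * pi"] pi_ge_two by simp
      then show ?thesis
        by (intro add_mono mult_right_mono) auto
    qed
    also have "\<dots> = ennreal (Q m + Q (m + 1))"
      unfolding Q[symmetric] using Q0 by simp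
    finally show ?thesis
      using Q0 by (subst (asm) ennreal_le_iff) auto
  qed
  then have low: "SG ?F \<le> ennreal (2 * (2 * 1) powr P) * (\<integral>\<^sup>+n. ennreal (Q n powr P) \<partial>count_space UNIV)"
    unfolding SG_def using Q0 Gm_nonneg P by (intro nn_integral_powr_neighbours[where j = "- 1"]) auto
  define MM where "MM = (\<integral>\<^sup>+n. ennreal (Q n powr P) \<partial>count_space UNIV)"
  have S: "SG ?F = ennreal S" "S \<ge> 0"
    using fin by (auto simp: S_def)
  have "MM < \<infinity>"
    using up unfolding MM_def S by (rule le_less_trans) (simp add: ennreal_mult_less_top)
  then have M: "MM = ennreal (enn2real MM)"
    by simp
  have "((L2_norm f)\<^sup>2) powr P = L2_norm f powr (2 * P)" for f
  proof (cases "L2_norm f = 0")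
    case False
    then have "L2_norm f > 0"
      unfolding L2_norm_def using Bochner_Integration.integral_nonneg[of lborel "\<lambda>x. (norm (f x))\<^sup>2"] by (simp add: less_le)
    then show ?thesis
      by (simp add: powr_powr flip: powr_numeral)
  qed simp
  then have "enn2real MM = (\<Sum>\<^sub>\<infinity>n. L2_norm (fourier_multiplier (\<lambda>\<xi>. \<psi> (\<xi> - of_int n)) u) powr (2 * P))"
    using nn_integral_eq_infsum[of "\<lambda>n. Q n powr P"] \<open>MM < \<infinity>\<close> unfolding MM_def Q_def by simp
  then have mn: "modulation_norm \<psi> (2 * P) u = enn2real MM powr (1 / (2 * P))"
    by (simp add: modulation_norm_def)
  have "enn2real MM \<le> (2 * (2 * (2 * pi * B\<^sup>2)) powr P) * S"
    using up unfolding MM_def[symmetric] S(1) M[symmetric]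
    using S(2) M by (metis (no_types, lifting) ennreal_le_iff ennreal_mult mult_nonneg_nonneg powr_ge_zero zero_le_numeral)
  then show "modulation_norm \<psi> (2 * P) u \<le> (2 * (2 * (2 * pi * B\<^sup>2)) powr P) powr (1 / (2 * P)) * S powr (1 / (2 * P))"
    unfolding mn using P S(2) by (subst powr_mult[symmetric]) (auto intro!: powr_mono2)
  have "S \<le> (2 * 2 powr P) * enn2real MM"
    using low unfolding MM_def[symmetric] S(1)
    using M by (metis (no_types, lifting) enn2real_nonneg ennreal_le_iff ennreal_mult mult_1_right mult_nonneg_nonneg powr_ge_zero zero_le_numeral)
  then show "S powr (1 / (2 * P)) \<le> (2 * 2 powr P) powr (1 / (2 * P)) * modulation_norm \<psi> (2 * P) u"
    unfolding mn using P S(2) by (subst powr_mult[symmetric]) (auto intro!: powr_mono2)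
qed

text \<open>Covers both equations on the circle through \<open>c\<close>. In
  \<open>growth_transfer\<close> the constant b is 1, because the norm is sqrt (2 pi) >= 1 times the
  cell quantity.\<close>

lemma torus_growth:
  assumes P: "P \<ge> 1" and \<sigma>: "\<sigma> = 1 \<or> \<sigma> = -1"
    and u: "\<And>t. smooth_torus (u t)" "continuous_into_smooth_torus u" and c: "continuous_on UNIV c"
    and flow: "\<And>t x. ((\<lambda>s. u s x) has_vector_derivative
      - (dx ^^ 3) (u t) x + of_real (\<sigma> * 6 * (norm (u t x))\<^sup>2 - c t) * dx (u t) x) (at t)"
  shows "fourier_lebesgue_norm (2 * P) (u t)
    \<le> sqrt (2 * pi) * geom.Cf gz P * (1 + fourier_lebesgue_norm (2 * P) (u 0)) powr (P - 1) * fourier_lebesgue_norm (2 * P) (u 0)"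
proof -
  interpret flow_geom circle "2 * pi" "\<lambda>_. 1" \<sigma> u c "count_space UNIV" real_of_int id gz "\<lambda>_. True" P
    "\<lambda>t k. circle.coef (u t) (of_int k)"
    by (rule flow_geom_torus[OF P \<sigma> u c flow])
  let ?s = "\<lambda>t. enn2real (SG (\<lambda>k. circle.coef (u t) (of_int k))) powr (1 / (2 * P))"
  have n: "fourier_lebesgue_norm (2 * P) (u t) = sqrt (2 * pi) * ?s t" for t
    by (rule fourier_lebesgue_norm_eq[OF P cont_u0 SG_bound(1)])
  have "1 \<le> sqrt (2 * pi)"
    using pi_ge_two by simp
  then have "?s 0 \<le> 1 * fourier_lebesgue_norm (2 * P) (u 0)"
    unfolding n by (simp add: mult_le_cancel_right1)
  from growth_transfer[OF eq_refl[OF n[of t]] SG_bound(2) this]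
  have "fourier_lebesgue_norm (2 * P) (u t) \<le> sqrt (2 * pi) * Cf * 1 powr (P - 1) * 1 * (1 + fourier_lebesgue_norm (2 * P) (u 0)) powr (P - 1)
      * fourier_lebesgue_norm (2 * P) (u 0)"
    using P Cf_pos by (simp add: n less_imp_le)
  then show ?thesis
    by simp
qed

theorem theoremA2:
  fixes p \<sigma> :: real and \<psi> :: "real \<Rightarrow> complex"
  assumes "2 \<le> p"
    and "\<sigma> = 1 \<or> \<sigma> = -1"
    and "modulation_window \<psi>"
  shows "(\<exists>C>0. \<forall>u. schwartz_mkdv_solution \<sigma> u \<longrightarrow> (\<forall>t.
            modulation_norm \<psi> p (u t)
              \<le> C * (1 + modulation_norm \<psi> p (u 0)) powr (p / 2 - 1) * modulation_norm \<psi> p (u 0)))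
       \<and> (\<exists>C>0.
            (\<forall>u. smooth_torus_mkdv_solution \<sigma> u \<longrightarrow> (\<forall>t.
              fourier_lebesgue_norm p (u t)
                \<le> C * (1 + fourier_lebesgue_norm p (u 0)) powr (p / 2 - 1)
                    * fourier_lebesgue_norm p (u 0)))
          \<and> (\<forall>u. smooth_torus_renormalized_mkdv_solution \<sigma> u \<longrightarrow> (\<forall>t.
              fourier_lebesgue_norm p (u t)
                \<le> C * (1 + fourier_lebesgue_norm p (u 0)) powr (p / 2 - 1)
                    * fourier_lebesgue_norm p (u 0))))"
proof -
  define P where "P = p / 2"
  have P: "P \<ge> 1" and p: "p = 2 * P"
    using assms(1) by (auto simp: P_def)
  obtain B where B: "B \<ge> 1" "\<And>\<xi>. norm (\<psi> \<xi>) \<le> B"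
  proof -
    have "bounded (range (\<lambda>x. x ^ 0 *\<^sub>R (dx ^^ 0) \<psi> x))"
      using assms(3) unfolding modulation_window_def schwartz_def by blast
    then obtain B where "\<And>\<xi>. norm (\<psi> \<xi>) \<le> B"
      unfolding bounded_iff by auto
    then show ?thesis
      using that[of "max 1 B"] by (simp add: le_max_iff_disj)
  qed
  \<comment> \<open>a and b are the two constants of \<open>modulation_norm_compare\<close>. They
    depend on p and on the window through B, but not on the solution.\<close>
  define a where "a = (2 * (2 * (2 * pi * B\<^sup>2)) powr P) powr (1 / (2 * P))"
  define b where "b = (2 * 2 powr P) powr (1 / (2 * P) :: real)"
  define C where "C = geom.Cf (\<lambda>s. 2 / (s - 1)) P"
  have a: "a > 0"
    using B(1) by (simp add: a_def)
  have b: "b \<ge> 1"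
    unfolding b_def using P ge_one_powr_ge_zero[of 2 P] by (intro ge_one_powr_ge_zero) auto
  have C: "C > 0"
    unfolding C_def by (rule geom.Cf_pos[OF geom_line[OF P]])
  have "modulation_norm \<psi> p (u t) \<le> a * C * b powr (p / 2 - 1) * b * (1 + modulation_norm \<psi> p (u 0)) powr (p / 2 - 1) * modulation_norm \<psi> p (u 0)"
    if u: "schwartz_mkdv_solution \<sigma> u" for u t
  proof -
    interpret flow_geom lborel 0 "\<lambda>x. 1 / (1 + x\<^sup>2)" \<sigma> u "\<lambda>_. 0" lborel "\<lambda>\<xi>. \<xi>" real_of_int "\<lambda>s. 2 / (s - 1)" "continuous_on UNIV" P
      "\<lambda>t. cauchy.coef (u t)"
      by (rule flow_geom_line[OF P assms(2) u])
    note mc = modulation_norm_compare[OF P assms(3) B(2) bdd_Ft nice_Ft SG_bound(1), folded p a_def b_def]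
    have "p / 2 - 1 = P - 1" "modulation_norm \<psi> p (u 0) \<ge> 0"
      by (simp_all add: P_def modulation_norm_def)
    then show ?thesis
      using growth_transfer[OF mc(1)[of t] SG_bound(2)[of t, folded p] mc(2)[of 0]] a b C P
      unfolding C_def by (simp add: less_imp_le)
  qed
  then have line: "\<exists>C>0. \<forall>u. schwartz_mkdv_solution \<sigma> u \<longrightarrow> (\<forall>t.
      modulation_norm \<psi> p (u t) \<le> C * (1 + modulation_norm \<psi> p (u 0)) powr (p / 2 - 1) * modulation_norm \<psi> p (u 0))"
    using a b C by (intro exI[of _ "a * C * b powr (p / 2 - 1) * b"]) auto
  \<comment> \<open>One constant serves both torus equations, as \<open>torus_growth\<close> does
    not involve \<open>c\<close> in its bound.\<close>
  define C' where "C' = sqrt (2 * pi) * geom.Cf gz P"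
  have C': "C' > 0"
    unfolding C'_def using geom.Cf_pos[OF geom_torus[OF P]] by simp
  have e: "p / 2 - 1 = P - 1"
    by (simp add: P_def)
  have t1: "fourier_lebesgue_norm p (u t)
      \<le> C' * (1 + fourier_lebesgue_norm p (u 0)) powr (p / 2 - 1) * fourier_lebesgue_norm p (u 0)"
    if u: "smooth_torus_mkdv_solution \<sigma> u" for u t
    unfolding e unfolding p C'_def
  proof (rule torus_growth[OF P assms(2)])
    show "((\<lambda>s. u s x) has_vector_derivative
      - (dx ^^ 3) (u t) x + of_real (\<sigma> * 6 * (norm (u t x))\<^sup>2 - 0) * dx (u t) x) (at t)" for t x
      using u unfolding smooth_torus_mkdv_solution_def mkdv_def by (simp only: diff_zero)
  qed (use u in \<open>auto simp: smooth_torus_mkdv_solution_def\<close>)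
  have t2: "fourier_lebesgue_norm p (u t)
      \<le> C' * (1 + fourier_lebesgue_norm p (u 0)) powr (p / 2 - 1) * fourier_lebesgue_norm p (u 0)"
    if u: "smooth_torus_renormalized_mkdv_solution \<sigma> u" for u t
    unfolding e unfolding p C'_def
  proof -
    have st: "smooth_torus (u t)" and ci: "continuous_into_smooth_torus u" and eq: "renormalized_mkdv \<sigma> u" for t
      using u by (auto simp: smooth_torus_renormalized_mkdv_solution_def)
    have w: "circle.wcont u"
      using wcont_torus[OF st ci, of 0] by simp
    have cu: "continuous_on UNIV (u t)" for t
      using st[of t] smooth_continuous unfolding smooth_torus_def by blast
    \<comment> \<open>The mean of |u|^2 is written as a Fourier coefficient at frequency 0, so that
      its continuity in time follows from \<open>coef_tendsto\<close>.\<close>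
    define c where "c t = \<sigma> * 6 * Re (circle.coef (\<lambda>x. u t x * cnj (u t x)) 0)" for t
    have wc: "circle.wcont (\<lambda>t x. u t x * cnj (u t x))"
      by (intro circle.wcont_mult2 circle.wcont_cnj w)
    have c: "continuous_on UNIV c"
      unfolding c_def[abs_def] continuous_on_def
      by (auto intro!: tendsto_intros circle.coef_tendsto[OF wc] continuous_intros cu)
    have mean: "c t = \<sigma> * 6 * (1 / (2 * pi) * (LINT y:{0..2 * pi}|lborel. (norm (u t y))\<^sup>2))" for t
    proof -
      have "(\<lambda>y. (norm (u t y))\<^sup>2) \<in> borel_measurable borel"
        by (intro borel_measurable_continuous_onI continuous_intros cu)
      then have i: "(LINT y|circle. (norm (u t y))\<^sup>2) = (LINT y:{0..2 * pi}|lborel. (norm (u t y))\<^sup>2)"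
        by (rule integral_circle)
      have "u t x * cnj (u t x) * cis (- (x * 0)) = of_real ((norm (u t x))\<^sup>2)" for x
        by (simp add: complex_of_norm_squared)
      then have "circle.coef (\<lambda>x. u t x * cnj (u t x)) 0 = of_real (1 / (2 * pi) * (LINT y|circle. (norm (u t y))\<^sup>2))"
        unfolding circle.coef_def by (simp only: integral_complex_of_real of_real_mult)
      then show ?thesis
        unfolding c_def i[symmetric] by (simp only: Re_complex_of_real)
    qed
    show "fourier_lebesgue_norm (2 * P) (u t)
      \<le> sqrt (2 * pi) * geom.Cf gz P * (1 + fourier_lebesgue_norm (2 * P) (u 0)) powr (P - 1) * fourier_lebesgue_norm (2 * P) (u 0)"
    proof (rule torus_growth[OF P assms(2) st ci c])
      show "((\<lambda>s. u s x) has_vector_derivative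
        - (dx ^^ 3) (u t) x + of_real (\<sigma> * 6 * (norm (u t x))\<^sup>2 - c t) * dx (u t) x) (at t)" for t x
        using eq unfolding renormalized_mkdv_def mean right_diff_distrib by blast
    qed
  qed
  show ?thesis
    using line t1 t2 C' by blast
qed

end
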